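(* There is an absolute constant $c_0>0$ such that, with the constants $c_{r,\delta}$ and the wavenumbers $\Lambda_u(t)$ defined (using this $c_0$) as in the context, the following holds. Let $u(t)$ and $v(t)$ be two weak solutions on $[0,\infty)$ of the 3D Navier-Stokes equations on $\mathbb{T}^3=[0,L]^3$ with the same viscosity $\nu>0$ and the same force $f$. Let $\Lambda(t):=\max\{\Lambda_u(t),\Lambda_v(t)\}$ and let $Q(t)$ be such that $\Lambda(t)=\lambda_{Q(t)}$. If $$u(t)_{\leq Q(t)}=v(t)_{\leq Q(t)}\qquad \text{for all } t>0,$$ then $$\lim_{t\to\infty}\|u(t)-v(t)\|_{H^{-5/4}}=0.$$
   Context: Equations. On the torus $\mathbb{T}^3=[0,L]^3$, $L>0$ (periodic boundary conditions), the Navier-Stokes equations are $u_t+(u\cdot\nabla)u-\nu\Delta u+\nabla p=f$, $\nabla\cdot u=0$, with $u$ and $f$ of zero mean over $\mathbb{T}^3$. A weak solution on $[0,\infty)$ is an $L^2(\mathbb{T}^3)$-valued function $u\in C([0,\infty);L^2_{\mathrm w})\cap L^2_{\mathrm{loc}}(0,\infty;H^1)$ (where $L^2_{\mathrm w}$ is $L^2$ with the weak topology) satisfying the equations in the sense of distributions. Littlewood-Paley decomposition. For integers $q$, $\lambda_q:=2^q/L$; $\lambda_\infty:=\infty$. Let $\chi\in C_0^\infty(\mathbb{R}^3)$ be a fixed nonnegative radial function with $\chi(\xi)=1$ for $|\xi|\le 3/4$ and $\chi(\xi)=0$ for $|\xi|\ge 1$; $\varphi(\xi):=\chi(\xi/2)-\chi(\xi)$;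 $\varphi_q(\xi):=\varphi(2^{-q}\xi)$ for $q\ge 0$ and $\varphi_{-1}:=\chi$. For a distribution $u$ on $\mathbb{T}^3$ with Fourier coefficients $\hat u(k)$, $u_q(x):=\sum_{k\in\mathbb{Z}^3}\hat u(k)\varphi_q(k)e^{i\frac{2\pi}{L}k\cdot x}$ for $q\ge -1$, and $u_{\le q}:=\sum_{p=-1}^q u_p$ (with $u_{\le\infty}=u$). $\|\cdot\|_r$ is the $L^r(\mathbb{T}^3)$ norm and $\|u\|_{H^s}:=\big(\sum_{q\ge -1}\lambda_q^{2s}\|u_q\|_2^2\big)^{1/2}$. Constants. Let $\mathcal{S}:=\{(r,\delta): r\in[2,\infty],\ \delta\in[0,3],\ (r,\delta)\ne(\infty,0)\}$, with $3/r=0$ if $r=\infty$. For $(r,\delta)\in\mathcal{S}$ put $\sigma:=\frac12(\delta-1)$, $s:=\min\{-\frac12+\frac{\delta}{4},0\}$, and $$c_{r,\delta}:=\frac{1}{2c_0\left(1+(1-2^{\,s-\sigma-\frac3r})^{-2}\right)}.$$ Determining wavenumber. For $(r,\delta)\in\mathcal{S}$, $$\Lambda_u^{r,\delta}(t):=\min\Big\{\lambda_q:\ q\in\mathbb{N},\ (L\lambda_{p-q})^{\frac3r-\frac12+\frac\delta2}\lambda_q^{-1+\frac3r}\|u_p(t)\|_r<c_{r,\delta}\nu\ \ \forall p>q,\ \text{ and }\ \lambda_q^{-2}\|\nabla u_{\le q}(t)\|_\infty<c_{r,\delta}\nu\Big\},$$ where $\mathbb{N}=\{0,1,2,\dots\}$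 and $\min\emptyset=\infty$. Finally $\Lambda_u(t):=\min_{(r,\delta)\in\mathcal{S}}\Lambda_u^{r,\delta}(t)$. *)

theory Defs
  imports "HOL-Probability.Probability"
begin

section \<open>Smooth functions\<close>

definition dderiv :: "'a::real_normed_vector \<Rightarrow> ('a \<Rightarrow> 'b::real_normed_vector) \<Rightarrow> 'a \<Rightarrow> 'b" where
  "dderiv e g = (\<lambda>x. frechet_derivative g (at x) e)"

primrec iter_dderiv :: "'a::real_normed_vector list \<Rightarrow> ('a \<Rightarrow> 'b::real_normed_vector) \<Rightarrow> 'a \<Rightarrow> 'b" where
  "iter_dderiv [] g = g"
| "iter_dderiv (e # es) g = dderiv e (iter_dderiv es g)"

text \<open>Every iterated directional derivative is itself (Frechet) differentiable everywhere,
  hence also continuous: this is the class of infinitely differentiable functions.\<close>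

definition smooth_fun :: "('a::real_normed_vector \<Rightarrow> 'b::real_normed_vector) \<Rightarrow> bool" where
  "smooth_fun g \<longleftrightarrow> (\<forall>es. iter_dderiv es g differentiable_on UNIV)"

section \<open>Functions on the torus\<close>

text \<open>A function on the torus of side \<open>L\<close> is represented by a function on \<open>\<real>\<^sup>3\<close> of which only the
  (almost everywhere) values on the period cell \<open>[0,L]\<^sup>3\<close> are used. Integrals are not normalised.\<close>

definition torus :: "real \<Rightarrow> (real^3) measure" where
  "torus L = lebesgue_on (cbox 0 (\<chi> i. L))"

definition L2_torus :: "real \<Rightarrow> (real^3 \<Rightarrow> real^3) set" where
  "L2_torus L = {g. g \<in> borel_measurable (torus L) \<and> integrable (torus L) (\<lambda>x. (norm (g x))\<^sup>2)}"

text \<open>The norm of \<open>L\<^sup>r\<close>, with \<open>2 \<le> r \<le> \<infinity>\<close>. It is only ever applied to trigonometric polynomials,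
  so it is kept real-valued.\<close>

definition Lr_norm :: "real \<Rightarrow> ereal \<Rightarrow> (real^3 \<Rightarrow> 'b::euclidean_space) \<Rightarrow> real" where
  "Lr_norm L r g =
     (if r = \<infinity> then real_of_ereal (esssup (torus L) (\<lambda>x. ereal (norm (g x))))
      else (LINT x|torus L. norm (g x) powr real_of_ereal r) powr (1 / real_of_ereal r))"

definition complexify :: "(real^3 \<Rightarrow> real^3) \<Rightarrow> real^3 \<Rightarrow> complex^3" where
  "complexify g = (\<lambda>x. \<chi> i. complex_of_real (g x $ i))"

text \<open>The matrix of first partial derivatives; its norm is the Frobenius norm.\<close>

definition grad :: "(real^3 \<Rightarrow> complex^3) \<Rightarrow> real^3 \<Rightarrow> complex^3^3" where
  "grad g = (\<lambda>x. \<chi> j. dderiv (axis j 1) g x)"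

section \<open>Littlewood-Paley decomposition\<close>

definition freq :: "int^3 \<Rightarrow> real^3" where
  "freq k = (\<chi> i. real_of_int (k $ i))"

definition fourier_coeff :: "real \<Rightarrow> (real^3 \<Rightarrow> real^3) \<Rightarrow> int^3 \<Rightarrow> complex^3" where
  "fourier_coeff L g k =
     (\<chi> i. complex_of_real (1 / L ^ 3) *
        (LINT x|torus L. complex_of_real (g x $ i) *
           exp (- (\<i> * complex_of_real (2 * pi / L * (freq k \<bullet> x))))))"

definition lam :: "real \<Rightarrow> int \<Rightarrow> real" where
  "lam L q = 2 powi q / L"

definition lam_ext :: "real \<Rightarrow> enat \<Rightarrow> ereal" where
  "lam_ext L q = (case q of enat n \<Rightarrow> ereal (lam L (int n)) | \<infinity> \<Rightarrow> \<infinity>)"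

definition lp_cutoff :: "(real^3 \<Rightarrow> real) \<Rightarrow> bool" where
  "lp_cutoff \<eta> \<longleftrightarrow>
     smooth_fun \<eta> \<and>
     (\<forall>\<xi>. 0 \<le> \<eta> \<xi>) \<and>
     (\<forall>\<xi> \<zeta>. norm \<xi> = norm \<zeta> \<longrightarrow> \<eta> \<xi> = \<eta> \<zeta>) \<and>
     (\<forall>\<xi>. norm \<xi> \<le> 3/4 \<longrightarrow> \<eta> \<xi> = 1) \<and>
     (\<forall>\<xi>. 1 \<le> norm \<xi> \<longrightarrow> \<eta> \<xi> = 0)"

text \<open>Meant for \<open>q \<ge> -1\<close> only.\<close>

definition lp_mult :: "(real^3 \<Rightarrow> real) \<Rightarrow> int \<Rightarrow> real^3 \<Rightarrow> real" where
  "lp_mult \<eta> q \<xi> =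
     (if q = -1 then \<eta> \<xi>
      else (let \<phi> = (\<lambda>\<zeta>. \<eta> ((1/2) *\<^sub>R \<zeta>) - \<eta> \<zeta>) in \<phi> ((2 powi (- q)) *\<^sub>R \<xi>)))"

text \<open>Only finitely many terms of the sum over \<open>k\<close> are nonzero. The blocks of a real field are
  real-valued because the cutoff is even, but they are kept in \<open>complex^3\<close>.\<close>

definition lp_block :: "(real^3 \<Rightarrow> real) \<Rightarrow> real \<Rightarrow> (real^3 \<Rightarrow> real^3) \<Rightarrow> int \<Rightarrow> real^3 \<Rightarrow> complex^3" where
  "lp_block \<eta> L g q = (\<lambda>x. \<Sum>\<^sub>\<infinity>k\<in>UNIV.
     (complex_of_real (lp_mult \<eta> q (freq k)) *
        exp (\<i> * complex_of_real (2 * pi / L * (freq k \<bullet> x)))) *s fourier_coeff L g k)"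

definition lp_low :: "(real^3 \<Rightarrow> real) \<Rightarrow> real \<Rightarrow> (real^3 \<Rightarrow> real^3) \<Rightarrow> enat \<Rightarrow> real^3 \<Rightarrow> complex^3" where
  "lp_low \<eta> L g q =
     (case q of enat n \<Rightarrow> (\<lambda>x. \<Sum>p\<in>{-1..int n}. lp_block \<eta> L g p x)
              | \<infinity> \<Rightarrow> complexify g)"

definition Hs_term :: "(real^3 \<Rightarrow> real) \<Rightarrow> real \<Rightarrow> real \<Rightarrow> (real^3 \<Rightarrow> real^3) \<Rightarrow> int \<Rightarrow> real" where
  "Hs_term \<eta> L s g q = lam L q powr (2 * s) * (Lr_norm L 2 (lp_block \<eta> L g q))\<^sup>2"

definition in_Hs :: "(real^3 \<Rightarrow> real) \<Rightarrow> real \<Rightarrow> real \<Rightarrow> (real^3 \<Rightarrow> real^3) \<Rightarrow> bool" where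
  "in_Hs \<eta> L s g \<longleftrightarrow> Hs_term \<eta> L s g summable_on {-1..}"

text \<open>Meaningful only under \<^term>\<open>in_Hs \<eta> L s g\<close>, which is automatic when \<open>s \<le> 0\<close> and \<open>g\<close> is in \<open>L\<^sup>2\<close>.\<close>

definition Hs_norm :: "(real^3 \<Rightarrow> real) \<Rightarrow> real \<Rightarrow> real \<Rightarrow> (real^3 \<Rightarrow> real^3) \<Rightarrow> real" where
  "Hs_norm \<eta> L s g = sqrt (\<Sum>\<^sub>\<infinity>q\<in>{-1..}. Hs_term \<eta> L s g q)"

section \<open>Distributions on \<open>(0,\<infinity>) \<times> \<T>\<^sup>3\<close>\<close>

definition test_funs :: "real \<Rightarrow> real \<Rightarrow> real \<Rightarrow> (real \<times> (real^3) \<Rightarrow> 'b::real_normed_vector) set" where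
  "test_funs L a b = {\<psi>. smooth_fun \<psi> \<and>
     (\<forall>t x j. \<psi> (t, x + axis j L) = \<psi> (t, x)) \<and>
     (\<forall>t x. t \<notin> {a..b} \<longrightarrow> \<psi> (t, x) = 0)}"

definition test_space :: "real \<Rightarrow> (real \<times> (real^3) \<Rightarrow> 'b::real_normed_vector) set" where
  "test_space L = (\<Union>a\<in>{0<..}. \<Union>b. test_funs L a b)"

text \<open>A linear functional on test functions (its values elsewhere are irrelevant) which, on test
  functions supported in a fixed compact time interval, is bounded by a multiple of a
  \<open>C\<^sup>N\<close> norm, i.e. is continuous for the usual topology.\<close>

definition distribution :: "real \<Rightarrow> ((real \<times> (real^3) \<Rightarrow> 'b::real_normed_vector) \<Rightarrow> real) \<Rightarrow> bool" where
  "distribution L T \<longleftrightarrow>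
     (\<forall>\<psi>\<in>test_space L. \<forall>\<psi>'\<in>test_space L. T (\<lambda>z. \<psi> z + \<psi>' z) = T \<psi> + T \<psi>') \<and>
     (\<forall>\<psi>\<in>test_space L. \<forall>c. T (\<lambda>z. c *\<^sub>R \<psi> z) = c * T \<psi>) \<and>
     (\<forall>a b. 0 < a \<longrightarrow> (\<exists>(N::nat) C. \<forall>\<psi>\<in>test_funs L a b. \<forall>M.
        (\<forall>es z. set es \<subseteq> Basis \<and> length es \<le> N \<longrightarrow> norm (iter_dderiv es \<psi> z) \<le> M)
          \<longrightarrow> \<bar>T \<psi>\<bar> \<le> C * M))"

text \<open>A vector-valued distribution acts on vector-valued test functions; it has zero spatial mean
  iff it annihilates those depending on time only.\<close>

definition zero_mean_distribution :: "real \<Rightarrow> ((real \<times> (real^3) \<Rightarrow> 'b::real_normed_vector) \<Rightarrow> real) \<Rightarrow> bool" where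
  "zero_mean_distribution L T \<longleftrightarrow>
     distribution L T \<and>
     (\<forall>\<psi>\<in>test_space L. (\<forall>t x y. \<psi> (t, x) = \<psi> (t, y)) \<longrightarrow> T \<psi> = 0)"

abbreviation dt :: "(real \<times> (real^3) \<Rightarrow> 'b::real_normed_vector) \<Rightarrow> real \<times> (real^3) \<Rightarrow> 'b" where
  "dt \<equiv> dderiv (1, 0)"

abbreviation dx :: "real^3 \<Rightarrow> (real \<times> (real^3) \<Rightarrow> 'b::real_normed_vector) \<Rightarrow> real \<times> (real^3) \<Rightarrow> 'b" where
  "dx w \<equiv> dderiv (0, w)"

definition laplace_x :: "(real \<times> (real^3) \<Rightarrow> 'b::real_normed_vector) \<Rightarrow> real \<times> (real^3) \<Rightarrow> 'b" where
  "laplace_x \<psi> z = (\<Sum>j\<in>UNIV. dx (axis j 1) (dx (axis j 1) \<psi>) z)"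

definition div_x :: "(real \<times> (real^3) \<Rightarrow> real^3) \<Rightarrow> real \<times> (real^3) \<Rightarrow> real" where
  "div_x \<psi> z = (\<Sum>j\<in>UNIV. dx (axis j 1) \<psi> z $ j)"

section \<open>Weak solutions of the Navier-Stokes equations\<close>

text \<open>\<open>\<nabla> \<cdot> u = 0\<close>, and \<open>u\<^sub>t + (u \<cdot> \<nabla>) u - \<nu> \<Delta> u + \<nabla> p = f\<close> for some pressure distribution \<open>p\<close>,
  tested against \<open>\<psi>\<close>. The term \<open>(u \<cdot> \<nabla>) u\<close> is the distribution \<open>\<nabla> \<cdot> (u \<otimes> u)\<close>, so that
  \<open>\<langle>(u \<cdot> \<nabla>) u, \<psi>\<rangle> = - \<integral>\<integral> u \<cdot> (u \<cdot> \<nabla>) \<psi>\<close>. Space-time integrals are iterated because \<open>u t\<close> is an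
  element of \<open>L\<^sup>2\<close> for each \<open>t\<close>, with no joint measurability of representatives.\<close>

definition divergence_free :: "real \<Rightarrow> (real \<Rightarrow> real^3 \<Rightarrow> real^3) \<Rightarrow> bool" where
  "divergence_free L u \<longleftrightarrow>
     (\<forall>\<psi> :: real \<times> (real^3) \<Rightarrow> real. \<psi> \<in> test_space L \<longrightarrow>
        (LBINT t:{0<..}. (LINT x|torus L. dx (u t x) \<psi> (t, x))) = 0)"

definition momentum_eq ::
  "real \<Rightarrow> real \<Rightarrow> ((real \<times> (real^3) \<Rightarrow> real^3) \<Rightarrow> real) \<Rightarrow> ((real \<times> (real^3) \<Rightarrow> real) \<Rightarrow> real) \<Rightarrow>
   (real \<Rightarrow> real^3 \<Rightarrow> real^3) \<Rightarrow> bool" where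
  "momentum_eq L \<nu> f p u \<longleftrightarrow>
     (\<forall>\<psi>\<in>test_space L.
        (LBINT t:{0<..}. (LINT x|torus L.
             - (u t x \<bullet> dt \<psi> (t, x))
             - (u t x \<bullet> dx (u t x) \<psi> (t, x))
             - \<nu> * (u t x \<bullet> laplace_x \<psi> (t, x))))
        - p (div_x \<psi>) = f \<psi>)"

definition weak_solution ::
  "(real^3 \<Rightarrow> real) \<Rightarrow> real \<Rightarrow> real \<Rightarrow> ((real \<times> (real^3) \<Rightarrow> real^3) \<Rightarrow> real) \<Rightarrow>
   (real \<Rightarrow> real^3 \<Rightarrow> real^3) \<Rightarrow> bool" where
  "weak_solution \<eta> L \<nu> f u \<longleftrightarrow>
     (\<forall>t\<ge>0. u t \<in> L2_torus L) \<and>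
     (\<forall>g\<in>L2_torus L. continuous_on {0..} (\<lambda>t. LINT x|torus L. u t x \<bullet> g x)) \<and>
     (\<forall>a b. 0 < a \<longrightarrow>
        (AE t in lebesgue_on {a..b}. in_Hs \<eta> L 1 (u t)) \<and>
        integrable (lebesgue_on {a..b}) (\<lambda>t. (Hs_norm \<eta> L 1 (u t))\<^sup>2)) \<and>
     (\<forall>t\<ge>0. (LINT x|torus L. u t x) = 0) \<and>
     divergence_free L u \<and>
     (\<exists>p. distribution L p \<and> momentum_eq L \<nu> f p u)"

section \<open>The determining wavenumber\<close>

definition wn_params :: "(ereal \<times> real) set" where
  "wn_params = {(r, \<delta>). 2 \<le> r \<and> \<delta> \<in> {0..3} \<and> (r, \<delta>) \<noteq> (\<infinity>, 0)}"

text \<open>\<open>3/r\<close>, which is \<open>0\<close> for \<open>r = \<infinity>\<close>.\<close>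

definition three_over :: "ereal \<Rightarrow> real" where
  "three_over r = real_of_ereal (3 / r)"

definition c_const :: "real \<Rightarrow> ereal \<Rightarrow> real \<Rightarrow> real" where
  "c_const c\<^sub>0 r \<delta> =
     (let \<sigma> = (\<delta> - 1) / 2; s = min (- 1/2 + \<delta>/4) 0
      in 1 / (2 * c\<^sub>0 * (1 + 1 / (1 - 2 powr (s - \<sigma> - three_over r))\<^sup>2)))"

text \<open>Infima stand for minima: all values lie in \<open>{\<lambda>\<^sub>q | q \<in> \<nat>} \<union> {\<infinity>}\<close>, which is well-ordered,
  and the infimum of the empty set is \<open>\<infinity>\<close>.\<close>

definition wavenumber_rd ::
  "(real^3 \<Rightarrow> real) \<Rightarrow> real \<Rightarrow> real \<Rightarrow> real \<Rightarrow> ereal \<Rightarrow> real \<Rightarrow> (real^3 \<Rightarrow> real^3) \<Rightarrow> ereal" where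
  "wavenumber_rd \<eta> L \<nu> c\<^sub>0 r \<delta> g = Inf {ereal (lam L (int q)) | q :: nat.
     (\<forall>p > int q. (L * lam L (p - int q)) powr (three_over r - 1/2 + \<delta>/2) *
          lam L (int q) powr (- 1 + three_over r) * Lr_norm L r (lp_block \<eta> L g p)
        < c_const c\<^sub>0 r \<delta> * \<nu>) \<and>
     lam L (int q) powr (- 2) * Lr_norm L \<infinity> (grad (lp_low \<eta> L g (enat q)))
        < c_const c\<^sub>0 r \<delta> * \<nu>}"

definition wavenumber ::
  "(real^3 \<Rightarrow> real) \<Rightarrow> real \<Rightarrow> real \<Rightarrow> real \<Rightarrow> (real^3 \<Rightarrow> real^3) \<Rightarrow> ereal" where
  "wavenumber \<eta> L \<nu> c\<^sub>0 g = (INF (r, \<delta>)\<in>wn_params. wavenumber_rd \<eta> L \<nu> c\<^sub>0 r \<delta> g)"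

end

theory Submission
  imports Defs
begin

text \<open>With \<open>w = u - v\<close> and Fourier coefficients \<open>W k\<close>, the proof bounds the energy
  \<open>\<Sum> \<bar>W k\<bar>\<^sup>2 / \<bar>k\<bar>\<close>, i.e. the square of the \<open>H\<close>-norm of order \<open>-1/2\<close>; it works uniformly for all
  \<open>(r, \<delta>)\<close> and dominates the norm of order \<open>-5/4\<close>. Its dissipation is a multiple of
  \<open>\<nu> \<Sum> \<bar>k\<bar> \<bar>W k\<bar>\<^sup>2\<close>. Since \<open>W\<close> vanishes below the determining wavenumber, only interactions of high modes
  of \<open>w\<close> remain: those with the low modes of \<open>u\<close> and \<open>v\<close> are controlled by the gradient condition
  (for the transport term after passing to a commutator), those with a high block by Bernstein's
  inequality and the block condition, which sum up as geometric series to
  \<open>O(\<nu> / c\<^sub>0) \<Sum> \<bar>k\<bar> \<bar>W k\<bar>\<^sup>2\<close>. Weak solutions satisfy no energy equality, so the energy is truncated to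
  \<open>\<bar>k\<bar> \<le> n\<close>; the truncation error tends to \<open>0\<close> because \<open>u\<close> and \<open>v\<close> are locally square
  integrable in time with values in \<open>H\<^sup>1\<close>. The remaining differential inequality forces decay.\<close>

section \<open>Fourier series on the torus\<close>

text \<open>The obstacle is that \<open>f\<close> is a mere distribution and a weak solution cannot
  be tested with itself. Everything therefore rests on the difference of the two momentum equations,
  tested with single divergence-free plane waves: \<open>f\<close> and the pressure drop out, and
  each mode of \<open>w\<close> obeys an integral equation in time that can be squared. The smooth
  functions of time needed for this come from the given cutoff, restricted to a line.

  Truncation destroys the antisymmetry of transport, because pairs with one frequency beyond
  \<open>n\<close> remain. They contribute at most a constant times the root of the truncated energy
  times a factor whose time integral vanishes as \<open>n\<close> grows.

  The weight 1/|k| makes the interaction of shells at distance d decay like 2^(-\<gamma> d) with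
  \<gamma> = \<delta>/2 + 3/r, which is positive for all admissible parameters. The exponent s -
  \<sigma> - 3/r in the constant c(r,\<delta>) lies between -\<gamma> and 0, so this constant pays
  for the geometric series with ratio 2^(-\<gamma>).\<close>

lemma freq_zero [simp]: "freq 0 = 0"
  by (simp add: freq_def vec_eq_iff)

lemma freq_add: "freq (k + l) = freq k + freq l"
  by (simp add: freq_def vec_eq_iff)

lemma freq_minus [simp]: "freq (- k) = - freq k"
  by (simp add: freq_def vec_eq_iff)

lemma freq_diff: "freq (k - l) = freq k - freq l"
  by (simp add: freq_def vec_eq_iff)

lemma freq_nth [simp]: "freq k $ i = of_int (k $ i)"
  by (simp add: freq_def)

lemma freq_eq_0_iff [simp]: "freq k = 0 \<longleftrightarrow> k = 0"
  by (simp add: freq_def vec_eq_iff)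

lemma norm_freq_ge_1: assumes "k \<noteq> 0" shows "1 \<le> norm (freq k)"
proof -
  obtain i where i: "k $ i \<noteq> 0" using assms by (auto simp: vec_eq_iff)
  have "1 \<le> \<bar>real_of_int (k $ i)\<bar>" using i by linarith
  also have "\<dots> \<le> norm (freq k)" using component_le_norm_cart[of "freq k" i] by simp
  finally show ?thesis .
qed

lemma box_card_le:
  assumes "0 \<le> R"
  shows "finite {k::int^3. \<forall>i. \<bar>real_of_int (k$i)\<bar> \<le> R}"
    and "real (card {k::int^3. \<forall>i. \<bar>real_of_int (k$i)\<bar> \<le> R}) \<le> (2 * R + 1) ^ 3"
proof -
  define N where "N = \<lfloor>R\<rfloor>"
  let ?S = "{k::int^3. \<forall>i. \<bar>real_of_int (k$i)\<bar> \<le> R}"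
  have S: "?S \<subseteq> vec_lambda ` (\<Pi>\<^sub>E i\<in>UNIV. {-N..N})"
  proof
    fix k :: "int^3" assume k: "k \<in> ?S"
    have "k$i \<in> {-N..N}" for i
    proof -
      have "\<bar>real_of_int (k$i)\<bar> \<le> R" using k by auto
      then have "real_of_int \<bar>k$i\<bar> \<le> R" by simp
      then have "\<bar>k$i\<bar> \<le> N" unfolding N_def by (simp add: le_floor_iff)
      then show ?thesis by auto
    qed
    then have "vec_nth k \<in> (\<Pi>\<^sub>E i\<in>UNIV. {-N..N})" by auto
    then show "k \<in> vec_lambda ` (\<Pi>\<^sub>E i\<in>UNIV. {-N..N})"
      by (metis image_eqI vec_nth_inverse)
  qed
  have fin: "finite (\<Pi>\<^sub>E i\<in>(UNIV::3 set). {-N..N})" by (intro finite_PiE) auto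
  show "finite ?S" by (rule finite_subset[OF S]) (use fin in auto)
  have "card ?S \<le> card (vec_lambda ` (\<Pi>\<^sub>E i\<in>(UNIV::3 set). {-N..N}))"
    by (rule card_mono[OF _ S]) (use fin in auto)
  also have "\<dots> \<le> card (\<Pi>\<^sub>E i\<in>(UNIV::3 set). {-N..N})" by (rule card_image_le[OF fin])
  also have "\<dots> = (nat (2 * N + 1)) ^ 3" by (simp add: card_PiE)
  finally have "real (card ?S) \<le> real ((nat (2 * N + 1)) ^ 3)" by (simp only: of_nat_le_iff)
  also have "\<dots> = real_of_int (2 * N + 1) ^ 3"
    using assms by (simp add: N_def)
  also have "\<dots> \<le> (2 * R + 1) ^ 3"
    using assms by (intro power_mono) (auto simp: N_def)
  finally show "real (card ?S) \<le> (2 * R + 1) ^ 3" .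
qed

lemma ball_subset_box: "{k::int^3. norm (freq k) \<le> R} \<subseteq> {k. \<forall>i. \<bar>real_of_int (k$i)\<bar> \<le> R}"
proof safe
  fix k :: "int^3" and i assume "norm (freq k) \<le> R"
  then show "\<bar>real_of_int (k$i)\<bar> \<le> R" using component_le_norm_cart[of "freq k" i] by simp
qed

lemma finite_freq_ball [simp]: "finite {k::int^3. norm (freq k) \<le> R}"
proof (cases "0 \<le> R")
  case True
  show ?thesis by (rule finite_subset[OF ball_subset_box box_card_le(1)[OF True]])
next
  case False
  then have "{k::int^3. norm (freq k) \<le> R} = {}" using norm_ge_zero by (auto simp: not_le intro: less_le_trans)
  then show ?thesis by simp
qed

lemma card_freq_ball: "0 \<le> R \<Longrightarrow> real (card {k::int^3. norm (freq k) \<le> R}) \<le> (2 * R + 1) ^ 3"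
  using card_mono[OF box_card_le(1) ball_subset_box, of R] box_card_le(2)[of R] by linarith

section \<open>Characters and integration over the period cell\<close>

definition ek :: "real \<Rightarrow> int^3 \<Rightarrow> real^3 \<Rightarrow> complex" where
  "ek L k x = exp (\<i> * complex_of_real (2 * pi / L * (freq k \<bullet> x)))"

lemma ek_0 [simp]: "ek L 0 x = 1" by (simp add: ek_def)

lemma ek_add: "ek L (k + l) x = ek L k x * ek L l x"
  by (simp add: ek_def freq_add inner_add_left distrib_left flip: exp_add)

lemma norm_ek [simp]: "cmod (ek L k x) = 1" by (simp add: ek_def)

lemma cnj_ek: "cnj (ek L k x) = ek L (- k) x"
  by (simp add: ek_def exp_cnj)

lemma ek_minus: "ek L (- k) x = exp (- (\<i> * complex_of_real (2 * pi / L * (freq k \<bullet> x))))"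
  by (simp add: ek_def)

lemma ek_at_0 [simp]: "ek L k 0 = 1" by (simp add: ek_def)

lemma continuous_ek [continuous_intros]: "continuous_on S (ek L k)"
  unfolding ek_def by (intro continuous_intros)

lemma space_torus [simp]: "space (torus L) = cbox 0 (\<chi> i. L)"
  by (simp add: torus_def)

lemma emeasure_torus: assumes "0 < L" shows "emeasure (torus L) (space (torus L)) = ennreal (L ^ 3)"
proof -
  have "emeasure (torus L) (space (torus L)) = emeasure lebesgue (cbox 0 (\<chi> i. L) :: (real^3) set)"
    by (simp add: torus_def emeasure_restrict_space)
  also have "\<dots> = emeasure lborel (cbox 0 (\<chi> i. L) :: (real^3) set)" by simp
  also have "\<dots> = ennreal (\<Prod>b\<in>Basis. ((\<chi> i. L) - 0 :: real^3) \<bullet> b)"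
    using assms by (subst emeasure_lborel_cbox) (auto simp: Basis_vec_def inner_axis)
  also have "(\<Prod>b\<in>Basis. ((\<chi> i. L) - 0 :: real^3) \<bullet> b) = (\<Prod>b\<in>(Basis::(real^3) set). L)"
    by (intro prod.cong) (auto simp: Basis_vec_def inner_axis)
  finally show ?thesis by simp
qed

lemma finite_measure_torus: "0 < L \<Longrightarrow> finite_measure (torus L)"
  by (intro finite_measureI) (simp only: emeasure_torus infinity_ennreal_def ennreal_neq_top not_False_eq_True)

lemma measure_torus: "0 < L \<Longrightarrow> measure (torus L) (space (torus L)) = L ^ 3"
  by (simp only: measure_def emeasure_torus) simp

lemma continuous_measurable_torus [measurable_dest]:
  fixes f :: "real^3 \<Rightarrow> 'b::topological_space"
  assumes "continuous_on UNIV f" shows "f \<in> borel_measurable (torus L)"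
proof -
  have "f \<in> borel_measurable borel" using assms by (rule borel_measurable_continuous_onI)
  then have "f \<in> measurable lebesgue borel" by (simp add: measurable_completion)
  then show ?thesis unfolding torus_def by (rule measurable_restrict_space1)
qed

lemma ek_measurable [measurable]: "ek L k \<in> borel_measurable (torus M)"
  by (rule continuous_measurable_torus) (rule continuous_ek)

text \<open>The measure \<open>torus L\<close> is a restriction of completed Lebesgue measure. Borel
  integrands can be moved to \<open>lborel\<close>, a product measure, where integrals factorise
  over the coordinates.\<close>

lemma integral_torus_borel:
  fixes f :: "real^3 \<Rightarrow> 'b::{banach,second_countable_topology}"
  assumes "f \<in> borel_measurable borel"
  shows "(LINT x|torus L. f x) = (LINT x|lborel. indicator (cbox 0 (\<chi> i. L)) x *\<^sub>R f x)"
proof -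
  have "(LINT x|torus L. f x) = (LINT x|lebesgue. indicator (cbox 0 (\<chi> i. L)) x *\<^sub>R f x)"
    unfolding torus_def by (subst integral_restrict_space) auto
  also have "\<dots> = (LINT x|lborel. indicator (cbox 0 (\<chi> i. L)) x *\<^sub>R f x)"
    by (rule integral_completion) (use assms in measurable)
  finally show ?thesis .
qed

lemma integral_exp_period:
  assumes "0 < L" and "n \<noteq> (0::int)"
  shows "(LINT y|lborel. indicator {0..L} y *\<^sub>R exp (\<i> * complex_of_real (2 * pi / L * (n * y)))) = 0"
proof -
  define c where "c = \<i> * complex_of_real (2 * pi / L * n)"
  have c: "c \<noteq> 0" using assms by (simp add: c_def)
  have "(LINT y|lborel. indicator {0..L} y *\<^sub>R exp (c * of_real y)) = exp (c * of_real L) / c - exp (c * of_real 0) / c"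
  proof (rule integral_FTC_atLeastAtMost)
    fix x assume "0 \<le> x" "x \<le> L"
    have "((\<lambda>z. exp (c * z) / c) has_field_derivative exp (c * of_real x)) (at (of_real x))"
      by (auto intro!: derivative_eq_intros simp: c)
    then show "((\<lambda>x. exp (c * of_real x) / c) has_vector_derivative exp (c * of_real x)) (at x within {0..L})"
      by (rule has_vector_derivative_real_field)
  qed (use assms in \<open>auto intro!: continuous_intros\<close>)
  also have "c * of_real L = \<i> * of_int n * (of_real pi * 2)"
    using assms by (simp add: c_def field_simps)
  also have "exp (\<i> * of_int n * (of_real pi * 2)) = 1"
    using exp_integer_2pi[of "of_int n"] by (simp add: mult_ac)
  finally show ?thesis by (simp add: c_def mult_ac)
qed

text \<open>A character is a product of one-dimensional exponentials, one for each coordinate, so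
  its integral is a product of integrals over full periods. A nonzero component of \<open>k\<close>
  makes the corresponding factor vanish.\<close>

lemma integral_ek:
  assumes "0 < L"
  shows "(LINT x|torus L. ek L k x) = (if k = 0 then complex_of_real (L ^ 3) else 0)"
proof (cases "k = 0")
  case True
  then have "(LINT x|torus L. ek L k x) = (LINT x|torus L. 1)" by simp
  also have "\<dots> = complex_of_real (L ^ 3)"
    using measure_torus[OF assms] by (simp add: scaleR_conv_of_real)
  finally show ?thesis using True by simp
next
  case False
  then obtain i where i: "k $ i \<noteq> 0" by (auto simp: vec_eq_iff)
  define g where "g b y = indicator {0..L} y *\<^sub>R exp (\<i> * complex_of_real (2 * pi / L * ((freq k \<bullet> b) * y)))" for b :: "real^3" and y :: real
  interpret product_sigma_finite "\<lambda>b::real^3. lborel :: real measure" by standard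
  let ?P = "\<Pi>\<^sub>M b\<in>(Basis::(real^3) set). (lborel :: real measure)"
  let ?T = "\<lambda>f. \<Sum>b\<in>(Basis::(real^3) set). f b *\<^sub>R b"
  have [measurable]: "ek L k \<in> borel_measurable borel"
    by (intro borel_measurable_continuous_onI continuous_ek)
  have lb: "(lborel :: (real^3) measure) = distr ?P borel ?T"
    unfolding lborel_def[where 'a="real^3"] lborel_eq_real ..
  have T: "?T f \<bullet> b = f b" if "b \<in> Basis" for f b
    using that by simp
  have "(LINT x|torus L. ek L k x) = (LINT x|lborel. indicator (cbox 0 (\<chi> i. L)) x *\<^sub>R ek L k x)"
    by (rule integral_torus_borel) measurable
  also have "\<dots> = (LINT f|?P. indicator (cbox 0 (\<chi> i. L)) (?T f) *\<^sub>R ek L k (?T f))"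
    unfolding lb by (rule integral_distr) measurable
  also have "\<dots> = (LINT f|?P. (\<Prod>b\<in>Basis. g b (f b)))"
  proof (rule Bochner_Integration.integral_cong[OF refl])
    fix f :: "real^3 \<Rightarrow> real"
    have B: "(\<chi> i. L) \<bullet> b = L" if "b \<in> Basis" for b :: "real^3"
      using that by (auto simp: Basis_vec_def inner_axis)
    have "indicator (cbox 0 (\<chi> i. L)) (?T f) = (\<Prod>b\<in>(Basis::(real^3) set). indicator {0..L} (f b) :: real)"
      by (auto simp: indicator_def mem_box T B)
    moreover have "ek L k (?T f) = (\<Prod>b\<in>Basis. exp (\<i> * complex_of_real (2 * pi / L * ((freq k \<bullet> b) * f b))))"
    proof -
      have "freq k \<bullet> ?T f = (\<Sum>b\<in>Basis. (freq k \<bullet> b) * f b)"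
        by (subst euclidean_inner) (simp add: T)
      then show ?thesis
        by (simp add: ek_def sum_distrib_left flip: exp_sum)
    qed
    ultimately show "indicator (cbox 0 (\<chi> i. L)) (?T f) *\<^sub>R ek L k (?T f) = (\<Prod>b\<in>Basis. g b (f b))"
      by (simp add: g_def scaleR_conv_of_real prod.distrib)
  qed
  also have "\<dots> = (\<Prod>b\<in>Basis. LINT y|lborel. g b y)"
  proof (rule product_integral_prod)
    fix b :: "real^3"
    show "integrable lborel (g b)" unfolding g_def
      by (rule borel_integrable_compact) (use assms in \<open>auto intro!: continuous_intros\<close>)
  qed simp
  also have "\<dots> = 0"
  proof (rule prod_zero)
    show "\<exists>b\<in>Basis. (LINT y|lborel. g b y) = 0"
    proof (rule bexI[of _ "axis i 1"])
      have "g (axis i 1) = (\<lambda>y. indicator {0..L} y *\<^sub>R exp (\<i> * complex_of_real (2 * pi / L * (real_of_int (k$i) * y))))"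
        by (simp add: g_def inner_axis fun_eq_iff)
      then show "(LINT y|lborel. g (axis i 1) y) = 0" using integral_exp_period[OF assms i] by simp
    qed (auto simp: axis_in_Basis_iff)
  qed simp
  finally show ?thesis using False by simp
qed

section \<open>Square-integrable functions, Fourier coefficients and Bessel's inequality\<close>

definition L2c :: "real \<Rightarrow> (real^3 \<Rightarrow> complex) set" where
  "L2c L = {f. f \<in> borel_measurable (torus L) \<and> integrable (torus L) (\<lambda>x. (cmod (f x))\<^sup>2)}"

definition fc :: "real \<Rightarrow> (real^3 \<Rightarrow> complex) \<Rightarrow> int^3 \<Rightarrow> complex" where
  "fc L f k = (LINT x|torus L. f x * ek L (- k) x) / complex_of_real (L ^ 3)"

text \<open>The trigonometric polynomial with spectrum in \<open>F\<close>; the values of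
  \<open>c\<close> outside \<open>F\<close> do not matter.\<close>

definition tp :: "real \<Rightarrow> (int^3) set \<Rightarrow> (int^3 \<Rightarrow> complex) \<Rightarrow> real^3 \<Rightarrow> complex" where
  "tp L F c x = (\<Sum>k\<in>F. c k * ek L k x)"

lemma bounded_integrable_torus:
  fixes f :: "real^3 \<Rightarrow> 'b::{banach,second_countable_topology}"
  assumes "0 < L" "f \<in> borel_measurable (torus L)" "\<And>x. norm (f x) \<le> K"
  shows "integrable (torus L) f"
proof -
  interpret finite_measure "torus L" by (rule finite_measure_torus[OF assms(1)])
  show ?thesis by (rule integrable_const_bound[of _ K]) (use assms in auto)
qed

lemma norm_mult_le_squares: "cmod (a * b) \<le> (cmod a)\<^sup>2 + (cmod b)\<^sup>2"
  using sum_squares_bound[of "cmod a" "cmod b"] mult_nonneg_nonneg[OF norm_ge_zero norm_ge_zero, of a b]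
  unfolding norm_mult mult.assoc by linarith

lemma cnj_measurable [measurable]: "f \<in> borel_measurable M \<Longrightarrow> (\<lambda>x. cnj (f x)) \<in> borel_measurable M"
  by (rule measurable_compose[OF _ borel_measurable_continuous_onI]) (auto intro!: continuous_intros)

lemma L2c_mult_integrable:
  assumes "f \<in> L2c L" "g \<in> L2c L" shows "integrable (torus L) (\<lambda>x. f x * g x)"
proof (rule Bochner_Integration.integrable_bound)
  show "integrable (torus L) (\<lambda>x. (cmod (f x))\<^sup>2 + (cmod (g x))\<^sup>2)"
    using assms by (auto simp: L2c_def)
  show "(\<lambda>x. f x * g x) \<in> borel_measurable (torus L)" using assms by (auto simp: L2c_def)
  show "AE x in torus L. norm (f x * g x) \<le> norm ((cmod (f x))\<^sup>2 + (cmod (g x))\<^sup>2)"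
    using norm_mult_le_squares by (auto intro!: AE_I2)
qed

lemma L2c_meas [measurable_dest]: "f \<in> L2c L \<Longrightarrow> f \<in> borel_measurable (torus L)"
  by (simp add: L2c_def)

lemma L2c_int: "f \<in> L2c L \<Longrightarrow> integrable (torus L) (\<lambda>x. (cmod (f x))\<^sup>2)"
  by (simp add: L2c_def)

lemma L2c_bounded_mult:
  assumes "f \<in> L2c L" and [measurable]: "g \<in> borel_measurable (torus L)" and "\<And>x. cmod (g x) \<le> K"
  shows "(\<lambda>x. f x * g x) \<in> L2c L"
proof -
  note [measurable] = L2c_meas[OF assms(1)]
  have "integrable (torus L) (\<lambda>x. (cmod (f x * g x))\<^sup>2)"
  proof (rule Bochner_Integration.integrable_bound)
    show "integrable (torus L) (\<lambda>x. K\<^sup>2 * (cmod (f x))\<^sup>2)" using L2c_int[OF assms(1)] by simp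
    show "AE x in torus L. norm ((cmod (f x * g x))\<^sup>2) \<le> norm (K\<^sup>2 * (cmod (f x))\<^sup>2)"
    proof (rule AE_I2)
      fix x
      have "(cmod (g x))\<^sup>2 \<le> K\<^sup>2" using assms(3)[of x] by (intro power_mono) auto
      then show "norm ((cmod (f x * g x))\<^sup>2) \<le> norm (K\<^sup>2 * (cmod (f x))\<^sup>2)"
        by (simp add: norm_mult power_mult_distrib mult.commute[of "K\<^sup>2"] mult_left_mono)
    qed
  qed measurable
  then show ?thesis by (simp add: L2c_def)
qed

lemma L2c_bounded:
  assumes "0 < L" "f \<in> borel_measurable (torus L)" "\<And>x. cmod (f x) \<le> K"
  shows "f \<in> L2c L"
proof -
  have [measurable]: "f \<in> borel_measurable (torus L)" by fact
  have "integrable (torus L) (\<lambda>x. (cmod (f x))\<^sup>2)"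
    by (rule bounded_integrable_torus[OF assms(1), of _ "K\<^sup>2"]) (use assms(3) in \<open>auto intro!: power_mono\<close>)
  then show ?thesis by (simp add: L2c_def)
qed

lemma L2c_ek: "0 < L \<Longrightarrow> ek L k \<in> L2c L"
  by (rule L2c_bounded[where K=1]) auto

lemma L2c_integrable: assumes "0 < L" "f \<in> L2c L" shows "integrable (torus L) f"
  using L2c_mult_integrable[OF assms(2) L2c_ek[OF assms(1), of 0]] by simp

lemma L2c_cmult: "f \<in> L2c L \<Longrightarrow> (\<lambda>x. c * f x) \<in> L2c L"
  using L2c_bounded_mult[of f L "\<lambda>_. c" "cmod c"] by (simp add: mult.commute)

lemma L2c_add: assumes f: "f \<in> L2c L" and g: "g \<in> L2c L" shows "(\<lambda>x. f x + g x) \<in> L2c L"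
proof -
  note [measurable] = L2c_meas[OF f] L2c_meas[OF g]
  have "integrable (torus L) (\<lambda>x. (cmod (f x + g x))\<^sup>2)"
  proof (rule Bochner_Integration.integrable_bound)
    show "integrable (torus L) (\<lambda>x. 2 * (cmod (f x))\<^sup>2 + 2 * (cmod (g x))\<^sup>2)"
      using L2c_int[OF f] L2c_int[OF g] by simp
    show "AE x in torus L. norm ((cmod (f x + g x))\<^sup>2) \<le> norm (2 * (cmod (f x))\<^sup>2 + 2 * (cmod (g x))\<^sup>2)"
    proof (rule AE_I2)
      fix x
      have "(cmod (f x + g x))\<^sup>2 \<le> (cmod (f x) + cmod (g x))\<^sup>2"
        by (intro power_mono norm_triangle_ineq) auto
      also have "\<dots> \<le> 2 * (cmod (f x))\<^sup>2 + 2 * (cmod (g x))\<^sup>2"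
        using sum_squares_bound[of "cmod (f x)" "cmod (g x)"] by (simp add: power2_sum)
      finally show "norm ((cmod (f x + g x))\<^sup>2) \<le> norm (2 * (cmod (f x))\<^sup>2 + 2 * (cmod (g x))\<^sup>2)" by simp
    qed
  qed measurable
  then show ?thesis by (simp add: L2c_def)
qed

lemma L2c_diff: "f \<in> L2c L \<Longrightarrow> g \<in> L2c L \<Longrightarrow> (\<lambda>x. f x - g x) \<in> L2c L"
  using L2c_add[of f L "\<lambda>x. (-1) * g x"] L2c_cmult[of g L "-1"] by simp

lemma L2c_zero [simp]: "(\<lambda>x. 0) \<in> L2c L" by (simp add: L2c_def)

lemma L2c_sum: "(\<And>i. i \<in> I \<Longrightarrow> f i \<in> L2c L) \<Longrightarrow> (\<lambda>x. \<Sum>i\<in>I. f i x) \<in> L2c L"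
  by (induction I rule: infinite_finite_induct) (auto intro!: L2c_add)

lemma L2c_tp: "0 < L \<Longrightarrow> tp L F c \<in> L2c L"
  unfolding tp_def by (intro L2c_sum L2c_cmult L2c_ek)

lemma L2c_cnj: "f \<in> L2c L \<Longrightarrow> (\<lambda>x. cnj (f x)) \<in> L2c L"
  by (simp add: L2c_def cnj_measurable)

lemma continuous_tp: "continuous_on S (tp L F c)"
  unfolding tp_def by (intro continuous_intros)

lemma tp_measurable [measurable]: "tp L F c \<in> borel_measurable (torus M)"
  by (rule continuous_measurable_torus) (rule continuous_tp)

lemma norm_tp_le: "cmod (tp L F c x) \<le> (\<Sum>k\<in>F. cmod (c k))"
  unfolding tp_def by (rule order_trans[OF norm_sum]) (simp add: norm_mult)

lemma fc_ek: assumes "0 < L" shows "fc L (ek L m) k = (if m = k then 1 else 0)"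
proof -
  have "fc L (ek L m) k = (LINT x|torus L. ek L (m - k) x) / complex_of_real (L ^ 3)"
    unfolding fc_def by (simp flip: ek_add)
  then show ?thesis using integral_ek[OF assms, of "m - k"] assms by simp
qed

lemma fc_cong_AE:
  assumes "AE x in torus L. f x = g x" "f \<in> borel_measurable (torus L)" "g \<in> borel_measurable (torus L)"
  shows "fc L f k = fc L g k"
proof -
  note [measurable] = assms(2,3)
  have "(LINT x|torus L. f x * ek L (- k) x) = (LINT x|torus L. g x * ek L (- k) x)"
    by (rule integral_cong_AE) (use assms(1) in \<open>auto\<close>)
  then show ?thesis by (simp add: fc_def)
qed

context fixes L :: real assumes L: "0 < L" begin

lemma fc_integrable: "f \<in> L2c L \<Longrightarrow> integrable (torus L) (\<lambda>x. f x * ek L k x)"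
  by (rule L2c_mult_integrable[OF _ L2c_ek[OF L]])

lemma fc_add: "f \<in> L2c L \<Longrightarrow> g \<in> L2c L \<Longrightarrow> fc L (\<lambda>x. f x + g x) k = fc L f k + fc L g k"
  by (simp add: fc_def distrib_right fc_integrable add_divide_distrib)

lemma fc_diff: "f \<in> L2c L \<Longrightarrow> g \<in> L2c L \<Longrightarrow> fc L (\<lambda>x. f x - g x) k = fc L f k - fc L g k"
  by (simp add: fc_def left_diff_distrib fc_integrable diff_divide_distrib)

lemma fc_cmult: "fc L (\<lambda>x. c * f x) k = c * fc L f k"
  by (simp add: fc_def mult.assoc)

lemma fc_sum: "(\<And>i. i \<in> I \<Longrightarrow> f i \<in> L2c L) \<Longrightarrow> fc L (\<lambda>x. \<Sum>i\<in>I. f i x) k = (\<Sum>i\<in>I. fc L (f i) k)"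
proof (induction I rule: infinite_finite_induct)
  case (insert i I)
  have "fc L (\<lambda>x. \<Sum>i\<in>insert i I. f i x) k = fc L (\<lambda>x. f i x + (\<Sum>i\<in>I. f i x)) k"
    using insert by simp
  also have "\<dots> = fc L (f i) k + fc L (\<lambda>x. \<Sum>i\<in>I. f i x) k"
    using insert by (intro fc_add L2c_sum) auto
  finally show ?case using insert by simp
qed (simp_all add: fc_def)

lemma fc_tp: "finite F \<Longrightarrow> fc L (tp L F c) k = (if k \<in> F then c k else 0)"
  unfolding tp_def
  by (subst fc_sum) (auto simp: fc_cmult fc_ek L if_distrib[where f="\<lambda>x. _ * x"] cong: if_cong intro!: L2c_cmult L2c_ek)

lemma integral_mult_cnj_tp:
  assumes "f \<in> L2c L"
  shows "(LINT x|torus L. f x * cnj (tp L F c x)) = complex_of_real (L^3) * (\<Sum>k\<in>F. fc L f k * cnj (c k))"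
proof -
  have "(LINT x|torus L. f x * cnj (tp L F c x)) = (LINT x|torus L. (\<Sum>k\<in>F. cnj (c k) * (f x * ek L (- k) x)))"
    by (simp add: tp_def sum_distrib_left cnj_ek mult_ac)
  also have "\<dots> = (\<Sum>k\<in>F. cnj (c k) * (LINT x|torus L. f x * ek L (- k) x))"
    by (subst Bochner_Integration.integral_sum) (auto intro!: fc_integrable assms)
  also have "\<dots> = complex_of_real (L^3) * (\<Sum>k\<in>F. fc L f k * cnj (c k))"
    using L by (simp add: fc_def sum_distrib_left mult_ac)
  finally show ?thesis .
qed

lemma integral_cmod_sq: "complex_of_real (LINT x|torus L. (cmod (f x))\<^sup>2) = (LINT x|torus L. f x * cnj (f x))"
  by (subst integral_complex_of_real[symmetric]) (simp only: complex_norm_square)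

lemma parseval_tp:
  assumes "finite F"
  shows "(LINT x|torus L. (cmod (tp L F c x))\<^sup>2) = L^3 * (\<Sum>k\<in>F. (cmod (c k))\<^sup>2)"
proof -
  have "complex_of_real (LINT x|torus L. (cmod (tp L F c x))\<^sup>2) = complex_of_real (L^3) * (\<Sum>k\<in>F. c k * cnj (c k))"
    unfolding integral_cmod_sq using integral_mult_cnj_tp[OF L2c_tp[OF L], of F c F c] assms
    by (simp add: fc_tp)
  also have "\<dots> = complex_of_real (L^3 * (\<Sum>k\<in>F. (cmod (c k))\<^sup>2))"
    by (simp only: of_real_mult of_real_sum complex_norm_square)
  finally show ?thesis by (simp only: of_real_eq_iff)
qed

lemma cmod_sq_diff: "(cmod (a - b))\<^sup>2 = (cmod a)\<^sup>2 - 2 * Re (a * cnj b) + (cmod b)\<^sup>2"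
  unfolding cmod_power2 by (simp add: power2_eq_square algebra_simps)

lemma Re_of_real_mult: "Re (complex_of_real c * z) = c * Re z" by simp

lemma integral_lin3:
  fixes A R C :: "'a \<Rightarrow> real"
  assumes "integrable M A" "integrable M R" "integrable M C"
  shows "(LINT x|M. A x - 2 * R x + C x) = (LINT x|M. A x) - 2 * (LINT x|M. R x) + (LINT x|M. C x)"
  using assms by simp

text \<open>Completing the square in the coefficients. Taking for \<open>c\<close> the coefficients
  of \<open>f\<close> gives Bessel's inequality; a general \<open>c\<close> shows that any
  approximation by trigonometric polynomials bounds the Parseval defect.\<close>

lemma L2_expand:
  assumes f: "f \<in> L2c L" and F: "finite F"
  shows "(LINT x|torus L. (cmod (f x - tp L F c x))\<^sup>2)
    = (LINT x|torus L. (cmod (f x))\<^sup>2) - L^3 * (\<Sum>k\<in>F. (cmod (fc L f k))\<^sup>2)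
      + L^3 * (\<Sum>k\<in>F. (cmod (fc L f k - c k))\<^sup>2)"
proof -
  have i: "integrable (torus L) (\<lambda>x. f x * cnj (tp L F c x))"
    by (intro L2c_mult_integrable f L2c_cnj L2c_tp L)
  have "(LINT x|torus L. (cmod (f x - tp L F c x))\<^sup>2)
     = (LINT x|torus L. (cmod (f x))\<^sup>2 - 2 * Re (f x * cnj (tp L F c x)) + (cmod (tp L F c x))\<^sup>2)"
    by (simp only: cmod_sq_diff)
  also have "\<dots> = (LINT x|torus L. (cmod (f x))\<^sup>2) - 2 * Re (LINT x|torus L. f x * cnj (tp L F c x))
      + (LINT x|torus L. (cmod (tp L F c x))\<^sup>2)"
    unfolding integral_Re[OF i, symmetric]
    by (rule integral_lin3) (intro L2c_int f L2c_tp L integrable_Re i)+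
  also have "\<dots> = (LINT x|torus L. (cmod (f x))\<^sup>2) + L^3 * (\<Sum>k\<in>F. (cmod (c k))\<^sup>2 - 2 * Re (fc L f k * cnj (c k)))"
    unfolding integral_mult_cnj_tp[OF f] parseval_tp[OF F] Re_of_real_mult Re_sum
    by (simp add: sum_subtractf sum_distrib_left[symmetric] right_diff_distrib del: times_complex.simps)
  also have "(\<Sum>k\<in>F. (cmod (c k))\<^sup>2 - 2 * Re (fc L f k * cnj (c k)))
     = (\<Sum>k\<in>F. (cmod (fc L f k - c k))\<^sup>2) - (\<Sum>k\<in>F. (cmod (fc L f k))\<^sup>2)"
    by (simp only: cmod_sq_diff sum_subtractf[symmetric]) (intro sum.cong; simp)
  finally show ?thesis by (simp add: algebra_simps)
qed

lemma bessel: assumes "f \<in> L2c L" "finite F"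
  shows "L^3 * (\<Sum>k\<in>F. (cmod (fc L f k))\<^sup>2) \<le> (LINT x|torus L. (cmod (f x))\<^sup>2)"
proof -
  have "0 \<le> (LINT x|torus L. (cmod (f x - tp L F (fc L f) x))\<^sup>2)" by simp
  then show ?thesis unfolding L2_expand[OF assms] by simp
qed

text \<open>The inner sum is the coefficient at \<open>k\<close> of a product of two trigonometric
  polynomials, and the outer sum pairs it with a third. Lattice sums thus become integrals over the
  torus, where Hoelder's inequality applies. The conjugate on \<open>g\<close> undoes the
  conjugation in the pairing.\<close>

lemma triple_sum:
  assumes H: "finite H" "\<And>n. n \<notin> H \<Longrightarrow> a n = 0" and "finite A" "finite B"
  shows "complex_of_real (L^3) * (\<Sum>k\<in>A. \<Sum>m\<in>B. a (k - m) * f m * g k)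
     = (LINT x|torus L. tp L H a x * tp L B f x * cnj (tp L A (\<lambda>k. cnj (g k)) x))"
proof -
  have fcp: "fc L (\<lambda>x. tp L H a x * tp L B f x) k = (\<Sum>m\<in>B. a (k - m) * f m)" for k
  proof -
    have e: "tp L H a x * tp L B f x = (\<Sum>m\<in>B. \<Sum>n\<in>H. (f m * a n) * ek L (n + m) x)" for x
    proof -
      have "tp L H a x * tp L B f x = (\<Sum>n\<in>H. \<Sum>m\<in>B. (a n * ek L n x) * (f m * ek L m x))"
        unfolding tp_def by (rule sum_product)
      also have "\<dots> = (\<Sum>m\<in>B. \<Sum>n\<in>H. (a n * ek L n x) * (f m * ek L m x))" by (rule sum.swap)
      finally show ?thesis by (simp add: ek_add mult_ac)
    qed
    have "fc L (\<lambda>x. tp L H a x * tp L B f x) k = (\<Sum>m\<in>B. fc L (\<lambda>x. \<Sum>n\<in>H. (f m * a n) * ek L (n + m) x) k)"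
      unfolding e by (rule fc_sum) (intro L2c_sum L2c_cmult L2c_ek L)
    also have "\<dots> = (\<Sum>m\<in>B. \<Sum>n\<in>H. (f m * a n) * (if n + m = k then 1 else 0))"
    proof (rule sum.cong[OF refl])
      fix m
      have "fc L (\<lambda>x. \<Sum>n\<in>H. (f m * a n) * ek L (n + m) x) k = (\<Sum>n\<in>H. fc L (\<lambda>x. (f m * a n) * ek L (n + m) x) k)"
        by (rule fc_sum) (intro L2c_cmult L2c_ek L)
      then show "fc L (\<lambda>x. \<Sum>n\<in>H. (f m * a n) * ek L (n + m) x) k = (\<Sum>n\<in>H. (f m * a n) * (if n + m = k then 1 else 0))"
        by (simp only: fc_cmult fc_ek L)
    qed
    also have "\<dots> = (\<Sum>m\<in>B. a (k - m) * f m)"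
    proof (rule sum.cong[OF refl])
      fix m
      have "(\<Sum>n\<in>H. (f m * a n) * (if n + m = k then 1 else 0)) = (\<Sum>n\<in>H. if n = k - m then f m * a n else 0)"
        by (intro sum.cong) (auto simp: algebra_simps)
      also have "\<dots> = a (k - m) * f m" using H by auto
      finally show "(\<Sum>n\<in>H. (f m * a n) * (if n + m = k then 1 else 0)) = a (k - m) * f m" .
    qed
    finally show ?thesis .
  qed
  have L2: "(\<lambda>x. tp L H a x * tp L B f x) \<in> L2c L"
    by (intro L2c_bounded_mult[where K="\<Sum>k\<in>B. cmod (f k)"] L2c_tp L norm_tp_le) measurable
  show ?thesis
    unfolding integral_mult_cnj_tp[OF L2] fcp by (simp add: sum_distrib_right)
qed

end

section \<open>Density of trigonometric polynomials and Parseval's identity\<close>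

inductive trig :: "real \<Rightarrow> (real^3 \<Rightarrow> complex) \<Rightarrow> bool" for L where
  trig_ek: "trig L (\<lambda>x. c * ek L k x)"
| trig_add: "trig L f \<Longrightarrow> trig L g \<Longrightarrow> trig L (\<lambda>x. f x + g x)"

lemma trig_mult1: "trig L f \<Longrightarrow> trig L (\<lambda>x. f x * (d * ek L m x))"
proof (induction rule: trig.induct)
  case (trig_ek c k)
  have "(\<lambda>x. c * ek L k x * (d * ek L m x)) = (\<lambda>x. (c * d) * ek L (k + m) x)"
    by (simp add: ek_add mult_ac)
  then show ?case using trig.trig_ek by metis
next
  case (trig_add f g)
  then show ?case by (simp add: distrib_right trig.trig_add)
qed

lemma trig_mult: "trig L g \<Longrightarrow> trig L f \<Longrightarrow> trig L (\<lambda>x. f x * g x)"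
  by (induction rule: trig.induct) (auto simp: distrib_left intro: trig_mult1 trig_add)

lemma trig_const: "trig L (\<lambda>x. c)"
  using trig_ek[of L c 0] by simp

lemma trig_sum: "(\<And>i. i \<in> I \<Longrightarrow> trig L (f i)) \<Longrightarrow> trig L (\<lambda>x. \<Sum>i\<in>I. f i x)"
  by (induction I rule: infinite_finite_induct) (auto intro: trig_const trig_add)

lemma trig_imp_tp: "trig L f \<Longrightarrow> \<exists>F c. finite F \<and> f = tp L F c"
proof (induction rule: trig.induct)
  case (trig_ek c k)
  have "(\<lambda>x. c * ek L k x) = tp L {k} (\<lambda>_. c)" by (simp add: tp_def fun_eq_iff)
  then show ?case by blast
next
  case (trig_add f g)
  then obtain F c G d where *: "finite F" "f = tp L F c" "finite G" "g = tp L G d" by blast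
  let ?c = "\<lambda>k. if k \<in> F then c k else 0" and ?d = "\<lambda>k. if k \<in> G then d k else 0"
  have "tp L F c x = tp L (F \<union> G) ?c x" "tp L G d x = tp L (F \<union> G) ?d x" for x
    unfolding tp_def using * by (auto intro!: sum.mono_neutral_cong_left)
  then have "(\<lambda>x. f x + g x) = tp L (F \<union> G) (\<lambda>k. ?c k + ?d k)"
    unfolding * by (simp add: fun_eq_iff) (simp add: tp_def distrib_right sum.distrib)
  then show ?case using * by blast
qed

text \<open>The embedding of the torus into complex 3-space by the three basic characters. A
  continuous function of \<open>circ L x\<close> is continuous and periodic in \<open>x\<close>, so
  polynomial approximation on a ball becomes trigonometric approximation.\<close>

definition circ :: "real \<Rightarrow> real^3 \<Rightarrow> complex^3" where
  "circ L x = (\<chi> j. ek L (axis j 1) x)"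

lemma trig_Re: "trig L (\<lambda>x. complex_of_real (Re (ek L k x)))"
proof -
  have "complex_of_real (Re (ek L k x)) = (1/2) * ek L k x + (1/2) * ek L (-k) x" for x
    using complex_add_cnj[of "ek L k x"] by (simp add: cnj_ek field_simps)
  then show ?thesis by (simp only:) (intro trig_add trig_ek)
qed

lemma trig_Im: "trig L (\<lambda>x. complex_of_real (Im (ek L k x)))"
proof -
  have "complex_of_real (Im (ek L k x)) = (-\<i>/2) * ek L k x + (\<i>/2) * ek L (-k) x" for x
    using complex_diff_cnj[of "ek L k x"] by (simp add: cnj_ek complex_eq_iff)
  then show ?thesis by (simp only:) (intro trig_add trig_ek)
qed

text \<open>A real linear functional of \<open>circ L x\<close> combines real and imaginary parts of
  characters, which are themselves combinations of a character and its opposite; sums and products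
  stay in the class.\<close>

lemma trig_polynomial:
  fixes p :: "complex^3 \<Rightarrow> real"
  assumes "real_polynomial_function p"
  shows "trig L (\<lambda>x. complex_of_real (p (circ L x)))"
  using assms
proof (induction rule: real_polynomial_function.induct)
  case (linear f)
  have "f z = (\<Sum>b\<in>Basis. (z \<bullet> b) * f b)" for z
  proof -
    have "f z = f (\<Sum>b\<in>Basis. (z \<bullet> b) *\<^sub>R b)" by (simp add: euclidean_representation)
    also have "\<dots> = (\<Sum>b\<in>Basis. (z \<bullet> b) * f b)"
      using bounded_linear.linear[OF linear] by (simp add: linear_sum linear_cmul)
    finally show ?thesis .
  qed
  then have fz: "f (circ L x) = (\<Sum>b\<in>Basis. (circ L x \<bullet> b) * f b)" for x by blast
  have "(\<lambda>x. complex_of_real (f (circ L x))) = (\<lambda>x. \<Sum>b\<in>Basis. complex_of_real (circ L x \<bullet> b) * complex_of_real (f b))"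
    by (rule ext, subst fz) simp
  moreover have "trig L (\<lambda>x. complex_of_real (circ L x \<bullet> b))" if b: "b \<in> Basis" for b
  proof -
    obtain i u where u: "u \<in> Basis" "b = axis i u" using b by (auto simp: Basis_vec_def)
    have e: "circ L x \<bullet> b = ek L (axis i 1) x \<bullet> u" for x
      by (simp add: u inner_axis circ_def)
    show ?thesis using u(1) unfolding e by (auto simp: Basis_complex_def trig_Re trig_Im)
  qed
  ultimately show ?case by (auto intro!: trig_sum trig_mult trig_const)
next
  case (const c) show ?case by (rule trig_const)
next
  case (add f g) then show ?case by (simp add: trig_add)
next
  case (mult f g) then show ?case by (simp add: trig_mult)
qed

definition approx :: "real \<Rightarrow> (real^3 \<Rightarrow> complex) \<Rightarrow> bool" where
  "approx L f \<longleftrightarrow> f \<in> L2c L \<and> (\<forall>e>0. \<exists>F c. finite F \<and> (LINT x|torus L. (cmod (f x - tp L F c x))\<^sup>2) < e)"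

lemma approxD: "approx L f \<Longrightarrow> e > 0 \<Longrightarrow> \<exists>F c. finite F \<and> (LINT x|torus L. (cmod (f x - tp L F c x))\<^sup>2) < e"
  unfolding approx_def by blast

lemma L2_triangle:
  assumes "f \<in> L2c L" "g \<in> L2c L" "h \<in> L2c L"
  shows "(LINT x|torus L. (cmod (f x - h x))\<^sup>2)
     \<le> 2 * (LINT x|torus L. (cmod (f x - g x))\<^sup>2) + 2 * (LINT x|torus L. (cmod (g x - h x))\<^sup>2)"
proof -
  have i: "integrable (torus L) (\<lambda>x. (cmod (f x - g x))\<^sup>2)" "integrable (torus L) (\<lambda>x. (cmod (g x - h x))\<^sup>2)"
     "integrable (torus L) (\<lambda>x. (cmod (f x - h x))\<^sup>2)"
    by (intro L2c_int L2c_diff assms)+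
  have "(LINT x|torus L. (cmod (f x - h x))\<^sup>2) \<le> (LINT x|torus L. 2 * (cmod (f x - g x))\<^sup>2 + 2 * (cmod (g x - h x))\<^sup>2)"
  proof (rule integral_mono)
    fix x
    have "cmod (f x - h x) \<le> cmod (f x - g x) + cmod (g x - h x)"
      using norm_triangle_ineq[of "f x - g x" "g x - h x"] by simp
    then have "(cmod (f x - h x))\<^sup>2 \<le> (cmod (f x - g x) + cmod (g x - h x))\<^sup>2"
      by (intro power_mono) auto
    also have "\<dots> \<le> 2 * (cmod (f x - g x))\<^sup>2 + 2 * (cmod (g x - h x))\<^sup>2"
      using sum_squares_bound[of "cmod (f x - g x)" "cmod (g x - h x)"] by (simp add: power2_sum)
    finally show "(cmod (f x - h x))\<^sup>2 \<le> 2 * (cmod (f x - g x))\<^sup>2 + 2 * (cmod (g x - h x))\<^sup>2" .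
  qed (use i in auto)
  also have "\<dots> = 2 * (LINT x|torus L. (cmod (f x - g x))\<^sup>2) + 2 * (LINT x|torus L. (cmod (g x - h x))\<^sup>2)"
    using i by simp
  finally show ?thesis .
qed

context fixes L :: real assumes L: "0 < L" begin

lemma approx_L2cD: "approx L f \<Longrightarrow> f \<in> L2c L"
  unfolding approx_def by (rule conjunct1)

lemma approx_limit:
  assumes f: "f \<in> L2c L"
    and g: "\<And>e. e > 0 \<Longrightarrow> \<exists>g. approx L g \<and> (LINT x|torus L. (cmod (f x - g x))\<^sup>2) < e"
  shows "approx L f"
  unfolding approx_def
proof (intro conjI f allI impI)
  fix e :: real assume e: "e > 0"
  then obtain g where g': "approx L g" "(LINT x|torus L. (cmod (f x - g x))\<^sup>2) < e/4" using g[of "e/4"] by auto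
  have e4: "e / 4 > 0" using e by simp
  obtain F c where F: "finite F" "(LINT x|torus L. (cmod (g x - tp L F c x))\<^sup>2) < e/4"
    using approxD[OF g'(1) e4] by (elim exE conjE)
  have "(LINT x|torus L. (cmod (f x - tp L F c x))\<^sup>2) < e"
    using L2_triangle[OF f approx_L2cD[OF g'(1)] L2c_tp[OF L], of F c] g'(2) F(2) by linarith
  then show "\<exists>F c. finite F \<and> (LINT x|torus L. (cmod (f x - tp L F c x))\<^sup>2) < e" using F(1) by (intro exI conjI)
qed

lemma approx_tp: "finite F \<Longrightarrow> approx L (tp L F c)"
  unfolding approx_def by (auto intro!: L2c_tp L exI[of _ F] exI[of _ c])

lemma approx_add:
  assumes "approx L f" "approx L g" shows "approx L (\<lambda>x. f x + g x)"
  unfolding approx_def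
proof (intro conjI allI impI)
  have f: "f \<in> L2c L" "g \<in> L2c L" using assms by (simp_all add: approx_L2cD)
  show "(\<lambda>x. f x + g x) \<in> L2c L" using f by (rule L2c_add)
  fix e :: real assume e: "e > 0"
  have e4: "e / 4 > 0" using e by simp
  obtain F c where F: "finite F" "(LINT x|torus L. (cmod (f x - tp L F c x))\<^sup>2) < e/4"
    using approxD[OF assms(1) e4] by (elim exE conjE)
  obtain G d where G: "finite G" "(LINT x|torus L. (cmod (g x - tp L G d x))\<^sup>2) < e/4"
    using approxD[OF assms(2) e4] by (elim exE conjE)
  have "trig L (tp L F c)" for F c unfolding tp_def[abs_def] by (intro trig_sum trig_ek)
  then obtain H b where H: "finite H" "(\<lambda>x. tp L F c x + tp L G d x) = tp L H b"
    using trig_imp_tp[OF trig_add[of L "tp L F c" "tp L G d"]] by blast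
  have "(LINT x|torus L. (cmod (f x + g x - tp L H b x))\<^sup>2) \<le>
     2 * (LINT x|torus L. (cmod ((f x + g x) - (tp L F c x + g x)))\<^sup>2) +
     2 * (LINT x|torus L. (cmod ((tp L F c x + g x) - (tp L F c x + tp L G d x)))\<^sup>2)"
    unfolding H(2)[symmetric] by (rule L2_triangle) (intro L2c_add f L2c_tp L)+
  also have "\<dots> < e" using F G by simp
  finally show "\<exists>F c. finite F \<and> (LINT x|torus L. (cmod (f x + g x - tp L F c x))\<^sup>2) < e" using H(1) by (intro exI conjI)
qed

lemma approx_cmult:
  assumes "approx L f" shows "approx L (\<lambda>x. a * f x)"
  unfolding approx_def
proof (intro conjI allI impI)
  have f: "f \<in> L2c L" using assms by (rule approx_L2cD)
  show "(\<lambda>x. a * f x) \<in> L2c L" using f by (rule L2c_cmult)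
  fix e :: real assume e: "e > 0"
  let ?d = "e / ((cmod a)\<^sup>2 + 1)"
  have d: "?d > 0" using e by (simp add: add_nonneg_pos)
  obtain F c where F: "finite F" "(LINT x|torus L. (cmod (f x - tp L F c x))\<^sup>2) < ?d"
    using approxD[OF assms d] by (elim exE conjE)
  have "tp L F (\<lambda>k. a * c k) x = a * tp L F c x" for x by (simp add: tp_def sum_distrib_left mult.assoc)
  then have "(LINT x|torus L. (cmod (a * f x - tp L F (\<lambda>k. a * c k) x))\<^sup>2) = (LINT x|torus L. (cmod a)\<^sup>2 * (cmod (f x - tp L F c x))\<^sup>2)"
    by (simp add: norm_mult power_mult_distrib flip: right_diff_distrib)
  also have "\<dots> = (cmod a)\<^sup>2 * (LINT x|torus L. (cmod (f x - tp L F c x))\<^sup>2)" by simp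
  also have "\<dots> \<le> (cmod a)\<^sup>2 * ?d" using F by (intro mult_left_mono) auto
  also have "\<dots> < e" using e by (simp add: divide_less_eq add_nonneg_pos distrib_left)
  finally show "\<exists>F c. finite F \<and> (LINT x|torus L. (cmod (a * f x - tp L F c x))\<^sup>2) < e" using F(1) by (intro exI conjI)
qed

lemma approx_sum: "finite I \<Longrightarrow> (\<And>i. i \<in> I \<Longrightarrow> approx L (f i)) \<Longrightarrow> approx L (\<lambda>x. \<Sum>i\<in>I. f i x)"
proof (induction I rule: finite_induct)
  case empty
  then show ?case using approx_tp[of "{}" "\<lambda>_. 0"] by (simp add: tp_def[abs_def])
qed (auto intro!: approx_add)

lemma L2_dist_bound:
  assumes "f \<in> L2c L" "g \<in> L2c L" "\<And>x. x \<in> space (torus L) \<Longrightarrow> cmod (f x - g x) \<le> d"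
  shows "(LINT x|torus L. (cmod (f x - g x))\<^sup>2) \<le> d\<^sup>2 * L^3"
proof -
  interpret finite_measure "torus L" by (rule finite_measure_torus[OF L])
  have "(LINT x|torus L. (cmod (f x - g x))\<^sup>2) \<le> (LINT x|torus L. d\<^sup>2)"
    by (rule integral_mono) (use assms in \<open>auto intro!: L2c_int L2c_diff power_mono\<close>)
  also have "\<dots> = d\<^sup>2 * L^3" using measure_torus[OF L] by simp
  finally show ?thesis .
qed

lemma continuous_circ: "continuous_on S (circ L)"
  unfolding circ_def by (intro continuous_on_vec_lambda continuous_ek)

lemma circ_in_ball: "circ L x \<in> cball 0 2"
proof -
  have "(norm (circ L x))\<^sup>2 = 3" by (simp add: norm_vec_def L2_set_def circ_def)
  then have "(norm (circ L x))\<^sup>2 \<le> 2\<^sup>2" by simp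
  then have "norm (circ L x) \<le> 2" by (rule power2_le_imp_le) simp
  then show ?thesis by simp
qed

lemma approx_continuous:
  assumes h: "continuous_on UNIV (h :: complex^3 \<Rightarrow> real)"
  shows "approx L (\<lambda>x. complex_of_real (h (circ L x)))"
proof (rule approx_limit)
  have hc: "continuous_on UNIV (\<lambda>x. complex_of_real (h (circ L x)))"
    by (intro continuous_intros continuous_on_compose2[OF h continuous_circ]) auto
  have "compact (h ` cball 0 2)" by (intro compact_continuous_image continuous_on_subset[OF h]) auto
  then have "bounded (h ` cball 0 2)" by (rule compact_imp_bounded)
  then obtain K where "\<forall>y\<in>h ` cball 0 2. norm y \<le> K" by (auto simp: bounded_iff)
  then have K: "\<bar>h z\<bar> \<le> K" if "z \<in> cball 0 2" for z using that by auto
  show fL: "(\<lambda>x. complex_of_real (h (circ L x))) \<in> L2c L"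
    by (rule L2c_bounded[OF L continuous_measurable_torus[OF hc], of K]) (use K circ_in_ball in auto)
  fix e :: real assume e: "e > 0"
  define d where "d = sqrt (e / (2 * L^3))"
  have d: "d > 0" "d\<^sup>2 * L^3 < e" using e L by (simp_all add: d_def)
  obtain p where p: "real_polynomial_function p" "\<And>z. z \<in> cball 0 2 \<Longrightarrow> \<bar>h z - p z\<bar> < d"
    by (rule Stone_Weierstrass_real_polynomial_function[of "cball 0 2" h d])
      (use d h in \<open>auto intro: continuous_on_subset\<close>)
  obtain F c where F: "finite F" "(\<lambda>x. complex_of_real (p (circ L x))) = tp L F c"
    using trig_imp_tp[OF trig_polynomial[OF p(1)]] by blast
  have "(LINT x|torus L. (cmod (complex_of_real (h (circ L x)) - tp L F c x))\<^sup>2) \<le> d\<^sup>2 * L^3"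
  proof (rule L2_dist_bound[OF fL L2c_tp[OF L]])
    fix x
    have "cmod (complex_of_real (h (circ L x)) - tp L F c x) = \<bar>h (circ L x) - p (circ L x)\<bar>"
      by (simp flip: F(2) of_real_diff)
    then show "cmod (complex_of_real (h (circ L x)) - tp L F c x) \<le> d" using p(2)[OF circ_in_ball] by (simp add: less_imp_le)
  qed
  with d have "(LINT x|torus L. (cmod (complex_of_real (h (circ L x)) - tp L F c x))\<^sup>2) < e" by simp
  then show "\<exists>g. approx L g \<and> (LINT x|torus L. (cmod (complex_of_real (h (circ L x)) - g x))\<^sup>2) < e"
    using approx_tp[OF F(1)] by (intro exI conjI)
qed

lemma approx_pointwise_limit:
  assumes g: "\<And>n. approx L (g n)" and b: "\<And>n x. x \<in> space (torus L) \<Longrightarrow> cmod (g n x) \<le> w x" and w: "integrable (torus L) (\<lambda>x. (w x)\<^sup>2)"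
    and fL: "f \<in> L2c L" and lim: "\<And>x. x \<in> space (torus L) \<Longrightarrow> (\<lambda>n. g n x) \<longlonglongrightarrow> f x"
  shows "approx L f"
proof (rule approx_limit[OF fL])
  fix e :: real assume e: "e > 0"
  note [measurable] = L2c_meas[OF fL]
  have [measurable]: "g n \<in> borel_measurable (torus L)" for n by (rule L2c_meas[OF approx_L2cD[OF g]])
  have bf: "cmod (f x) \<le> w x" if "x \<in> space (torus L)" for x
    by (rule tendsto_upperbound[OF tendsto_norm[OF lim[OF that]]]) (simp_all add: b[OF that])
  have "(\<lambda>n. LINT x|torus L. (cmod (f x - g n x))\<^sup>2) \<longlonglongrightarrow> (LINT x|torus L. 0)"
  proof (rule integral_dominated_convergence[where w="\<lambda>x. 4 * (w x)\<^sup>2"])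
    show "AE x in torus L. (\<lambda>n. (cmod (f x - g n x))\<^sup>2) \<longlonglongrightarrow> 0"
    proof (rule AE_I2)
      fix x assume "x \<in> space (torus L)"
      then have "(\<lambda>n. (cmod (f x - g n x))\<^sup>2) \<longlonglongrightarrow> (cmod (f x - f x))\<^sup>2" by (intro tendsto_intros lim)
      then show "(\<lambda>n. (cmod (f x - g n x))\<^sup>2) \<longlonglongrightarrow> 0" by simp
    qed
    show "AE x in torus L. norm ((cmod (f x - g n x))\<^sup>2) \<le> 4 * (w x)\<^sup>2" for n
    proof (rule AE_I2)
      fix x assume x: "x \<in> space (torus L)"
      have "cmod (f x - g n x) \<le> 2 * w x" using norm_triangle_ineq4[of "f x" "g n x"] bf[OF x] b[OF x, of n] by linarith
      then have "(cmod (f x - g n x))\<^sup>2 \<le> (2 * w x)\<^sup>2" by (intro power_mono) auto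
      then show "norm ((cmod (f x - g n x))\<^sup>2) \<le> 4 * (w x)\<^sup>2" by (simp add: power_mult_distrib)
    qed
  qed (use w in auto)
  then have "(\<lambda>n. LINT x|torus L. (cmod (f x - g n x))\<^sup>2) \<longlonglongrightarrow> 0" by simp
  then have "eventually (\<lambda>n. (LINT x|torus L. (cmod (f x - g n x))\<^sup>2) < e) sequentially" using e by (rule order_tendstoD)
  then obtain n where "(LINT x|torus L. (cmod (f x - g n x))\<^sup>2) < e" by (auto simp: eventually_sequentially)
  then show "\<exists>g. approx L g \<and> (LINT x|torus L. (cmod (f x - g x))\<^sup>2) < e" using g by (intro exI conjI)
qed

lemma indicator_L2c:
  assumes "S \<in> sets (torus L)" shows "(indicator S :: _ \<Rightarrow> complex) \<in> L2c L"
  by (rule L2c_bounded[OF L, of _ 1]) (use assms in \<open>auto simp: indicator_def\<close>)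

text \<open>Away from the points with a nonnegative real coordinate, the three arguments invert
  \<open>circ\<close> continuously. An open subset of the open cell is therefore the preimage under
  \<open>circ\<close> of an open set, whose indicator is a pointwise limit of continuous
  functions.\<close>

lemma approx_indicator_open:
  assumes V: "open V" "V \<subseteq> box 0 (\<chi> i. L)"
  shows "approx L (indicator V)"
proof -
  define A where "A z = (\<chi> j. L / (2*pi) * Arg2pi (z $ j))" for z :: "complex^3"
  define P where "P = {z::complex^3. \<forall>j. z $ j \<notin> \<real>\<^sub>\<ge>\<^sub>0}"
  have P: "open P"
  proof -
    have "P = (\<Inter>j. (\<lambda>z. z $ j) -` (- \<real>\<^sub>\<ge>\<^sub>0))" by (auto simp: P_def)
    also have "open \<dots>"
      by (intro open_INT ballI open_vimage_vec_nth) (auto intro!: open_Compl closed_nonneg_Reals_complex)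
    finally show ?thesis .
  qed
  have "continuous_on P A" unfolding A_def
  proof (intro continuous_on_vec_lambda continuous_intros)
    fix j
    have "continuous_on (- \<real>\<^sub>\<ge>\<^sub>0) Arg2pi"
      by (rule continuous_at_imp_continuous_on) (auto intro: continuous_at_Arg2pi)
    then show "continuous_on P (\<lambda>z. Arg2pi (z $ j))"
      by (rule continuous_on_compose2) (auto intro!: continuous_intros simp: P_def)
  qed
  then have O: "open (A -` V \<inter> P)" using V P by (simp add: continuous_on_open_vimage)
  define O' where "O' = A -` V \<inter> P"
  have "0 \<in> - O'" by (simp add: O'_def P_def)
  then have ne: "- O' \<noteq> {}" by blast
  have cO: "closed (- O')" using O unfolding O'_def closed_def double_complement .
  \<comment> \<open>Truncated multiples of the distance to the complement increase to the indicator
    of the open set.\<close>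
  define h where "h n z = min 1 (real n * infdist z (- O'))" for n z
  have hc: "continuous_on UNIV (h n)" for n
    unfolding h_def by (intro continuous_intros)
  have hlim: "(\<lambda>n. h n z) \<longlonglongrightarrow> indicator O' z" for z
  proof (cases "z \<in> O'")
    case True
    then have "infdist z (- O') \<noteq> 0" using in_closed_iff_infdist_zero[OF cO ne] by auto
    then have pos: "infdist z (- O') > 0" using infdist_nonneg[of z "- O'"] by linarith
    then obtain N :: nat where N: "1 < real N * infdist z (- O')" using reals_Archimedean3 by blast
    have "eventually (\<lambda>n. h n z = 1) sequentially"
      unfolding eventually_sequentially
    proof (intro exI allI impI)
      fix n assume "N \<le> n"
      then have "real N * infdist z (- O') \<le> real n * infdist z (- O')" using pos by (intro mult_right_mono) auto
      then show "h n z = 1" using N by (simp add: h_def)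
    qed
    then show ?thesis using True by (simp add: tendsto_eventually)
  next
    case False
    then show ?thesis by (simp add: h_def)
  qed
  have key: "circ L x \<in> O' \<longleftrightarrow> x \<in> V" if x: "x \<in> cbox 0 (\<chi> i. L)" for x
  proof (cases "x \<in> box 0 (\<chi> i. L)")
    case True
    have xj: "0 < x $ j" "x $ j < L" for j using True by (auto simp: mem_box_cart)
    have arg: "Arg2pi (circ L x $ j) = 2 * pi / L * x $ j" for j
    proof -
      have "circ L x $ j = exp (\<i> * of_real (2 * pi / L * x $ j))"
      proof -
        have "freq (axis j 1) = axis j 1" by (simp add: vec_eq_iff axis_def)
        then show ?thesis by (simp add: circ_def ek_def inner_axis')
      qed
      moreover have "2 * pi / L * x $ j < 2 * pi" using xj[of j] L by (simp add: field_simps)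
      ultimately show ?thesis using xj[of j] L
        by (intro Arg2pi_unique[of 1]) auto
    qed
    have "circ L x \<in> P"
    proof -
      have "circ L x $ j \<notin> \<real>\<^sub>\<ge>\<^sub>0" for j
      proof
        assume "circ L x $ j \<in> \<real>\<^sub>\<ge>\<^sub>0"
        then have "Arg2pi (circ L x $ j) = 0" by (auto simp: Arg2pi_eq_0 complex_nonneg_Reals_iff complex_is_Real_iff)
        then show False using arg[of j] xj[of j] L by simp
      qed
      then show ?thesis by (auto simp: P_def)
    qed
    moreover have "A (circ L x) = x" using L by (simp add: A_def arg vec_eq_iff)
    ultimately show ?thesis by (simp add: O'_def)
  next
    \<comment> \<open>On the boundary of the cell some coordinate of \<open>circ L x\<close> equals
      1 and is excluded from \<open>P\<close>, while \<open>V\<close> does not meet the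
      boundary.\<close>
    case False
    then obtain j where j: "x $ j = 0 \<or> x $ j = L"
      using x by (force simp: mem_box_cart less_le)
    have "circ L x $ j = exp (\<i> * of_real (2 * pi / L * x $ j))"
    proof -
      have "freq (axis j 1) = axis j 1" by (simp add: vec_eq_iff axis_def)
      then show ?thesis by (simp add: circ_def ek_def inner_axis')
    qed
    also have "\<dots> = 1" using j L exp_two_pi_i by (auto simp: mult_ac)
    finally have "circ L x \<notin> P" by (auto simp: P_def intro!: exI[of _ j])
    then show ?thesis using False V by (auto simp: O'_def)
  qed
  have Vs: "V \<in> sets (torus L)"
  proof -
    have "V \<subseteq> cbox 0 (\<chi> i. L)" using V(2) box_subset_cbox by blast
    then show ?thesis using V(1) by (auto simp: torus_def sets_restrict_space_iff)
  qed
  show ?thesis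
  proof (rule approx_pointwise_limit[of "\<lambda>n x. complex_of_real (h n (circ L x))" "\<lambda>_. 1"])
    show "approx L (\<lambda>x. complex_of_real (h n (circ L x)))" for n by (rule approx_continuous[OF hc])
    show "cmod (complex_of_real (h n (circ L x))) \<le> 1" for n x
      using infdist_nonneg[of "circ L x" "- O'"] by (simp add: h_def)
    show "integrable (torus L) (\<lambda>x. 1\<^sup>2 :: real)" by (rule bounded_integrable_torus[OF L, of _ 1]) auto
    show "indicator V \<in> L2c L" by (rule indicator_L2c[OF Vs])
    fix x assume x: "x \<in> space (torus L)"
    have "(\<lambda>n. complex_of_real (h n (circ L x))) \<longlonglongrightarrow> complex_of_real (indicator O' (circ L x))"
      by (intro tendsto_intros hlim)
    moreover have "complex_of_real (indicator O' (circ L x)) = indicator V x"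
      using key x by (simp add: indicator_def)
    ultimately show "(\<lambda>n. complex_of_real (h n (circ L x))) \<longlonglongrightarrow> indicator V x" by simp
  qed
qed

text \<open>Outer regularity replaces a measurable set by an open one up to small measure;
  intersecting with the open cell then removes only the faces of the cell, a null set.\<close>

lemma approx_indicator:
  assumes S: "S \<in> sets (torus L)"
  shows "approx L (indicator S)"
proof (rule approx_limit[OF indicator_L2c[OF S]])
  fix e :: real assume e: "e > 0"
  let ?C = "cbox 0 (\<chi> i. L) :: (real^3) set" and ?B = "box 0 (\<chi> i. L) :: (real^3) set"
  have S': "S \<in> sets lebesgue" "S \<subseteq> ?C"
    using S by (auto simp: torus_def sets_restrict_space_iff)
  obtain T where T: "open T" "S \<subseteq> T" "(T - S) \<in> lmeasurable" "emeasure lebesgue (T - S) < ennreal e"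
    by (rule sets_lebesgue_outer_open[OF S'(1) e])
  define V where "V = T \<inter> ?B"
  have V: "open V" "V \<subseteq> ?B" using T by (auto simp: V_def)
  have Vs: "V \<in> sets (torus L)"
    using V box_subset_cbox[of 0 "(\<chi> i. L) :: real^3"] by (auto simp: torus_def sets_restrict_space_iff)
  have TS: "T - S \<in> sets lebesgue" using T(3) by auto
  have "AE x in lebesgue. x \<notin> ?C - ?B"
  proof (rule AE_not_in)
    show "?C - ?B \<in> null_sets lebesgue"
      using negligible_frontier_interval[of 0 "(\<chi> i. L) :: real^3"] by (simp add: negligible_iff_null_sets)
  qed
  then have ae: "AE x in torus L. x \<notin> ?C - ?B"
    unfolding torus_def by (simp add: AE_restrict_space_iff)
  have "(LINT x|torus L. (cmod (indicator S x - indicator V x))\<^sup>2) = (LINT x|torus L. indicator ((T - S) \<inter> ?C) x)"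
  proof (rule integral_cong_AE)
    show "AE x in torus L. (cmod (indicator S x - indicator V x))\<^sup>2 = indicator ((T - S) \<inter> ?C) x"
      using ae AE_space
    proof eventually_elim
      case (elim x)
      then show ?case using T(2) S'(2) by (auto simp: indicator_def V_def)
    qed
    show "(\<lambda>x. (cmod (indicator S x - indicator V x))\<^sup>2) \<in> borel_measurable (torus L)" using S Vs by measurable
    show "(indicator ((T - S) \<inter> ?C) :: _ \<Rightarrow> real) \<in> borel_measurable (torus L)"
      using TS by (intro borel_measurable_indicator) (auto simp: torus_def sets_restrict_space_iff)
  qed
  also have "\<dots> = measure (torus L) ((T - S) \<inter> ?C)" by simp
  also have "\<dots> = measure lebesgue ((T - S) \<inter> ?C)"
    unfolding torus_def by (rule measure_restrict_space) auto
  also have "\<dots> \<le> measure lebesgue (T - S)"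
    by (rule measure_mono_fmeasurable) (use T(3) TS in auto)
  also have "\<dots> < e"
    using T(4) unfolding emeasure_eq_measure2[OF T(3)] by (rule ennreal_less_iff[THEN iffD1, rotated]) simp
  finally show "\<exists>g. approx L g \<and> (LINT x|torus L. (cmod (indicator S x - g x))\<^sup>2) < e"
    using approx_indicator_open[OF V] by (intro exI conjI)
qed

lemma approx_L2c:
  assumes f: "f \<in> L2c L" shows "approx L f"
proof -
  obtain s where s: "\<And>i. simple_function (torus L) (s i)" "\<And>x. x \<in> space (torus L) \<Longrightarrow> (\<lambda>i. s i x) \<longlonglongrightarrow> f x"
    "\<And>i x. x \<in> space (torus L) \<Longrightarrow> dist (s i x) 0 \<le> 2 * dist (f x) 0"
    using borel_measurable_implies_sequence_metric[OF L2c_meas[OF f], of 0] by metis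
  \<comment> \<open>A simple function is unconstrained outside the space of the measure. Setting it
    to 0 there makes it equal to its indicator representation everywhere.\<close>
  show ?thesis
  proof (rule approx_pointwise_limit[where w="\<lambda>x. 2 * cmod (f x)" and g="\<lambda>i x. (if x \<in> space (torus L) then s i x else 0)"])
    fix i
    let ?g = "\<lambda>x. \<Sum>y\<in>s i ` space (torus L). y * indicator (s i -` {y} \<inter> space (torus L)) x"
    have "approx L ?g"
      using simple_functionD[OF s(1)[of i]] by (intro approx_sum approx_cmult approx_indicator) auto
    moreover have "?g = (\<lambda>x. (if x \<in> space (torus L) then s i x else 0))"
    proof (rule ext)
      fix x
      show "?g x = (if x \<in> space (torus L) then s i x else 0)"
      proof (cases "x \<in> space (torus L)")
        case True
        have "s i x = (\<Sum>y\<in>s i ` space (torus L). indicator (s i -` {y} \<inter> space (torus L)) x *\<^sub>R y)"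
          by (rule simple_function_indicator_representation_banach[OF s(1) True])
        also have "\<dots> = ?g x" by (intro sum.cong refl) (simp split: split_indicator)
        finally have e: "s i x = ?g x" .
        show ?thesis by (rule trans[OF e[symmetric]]) (simp only: True if_True)
      next
        case False
        then have "?g x = 0" by (intro sum.neutral ballI) (simp split: split_indicator)
        then show ?thesis using False by simp
      qed
    qed
    ultimately show "approx L (\<lambda>x. (if x \<in> space (torus L) then s i x else 0))" by simp
    show "cmod (if x \<in> space (torus L) then s i x else 0) \<le> 2 * cmod (f x)" if "x \<in> space (torus L)" for i x
      using s(3)[OF that, of i] that by simp
    show "integrable (torus L) (\<lambda>x. (2 * cmod (f x))\<^sup>2)"
      using L2c_int[OF f] by (simp add: power_mult_distrib)
    show "(\<lambda>i. if x \<in> space (torus L) then s i x else 0) \<longlonglongrightarrow> f x" if "x \<in> space (torus L)" for x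
      using s(2)[OF that] that by simp
  qed (rule f)
qed

text \<open>Parseval's identity in the form used later: the partial sums increase with the set, so
  the defect stays small for every finite set containing \<open>F\<close>.\<close>

theorem parseval_tail:
  assumes f: "f \<in> L2c L" and e: "e > 0"
  obtains F where "finite F" "\<And>G. finite G \<Longrightarrow> F \<subseteq> G \<Longrightarrow>
     (LINT x|torus L. (cmod (f x))\<^sup>2) - L^3 * (\<Sum>k\<in>G. (cmod (fc L f k))\<^sup>2) < e"
proof -
  obtain F c where F: "finite F" "(LINT x|torus L. (cmod (f x - tp L F c x))\<^sup>2) < e"
    using approxD[OF approx_L2c[OF f] e] by (elim exE conjE)
  show ?thesis
  proof (rule that[OF F(1)])
    fix G assume G: "finite G" "F \<subseteq> G"
    have "(\<Sum>k\<in>F. (cmod (fc L f k))\<^sup>2) \<le> (\<Sum>k\<in>G. (cmod (fc L f k))\<^sup>2)" using G by (intro sum_mono2) auto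
    then have "L^3 * (\<Sum>k\<in>F. (cmod (fc L f k))\<^sup>2) \<le> L^3 * (\<Sum>k\<in>G. (cmod (fc L f k))\<^sup>2)" using L by simp
    moreover have "0 \<le> L^3 * (\<Sum>k\<in>F. (cmod (fc L f k - c k))\<^sup>2)" using L by (simp add: sum_nonneg)
    ultimately show "(LINT x|torus L. (cmod (f x))\<^sup>2) - L^3 * (\<Sum>k\<in>G. (cmod (fc L f k))\<^sup>2) < e"
      using F(2) unfolding L2_expand[OF L f F(1)] by linarith
  qed
qed

end

section \<open>Bernstein's inequality\<close>

text \<open>\<open>\<theta> = 2/r\<close> encodes the exponent, so that \<open>\<theta> = 0\<close> is \<open>r = \<infinity>\<close>; norms are normalised by the volume.\<close>

definition Lr_bound :: "real \<Rightarrow> real \<Rightarrow> real \<Rightarrow> (real^3 \<Rightarrow> complex) \<Rightarrow> bool" where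
  "Lr_bound L \<theta> R a \<longleftrightarrow> (if \<theta> = 0 then AE x in torus L. cmod (a x) \<le> R
     else (LINT x|torus L. cmod (a x) powr (2 / \<theta>)) \<le> L^3 * R powr (2 / \<theta>))"

text \<open>Cubes instead of balls: the sum of two points of \<open>cube n\<close> lies in
  \<open>cube (2 * n)\<close>, and the cardinality is explicit.\<close>

definition cube :: "nat \<Rightarrow> (int^3) set" where
  "cube n = {k. \<forall>i. \<bar>k $ i\<bar> \<le> int n}"

lemma cube_card: "finite (cube n)" "card (cube n) = (2 * n + 1)^3"
proof -
  have e: "cube n = vec_lambda ` (\<Pi>\<^sub>E i\<in>UNIV. {-int n..int n})"
  proof (intro equalityI subsetI)
    fix k assume "k \<in> cube n"
    then have "vec_nth k \<in> (\<Pi>\<^sub>E i\<in>UNIV. {-int n..int n})" by (auto simp: cube_def abs_le_iff) (metis minus_le_iff)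
    then show "k \<in> vec_lambda ` (\<Pi>\<^sub>E i\<in>UNIV. {-int n..int n})" by (metis image_eqI vec_nth_inverse)
  next
    fix k :: "int^3" assume "k \<in> vec_lambda ` (\<Pi>\<^sub>E i\<in>UNIV. {-int n..int n})"
    then show "k \<in> cube n" by (auto simp: cube_def PiE_iff abs_le_iff) (metis minus_le_iff)
  qed
  have fin: "finite (\<Pi>\<^sub>E i\<in>(UNIV::3 set). {-int n..int n})" by (intro finite_PiE) auto
  show "finite (cube n)" unfolding e using fin by simp
  have "card (cube n) = card (\<Pi>\<^sub>E i\<in>(UNIV::3 set). {-int n..int n})"
    unfolding e by (rule card_image) (auto simp: inj_on_def vec_lambda_inject)
  also have "\<dots> = (nat (2 * int n + 1))^3" by (simp add: card_PiE)
  also have "nat (2 * int n + 1) = 2 * n + 1" by linarith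
  finally show "card (cube n) = (2 * n + 1)^3" .
qed

context fixes L :: real assumes L: "0 < L" begin

text \<open>The weighted Young inequality for X = (a/R)^(2/\<theta>) and Y = (g/B)^2. The part
  g^(2\<theta>) of the square of \<open>g\<close> is first bounded by the supremum \<open>G\<close>;
  the rest becomes Y^(1-\<theta>).\<close>

lemma young_pointwise:
  assumes th: "0 < \<theta>" "\<theta> \<le> 1" and R: "R > 0" "B > 0" "G > 0" and a: "0 \<le> (a::real)" "0 \<le> g" "g \<le> G"
  shows "a\<^sup>2 * g\<^sup>2 \<le> (R * B powr (1-\<theta>) * G powr \<theta>)\<^sup>2 * (\<theta> * (a powr (2/\<theta>) / R powr (2/\<theta>)) + (1-\<theta>) * (g\<^sup>2 / B\<^sup>2))"
proof (cases "a = 0 \<or> g = 0")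
  case True
  then have "a\<^sup>2 * g\<^sup>2 = 0" by auto
  also have "\<dots> \<le> (R * B powr (1-\<theta>) * G powr \<theta>)\<^sup>2 * (\<theta> * (a powr (2/\<theta>) / R powr (2/\<theta>)) + (1-\<theta>) * (g\<^sup>2 / B\<^sup>2))"
    using th by (intro mult_nonneg_nonneg add_nonneg_nonneg divide_nonneg_nonneg) auto
  finally show ?thesis .
next
  case False
  then have a': "a > 0" "g > 0" using a by auto
  define X Y where "X = a powr (2/\<theta>) / R powr (2/\<theta>)" and "Y = g\<^sup>2 / B\<^sup>2"
  have XY: "X > 0" "Y > 0" using a' R by (auto simp: X_def Y_def)
  have X: "X powr \<theta> = a\<^sup>2 / R\<^sup>2"
    using th a' R by (simp add: X_def powr_divide powr_powr powr_numeral)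
  have sq1: "z\<^sup>2 powr s = z powr (2 * s)" if "z > 0" for z s :: real
    using powr_powr[of z 2 s] that by simp
  have sq2: "(z powr s)\<^sup>2 = z powr (2 * s)" if "z > 0" for z s :: real
    using powr_powr[of z s 2] that by (simp add: mult.commute)
  have Y: "Y powr (1-\<theta>) = g powr (2*(1-\<theta>)) / B powr (2*(1-\<theta>))"
    using a' R by (simp add: Y_def powr_divide sq1)
  have K: "(R * B powr (1-\<theta>) * G powr \<theta>)\<^sup>2 = R\<^sup>2 * B powr (2*(1-\<theta>)) * G powr (2*\<theta>)"
    using R by (simp add: power_mult_distrib sq2)
  have "a\<^sup>2 * g\<^sup>2 = a\<^sup>2 * (g powr (2*(1-\<theta>)) * g powr (2*\<theta>))"
  proof -
    have "g powr (2*(1-\<theta>)) * g powr (2*\<theta>) = g powr 2" unfolding powr_add[symmetric] by (simp add: algebra_simps)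
    then show ?thesis using a' by simp
  qed
  also have "\<dots> \<le> a\<^sup>2 * (g powr (2*(1-\<theta>)) * G powr (2*\<theta>))"
    using a a' th by (intro mult_left_mono powr_mono2) auto
  also have "\<dots> = (R * B powr (1-\<theta>) * G powr \<theta>)\<^sup>2 * (X powr \<theta> * Y powr (1-\<theta>))"
    unfolding K X Y using R by (simp add: field_simps)
  also have "\<dots> \<le> (R * B powr (1-\<theta>) * G powr \<theta>)\<^sup>2 * (\<theta> * X + (1-\<theta>) * Y)"
    using th XY by (intro mult_left_mono Youngs_inequality_0) auto
  finally show ?thesis by (simp only: X_def Y_def)
qed

text \<open>Hoelder with exponents 2/\<theta> for \<open>a\<close> and 2/(1-\<theta>) for
  \<open>g\<close>, the latter norm being interpolated between the mean-square bound
  \<open>B\<close> and the supremum \<open>G\<close>. Integrating the pointwise Young inequality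
  does both at once.\<close>

lemma holder_sq:
  assumes th: "0 \<le> \<theta>" "\<theta> \<le> 1" and R: "R > 0" "B > 0" "G > 0"
    and m [measurable]: "a \<in> borel_measurable (torus L)" "g \<in> borel_measurable (torus L)"
    and ba: "\<And>x. cmod (a x) \<le> Ka" and a: "Lr_bound L \<theta> R a"
    and gG: "\<And>x. cmod (g x) \<le> G" and gB: "(LINT x|torus L. (cmod (g x))\<^sup>2) \<le> L^3 * B\<^sup>2"
  shows "(LINT x|torus L. (cmod (a x * g x))\<^sup>2) \<le> L^3 * (R * B powr (1-\<theta>) * G powr \<theta>)\<^sup>2"
proof -
  have gi: "integrable (torus L) (\<lambda>x. (cmod (g x))\<^sup>2)"
    by (rule bounded_integrable_torus[OF L, of _ "G\<^sup>2"]) (use gG in \<open>auto intro!: power_mono\<close>)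
  have Ka: "0 \<le> Ka" using ba[of 0] norm_ge_zero order_trans by blast
  have agi: "integrable (torus L) (\<lambda>x. (cmod (a x * g x))\<^sup>2)"
  proof (rule bounded_integrable_torus[OF L, of _ "(Ka * G)\<^sup>2"])
    fix x
    have "cmod (a x * g x) \<le> Ka * G" unfolding norm_mult using ba gG Ka by (intro mult_mono) auto
    then show "norm ((cmod (a x * g x))\<^sup>2) \<le> (Ka * G)\<^sup>2" by (simp add: power_mono)
  qed measurable
  show ?thesis
  proof (cases "\<theta> = 0")
    case True
    have "(LINT x|torus L. (cmod (a x * g x))\<^sup>2) \<le> (LINT x|torus L. R\<^sup>2 * (cmod (g x))\<^sup>2)"
    proof (rule integral_mono_AE)
      have "AE x in torus L. cmod (a x) \<le> R" using a True by (simp add: Lr_bound_def)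
      then show "AE x in torus L. (cmod (a x * g x))\<^sup>2 \<le> R\<^sup>2 * (cmod (g x))\<^sup>2"
        by eventually_elim (auto simp: norm_mult power_mult_distrib intro!: mult_right_mono power_mono)
    qed (use agi gi in auto)
    also have "\<dots> = R\<^sup>2 * (LINT x|torus L. (cmod (g x))\<^sup>2)" by simp
    also have "\<dots> \<le> R\<^sup>2 * (L^3 * B\<^sup>2)" using gB by (intro mult_left_mono) auto
    finally show ?thesis using True R by (simp add: power_mult_distrib mult_ac)
  next
    case False
    then have th': "\<theta> > 0" using th by simp
    let ?K = "(R * B powr (1-\<theta>) * G powr \<theta>)\<^sup>2"
    let ?A = "\<lambda>x. cmod (a x) powr (2/\<theta>)"
    have ai: "integrable (torus L) ?A"
      by (rule bounded_integrable_torus[OF L, of _ "Ka powr (2/\<theta>)"]) (use ba th' in \<open>auto intro!: powr_mono2\<close>)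
    have aR: "(LINT x|torus L. ?A x) \<le> L^3 * R powr (2/\<theta>)" using a False by (simp add: Lr_bound_def)
    have "(LINT x|torus L. (cmod (a x * g x))\<^sup>2)
       \<le> (LINT x|torus L. ?K * (\<theta> * (?A x / R powr (2/\<theta>)) + (1-\<theta>) * ((cmod (g x))\<^sup>2 / B\<^sup>2)))"
      by (rule integral_mono[OF agi])
        (use ai gi young_pointwise[OF th' th(2) R _ _ gG] in \<open>auto simp: norm_mult power_mult_distrib\<close>)
    also have "\<dots> = ?K * (\<theta> * ((LINT x|torus L. ?A x) / R powr (2/\<theta>)) + (1-\<theta>) * ((LINT x|torus L. (cmod (g x))\<^sup>2) / B\<^sup>2))"
      using ai gi by simp
    also have "\<dots> \<le> ?K * (\<theta> * L^3 + (1-\<theta>) * L^3)"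
      using aR gB R th by (intro mult_left_mono add_mono) (auto simp: divide_le_eq)
    finally show ?thesis by (simp add: algebra_simps)
  qed
qed

text \<open>Cauchy-Schwarz against \<open>f\<close>, in the form of Young's inequality with weights
  chosen so that both squares contribute the same amount.\<close>

lemma holder:
  assumes th: "0 \<le> \<theta>" "\<theta> \<le> 1" and R: "R > 0" "B > 0" "G > 0" "F > 0"
    and m [measurable]: "a \<in> borel_measurable (torus L)" "g \<in> borel_measurable (torus L)"
    and f: "f \<in> L2c L" and fF: "(LINT x|torus L. (cmod (f x))\<^sup>2) \<le> L^3 * F\<^sup>2"
    and ba: "\<And>x. cmod (a x) \<le> Ka" and a: "Lr_bound L \<theta> R a"
    and gG: "\<And>x. cmod (g x) \<le> G" and gB: "(LINT x|torus L. (cmod (g x))\<^sup>2) \<le> L^3 * B\<^sup>2"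
  shows "cmod (LINT x|torus L. a x * f x * g x) \<le> L^3 * (R * F * B powr (1-\<theta>) * G powr \<theta>)"
proof -
  define K where "K = R * B powr (1-\<theta>) * G powr \<theta>"
  have K: "K > 0" using R by (simp add: K_def)
  have Ka: "0 \<le> Ka" using ba[of 0] norm_ge_zero order_trans by blast
  have agL: "(\<lambda>x. a x * g x) \<in> L2c L"
  proof (rule L2c_bounded[OF L, of _ "Ka * G"])
    fix x show "cmod (a x * g x) \<le> Ka * G" unfolding norm_mult using ba gG Ka by (intro mult_mono) auto
  qed measurable
  have ag: "(LINT x|torus L. (cmod (a x * g x))\<^sup>2) \<le> L^3 * K\<^sup>2"
    unfolding K_def by (rule holder_sq) (use assms in auto)
  have i: "integrable (torus L) (\<lambda>x. f x * (a x * g x))" by (rule L2c_mult_integrable[OF f agL])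
  have e: "(LINT x|torus L. a x * f x * g x) = (LINT x|torus L. f x * (a x * g x))" by (simp add: mult_ac)
  have "cmod (LINT x|torus L. f x * (a x * g x)) \<le> (LINT x|torus L. cmod (f x * (a x * g x)))"
    by (rule integral_norm_bound)
  also have "\<dots> \<le> (LINT x|torus L. K / (2*F) * (cmod (f x))\<^sup>2 + F / (2*K) * (cmod (a x * g x))\<^sup>2)"
  proof (rule integral_mono)
    fix x
    define p q where "p = cmod (f x)" and "q = cmod (a x * g x)"
    have "0 \<le> (K * p - F * q)\<^sup>2 / (2 * F * K)" using K R by auto
    also have "\<dots> = K / (2*F) * p\<^sup>2 + F / (2*K) * q\<^sup>2 - p * q"
      using K R by (simp add: power2_eq_square field_simps)
    finally show "cmod (f x * (a x * g x)) \<le> K / (2*F) * (cmod (f x))\<^sup>2 + F / (2*K) * (cmod (a x * g x))\<^sup>2"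
      unfolding norm_mult[of "f x"] p_def[symmetric] q_def[symmetric] by simp
  qed (use i L2c_int[OF f] L2c_int[OF agL] in auto)
  also have "\<dots> = K / (2*F) * (LINT x|torus L. (cmod (f x))\<^sup>2) + F / (2*K) * (LINT x|torus L. (cmod (a x * g x))\<^sup>2)"
    using L2c_int[OF f] L2c_int[OF agL] by simp
  also have "\<dots> \<le> K / (2*F) * (L^3 * F\<^sup>2) + F / (2*K) * (L^3 * K\<^sup>2)"
    using K R fF ag by (intro add_mono mult_left_mono) auto
  also have "\<dots> = L^3 * (K * F)" using K R by (simp add: power2_eq_square field_simps)
  finally show ?thesis unfolding e by (simp add: K_def mult_ac)
qed

text \<open>Convolution with the product of two Dirichlet kernels over the cubes of sizes \<open>n\<close> and \<open>2n\<close>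
  reproduces trigonometric polynomials of degree \<open>n\<close> up to the factor \<open>card (cube n)\<close>, and the
  three-function Hoelder inequality applies to it.\<close>

lemma bernstein:
  assumes th: "0 \<le> \<theta>" "\<theta> \<le> 1" and R: "R > 0"
    and H: "H \<subseteq> cube n" and z: "\<And>k. k \<notin> H \<Longrightarrow> \<alpha> k = 0"
    and a: "Lr_bound L \<theta> R (tp L H \<alpha>)"
  shows "cmod (tp L H \<alpha> x) \<le> 3 * R * real (2 * n + 1) powr (3 * \<theta> / 2)"
proof -
  \<comment> \<open>For \<open>m\<close> in \<open>B\<close> the translate of \<open>H\<close> by
    \<open>m\<close> stays inside \<open>A\<close>, so every inner sum below runs over the whole
    spectrum and reproduces the polynomial at \<open>x\<close>.\<close>
  define A B where "A = cube (2 * n)" and "B = cube n"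
  define f g where "f m = ek L (- m) x" and "g k = ek L k x" for m k
  have fin: "finite A" "finite B" "finite H" using cube_card(1) finite_subset[OF H] by (simp_all add: A_def B_def)
  have "(\<Sum>k\<in>A. \<Sum>m\<in>B. \<alpha> (k - m) * f m * g k) = (\<Sum>m\<in>B. \<Sum>k\<in>A. \<alpha> (k - m) * ek L (k - m) x)"
    by (subst sum.swap) (simp add: f_def g_def mult.assoc flip: ek_add)
  also have "\<dots> = (\<Sum>m\<in>B. tp L H \<alpha> x)"
  proof (rule sum.cong[OF refl])
    fix m assume m: "m \<in> B"
    have "(\<Sum>k\<in>A. \<alpha> (k - m) * ek L (k - m) x) = (\<Sum>k\<in>(+) m ` H. \<alpha> (k - m) * ek L (k - m) x)"
    proof (rule sum.mono_neutral_right[OF fin(1)])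
      show "(+) m ` H \<subseteq> A"
      proof
        fix k assume "k \<in> (+) m ` H"
        then obtain h where h: "h \<in> cube n" "k = m + h" using H by auto
        have "\<bar>k $ i\<bar> \<le> int (2 * n)" for i
          using h m abs_triangle_ineq[of "m $ i" "h $ i"] by (auto simp: cube_def B_def dest!: spec[of _ i])
        then show "k \<in> A" by (simp add: A_def cube_def)
      qed
      show "\<forall>k\<in>A - (+) m ` H. \<alpha> (k - m) * ek L (k - m) x = 0"
      proof
        fix k assume "k \<in> A - (+) m ` H"
        then have "k - m \<notin> H" by (auto simp: image_iff algebra_simps)
        then show "\<alpha> (k - m) * ek L (k - m) x = 0" using z by simp
      qed
    qed
    also have "\<dots> = tp L H \<alpha> x" by (simp add: sum.reindex tp_def)
    finally show "(\<Sum>k\<in>A. \<alpha> (k - m) * ek L (k - m) x) = tp L H \<alpha> x" .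
  qed
  also have "\<dots> = of_nat (card B) * tp L H \<alpha> x" by simp
  finally have id: "complex_of_real (L^3) * (of_nat (card B) * tp L H \<alpha> x)
      = (LINT y|torus L. tp L H \<alpha> y * tp L B f y * cnj (tp L A (\<lambda>k. cnj (g k)) y))"
    using triple_sum[where a=\<alpha> and f=f and g=g, OF L fin(3) z fin(1,2)] by simp
  define N where "N = real (2 * n + 1)"
  have N: "N \<ge> 1" by (simp add: N_def)
  have cB: "real (card B) = N^3" by (simp add: B_def cube_card N_def)
  have cA: "real (card A) \<le> 8 * N^3"
  proof -
    have "real (card A) = (2 * N - 1)^3" by (simp add: A_def cube_card N_def)
    also have "\<dots> \<le> (2 * N)^3" using N by (intro power_mono) auto
    finally show ?thesis by (simp add: power_mult_distrib)
  qed
  \<comment> \<open>\<open>A\<close> has at most 8 N^3 points; enlarging this to the square 9 N^3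
    produces the constant 3 of the statement.\<close>
  define F where "F = 3 * N powr (3/2)"
  have F2: "F\<^sup>2 = 9 * N^3"
    using N by (simp add: F_def power_mult_distrib powr_power powr_numeral)
  have e: "(LINT y|torus L. tp L H \<alpha> y * tp L B f y * cnj (tp L A (\<lambda>k. cnj (g k)) y))
     = (LINT y|torus L. tp L H \<alpha> y * cnj (tp L A (\<lambda>k. cnj (g k)) y) * tp L B f y)"
    by (simp add: mult_ac)
  have "cmod (LINT y|torus L. tp L H \<alpha> y * cnj (tp L A (\<lambda>k. cnj (g k)) y) * tp L B f y)
    \<le> L^3 * (R * F * (N powr (3/2)) powr (1-\<theta>) * (N^3) powr \<theta>)"
  proof (rule holder[OF th R])
    show "N powr (3/2) > 0" "N^3 > 0" "F > 0" using N by (auto simp: F_def)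
    show "(\<lambda>y. cnj (tp L A (\<lambda>k. cnj (g k)) y)) \<in> L2c L" by (intro L2c_cnj L2c_tp L)
    show "(LINT y|torus L. (cmod (cnj (tp L A (\<lambda>k. cnj (g k)) y)))\<^sup>2) \<le> L^3 * F\<^sup>2"
      unfolding complex_mod_cnj parseval_tp[OF L fin(1)] F2 using cA N L
      by (intro mult_left_mono) (auto simp: g_def)
    show "cmod (tp L H \<alpha> y) \<le> (\<Sum>k\<in>H. cmod (\<alpha> k))" for y by (rule norm_tp_le)
    show "Lr_bound L \<theta> R (tp L H \<alpha>)" by fact
    show "cmod (tp L B f y) \<le> N^3" for y
      using norm_tp_le[of L B f y] by (simp add: f_def flip: cB)
    show "(LINT y|torus L. (cmod (tp L B f y))\<^sup>2) \<le> L^3 * (N powr (3/2))\<^sup>2"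
      unfolding parseval_tp[OF L fin(2)] using L N cB by (simp add: f_def powr_power powr_numeral)
  qed measurable
  also have "R * F * (N powr (3/2)) powr (1-\<theta>) * (N^3) powr \<theta> = N^3 * (3 * R * N powr (3*\<theta>/2))"
  proof -
    have e1: "(N powr (3/2)) powr (1-\<theta>) = N powr (3/2 * (1-\<theta>))" by (rule powr_powr)
    have e2: "(N^3) powr \<theta> = N powr (3 * \<theta>)" using powr_powr[of N 3 \<theta>] N by simp
    have "N powr (3/2) * N powr (3/2 * (1-\<theta>)) * N powr (3 * \<theta>) = N powr 3 * N powr (3*\<theta>/2)"
      unfolding powr_add[symmetric] by (rule arg_cong[where f="\<lambda>z. N powr z"]) (simp add: field_simps)
    then show ?thesis unfolding e1 e2 F_def using N by (simp add: mult_ac)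
  qed
  finally have "L^3 * (N^3 * cmod (tp L H \<alpha> x)) \<le> L^3 * (N^3 * (3 * R * N powr (3*\<theta>/2)))"
    unfolding e[symmetric] id[symmetric] using L cB by (simp add: norm_mult norm_power)
  then show ?thesis using L N by (simp add: N_def)
qed

end

section \<open>Trilinear lattice sums and Hoelder's inequality\<close>

definition l2n :: "(int^3) set \<Rightarrow> (int^3 \<Rightarrow> complex) \<Rightarrow> real" where
  "l2n A f = sqrt (\<Sum>k\<in>A. (cmod (f k))\<^sup>2)"

lemma l2n_nonneg [simp]: "0 \<le> l2n A f" by (simp add: l2n_def sum_nonneg)

lemma l2n_sq: "(l2n A f)\<^sup>2 = (\<Sum>k\<in>A. (cmod (f k))\<^sup>2)" by (simp add: l2n_def sum_nonneg)

lemma l2n_eq_0: "finite A \<Longrightarrow> l2n A f = 0 \<Longrightarrow> k \<in> A \<Longrightarrow> f k = 0"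
  by (simp add: l2n_def sum_nonneg_eq_0_iff)

lemma l2n_mono: assumes "\<And>k. k \<in> A \<Longrightarrow> cmod (f k) \<le> cmod (g k)" shows "l2n A f \<le> l2n A g"
  unfolding l2n_def using assms by (intro real_sqrt_le_mono sum_mono power_mono) auto

text \<open>The nonlinearity in Fourier variables: \<open>k\<close> is the output frequency,
  \<open>m\<close> that of one factor and \<open>k - m\<close> that of the other.\<close>

definition trisum :: "(int^3) set \<Rightarrow> (int^3) set \<Rightarrow> (int^3 \<Rightarrow> complex) \<Rightarrow> (int^3 \<Rightarrow> complex) \<Rightarrow> (int^3 \<Rightarrow> complex) \<Rightarrow> complex" where
  "trisum X Y a f g = (\<Sum>k\<in>X. \<Sum>m\<in>Y. a (k - m) * f m * g k)"

lemma sum_cmod_le_l2n: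
  "(\<Sum>k\<in>A. cmod (f k)) \<le> sqrt (real (card A)) * l2n A f"
proof -
  have "(\<Sum>k\<in>A. 1 * cmod (f k))\<^sup>2 \<le> (\<Sum>k\<in>A. 1\<^sup>2) * (\<Sum>k\<in>A. (cmod (f k))\<^sup>2)"
    by (rule Cauchy_Schwarz_ineq_sum)
  then have "(\<Sum>k\<in>A. cmod (f k)) \<le> sqrt (real (card A) * (\<Sum>k\<in>A. (cmod (f k))\<^sup>2))"
    by (intro real_le_rsqrt) simp
  then show ?thesis by (simp add: l2n_def real_sqrt_mult)
qed

text \<open>Cauchy-Schwarz and a count of at most 5^3 * 8^b lattice points; 12 is a round bound for
  5^(3/2).\<close>

lemma sum_cmod_le_ball:
  assumes "finite A" "\<And>k. k \<in> A \<Longrightarrow> norm (freq k) \<le> 2 * 2 ^ b"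
  shows "(\<Sum>k\<in>A. cmod (f k)) \<le> 12 * 2 powr (3 * real b / 2) * l2n A f"
proof -
  have "real (card A) \<le> real (card {k::int^3. norm (freq k) \<le> 2 * 2 ^ b})"
    using assms by (intro of_nat_mono card_mono) auto
  also have "\<dots> \<le> (2 * (2 * 2 ^ b) + 1) ^ 3" by (rule card_freq_ball) simp
  also have "\<dots> \<le> (5 * 2 ^ b)^3" by (intro power_mono) auto
  also have "\<dots> \<le> (12 * 2 powr (3 * real b / 2))\<^sup>2"
  proof -
    have "(2 powr (3 * real b / 2))\<^sup>2 = (2 ^ b :: real)^3"
      by (simp add: powr_power flip: powr_realpow powr_numeral) (simp add: powr_powr mult.commute)
    then show ?thesis by (simp add: power_mult_distrib)
  qed
  finally have "sqrt (real (card A)) \<le> 12 * 2 powr (3 * real b / 2)"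
    by (intro real_le_lsqrt) auto
  then show ?thesis using sum_cmod_le_l2n[of f A] by (meson l2n_nonneg mult_right_mono order_trans)
qed

context fixes L :: real assumes L: "0 < L" begin

lemma trisum_zero:
  assumes "finite X" "finite Y" "l2n Y f = 0 \<or> l2n X g = 0"
  shows "trisum X Y a f g = 0"
  unfolding trisum_def using assms l2n_eq_0[of Y f] l2n_eq_0[of X g] by (auto intro!: sum.neutral)

text \<open>For \<open>f\<close> of low frequency: its polynomial is bounded by
  \<open>K * l2n Y f\<close>, so interpolation between the supremum and the mean-square norm costs
  only K^\<theta>.\<close>

lemma trisum_holder_low_f:
  assumes th: "0 \<le> \<theta>" "\<theta> \<le> 1" and R: "R > 0" "K > 0"
    and H: "finite H" "\<And>n. n \<notin> H \<Longrightarrow> a n = 0" and XY: "finite X" "finite Y"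
    and a: "Lr_bound L \<theta> R (tp L H a)"
    and K: "(\<Sum>k\<in>Y. cmod (f k)) \<le> K * l2n Y f"
  shows "cmod (trisum X Y a f g) \<le> K powr \<theta> * R * l2n Y f * l2n X g"
proof (cases "l2n Y f = 0 \<or> l2n X g = 0")
  case True
  then show ?thesis using trisum_zero[OF XY True] by auto
next
  case False
  then have pos: "l2n Y f > 0" "l2n X g > 0" by (auto simp: less_le)
  have e: "complex_of_real (L^3) * trisum X Y a f g
     = (LINT x|torus L. tp L H a x * cnj (tp L X (\<lambda>k. cnj (g k)) x) * tp L Y f x)"
  proof -
    have "complex_of_real (L^3) * trisum X Y a f g
      = (LINT x|torus L. tp L H a x * tp L Y f x * cnj (tp L X (\<lambda>k. cnj (g k)) x))"
      unfolding trisum_def by (rule triple_sum[OF L]) (fact H XY)+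
    then show ?thesis by (simp only: mult_ac)
  qed
  have "cmod (LINT x|torus L. tp L H a x * cnj (tp L X (\<lambda>k. cnj (g k)) x) * tp L Y f x)
     \<le> L^3 * (R * l2n X g * (l2n Y f) powr (1-\<theta>) * (K * l2n Y f) powr \<theta>)"
  proof (rule holder[OF L th R(1)])
    show "K * l2n Y f > 0" using pos R by simp
    show "(\<lambda>y. cnj (tp L X (\<lambda>k. cnj (g k)) y)) \<in> L2c L" by (intro L2c_cnj L2c_tp L)
    show "(LINT y|torus L. (cmod (cnj (tp L X (\<lambda>k. cnj (g k)) y)))\<^sup>2) \<le> L^3 * (l2n X g)\<^sup>2"
      unfolding complex_mod_cnj parseval_tp[OF L XY(1)] l2n_sq by simp
    show "cmod (tp L H a y) \<le> (\<Sum>k\<in>H. cmod (a k))" for y by (rule norm_tp_le)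
    show "cmod (tp L Y f y) \<le> K * l2n Y f" for y using norm_tp_le K order_trans by blast
    show "(LINT y|torus L. (cmod (tp L Y f y))\<^sup>2) \<le> L^3 * (l2n Y f)\<^sup>2"
      unfolding parseval_tp[OF L XY(2)] l2n_sq by simp
  qed (use pos a in auto)
  also have "R * l2n X g * (l2n Y f) powr (1-\<theta>) * (K * l2n Y f) powr \<theta> = K powr \<theta> * R * l2n Y f * l2n X g"
  proof -
    have "(l2n Y f) powr (1-\<theta>) * (l2n Y f) powr \<theta> = l2n Y f"
      using pos by (simp flip: powr_add)
    then show ?thesis using R pos by (simp add: powr_mult mult_ac)
  qed
  finally have "L^3 * cmod (trisum X Y a f g) \<le> L^3 * (K powr \<theta> * R * l2n Y f * l2n X g)"
    unfolding e[symmetric] using L by (simp add: norm_mult norm_power)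
  then show ?thesis using L by simp
qed

text \<open>The mirror image for a low output frequency: the supremum bound is now spent on
  \<open>g\<close>.\<close>

lemma trisum_holder_low_g:
  assumes th: "0 \<le> \<theta>" "\<theta> \<le> 1" and R: "R > 0" "K > 0"
    and H: "finite H" "\<And>n. n \<notin> H \<Longrightarrow> a n = 0" and XY: "finite X" "finite Y"
    and a: "Lr_bound L \<theta> R (tp L H a)"
    and K: "(\<Sum>k\<in>X. cmod (g k)) \<le> K * l2n X g"
  shows "cmod (trisum X Y a f g) \<le> K powr \<theta> * R * l2n Y f * l2n X g"
proof (cases "l2n Y f = 0 \<or> l2n X g = 0")
  case True
  then show ?thesis using trisum_zero[OF XY True] by auto
next
  case False
  then have pos: "l2n Y f > 0" "l2n X g > 0" by (auto simp: less_le)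
  have e: "complex_of_real (L^3) * trisum X Y a f g
     = (LINT x|torus L. tp L H a x * tp L Y f x * cnj (tp L X (\<lambda>k. cnj (g k)) x))"
    unfolding trisum_def by (rule triple_sum[OF L]) (fact H XY)+
  have "cmod (LINT x|torus L. tp L H a x * tp L Y f x * cnj (tp L X (\<lambda>k. cnj (g k)) x))
     \<le> L^3 * (R * l2n Y f * (l2n X g) powr (1-\<theta>) * (K * l2n X g) powr \<theta>)"
  proof (rule holder[OF L th R(1)])
    show "K * l2n X g > 0" using pos R by simp
    show "(LINT y|torus L. (cmod (cnj (tp L X (\<lambda>k. cnj (g k)) y)))\<^sup>2) \<le> L^3 * (l2n X g)\<^sup>2"
      unfolding complex_mod_cnj parseval_tp[OF L XY(1)] l2n_sq by simp
    show "cmod (tp L H a y) \<le> (\<Sum>k\<in>H. cmod (a k))" for y by (rule norm_tp_le)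
    show "cmod (cnj (tp L X (\<lambda>k. cnj (g k)) y)) \<le> K * l2n X g" for y
      using norm_tp_le[of L X "\<lambda>k. cnj (g k)" y] K by simp
    show "(LINT y|torus L. (cmod (tp L Y f y))\<^sup>2) \<le> L^3 * (l2n Y f)\<^sup>2"
      unfolding parseval_tp[OF L XY(2)] l2n_sq by simp
    show "tp L Y f \<in> L2c L" by (rule L2c_tp[OF L])
  qed (use pos a in auto)
  also have "R * l2n Y f * (l2n X g) powr (1-\<theta>) * (K * l2n X g) powr \<theta> = K powr \<theta> * R * l2n Y f * l2n X g"
  proof -
    have "(l2n X g) powr (1-\<theta>) * (l2n X g) powr \<theta> = l2n X g"
      using pos by (simp flip: powr_add)
    then show ?thesis using R pos by (simp add: powr_mult mult_ac)
  qed
  finally have "L^3 * cmod (trisum X Y a f g) \<le> L^3 * (K powr \<theta> * R * l2n Y f * l2n X g)"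
    unfolding e[symmetric] using L by (simp add: norm_mult norm_power)
  then show ?thesis using L by simp
qed

text \<open>The case \<theta> = 0: the factor K^\<theta> is 1 for every positive \<open>K\<close>,
  so a crude one serves. The added 1 keeps it positive when \<open>Y\<close> is empty.\<close>

lemma trisum_sup:
  assumes S: "S > 0"
    and H: "finite H" "\<And>n. n \<notin> H \<Longrightarrow> a n = 0" and XY: "finite X" "finite Y"
    and a: "AE x in torus L. cmod (tp L H a x) \<le> S"
  shows "cmod (trisum X Y a f g) \<le> S * l2n Y f * l2n X g"
proof -
  have "cmod (trisum X Y a f g) \<le> (sqrt (real (card Y)) + 1) powr 0 * S * l2n Y f * l2n X g"
  proof (rule trisum_holder_low_f[OF _ _ S _ H XY])
    show "(\<Sum>k\<in>Y. cmod (f k)) \<le> (sqrt (real (card Y)) + 1) * l2n Y f"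
      using sum_cmod_le_l2n[of f Y] by (simp add: distrib_right add_increasing2)
    show "sqrt (real (card Y)) + 1 > 0" by (simp add: add_nonneg_pos)
  qed (use a in \<open>auto simp: Lr_bound_def\<close>)
  moreover have "(sqrt (real (card Y)) + 1) powr 0 = 1"
  proof -
    have "sqrt (real (card Y)) + 1 > 0" by (simp add: add_nonneg_pos)
    then show ?thesis by simp
  qed
  ultimately show ?thesis by simp
qed

end

section \<open>Dyadic levels and Schur's test\<close>

definition lev :: "int^3 \<Rightarrow> nat" where "lev k = nat \<lfloor>log 2 (norm (freq k))\<rfloor>"

lemma lev_bounds: assumes "k \<noteq> 0" shows "2 ^ lev k \<le> norm (freq k)" "norm (freq k) < 2 * 2 ^ lev k"
proof -
  have n: "1 \<le> norm (freq k)" by (rule norm_freq_ge_1[OF assms])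
  then have "log 2 1 \<le> log 2 (norm (freq k))" by (intro log_mono) auto
  then have l: "0 \<le> log 2 (norm (freq k))" by simp
  have r: "real (lev k) \<le> log 2 (norm (freq k))" "log 2 (norm (freq k)) < real (lev k) + 1"
    using l by (auto simp: lev_def of_nat_nat)
  have "2 powr real (lev k) \<le> norm (freq k)" using r(1) assms le_log_iff[of 2 "norm (freq k)" "real (lev k)"] by simp
  then show "2 ^ lev k \<le> norm (freq k)" by (simp add: powr_realpow)
  have "norm (freq k) < 2 powr (real (lev k) + 1)" using r(2) assms log_less_iff[of 2 "norm (freq k)" "real (lev k) + 1"] by simp
  then show "norm (freq k) < 2 * 2 ^ lev k" by (simp add: powr_add powr_realpow mult.commute)
qed

lemma geometric_sum_le:
  fixes \<rho> :: real
  assumes "0 \<le> \<rho>" "\<rho> < 1" "finite I"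
  shows "(\<Sum>i\<in>I. \<rho> ^ i) \<le> 1 / (1 - \<rho>)"
proof -
  have s: "summable (\<lambda>i. \<rho> ^ i)" using assms by simp
  have "(\<Sum>i\<in>I. \<rho> ^ i) \<le> (\<Sum>i. \<rho> ^ i)" by (rule sum_le_suminf[OF s]) (use assms in auto)
  also have "\<dots> = 1 / (1 - \<rho>)" using assms by (simp add: suminf_geometric)
  finally show ?thesis .
qed

text \<open>The distance of two levels: one of the two truncated differences is always zero.\<close>

definition ndist :: "nat \<Rightarrow> nat \<Rightarrow> nat" where "ndist a b = (a - b) + (b - a)"

lemma schur_sum:
  fixes \<rho> :: real
  assumes r: "0 \<le> \<rho>" "\<rho> < 1" and I: "finite I"
  shows "(\<Sum>b\<in>I. \<rho> ^ ndist a b) \<le> 2 / (1 - \<rho>)"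
proof -
  have "(\<Sum>b\<in>I. \<rho> ^ ndist a b) = (\<Sum>b\<in>I \<inter> {..a}. \<rho> ^ ndist a b) + (\<Sum>b\<in>I - {..a}. \<rho> ^ ndist a b)"
    by (rule sum.Int_Diff[OF I])
  also have "(\<Sum>b\<in>I \<inter> {..a}. \<rho> ^ ndist a b) = (\<Sum>i\<in>(\<lambda>b. a - b) ` (I \<inter> {..a}). \<rho> ^ i)"
    by (subst sum.reindex) (auto simp: inj_on_def ndist_def)
  also have "\<dots> \<le> 1 / (1 - \<rho>)" by (rule geometric_sum_le) (use assms in auto)
  also have "(\<Sum>b\<in>I - {..a}. \<rho> ^ ndist a b) = (\<Sum>i\<in>(\<lambda>b. b - a) ` (I - {..a}). \<rho> ^ i)"
    by (subst sum.reindex) (auto simp: inj_on_def ndist_def)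
  also have "\<dots> \<le> 1 / (1 - \<rho>)" by (rule geometric_sum_le) (use assms in auto)
  finally show ?thesis by simp
qed

lemma ndist_sym: "ndist a b = ndist b a" by (simp add: ndist_def)

text \<open>Schur's test for the kernel \<rho>^|a-b|, whose row and column sums are at most
  2/(1-\<rho>).\<close>

lemma schur:
  fixes \<rho> :: real
  assumes r: "0 \<le> \<rho>" "\<rho> < 1" and I: "finite I"
  shows "(\<Sum>b\<in>I. \<Sum>a\<in>I. x a * y b * \<rho> ^ ndist a b) \<le> 1 / (1 - \<rho>) * ((\<Sum>a\<in>I. (x a)\<^sup>2) + (\<Sum>b\<in>I. (y b)\<^sup>2))"
proof -
  have "(\<Sum>b\<in>I. \<Sum>a\<in>I. x a * y b * \<rho> ^ ndist a b)
     \<le> (\<Sum>b\<in>I. \<Sum>a\<in>I. (x a)\<^sup>2 / 2 * \<rho> ^ ndist a b + (y b)\<^sup>2 / 2 * \<rho> ^ ndist a b)"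
  proof (intro sum_mono)
    fix a b
    have "x a * y b \<le> (x a)\<^sup>2 / 2 + (y b)\<^sup>2 / 2" using sum_squares_bound[of "x a" "y b"] by simp
    then have "x a * y b * \<rho> ^ ndist a b \<le> ((x a)\<^sup>2 / 2 + (y b)\<^sup>2 / 2) * \<rho> ^ ndist a b"
      using r by (intro mult_right_mono) auto
    then show "x a * y b * \<rho> ^ ndist a b \<le> (x a)\<^sup>2 / 2 * \<rho> ^ ndist a b + (y b)\<^sup>2 / 2 * \<rho> ^ ndist a b"
      by (simp add: distrib_right)
  qed
  also have "\<dots> = (\<Sum>a\<in>I. (x a)\<^sup>2 / 2 * (\<Sum>b\<in>I. \<rho> ^ ndist a b)) + (\<Sum>b\<in>I. (y b)\<^sup>2 / 2 * (\<Sum>a\<in>I. \<rho> ^ ndist b a))"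
    unfolding sum.distrib sum_distrib_left by (subst sum.swap) (simp add: ndist_sym)
  also have "\<dots> \<le> (\<Sum>a\<in>I. (x a)\<^sup>2 / 2 * (2 / (1 - \<rho>))) + (\<Sum>b\<in>I. (y b)\<^sup>2 / 2 * (2 / (1 - \<rho>)))"
    by (intro add_mono sum_mono mult_left_mono schur_sum r I) auto
  also have "\<dots> = 1 / (1 - \<rho>) * ((\<Sum>a\<in>I. (x a)\<^sup>2) + (\<Sum>b\<in>I. (y b)\<^sup>2))"
    by (simp add: distrib_left sum_divide_distrib)
  finally show ?thesis .
qed

section \<open>High-low interactions\<close>

lemma two_powr_nat: "(2::real) powr real n = 2 ^ n" by (simp add: powr_realpow)

lemma pow2_less_cancel: assumes "(2::real) ^ m < 2 ^ n" shows "m < n"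
  using assms by (simp add: power_strict_increasing_iff)

text \<open>The triangle inequality on dyadic shells. A difference cannot exceed the larger shell by
  more than a few levels, and for shells at least two levels apart no cancellation is possible, so
  the difference has essentially the larger level.\<close>

lemma freq_diff_bounds:
  assumes "2 ^ b \<le> norm (freq k)" "norm (freq k) < 2 * 2 ^ b" "2 ^ a \<le> norm (freq m)" "norm (freq m) < 2 * 2 ^ a"
    and p: "3/4 * 2 ^ p \<le> norm (freq (k - m))" "norm (freq (k - m)) \<le> 2 * 2 ^ p"
  shows "p \<le> max a b + 2" and "b + 2 \<le> a \<Longrightarrow> a \<le> p + 2" and "a + 2 \<le> b \<Longrightarrow> b \<le> p + 2"
proof -
  have t: "norm (freq (k - m)) \<le> norm (freq k) + norm (freq m)"
    "norm (freq m) - norm (freq k) \<le> norm (freq (k - m))"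
    "norm (freq k) - norm (freq m) \<le> norm (freq (k - m))"
    using norm_triangle_ineq4[of "freq k" "freq m"] norm_triangle_ineq2[of "freq m" "freq k"] norm_triangle_ineq2[of "freq k" "freq m"]
    by (auto simp: freq_diff norm_minus_commute)
  have mx: "(2::real) ^ a \<le> 2 ^ max a b" "(2::real) ^ b \<le> 2 ^ max a b" by auto
  have "(2::real) ^ p < 2 ^ (max a b + 3)"
  proof -
    have "(2::real) ^ (max a b + 3) = 8 * 2 ^ max a b" by (simp add: power_add)
    moreover have "0 < (2::real) ^ max a b" by simp
    ultimately show ?thesis using t(1) mx assms(2,4) p(1) by linarith
  qed
  from pow2_less_cancel[OF this] show "p \<le> max a b + 2" by simp
  {
    assume "b + 2 \<le> a"
    then have "(2::real) ^ (b + 2) \<le> 2 ^ a" by (intro power_increasing) auto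
    moreover have "(2::real) ^ (b + 2) = 4 * 2 ^ b" "(2::real) ^ (p + 3) = 8 * 2 ^ p" "0 < (2::real) ^ p"
      by (simp_all add: power_add)
    ultimately have "(2::real) ^ a < 2 ^ (p + 3)" using t(2) assms(2,3) p(2) by linarith
    from pow2_less_cancel[OF this] show "a \<le> p + 2" by simp
  }
  {
    assume "a + 2 \<le> b"
    then have "(2::real) ^ (a + 2) \<le> 2 ^ b" by (intro power_increasing) auto
    moreover have "(2::real) ^ (a + 2) = 4 * 2 ^ a" "(2::real) ^ (p + 3) = 8 * 2 ^ p" "0 < (2::real) ^ p"
      by (simp_all add: power_add)
    ultimately have "(2::real) ^ b < 2 ^ (p + 3)" using t(3) assms(1,4) p(2) by linarith
    from pow2_less_cancel[OF this] show "b \<le> p + 2" by simp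
  }
qed

text \<open>A geometric sum with ratio \<open>sqrt 2\<close> is dominated by its last term; the
  factor 4 survives the induction step because \<open>sqrt 2\<close> is at least 4/3.\<close>

lemma sum_powr_half_le: "(\<Sum>p\<in>{..M}. 2 powr (real p / 2)) \<le> 4 * 2 powr (real M / 2)"
proof (induction M)
  case 0 then show ?case by simp
next
  case (Suc M)
  have s: "sqrt 2 \<ge> 4/3" by (rule real_le_rsqrt) (simp add: power2_eq_square)
  have e: "2 powr (real (Suc M) / 2) = sqrt 2 * 2 powr (real M / 2)"
    by (simp add: add_divide_distrib powr_add powr_half_sqrt)
  have "4 * 2 powr (real M / 2) + sqrt 2 * 2 powr (real M / 2) \<le> 4 * (sqrt 2 * 2 powr (real M / 2))"
  proof -
    have "(4 + sqrt 2) * 2 powr (real M / 2) \<le> (4 * sqrt 2) * 2 powr (real M / 2)"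
      using s by (intro mult_right_mono) auto
    then show ?thesis by (simp add: algebra_simps)
  qed
  then show ?case using Suc unfolding sum.atMost_Suc e by linarith
qed

text \<open>The block condition for one component, freed of the solution: \<theta> = 2/r, \<gamma> =
  \<delta>/2 + 3/r, and \<open>Bc\<close> will be c(r,\<delta>) \<nu> / L. Solving the condition for
  the norm of block \<open>p\<close> gives the power of 2 in \<open>nrm\<close>.\<close>

locale high =
  fixes L \<theta> \<delta> \<gamma> Bc :: real and q :: nat and \<alpha> :: "nat \<Rightarrow> int^3 \<Rightarrow> complex"
  assumes L: "0 < L" and th: "0 \<le> \<theta>" "\<theta> \<le> 1" and de: "0 \<le> \<delta>" "\<delta> \<le> 3"
    and ga: "\<gamma> = \<delta> / 2 + 3 * \<theta> / 2" "\<gamma> > 0" and Bc: "Bc > 0"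
    and supp: "\<And>p k. q < p \<Longrightarrow> \<alpha> p k \<noteq> 0 \<Longrightarrow> 3/4 * 2 ^ p \<le> norm (freq k) \<and> norm (freq k) \<le> 2 * 2 ^ p"
    and nrm: "\<And>p. q < p \<Longrightarrow> Lr_bound L \<theta> (Bc * 2 powr (real q * (1/2 + \<delta>/2) + real p * (1/2 - \<gamma>)))
       (tp L {k. norm (freq k) \<le> 2 * 2 ^ p} (\<alpha> p))"
begin

definition "R p = Bc * 2 powr (real q * (1/2 + \<delta>/2) + real p * (1/2 - \<gamma>))"

lemma R_pos: "R p > 0" using Bc by (simp add: R_def)

lemma gamma3: "\<gamma> \<le> 3" using ga th de by simp

definition "shell b X \<longleftrightarrow> finite X \<and> (\<forall>k\<in>X. 2 ^ b \<le> norm (freq k) \<and> norm (freq k) < 2 * 2 ^ b)"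

lemma trisum_vanish:
  assumes "shell b X" "shell a Y" "q < p" "\<not> (p \<le> max a b + 2 \<and> (b + 2 \<le> a \<longrightarrow> a \<le> p + 2) \<and> (a + 2 \<le> b \<longrightarrow> b \<le> p + 2))"
  shows "trisum X Y (\<alpha> p) f g = 0"
  unfolding trisum_def
proof (intro sum.neutral ballI)
  fix k m assume "k \<in> X" "m \<in> Y"
  then have b: "2 ^ b \<le> norm (freq k)" "norm (freq k) < 2 * 2 ^ b" "2 ^ a \<le> norm (freq m)" "norm (freq m) < 2 * 2 ^ a"
    using assms by (auto simp: shell_def)
  have "\<alpha> p (k - m) = 0"
    using supp[OF assms(3), of "k - m"] freq_diff_bounds[OF b, of p] assms(4) by blast
  then show "\<alpha> p (k - m) * f m * g k = 0" by simp
qed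

lemma supp0: "q < p \<Longrightarrow> n \<notin> {k. norm (freq k) \<le> 2 * 2 ^ p} \<Longrightarrow> \<alpha> p n = 0"
  using supp[of p n] by auto

lemma powr_theta_12: "(12 * 2 powr (3 * real b / 2)) powr \<theta> \<le> 12 * 2 powr (3 * \<theta> / 2 * real b)"
proof -
  have "(12 * 2 powr (3 * real b / 2)) powr \<theta> = 12 powr \<theta> * 2 powr (3 * \<theta> / 2 * real b)"
    by (simp add: powr_mult powr_powr mult_ac)
  also have "(12::real) powr \<theta> \<le> 12 powr 1" using th by (intro powr_mono) auto
  finally show ?thesis by (simp add: mult_right_mono)
qed

text \<open>Meant for an output shell far below the input shell: the cost of interpolation is then
  paid at the lower level \<open>b\<close>. The next lemma is for the opposite order.\<close>

lemma far_low_g: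
  assumes "shell b X" "finite Y" "q < p"
  shows "cmod (trisum X Y (\<alpha> p) f g) \<le> 12 * 2 powr (3 * \<theta> / 2 * real b) * R p * l2n Y f * l2n X g"
proof -
  have K: "(\<Sum>k\<in>X. cmod (g k)) \<le> 12 * 2 powr (3 * real b / 2) * l2n X g"
    using assms(1) by (intro sum_cmod_le_ball) (auto simp: shell_def intro: less_imp_le)
  have "cmod (trisum X Y (\<alpha> p) f g) \<le> (12 * 2 powr (3 * real b / 2)) powr \<theta> * R p * l2n Y f * l2n X g"
    by (rule trisum_holder_low_g[where H="{k. norm (freq k) \<le> 2 * 2 ^ p}", OF L th R_pos])
      (use assms nrm[OF assms(3)] supp0 K in \<open>auto simp: shell_def R_def\<close>)
  also have "\<dots> \<le> (12 * 2 powr (3 * \<theta> / 2 * real b)) * R p * l2n Y f * l2n X g"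
    using R_pos[of p] powr_theta_12 by (intro mult_right_mono) auto
  finally show ?thesis .
qed

lemma far_low_f:
  assumes "finite X" "shell a Y" "q < p"
  shows "cmod (trisum X Y (\<alpha> p) f g) \<le> 12 * 2 powr (3 * \<theta> / 2 * real a) * R p * l2n Y f * l2n X g"
proof -
  have K: "(\<Sum>k\<in>Y. cmod (f k)) \<le> 12 * 2 powr (3 * real a / 2) * l2n Y f"
    using assms(2) by (intro sum_cmod_le_ball) (auto simp: shell_def intro: less_imp_le)
  have "cmod (trisum X Y (\<alpha> p) f g) \<le> (12 * 2 powr (3 * real a / 2)) powr \<theta> * R p * l2n Y f * l2n X g"
    by (rule trisum_holder_low_f[where H="{k. norm (freq k) \<le> 2 * 2 ^ p}", OF L th R_pos])
      (use assms nrm[OF assms(3)] supp0 K in \<open>auto simp: shell_def R_def\<close>)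
  also have "\<dots> \<le> (12 * 2 powr (3 * \<theta> / 2 * real a)) * R p * l2n Y f * l2n X g"
    using R_pos[of p] powr_theta_12 by (intro mult_right_mono) auto
  finally show ?thesis .
qed

text \<open>For comparable shells the block itself goes into the supremum norm by Bernstein's
  inequality. The cost 2^(3\<theta>p/2) turns the coefficient 1/2 - \<gamma> of \<open>p\<close> in
  the exponent into 1/2 - \<delta>/2, and q < p lets the terms with \<delta> be dropped.\<close>

lemma near:
  assumes "finite X" "finite Y" "q < p"
  shows "cmod (trisum X Y (\<alpha> p) f g) \<le> 36 * Bc * 2 powr (real q / 2) * 2 powr (real p / 2) * l2n Y f * l2n X g"
proof -
  let ?H = "{k::int^3. norm (freq k) \<le> 2 * 2 ^ p}"
  have Hc: "?H \<subseteq> cube (2 * 2 ^ p)"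
  proof
    fix k assume "k \<in> ?H"
    then have "\<bar>real_of_int (k $ i)\<bar> \<le> 2 * 2 ^ p" for i
      using component_le_norm_cart[of "freq k" i] by simp
    then have "real_of_int \<bar>k $ i\<bar> \<le> real_of_int (int (2 * 2 ^ p))" for i by simp
    then have "\<bar>k $ i\<bar> \<le> int (2 * 2 ^ p)" for i by (simp only: of_int_le_iff)
    then show "k \<in> cube (2 * 2 ^ p)" by (simp add: cube_def)
  qed
  have S: "cmod (tp L ?H (\<alpha> p) x) \<le> 36 * (Bc * 2 powr (real q / 2) * 2 powr (real p / 2))" for x
  proof -
    have "cmod (tp L ?H (\<alpha> p) x) \<le> 3 * R p * real (2 * (2 * 2 ^ p) + 1) powr (3 * \<theta> / 2)"
      by (rule bernstein[OF L th R_pos Hc]) (use nrm[OF assms(3)] supp0[OF assms(3)] in \<open>auto simp: R_def\<close>)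
    also have "\<dots> \<le> 3 * R p * ((12 * 2 powr (3 * real p / 2)) powr \<theta>)"
    proof -
      have "real (2 * (2 * 2 ^ p) + 1) \<le> 5 * 2 ^ p" by simp
      then have "real (2 * (2 * 2 ^ p) + 1) powr (3 * \<theta> / 2) \<le> (5 * 2 ^ p) powr (3 * \<theta> / 2)"
        using th by (intro powr_mono2) auto
      also have "\<dots> = ((5 * 2 ^ p) powr (3/2)) powr \<theta>" by (simp add: powr_powr)
      also have "(5 * 2 ^ p) powr (3/2) = 5 powr (3/2) * 2 powr (3 * real p / 2)"
        by (simp add: powr_mult powr_powr mult_ac flip: powr_realpow)
      also have "((5::real) powr (3/2) * 2 powr (3 * real p / 2)) powr \<theta> \<le> (12 * 2 powr (3 * real p / 2)) powr \<theta>"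
      proof (intro powr_mono2 mult_right_mono)
        have "((5::real) powr (3/2))\<^sup>2 = 5 powr 3" using powr_powr[of "5::real" "3/2" 2] by simp
        then have "((5::real) powr (3/2))\<^sup>2 \<le> 12\<^sup>2" by simp
        then show "(5::real) powr (3/2) \<le> 12" by (rule power2_le_imp_le) simp
      qed (use th in auto)
      finally show ?thesis using R_pos[of p] by (intro mult_left_mono) auto
    qed
    also have "\<dots> \<le> 3 * R p * (12 * 2 powr (3 * \<theta> / 2 * real p))"
      using R_pos[of p] powr_theta_12 by (intro mult_left_mono) auto
    also have "\<dots> = 36 * Bc * 2 powr (real q * (1/2 + \<delta>/2) + real p * (1/2 - \<gamma>) + 3 * \<theta> / 2 * real p)"
      by (simp add: R_def powr_add)
    also have "\<dots> \<le> 36 * Bc * 2 powr (real q / 2 + real p / 2)"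
    proof (intro mult_left_mono powr_mono)
      have "real q * \<delta> \<le> real p * \<delta>" using assms(3) de by (intro mult_right_mono) auto
      then show "real q * (1/2 + \<delta>/2) + real p * (1/2 - \<gamma>) + 3 * \<theta> / 2 * real p \<le> real q / 2 + real p / 2"
        unfolding ga(1) by (simp add: algebra_simps)
    qed (use Bc in auto)
    finally show ?thesis by (simp add: powr_add mult_ac)
  qed
  have "cmod (trisum X Y (\<alpha> p) f g) \<le> (36 * (Bc * 2 powr (real q / 2) * 2 powr (real p / 2))) * l2n Y f * l2n X g"
    by (rule trisum_sup[where H="?H", OF L])
      (use assms S Bc supp0[OF assms(3)] in auto)
  then show ?thesis by (simp add: mult_ac)
qed

text \<open>The norm of order 1/2 on a single shell, which is the scale of the dissipation.\<close>

definition "wn a Y f = 2 powr (real a / 2) * l2n Y f"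

lemma wn_nonneg [simp]: "0 \<le> wn a Y f" by (simp add: wn_def)

text \<open>The exponent arithmetic of the high-low interactions: \<open>c\<close> is the low level, \<open>d\<close> the high one.\<close>

lemma far_term:
  assumes "q \<le> c" "p \<le> d + 2" "d \<le> p + 2"
  shows "2 powr (3 * \<theta> / 2 * real c) * R p \<le> 32 * Bc * 2 powr (real c / 2 + real d / 2) * 2 powr (- \<gamma> * (real d - real c))"
proof -
  have 1: "real q * (1/2 + \<delta>/2) \<le> real c * (1/2 + \<delta>/2)" using assms de by (intro mult_right_mono) auto
  \<comment> \<open>The distance of \<open>p\<close> and \<open>d\<close> is at most 2 and |1/2 -
    \<gamma>| at most 5/2, which costs 2^5 = 32.\<close>
  have 2: "(real p - real d) * (1/2 - \<gamma>) \<le> 5"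
  proof -
    have "(real p - real d) * (1/2 - \<gamma>) \<le> \<bar>real p - real d\<bar> * \<bar>1/2 - \<gamma>\<bar>" by (metis abs_ge_self abs_mult)
    also have "\<dots> \<le> 2 * (5/2)"
    proof (rule mult_mono)
      show "\<bar>real p - real d\<bar> \<le> 2" using assms by linarith
      show "\<bar>1/2 - \<gamma>\<bar> \<le> 5/2" using gamma3 ga(2) by linarith
    qed auto
    finally show ?thesis by simp
  qed
  have "2 powr (3 * \<theta> / 2 * real c) * R p = Bc * 2 powr (3 * \<theta> / 2 * real c + (real q * (1/2 + \<delta>/2) + real p * (1/2 - \<gamma>)))"
    by (simp add: R_def powr_add)
  also have "\<dots> \<le> Bc * 2 powr (5 + (real c / 2 + real d / 2) + (- \<gamma> * (real d - real c)))"
  proof (intro mult_left_mono powr_mono)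
    show "3 * \<theta> / 2 * real c + (real q * (1/2 + \<delta>/2) + real p * (1/2 - \<gamma>)) \<le> 5 + (real c / 2 + real d / 2) + (- \<gamma> * (real d - real c))"
    proof -
      have e1: "real c * \<gamma> = real c * \<delta> / 2 + 3 * \<theta> / 2 * real c" unfolding ga(1) by (simp add: algebra_simps)
      have e2: "real c * (1/2 + \<delta>/2) = real c / 2 + real c * \<delta> / 2" by (simp add: algebra_simps)
      have e3: "(real p - real d) * (1/2 - \<gamma>) = real p * (1/2 - \<gamma>) - real d / 2 + real d * \<gamma>" by (simp add: field_simps)
      have e4: "- \<gamma> * (real d - real c) = real c * \<gamma> - real d * \<gamma>" by (simp add: algebra_simps)
      show ?thesis using 1 2 e1 e2 e3 e4 by linarith
    qed
  qed (use Bc in auto)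
  also have "\<dots> = 32 * Bc * 2 powr (real c / 2 + real d / 2) * 2 powr (- \<gamma> * (real d - real c))"
  proof -
    have "2 powr (5 + X + Y) = 32 * 2 powr X * 2 powr Y" for X Y :: real by (simp add: powr_add)
    then show ?thesis by (simp only: mult_ac)
  qed
  finally show ?thesis .
qed

text \<open>For shells at least two levels apart only the five or fewer blocks near the higher level
  contribute, each with the factor 2^(-\<gamma>) per level of distance. For comparable shells all
  blocks from \<open>q\<close> up to their level contribute, with geometrically growing bounds. The
  two cases cost 12 * 32 * 5 = 1920 and 36 * 4 * 2 * 8 = 2304.\<close>

lemma level_bound:
  assumes X: "shell b X" and Y: "shell a Y" and qa: "q \<le> a" "q \<le> b"
  shows "(\<Sum>p\<in>{q<..P}. cmod (trisum X Y (\<alpha> p) f g)) \<le> 2304 * Bc * (wn a Y f * wn b X g * (2 powr (- \<gamma>)) ^ ndist a b)"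
proof -
  have fin: "finite X" "finite Y" using X Y by (auto simp: shell_def)
  have rho: "(2 powr (- \<gamma>)) ^ n = 2 powr (- \<gamma> * real n)" for n by (simp add: powr_power mult.commute)
  have far: "(\<Sum>p\<in>{q<..P}. cmod (trisum X Y (\<alpha> p) f g)) \<le> 2304 * Bc * (wn a Y f * wn b X g * (2 powr (- \<gamma>)) ^ ndist a b)"
    if cd: "c + 2 \<le> d" "q \<le> c" "ndist a b = d - c" "real c + real d = real a + real b"
      and van: "\<And>p. q < p \<Longrightarrow> \<not> (p \<le> d + 2 \<and> d \<le> p + 2) \<Longrightarrow> trisum X Y (\<alpha> p) f g = 0"
      and bnd: "\<And>p. q < p \<Longrightarrow> cmod (trisum X Y (\<alpha> p) f g) \<le> 12 * 2 powr (3 * \<theta> / 2 * real c) * R p * l2n Y f * l2n X g"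
    for c d
  proof -
    define Z where "Z = 12 * (32 * Bc) * (wn a Y f * wn b X g * (2 powr (- \<gamma>)) ^ ndist a b)"
    have Z: "0 \<le> Z" using Bc by (simp add: Z_def)
    have t: "cmod (trisum X Y (\<alpha> p) f g) \<le> Z" if p: "q < p" "p \<le> d + 2" "d \<le> p + 2" for p
    proof -
      have "cmod (trisum X Y (\<alpha> p) f g) \<le> 12 * (2 powr (3 * \<theta> / 2 * real c) * R p) * (l2n Y f * l2n X g)"
        using bnd[OF p(1)] by (simp add: mult_ac)
      also have "\<dots> \<le> 12 * (32 * Bc * 2 powr (real c / 2 + real d / 2) * 2 powr (- \<gamma> * (real d - real c))) * (l2n Y f * l2n X g)"
        using far_term[OF cd(2) p(2,3)] by (intro mult_right_mono mult_left_mono) auto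
      also have "\<dots> = Z"
      proof -
        have "real c / 2 + real d / 2 = real a / 2 + real b / 2" using cd(4) by (simp flip: add_divide_distrib)
        moreover have "real (ndist a b) = real d - real c" using cd by simp
        ultimately show ?thesis by (simp add: Z_def wn_def rho powr_add mult_ac)
      qed
      finally show ?thesis .
    qed
    have "(\<Sum>p\<in>{q<..P}. cmod (trisum X Y (\<alpha> p) f g)) \<le> (\<Sum>p\<in>{q<..P}. if p \<in> {d - 2..d + 2} then Z else 0)"
      using t van by (intro sum_mono) force
    also have "\<dots> = (\<Sum>p\<in>{q<..P} \<inter> {d - 2..d + 2}. Z)" by (rule sum.inter_restrict[symmetric]) simp
    also have "\<dots> \<le> (\<Sum>p\<in>{d - 2..d + 2}. Z)" using Z by (intro sum_mono2) auto
    also have "\<dots> \<le> 5 * Z" using Z by (auto intro!: mult_right_mono)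
    also have "\<dots> \<le> 2304 * Bc * (wn a Y f * wn b X g * (2 powr (- \<gamma>)) ^ ndist a b)"
      using Bc by (simp add: Z_def)
    finally show ?thesis .
  qed
  consider "b + 2 \<le> a" | "a + 2 \<le> b" | "a \<le> b + 1 \<and> b \<le> a + 1" by linarith
  then show ?thesis
  proof cases
    case 1
    show ?thesis
    proof (rule far[of b a])
      fix p assume p: "q < p"
      show "trisum X Y (\<alpha> p) f g = 0" if "\<not> (p \<le> a + 2 \<and> a \<le> p + 2)"
        using that 1 by (intro trisum_vanish[OF X Y p]) auto
      show "cmod (trisum X Y (\<alpha> p) f g) \<le> 12 * 2 powr (3 * \<theta> / 2 * real b) * R p * l2n Y f * l2n X g"
        by (rule far_low_g[OF X fin(2) p])
    qed (use 1 qa in \<open>auto simp: ndist_def\<close>)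
  next
    case 2
    show ?thesis
    proof (rule far[of a b])
      fix p assume p: "q < p"
      show "trisum X Y (\<alpha> p) f g = 0" if "\<not> (p \<le> b + 2 \<and> b \<le> p + 2)"
        using that 2 by (intro trisum_vanish[OF X Y p]) auto
      show "cmod (trisum X Y (\<alpha> p) f g) \<le> 12 * 2 powr (3 * \<theta> / 2 * real a) * R p * l2n Y f * l2n X g"
        by (rule far_low_f[OF fin(1) Y p])
    qed (use 2 qa in \<open>auto simp: ndist_def\<close>)
  next
    case 3
    define M mn where "M = max a b + 2" and "mn = min a b"
    let ?E = "36 * Bc * 2 powr (real q / 2) * l2n Y f * l2n X g"
    have E: "0 \<le> ?E" using Bc by simp
    have "(\<Sum>p\<in>{q<..P}. cmod (trisum X Y (\<alpha> p) f g)) \<le> (\<Sum>p\<in>{q<..P}. if p \<in> {..M} then ?E * 2 powr (real p / 2) else 0)"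
    proof (rule sum_mono)
      fix p assume "p \<in> {q<..P}"
      then have p: "q < p" by simp
      show "cmod (trisum X Y (\<alpha> p) f g) \<le> (if p \<in> {..M} then ?E * 2 powr (real p / 2) else 0)"
        using near[OF fin p, of f g] trisum_vanish[OF X Y p, of f g] by (auto simp: M_def mult_ac)
    qed
    also have "\<dots> = (\<Sum>p\<in>{q<..P} \<inter> {..M}. ?E * 2 powr (real p / 2))" by (rule sum.inter_restrict[symmetric]) simp
    also have "\<dots> \<le> (\<Sum>p\<in>{..M}. ?E * 2 powr (real p / 2))" using E by (intro sum_mono2) auto
    also have "\<dots> = ?E * (\<Sum>p\<in>{..M}. 2 powr (real p / 2))" by (simp add: sum_distrib_left)
    also have "\<dots> \<le> ?E * (4 * 2 powr (real M / 2))" by (intro mult_left_mono sum_powr_half_le E)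
    also have "\<dots> = 144 * Bc * (2 powr (real q / 2) * 2 powr (real M / 2)) * (l2n Y f * l2n X g)" by (simp add: mult_ac)
    also have "\<dots> \<le> 144 * Bc * (2 * (2 powr (real a / 2) * 2 powr (real b / 2))) * (l2n Y f * l2n X g)"
    proof (intro mult_right_mono mult_left_mono)
      have "2 powr (real q / 2) * 2 powr (real M / 2) = 2 powr (real q / 2 + real M / 2)" by (simp add: powr_add)
      also have "\<dots> \<le> 2 powr (1 + (real a / 2 + real b / 2))"
      proof (intro powr_mono)
        have "real q + real M \<le> 2 + (real a + real b)" using qa by (auto simp: M_def max_def)
        then show "real q / 2 + real M / 2 \<le> 1 + (real a / 2 + real b / 2)" by linarith
      qed simp
      finally show "2 powr (real q / 2) * 2 powr (real M / 2) \<le> 2 * (2 powr (real a / 2) * 2 powr (real b / 2))"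
        by (simp add: powr_add)
    qed (use Bc in auto)
    also have "\<dots> = 288 * Bc * (wn a Y f * wn b X g)" by (simp add: wn_def mult_ac)
    \<comment> \<open>The distance is at most 1 and \<gamma> at most 3, so the factor 8 pays for the
      decay that the statement demands.\<close>
    also have "\<dots> \<le> 288 * Bc * (wn a Y f * wn b X g * (8 * (2 powr (- \<gamma>)) ^ ndist a b))"
    proof -
      have nd: "ndist a b \<le> 1" using 3 by (auto simp: ndist_def)
      have "8 * (2 powr (- \<gamma>)) ^ ndist a b = 2 powr (3 - \<gamma> * real (ndist a b))"
        unfolding rho by (simp add: powr_diff powr_minus field_simps)
      moreover have "\<gamma> * real (ndist a b) \<le> 3 * 1" using nd gamma3 ga(2) by (intro mult_mono) auto
      ultimately have "1 \<le> 8 * (2 powr (- \<gamma>)) ^ ndist a b" by (simp add: ge_one_powr_ge_zero)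
      then have "wn a Y f * wn b X g * 1 \<le> wn a Y f * wn b X g * (8 * (2 powr (- \<gamma>)) ^ ndist a b)"
        by (intro mult_left_mono) auto
      then show ?thesis using Bc by simp
    qed
    finally show ?thesis by (simp add: mult_ac)
  qed
qed

text \<open>Grouping the frequencies into shells reduces the sum to \<open>level_bound\<close>. The
  decay 2^(-\<gamma>) per level makes Schur's test applicable and leaves the denominator 1 -
  2^(-\<gamma>), to be compensated by c(r,\<delta>).\<close>

theorem high_estimate:
  assumes A: "finite A" "\<And>k. k \<in> A \<Longrightarrow> k \<noteq> 0 \<and> 2 ^ q \<le> norm (freq k)"
  shows "cmod (\<Sum>p\<in>{q<..P}. trisum A A (\<alpha> p) f g)
    \<le> 2304 * Bc / (1 - 2 powr (- \<gamma>)) * ((\<Sum>k\<in>A. norm (freq k) * (cmod (f k))\<^sup>2) + (\<Sum>k\<in>A. norm (freq k) * (cmod (g k))\<^sup>2))"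
proof -
  define I where "I = lev ` A"
  define S where "S a = {k\<in>A. lev k = a}" for a
  have I: "finite I" using A by (simp add: I_def)
  have sh: "shell a (S a)" for a
    using A lev_bounds by (auto simp: shell_def S_def)
  have qI: "q \<le> a" if "a \<in> I" for a
  proof -
    obtain k where k: "k \<in> A" "a = lev k" using \<open>a \<in> I\<close> by (auto simp: I_def)
    then have "(2::real) ^ q < 2 ^ (a + 1)" using A(2)[OF k(1)] lev_bounds(2)[of k] by simp
    from pow2_less_cancel[OF this] show ?thesis by simp
  qed
  have grp: "(\<Sum>k\<in>A. h k) = (\<Sum>a\<in>I. \<Sum>k\<in>S a. h k)" for h :: "int^3 \<Rightarrow> 'z::comm_monoid_add"
    unfolding S_def by (rule sum.group[symmetric]) (use A I in \<open>auto simp: I_def\<close>)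
  have tri: "trisum A A a f g = (\<Sum>b\<in>I. \<Sum>c\<in>I. trisum (S b) (S c) a f g)" for a
  proof -
    have "trisum A A a f g = (\<Sum>b\<in>I. \<Sum>k\<in>S b. \<Sum>c\<in>I. \<Sum>m\<in>S c. a (k - m) * f m * g k)"
      unfolding trisum_def by (subst grp) (intro sum.cong refl, rule grp)
    also have "\<dots> = (\<Sum>b\<in>I. \<Sum>c\<in>I. trisum (S b) (S c) a f g)"
      unfolding trisum_def by (intro sum.cong refl sum.swap)
    finally show ?thesis .
  qed
  have rho: "0 \<le> 2 powr (- \<gamma>)" "2 powr (- \<gamma>) < 1" using powr_less_mono[of "- \<gamma>" 0 2] ga(2) by auto
  have wn2: "(\<Sum>a\<in>I. (wn a (S a) h)\<^sup>2) \<le> (\<Sum>k\<in>A. norm (freq k) * (cmod (h k))\<^sup>2)" for h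
  proof -
    have "(wn a (S a) h)\<^sup>2 \<le> (\<Sum>k\<in>S a. norm (freq k) * (cmod (h k))\<^sup>2)" for a
    proof -
      have "(2 powr (real a / 2))\<^sup>2 = (2::real) ^ a"
        using powr_powr[of "2::real" "real a / 2" 2] by (simp add: two_powr_nat)
      then have "(wn a (S a) h)\<^sup>2 = (\<Sum>k\<in>S a. 2 ^ a * (cmod (h k))\<^sup>2)"
        by (simp add: wn_def power_mult_distrib l2n_sq sum_distrib_left)
      also have "\<dots> \<le> (\<Sum>k\<in>S a. norm (freq k) * (cmod (h k))\<^sup>2)"
        using sh[of a] by (intro sum_mono mult_right_mono) (auto simp: shell_def)
      finally show ?thesis .
    qed
    then show ?thesis unfolding grp by (intro sum_mono)
  qed
  have "cmod (\<Sum>p\<in>{q<..P}. trisum A A (\<alpha> p) f g) \<le> (\<Sum>p\<in>{q<..P}. \<Sum>b\<in>I. \<Sum>c\<in>I. cmod (trisum (S b) (S c) (\<alpha> p) f g))"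
    unfolding tri by (intro order_trans[OF norm_sum] sum_mono) auto
  also have "\<dots> = (\<Sum>b\<in>I. \<Sum>c\<in>I. \<Sum>p\<in>{q<..P}. cmod (trisum (S b) (S c) (\<alpha> p) f g))"
    by (subst sum.swap) (intro sum.cong refl sum.swap)
  also have "\<dots> \<le> (\<Sum>b\<in>I. \<Sum>c\<in>I. 2304 * Bc * (wn c (S c) f * wn b (S b) g * (2 powr (- \<gamma>)) ^ ndist c b))"
    by (intro sum_mono level_bound sh qI)
  also have "\<dots> = 2304 * Bc * (\<Sum>b\<in>I. \<Sum>c\<in>I. wn c (S c) f * wn b (S b) g * (2 powr (- \<gamma>)) ^ ndist c b)"
    by (simp add: sum_distrib_left)
  also have "\<dots> \<le> 2304 * Bc * (1 / (1 - 2 powr (- \<gamma>)) * ((\<Sum>a\<in>I. (wn a (S a) f)\<^sup>2) + (\<Sum>b\<in>I. (wn b (S b) g)\<^sup>2)))"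
    using Bc by (intro mult_left_mono schur rho I) auto
  also have "\<dots> \<le> 2304 * Bc * (1 / (1 - 2 powr (- \<gamma>)) * ((\<Sum>k\<in>A. norm (freq k) * (cmod (f k))\<^sup>2) + (\<Sum>k\<in>A. norm (freq k) * (cmod (g k))\<^sup>2)))"
    using Bc rho by (intro mult_left_mono add_mono wn2) auto
  finally show ?thesis by simp
qed

end

section \<open>The commutator in the transport term\<close>

lemma inverse_sum_integral:
  fixes a :: real assumes "a > 0"
  shows "((\<lambda>t. exp (- a * t)) has_integral 1 / a) {0..}"
  using has_integral_exp_minus_to_infinity[OF assms, of 0] by simp

definition fk :: "int^3 \<Rightarrow> 3 \<Rightarrow> complex" where "fk k i = of_int (k $ i)"

text \<open>The difference of the squared norms factorises as the inner product of m - k and m + k.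
  The first factor becomes a derivative of the low modes, the second is absorbed by the norms in the
  denominator.\<close>

lemma inverse_norm_diff:
  assumes "k \<noteq> 0" "m \<noteq> (0::int^3)"
  shows "complex_of_real (1 / norm (freq k) - 1 / norm (freq m))
     = - (\<Sum>l\<in>UNIV. fk (k - m) l * (fk k l + fk m l)) / complex_of_real (norm (freq k) * norm (freq m) * (norm (freq k) + norm (freq m)))"
proof -
  have p: "norm (freq k) > 0" "norm (freq m) > 0" using assms by auto
  have e: "1 / norm (freq k) - 1 / norm (freq m)
     = ((norm (freq m))\<^sup>2 - (norm (freq k))\<^sup>2) / (norm (freq k) * norm (freq m) * (norm (freq k) + norm (freq m)))"
  proof -
    have "1 / norm (freq k) - 1 / norm (freq m) = (norm (freq m) - norm (freq k)) / (norm (freq k) * norm (freq m))"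
      using p by (simp add: diff_divide_eq_iff divide_diff_eq_iff)
    also have "\<dots> = ((norm (freq m) - norm (freq k)) * (norm (freq k) + norm (freq m))) / (norm (freq k) * norm (freq m) * (norm (freq k) + norm (freq m)))"
    proof -
      have "norm (freq k) + norm (freq m) \<noteq> 0" using p by linarith
      then show ?thesis by simp
    qed
    also have "(norm (freq m) - norm (freq k)) * (norm (freq k) + norm (freq m)) = (norm (freq m))\<^sup>2 - (norm (freq k))\<^sup>2"
      by (simp add: power2_eq_square algebra_simps)
    finally show ?thesis .
  qed
  have n: "(norm (freq k))\<^sup>2 = (\<Sum>l\<in>UNIV. real_of_int (k $ l) ^ 2)" for k
    by (simp only: power2_norm_eq_inner inner_vec_def) (simp add: power2_eq_square)
  have "(norm (freq m))\<^sup>2 - (norm (freq k))\<^sup>2 = (\<Sum>l\<in>UNIV. real_of_int (m $ l) ^ 2 - real_of_int (k $ l) ^ 2)"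
    unfolding n by (simp add: sum_subtractf)
  also have "\<dots> = - (\<Sum>l\<in>UNIV. real_of_int ((k - m) $ l) * (real_of_int (k $ l) + real_of_int (m $ l)))"
    unfolding sum_negf[symmetric] by (intro sum.cong) (auto simp: power2_eq_square algebra_simps)
  finally have "complex_of_real ((norm (freq m))\<^sup>2 - (norm (freq k))\<^sup>2) = - (\<Sum>l\<in>UNIV. fk (k - m) l * (fk k l + fk m l))"
    by (simp only: of_real_minus of_real_sum of_real_mult of_real_add of_real_of_int_eq fk_def)
  then show ?thesis unfolding e of_real_divide by simp
qed

lemma fk_diff: "fk (k - m) i = fk k i - fk m i" by (simp add: fk_def)
lemma cnj_fk [simp]: "cnj (fk k i) = fk k i" by (simp add: fk_def)
lemma cmod_fk_le: "cmod (fk k i) \<le> norm (freq k)"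
  using component_le_norm_cart[of "freq k" i] by (simp add: fk_def)

context fixes L :: real assumes L: "0 < L" begin

text \<open>\<open>1 / (\<bar>k\<bar> + \<bar>m\<bar>) = \<integral>\<^sub>0\<^sup>\<infinity> e\<^sup>-\<^sup>t\<^sup>\<bar>\<^sup>k\<^sup>\<bar> e\<^sup>-\<^sup>t\<^sup>\<bar>\<^sup>m\<^sup>\<bar> dt\<close> separates the variables.\<close>

lemma trisum_inverse_sum:
  assumes S: "S > 0" and H: "finite H" "\<And>n. n \<notin> H \<Longrightarrow> a n = 0" and F: "finite F" "0 \<notin> F"
    and a: "AE x in torus L. cmod (tp L H a x) \<le> S"
    and f: "\<And>k. k \<in> F \<Longrightarrow> cmod (f k) \<le> w k" and g: "\<And>k. k \<in> F \<Longrightarrow> cmod (g k) \<le> w k"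
  shows "cmod (\<Sum>k\<in>F. \<Sum>m\<in>F. a (k - m) * f m * g k / complex_of_real (norm (freq k) + norm (freq m)))
     \<le> S / 2 * (\<Sum>k\<in>F. (w k)\<^sup>2 / norm (freq k))"
proof -
  let ?e = "\<lambda>t k. exp (- norm (freq k) * t)"
  let ?h = "\<lambda>t. trisum F F a (\<lambda>m. f m * of_real (?e t m)) (\<lambda>k. g k * of_real (?e t k))"
  let ?b = "\<lambda>t. S * (\<Sum>k\<in>F. (w k)\<^sup>2 * exp (- (2 * norm (freq k)) * t))"
  have pos: "norm (freq k) > 0" if "k \<in> F" for k using F that by auto
  have I1: "(?h has_integral (\<Sum>k\<in>F. \<Sum>m\<in>F. a (k - m) * f m * g k / complex_of_real (norm (freq k) + norm (freq m)))) {0..}"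
    unfolding trisum_def
  proof (intro has_integral_sum F)
    fix k m assume km: "k \<in> F" "m \<in> F"
    have p: "norm (freq k) + norm (freq m) > 0" by (rule add_pos_pos[OF pos[OF km(1)] pos[OF km(2)]])
    have "((\<lambda>t. (a (k - m) * f m * g k) * of_real (exp (- (norm (freq k) + norm (freq m)) * t)))
       has_integral (a (k - m) * f m * g k) * of_real (1 / (norm (freq k) + norm (freq m)))) {0..}"
      by (intro has_integral_mult_right has_integral_of_real inverse_sum_integral p)
    note i1 = this
    have i2: "(a (k - m) * f m * g k) * of_real (exp (- (norm (freq k) + norm (freq m)) * t))
       = a (k - m) * (f m * of_real (?e t m)) * (g k * of_real (?e t k))" for t
    proof -
      have "exp (- (norm (freq k) + norm (freq m)) * t) = ?e t k * ?e t m"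
        by (simp add: algebra_simps flip: exp_add)
      then show ?thesis by (simp add: mult_ac)
    qed
    show "((\<lambda>t. a (k - m) * (f m * of_real (?e t m)) * (g k * of_real (?e t k)))
       has_integral a (k - m) * f m * g k / complex_of_real (norm (freq k) + norm (freq m))) {0..}"
      using i1 unfolding i2 by simp
  qed
  have I2: "(?b has_integral S * (\<Sum>k\<in>F. (w k)\<^sup>2 * (1 / (2 * norm (freq k))))) {0..}"
    by (intro has_integral_mult_right has_integral_sum F inverse_sum_integral) (use pos in auto)
  have "cmod (?h t) \<le> ?b t" for t
  proof -
    have w: "l2n F (\<lambda>k. h k * of_real (?e t k)) \<le> l2n F (\<lambda>k. of_real (w k * ?e t k))"
      if "\<And>k. k \<in> F \<Longrightarrow> cmod (h k) \<le> w k" for h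
    proof (rule l2n_mono)
      fix k assume k: "k \<in> F"
      then have "0 \<le> w k" using that[OF k] norm_ge_zero order_trans by blast
      then show "cmod (h k * of_real (?e t k)) \<le> cmod (of_real (w k * ?e t k))"
        using that[OF k] by (simp add: norm_mult mult_right_mono)
    qed
    have "cmod (?h t) \<le> S * l2n F (\<lambda>k. f k * of_real (?e t k)) * l2n F (\<lambda>k. g k * of_real (?e t k))"
      by (rule trisum_sup[OF L S _ _ F(1) F(1) a]) (fact H)+
    also have "\<dots> \<le> S * l2n F (\<lambda>k. of_real (w k * ?e t k)) * l2n F (\<lambda>k. of_real (w k * ?e t k))"
      using S w f g by (intro mult_mono) auto
    also have "\<dots> = S * (l2n F (\<lambda>k. of_real (w k * ?e t k)))\<^sup>2" by (simp add: power2_eq_square)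
    also have "\<dots> = ?b t"
    proof -
      have "(cmod (of_real (w k * ?e t k)))\<^sup>2 = (w k)\<^sup>2 * exp (- (2 * norm (freq k)) * t)" for k
      proof -
        have "(?e t k)\<^sup>2 = exp (- (2 * norm (freq k)) * t)" by (simp add: power2_eq_square flip: exp_add)
        then show ?thesis by (simp only: norm_of_real power2_abs power_mult_distrib)
      qed
      then show ?thesis unfolding l2n_sq by simp
    qed
    finally show ?thesis .
  qed
  then have "cmod (integral {0..} ?h) \<le> integral {0..} ?b"
    by (intro integral_norm_bound_integral has_integral_integrable[OF I1] has_integral_integrable[OF I2]) auto
  then have "cmod (\<Sum>k\<in>F. \<Sum>m\<in>F. a (k - m) * f m * g k / complex_of_real (norm (freq k) + norm (freq m)))
     \<le> S * (\<Sum>k\<in>F. (w k)\<^sup>2 * (1 / (2 * norm (freq k))))"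
    by (simp only: integral_unique[OF I1] integral_unique[OF I2])
  also have "\<dots> = S / 2 * (\<Sum>k\<in>F. (w k)\<^sup>2 / norm (freq k))"
    by (simp add: sum_distrib_left mult_ac)
  finally show ?thesis .
qed

text \<open>The transport term is antisymmetric and \<open>\<bar>k\<bar>\<^sup>-\<^sup>1\<close> symmetric, so only their commutator survives
  in the imaginary part; it moves one derivative onto \<open>U\<close>.\<close>

lemma commutator_estimate:
  assumes S: "S > 0" and H: "finite H" "\<And>i n. n \<notin> H \<Longrightarrow> U i n = 0" and F: "finite F" "0 \<notin> F"
    and div: "\<And>n. (\<Sum>i\<in>UNIV. fk n i * U i n) = 0"
    and re: "\<And>i n. cnj (U i n) = U i (- n)"
    and gr: "\<And>i l. AE x in torus L. cmod (tp L H (\<lambda>n. fk n l * U i n) x) \<le> S"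
  shows "\<bar>Im (\<Sum>i\<in>UNIV. trisum F F (U i) W (\<lambda>k. fk k i * cnj (W k) / norm (freq k)))\<bar>
     \<le> 9 / 2 * S * (\<Sum>k\<in>F. (cmod (W k))\<^sup>2 / norm (freq k))"
proof -
  define b where "b k m = (\<Sum>i\<in>UNIV. U i (k - m) * fk k i)" for k m
  \<comment> \<open>Freedom from divergence allows \<open>k\<close> to be replaced by
    \<open>m\<close> in the symbol, and reality of \<open>U\<close> then makes the symbol Hermitian;
    this is the antisymmetry of transport, whose operator carries a further factor i.\<close>
  have b2: "b k m = (\<Sum>i\<in>UNIV. U i (k - m) * fk m i)" for k m
    using div[of "k - m"] by (simp add: b_def fk_diff left_diff_distrib right_diff_distrib sum_subtractf mult.commute)
  have b3: "cnj (b m k) = b k m" for k m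
    unfolding b2[of m k] by (simp add: b_def re cnj_sum)
  define X where "X = (\<Sum>k\<in>F. \<Sum>m\<in>F. b k m * of_real (1 / norm (freq k)) * (cnj (W k) * W m))"
  have X: "(\<Sum>i\<in>UNIV. trisum F F (U i) W (\<lambda>k. fk k i * cnj (W k) / norm (freq k))) = X"
  proof -
    have "(\<Sum>i\<in>UNIV. trisum F F (U i) W (\<lambda>k. fk k i * cnj (W k) / norm (freq k)))
      = (\<Sum>k\<in>F. \<Sum>m\<in>F. \<Sum>i\<in>UNIV. U i (k - m) * W m * (fk k i * cnj (W k) / norm (freq k)))"
      unfolding trisum_def by (subst sum.swap) (intro sum.cong refl sum.swap)
    also have "\<dots> = X"
      unfolding X_def b_def sum_distrib_right by (intro sum.cong refl) (simp add: mult_ac)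
    finally show ?thesis .
  qed
  have "cnj X = (\<Sum>k\<in>F. \<Sum>m\<in>F. cnj (b k m) * of_real (1 / norm (freq k)) * (W k * cnj (W m)))"
    by (simp add: X_def cnj_sum)
  also have "\<dots> = (\<Sum>k\<in>F. \<Sum>m\<in>F. b k m * of_real (1 / norm (freq m)) * (cnj (W k) * W m))"
    by (subst sum.swap) (simp add: b3 mult_ac)
  finally have "X - cnj X = (\<Sum>k\<in>F. \<Sum>m\<in>F. b k m * of_real (1 / norm (freq k) - 1 / norm (freq m)) * (cnj (W k) * W m))"
    by (simp add: X_def sum_subtractf[symmetric] left_diff_distrib right_diff_distrib)
  also have "\<dots> = - (\<Sum>i\<in>UNIV. \<Sum>l\<in>UNIV.
      (\<Sum>k\<in>F. \<Sum>m\<in>F. (fk (k - m) l * U i (k - m)) * (fk m i / norm (freq m) * W m) * (fk k l / norm (freq k) * cnj (W k)) / complex_of_real (norm (freq k) + norm (freq m))) +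
      (\<Sum>k\<in>F. \<Sum>m\<in>F. (fk (k - m) l * U i (k - m)) * (fk m l / norm (freq m) * W m) * (fk k i / norm (freq k) * cnj (W k)) / complex_of_real (norm (freq k) + norm (freq m))))"
    (is "_ = - (\<Sum>i\<in>UNIV. \<Sum>l\<in>UNIV. (\<Sum>k\<in>F. \<Sum>m\<in>F. ?A i l k m) + (\<Sum>k\<in>F. \<Sum>m\<in>F. ?B i l k m))")
  proof -
    have t: "b k m * of_real (1 / norm (freq k) - 1 / norm (freq m)) * (cnj (W k) * W m)
      = - (\<Sum>i\<in>UNIV. \<Sum>l\<in>UNIV. ?A i l k m + ?B i l k m)" if km: "k \<in> F" "m \<in> F" for k m
    proof -
      have kn: "k \<noteq> 0" "m \<noteq> 0" using km F by auto
      define z where "z = cnj (W k) * W m / complex_of_real (norm (freq k) * norm (freq m) * (norm (freq k) + norm (freq m)))"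
      have "b k m * of_real (1 / norm (freq k) - 1 / norm (freq m)) * (cnj (W k) * W m)
        = - (\<Sum>l\<in>UNIV. b k m * fk (k - m) l * (fk k l + fk m l) * z)"
        unfolding inverse_norm_diff[OF kn] z_def by (simp add: sum_distrib_left sum_distrib_right sum_divide_distrib mult_ac)
      also have "(\<Sum>l\<in>UNIV. b k m * fk (k - m) l * (fk k l + fk m l) * z)
        = (\<Sum>l\<in>UNIV. (\<Sum>i\<in>UNIV. U i (k - m) * fk m i) * (fk (k - m) l * fk k l * z) + (\<Sum>i\<in>UNIV. U i (k - m) * fk k i) * (fk (k - m) l * fk m l * z))"
        unfolding b2[symmetric] b_def[symmetric] by (intro sum.cong refl) (simp add: algebra_simps)
      also have "\<dots> = (\<Sum>l\<in>UNIV. \<Sum>i\<in>UNIV. ?A i l k m + ?B i l k m)"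
        unfolding sum_distrib_right sum.distrib[symmetric] z_def by (intro sum.cong refl) (simp add: mult_ac)
      also have "\<dots> = (\<Sum>i\<in>UNIV. \<Sum>l\<in>UNIV. ?A i l k m + ?B i l k m)" by (rule sum.swap)
      finally show ?thesis .
    qed
    have "(\<Sum>k\<in>F. \<Sum>m\<in>F. b k m * of_real (1 / norm (freq k) - 1 / norm (freq m)) * (cnj (W k) * W m))
      = - (\<Sum>k\<in>F. \<Sum>m\<in>F. \<Sum>i\<in>UNIV. \<Sum>l\<in>UNIV. ?A i l k m + ?B i l k m)"
      unfolding sum_negf[symmetric] by (intro sum.cong refl) (simp only: t sum_negf)
    also have "(\<Sum>k\<in>F. \<Sum>m\<in>F. \<Sum>i\<in>UNIV. \<Sum>l\<in>UNIV. ?A i l k m + ?B i l k m)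
      = (\<Sum>i\<in>UNIV. \<Sum>k\<in>F. \<Sum>m\<in>F. \<Sum>l\<in>UNIV. ?A i l k m + ?B i l k m)"
      by (subst (2) sum.swap) (subst sum.swap, rule refl)
    also have "\<dots> = (\<Sum>i\<in>UNIV. \<Sum>l\<in>UNIV. \<Sum>k\<in>F. \<Sum>m\<in>F. ?A i l k m + ?B i l k m)"
      by (intro sum.cong refl, subst (2) sum.swap) (subst sum.swap, rule refl)
    finally show ?thesis by (simp only: sum.distrib)
  qed
  finally have XX: "X - cnj X = - (\<Sum>i\<in>UNIV. \<Sum>l\<in>UNIV. (\<Sum>k\<in>F. \<Sum>m\<in>F. ?A i l k m) + (\<Sum>k\<in>F. \<Sum>m\<in>F. ?B i l k m))" .
  have quot: "cmod (fk k i / norm (freq k) * z) \<le> cmod z" for k i z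
  proof -
    have "cmod (fk k i / norm (freq k)) \<le> 1" using cmod_fk_le[of k i] by (simp add: norm_divide divide_le_eq)
    then show ?thesis unfolding norm_mult by (intro mult_left_le_one_le) auto
  qed
  let ?E = "S / 2 * (\<Sum>k\<in>F. (cmod (W k))\<^sup>2 / norm (freq k))"
  have A: "cmod (\<Sum>k\<in>F. \<Sum>m\<in>F. (fk (k - m) l * U i (k - m)) * (fk m i' / norm (freq m) * W m) * (fk k l' / norm (freq k) * cnj (W k)) / complex_of_real (norm (freq k) + norm (freq m))) \<le> ?E" for i l i' l'
    by (rule trisum_inverse_sum[OF S H(1) _ F gr]) (use H(2) quot[of _ _ "W _"] quot[of _ _ "cnj (W _)"] in auto)
  \<comment> \<open>Nine index pairs with two sums each, every sum costing \<open>S / 2\<close>,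
    give \<open>9 * S\<close> for twice the imaginary part.\<close>
  have "cmod (X - cnj X) \<le> (\<Sum>i\<in>(UNIV::3 set). \<Sum>l\<in>(UNIV::3 set). ?E + ?E)"
    unfolding XX norm_minus_cancel by (intro order_trans[OF norm_sum] sum_mono order_trans[OF norm_triangle_ineq] add_mono A)
  also have "\<dots> = 9 * S * (\<Sum>k\<in>F. (cmod (W k))\<^sup>2 / norm (freq k))" by simp
  finally have "2 * \<bar>Im X\<bar> \<le> 9 * S * (\<Sum>k\<in>F. (cmod (W k))\<^sup>2 / norm (freq k))"
    by (simp add: complex_diff_cnj norm_mult)
  then show ?thesis unfolding X by simp
qed

end

section \<open>The error made by cutting off the frequencies\<close>

lemma schur_convolution:
  fixes x y :: "int^3 \<Rightarrow> real" and u :: "int^3 \<Rightarrow> real"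
  assumes F: "finite F" "finite G" "finite H" and u: "\<And>n. 0 \<le> u n" "\<And>n. n \<notin> H \<Longrightarrow> u n = 0"
  shows "(\<Sum>k\<in>F. \<Sum>m\<in>G. u (k - m) * x m * y k) \<le> (\<Sum>n\<in>H. u n) * sqrt (\<Sum>m\<in>G. (x m)\<^sup>2) * sqrt (\<Sum>k\<in>F. (y k)\<^sup>2)"
proof -
  let ?T = "F \<times> G"
  have s: "(\<Sum>k\<in>F. \<Sum>m\<in>G. h k m) = (\<Sum>z\<in>?T. h (fst z) (snd z))" for h :: "int^3 \<Rightarrow> int^3 \<Rightarrow> real"
    by (simp add: sum.cartesian_product case_prod_beta)
  have sub: "(\<Sum>n\<in>h ` C. u n) \<le> (\<Sum>n\<in>H. u n)" if "finite C" for h and C :: "(int^3) set"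
  proof -
    have "(\<Sum>n\<in>h ` C. u n) = (\<Sum>n\<in>h ` C \<inter> H. u n)" using u that by (intro sum.mono_neutral_right) auto
    also have "\<dots> \<le> (\<Sum>n\<in>H. u n)" using u F by (intro sum_mono2) auto
    finally show ?thesis .
  qed
  have c1: "(\<Sum>k\<in>F. \<Sum>m\<in>G. u (k - m) * (x m)\<^sup>2) \<le> (\<Sum>n\<in>H. u n) * (\<Sum>m\<in>G. (x m)\<^sup>2)"
  proof -
    have "(\<Sum>k\<in>F. \<Sum>m\<in>G. u (k - m) * (x m)\<^sup>2) = (\<Sum>m\<in>G. (\<Sum>k\<in>F. u (k - m)) * (x m)\<^sup>2)"
      by (subst sum.swap) (simp add: sum_distrib_right)
    also have "\<dots> \<le> (\<Sum>m\<in>G. (\<Sum>n\<in>H. u n) * (x m)\<^sup>2)"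
    proof (intro sum_mono mult_right_mono)
      fix m
      have "(\<Sum>k\<in>F. u (k - m)) = (\<Sum>n\<in>(\<lambda>k. k - m) ` F. u n)" by (subst sum.reindex) (auto simp: inj_on_def)
      then show "(\<Sum>k\<in>F. u (k - m)) \<le> (\<Sum>n\<in>H. u n)" using sub[OF F(1)] by simp
    qed simp
    finally show ?thesis by (simp add: sum_distrib_left)
  qed
  have c2: "(\<Sum>k\<in>F. \<Sum>m\<in>G. u (k - m) * (y k)\<^sup>2) \<le> (\<Sum>n\<in>H. u n) * (\<Sum>k\<in>F. (y k)\<^sup>2)"
  proof -
    have "(\<Sum>k\<in>F. \<Sum>m\<in>G. u (k - m) * (y k)\<^sup>2) = (\<Sum>k\<in>F. (\<Sum>m\<in>G. u (k - m)) * (y k)\<^sup>2)"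
      by (simp add: sum_distrib_right)
    also have "\<dots> \<le> (\<Sum>k\<in>F. (\<Sum>n\<in>H. u n) * (y k)\<^sup>2)"
    proof (intro sum_mono mult_right_mono)
      fix k
      have "(\<Sum>m\<in>G. u (k - m)) = (\<Sum>n\<in>(\<lambda>m. k - m) ` G. u n)" by (subst sum.reindex) (auto simp: inj_on_def)
      then show "(\<Sum>m\<in>G. u (k - m)) \<le> (\<Sum>n\<in>H. u n)" using sub[OF F(2)] by simp
    qed simp
    finally show ?thesis by (simp add: sum_distrib_left)
  qed
  have un: "0 \<le> (\<Sum>n\<in>H. u n)" using u by (simp add: sum_nonneg)
  \<comment> \<open>Cauchy-Schwarz over all pairs, with the kernel split into two square roots: the
    usual proof of Young's inequality for convolutions.\<close>
  have "(\<Sum>k\<in>F. \<Sum>m\<in>G. u (k - m) * x m * y k)\<^sup>2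
     = (\<Sum>z\<in>?T. (sqrt (u (fst z - snd z)) * x (snd z)) * (sqrt (u (fst z - snd z)) * y (fst z)))\<^sup>2"
  proof -
    have "(sqrt c * x') * (sqrt c * y') = c * x' * y'" if "0 \<le> c" for c x' y' :: real
    proof -
      have "(sqrt c * x') * (sqrt c * y') = (sqrt c * sqrt c) * x' * y'" by (simp only: mult_ac)
      then show ?thesis using that by simp
    qed
    then show ?thesis unfolding s by (simp only: u)
  qed
  also have "\<dots> \<le> (\<Sum>z\<in>?T. (sqrt (u (fst z - snd z)) * x (snd z))\<^sup>2) * (\<Sum>z\<in>?T. (sqrt (u (fst z - snd z)) * y (fst z))\<^sup>2)"
    by (rule Cauchy_Schwarz_ineq_sum)
  also have "\<dots> = (\<Sum>k\<in>F. \<Sum>m\<in>G. u (k - m) * (x m)\<^sup>2) * (\<Sum>k\<in>F. \<Sum>m\<in>G. u (k - m) * (y k)\<^sup>2)"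
    unfolding s by (simp add: power_mult_distrib u)
  also have "\<dots> \<le> ((\<Sum>n\<in>H. u n) * (\<Sum>m\<in>G. (x m)\<^sup>2)) * ((\<Sum>n\<in>H. u n) * (\<Sum>k\<in>F. (y k)\<^sup>2))"
    using un u by (intro mult_mono c1 c2) (auto intro!: sum_nonneg mult_nonneg_nonneg)
  also have "\<dots> = ((\<Sum>n\<in>H. u n) * sqrt (\<Sum>m\<in>G. (x m)\<^sup>2) * sqrt (\<Sum>k\<in>F. (y k)\<^sup>2))\<^sup>2"
  proof -
    have "(sqrt (\<Sum>m\<in>G. (x m)\<^sup>2))\<^sup>2 = (\<Sum>m\<in>G. (x m)\<^sup>2)" "(sqrt (\<Sum>k\<in>F. (y k)\<^sup>2))\<^sup>2 = (\<Sum>k\<in>F. (y k)\<^sup>2)"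
      by (auto intro!: real_sqrt_pow2 sum_nonneg)
    then show ?thesis unfolding power_mult_distrib by (simp only: power2_eq_square mult_ac)
  qed
  finally show ?thesis
    by (rule power2_le_imp_le) (use un in \<open>auto intro!: mult_nonneg_nonneg sum_nonneg\<close>)
qed

text \<open>In dimension three the shell of level \<open>a\<close> has at most 125 * 8^a points,
  each of weight at most 4^(-a); the shells then sum geometrically to at most 125 * 4 * 2^q.\<close>

lemma sum_inverse_square:
  "(\<Sum>n | n \<noteq> 0 \<and> norm (freq n) \<le> 2 * 2 ^ q. 1 / (norm (freq n))\<^sup>2) \<le> 500 * 2 ^ q"
proof -
  let ?A = "{n::int^3. n \<noteq> 0 \<and> norm (freq n) \<le> 2 * 2 ^ q}"
  have fin: "finite ?A" by (rule finite_subset[OF _ finite_freq_ball[of "2 * 2 ^ q"]]) auto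
  have sub: "lev ` ?A \<subseteq> {..Suc q}"
  proof
    fix a assume "a \<in> lev ` ?A"
    then obtain n where n: "n \<noteq> 0" "norm (freq n) \<le> 2 * 2 ^ q" "a = lev n" by auto
    then have "(2::real) ^ a \<le> 2 ^ Suc q" using lev_bounds(1)[OF n(1)] by simp
    then show "a \<in> {..Suc q}" by (simp only: power_increasing_iff one_less_numeral_iff semiring_norm atMost_iff)
  qed
  have "(\<Sum>n\<in>?A. 1 / (norm (freq n))\<^sup>2) = (\<Sum>a\<in>{..Suc q}. \<Sum>n\<in>{n\<in>?A. lev n = a}. 1 / (norm (freq n))\<^sup>2)"
    by (rule sum.group[symmetric, OF fin _ sub]) simp
  also have "\<dots> \<le> (\<Sum>a\<in>{..Suc q}. 125 * 2 ^ a)"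
  proof (rule sum_mono)
    fix a
    let ?B = "{n\<in>?A. lev n = a}"
    have "(\<Sum>n\<in>?B. 1 / (norm (freq n))\<^sup>2) \<le> (\<Sum>n\<in>?B. 1 / (2 ^ a)\<^sup>2)"
    proof (intro sum_mono divide_left_mono power_mono)
      fix n assume n: "n \<in> ?B"
      then show "2 ^ a \<le> norm (freq n)" using lev_bounds(1)[of n] by auto
      show "0 < (norm (freq n))\<^sup>2 * (2 ^ a)\<^sup>2" using n by auto
    qed auto
    also have "\<dots> = real (card ?B) * (1 / (2 ^ a)\<^sup>2)" by simp
    also have "\<dots> \<le> (5 * 2 ^ a)^3 * (1 / (2 ^ a)\<^sup>2)"
    proof (rule mult_right_mono)
      have "real (card ?B) \<le> real (card {k::int^3. norm (freq k) \<le> 2 * 2 ^ a})"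
        using lev_bounds(2) by (intro of_nat_mono card_mono) (auto intro: less_imp_le)
      also have "\<dots> \<le> (2 * (2 * 2 ^ a) + 1)^3" by (rule card_freq_ball) simp
      also have "\<dots> \<le> (5 * 2 ^ a)^3" by (intro power_mono) auto
      finally show "real (card ?B) \<le> (5 * 2 ^ a)^3" .
    qed simp
    also have "\<dots> = 125 * 2 ^ a" by (simp add: power2_eq_square power3_eq_cube)
    finally show "(\<Sum>n\<in>?B. 1 / (norm (freq n))\<^sup>2) \<le> 125 * 2 ^ a" .
  qed
  also have "\<dots> = 125 * (\<Sum>a\<in>{..Suc q}. 2 ^ a)" by (simp add: sum_distrib_left)
  also have "(\<Sum>a\<in>{..Suc q}. (2::real) ^ a) \<le> 4 * 2 ^ q"
    using geometric_sum[of "2::real" "Suc (Suc q)"] by (simp add: lessThan_Suc_atMost)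
  finally show ?thesis by simp
qed

text \<open>Pairs with \<open>k\<close> inside the cutoff and \<open>m\<close> outside have no
  antisymmetric partner. The absolute sum of \<open>U\<close> is at most
  \<open>25 * sqrt (2 ^ q) * h\<close> by Cauchy-Schwarz against |n|^(-2). Its growth in
  \<open>q\<close> is cancelled because both |k| and 2^q are at most |m|, so the bound does not
  depend on \<open>q\<close> and is small once the tail of \<open>f\<close> is.\<close>

lemma cross_estimate:
  assumes F: "finite F" "finite G"
    and kF: "\<And>k. k \<in> F \<Longrightarrow> k \<noteq> 0 \<and> norm (freq k) \<le> N" and mG: "\<And>m. m \<in> G \<Longrightarrow> N < norm (freq m) \<and> 2 ^ q \<le> norm (freq m)"
    and U: "\<And>n. 2 * 2 ^ q < norm (freq n) \<Longrightarrow> U n = 0" "U 0 = 0"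
    and h: "(\<Sum>n | norm (freq n) \<le> 2 * 2 ^ q. (norm (freq n))\<^sup>2 * (cmod (U n))\<^sup>2) \<le> h\<^sup>2" "0 \<le> h"
  shows "cmod (trisum F G U f g) \<le> 25 * h * sqrt (\<Sum>m\<in>G. (norm (freq m))\<^sup>2 * (cmod (f m))\<^sup>2) * sqrt (\<Sum>k\<in>F. (cmod (g k))\<^sup>2 / norm (freq k))"
proof -
  let ?H = "{n::int^3. norm (freq n) \<le> 2 * 2 ^ q}" and ?A = "{n::int^3. n \<noteq> 0 \<and> norm (freq n) \<le> 2 * 2 ^ q}"
  have fin: "finite ?A" by (rule finite_subset[OF _ finite_freq_ball[of "2 * 2 ^ q"]]) auto
  have sumU: "(\<Sum>n\<in>?H. cmod (U n)) \<le> 25 * sqrt (2 ^ q) * h"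
  proof -
    have "(\<Sum>n\<in>?H. cmod (U n)) = (\<Sum>n\<in>?A. (1 / norm (freq n)) * (norm (freq n) * cmod (U n)))"
      using U(2) by (intro sum.mono_neutral_cong_right) auto
    also have "\<dots> \<le> sqrt ((\<Sum>n\<in>?A. (1 / norm (freq n))\<^sup>2) * (\<Sum>n\<in>?A. (norm (freq n) * cmod (U n))\<^sup>2))"
      by (rule real_le_rsqrt[OF Cauchy_Schwarz_ineq_sum])
    also have "\<dots> \<le> sqrt ((500 * 2 ^ q) * h\<^sup>2)"
    proof (intro real_sqrt_le_mono mult_mono)
      show "(\<Sum>n\<in>?A. (1 / norm (freq n))\<^sup>2) \<le> 500 * 2 ^ q"
        using sum_inverse_square[of q] by (simp add: power_divide)
      have "(\<Sum>n\<in>?A. (norm (freq n) * cmod (U n))\<^sup>2) \<le> (\<Sum>n\<in>?H. (norm (freq n))\<^sup>2 * (cmod (U n))\<^sup>2)"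
        unfolding power_mult_distrib by (rule sum_mono2) auto
      then show "(\<Sum>n\<in>?A. (norm (freq n) * cmod (U n))\<^sup>2) \<le> h\<^sup>2" using h by simp
    qed (auto intro!: sum_nonneg)
    also have "\<dots> = sqrt 500 * sqrt (2 ^ q) * h" using h by (simp add: real_sqrt_mult)
    also have "\<dots> \<le> 25 * sqrt (2 ^ q) * h"
      using h by (intro mult_right_mono real_le_lsqrt) auto
    finally show ?thesis .
  qed
  let ?x = "\<lambda>m. norm (freq m) * cmod (f m)" and ?y = "\<lambda>k. cmod (g k) / sqrt (norm (freq k))"
  have trm: "cmod (U (k - m) * f m * g k) \<le> 1 / sqrt (2 ^ q) * (cmod (U (k - m)) * ?x m * ?y k)" if k: "k \<in> F" and m: "m \<in> G" for k m
  proof -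
    have mp: "0 < norm (freq m)" using mG[OF m] by (smt (verit) zero_less_power)
    have kp: "0 < norm (freq k)" using kF[OF k] by simp
    have "sqrt (norm (freq k)) * sqrt (2 ^ q) \<le> sqrt (norm (freq m)) * sqrt (norm (freq m))"
      using kF[OF k] mG[OF m] by (intro mult_mono real_sqrt_le_mono) auto
    then have "sqrt (norm (freq k)) * sqrt (2 ^ q) \<le> norm (freq m)" by simp
    then have "1 \<le> 1 / sqrt (2 ^ q) * (norm (freq m) / sqrt (norm (freq k)))"
      using kp by (simp add: field_simps)
    then have "cmod (U (k - m)) * cmod (f m) * cmod (g k) * 1 \<le> cmod (U (k - m)) * cmod (f m) * cmod (g k) * (1 / sqrt (2 ^ q) * (norm (freq m) / sqrt (norm (freq k))))"
      by (intro mult_left_mono) auto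
    then show ?thesis by (simp add: norm_mult mult_ac)
  qed
  have "cmod (trisum F G U f g) \<le> (\<Sum>k\<in>F. \<Sum>m\<in>G. cmod (U (k - m) * f m * g k))"
    unfolding trisum_def by (intro order_trans[OF norm_sum] sum_mono order_refl norm_sum)
  also have "\<dots> \<le> (\<Sum>k\<in>F. \<Sum>m\<in>G. 1 / sqrt (2 ^ q) * (cmod (U (k - m)) * ?x m * ?y k))"
    by (intro sum_mono trm)
  also have "\<dots> = 1 / sqrt (2 ^ q) * (\<Sum>k\<in>F. \<Sum>m\<in>G. cmod (U (k - m)) * ?x m * ?y k)"
    by (simp add: sum_distrib_left)
  also have "\<dots> \<le> 1 / sqrt (2 ^ q) * ((\<Sum>n\<in>?H. cmod (U n)) * sqrt (\<Sum>m\<in>G. (?x m)\<^sup>2) * sqrt (\<Sum>k\<in>F. (?y k)\<^sup>2))"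
    using U by (intro mult_left_mono schur_convolution F) auto
  also have "\<dots> \<le> 1 / sqrt (2 ^ q) * ((25 * sqrt (2 ^ q) * h) * sqrt (\<Sum>m\<in>G. (?x m)\<^sup>2) * sqrt (\<Sum>k\<in>F. (?y k)\<^sup>2))"
    by (intro mult_left_mono mult_right_mono sumU) (auto intro!: sum_nonneg)
  also have "\<dots> = 25 * h * sqrt (\<Sum>m\<in>G. (norm (freq m))\<^sup>2 * (cmod (f m))\<^sup>2) * sqrt (\<Sum>k\<in>F. (cmod (g k))\<^sup>2 / norm (freq k))"
    by (simp add: power_mult_distrib power_divide)
  finally show ?thesis .
qed

section \<open>Weak derivatives in time\<close>

text \<open>The chain rule for the square of an absolutely continuous function, by Fubini: the
  integral of g(s) g(r) over the triangle s <= r is computed in both orders.\<close>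

lemma square_of_integral:
  fixes g \<alpha> :: "real \<Rightarrow> real"
  assumes ab: "a \<le> b" and g: "set_integrable lborel {a..b} g"
    and \<alpha>: "\<And>t. a \<le> t \<Longrightarrow> t \<le> b \<Longrightarrow> \<alpha> t - \<alpha> a = (LBINT s:{a..t}. g s)"
  shows "(\<alpha> b)\<^sup>2 - (\<alpha> a)\<^sup>2 = (LBINT t:{a..b}. 2 * (\<alpha> t * g t))" "set_integrable lborel {a..b} (\<lambda>t. \<alpha> t * g t)"
proof -
  define G where "G t = indicator {a..b} t * g t" for t
  have G: "integrable lborel G" using g by (simp add: set_integrable_def G_def[abs_def])
  have [measurable]: "G \<in> borel_measurable borel" using borel_measurable_integrable[OF G] by simp
  define f where "f s r = (if s \<le> r then G s * G r else 0)" for s r :: real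
  have fb: "norm (f s r) \<le> norm (G s) * norm (G r)" for s r by (simp add: f_def abs_mult)
  have m: "(\<lambda>(s, r). f s r) \<in> borel_measurable (lborel \<Otimes>\<^sub>M lborel)"
    unfolding f_def by measurable
  have int: "integrable (lborel \<Otimes>\<^sub>M lborel) (\<lambda>(s, r). f s r)"
  proof (rule lborel_pair.Fubini_integrable[OF m])
    have fi: "integrable lborel (\<lambda>r. f s r)" for s
      by (rule Bochner_Integration.integrable_bound[where f="\<lambda>r. norm (G s) * norm (G r)"])
        (use G fb in \<open>auto simp: f_def\<close>)
    then show "AE s in lborel. integrable lborel (\<lambda>r. (case (s, r) of (s, r) \<Rightarrow> f s r))" by simp
    show "integrable lborel (\<lambda>s. LBINT r. norm (case (s, r) of (s, r) \<Rightarrow> f s r))"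
    proof (rule Bochner_Integration.integrable_bound[where f="\<lambda>s. norm (G s) * (LBINT r. norm (G r))"])
      show "integrable lborel (\<lambda>s. norm (G s) * (LBINT r. norm (G r)))" using G by simp
      show "(\<lambda>s. LBINT r. norm (case (s, r) of (s, r) \<Rightarrow> f s r)) \<in> borel_measurable lborel"
        using m by measurable
      show "AE s in lborel. norm (LBINT r. norm (case (s, r) of (s, r) \<Rightarrow> f s r)) \<le> norm (norm (G s) * (LBINT r. norm (G r)))"
      proof (rule AE_I2)
        fix s
        have "(LBINT r. norm (f s r)) \<le> (LBINT r. norm (G s) * norm (G r))"
          by (rule integral_mono) (use fi G fb in auto)
        then show "norm (LBINT r. norm (case (s, r) of (s, r) \<Rightarrow> f s r)) \<le> norm (norm (G s) * (LBINT r. norm (G r)))"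
          by (simp add: abs_mult)
      qed
    qed
  qed
  have F: "(LBINT r. LBINT s. f s r) = (LBINT s. LBINT r. f s r)"
    by (rule lborel_pair.Fubini_integral[OF int])
  have inner1: "(LBINT s. f s r) = G r * (\<alpha> r - \<alpha> a)" for r
  proof (cases "r \<in> {a..b}")
    case True
    have "(LBINT s. f s r) = (LBINT s. G r * (indicator {a..r} s *\<^sub>R g s))"
      using True by (intro Bochner_Integration.integral_cong) (auto simp: f_def G_def indicator_def)
    also have "\<dots> = G r * (LBINT s:{a..r}. g s)" by (simp add: set_lebesgue_integral_def)
    finally show ?thesis using \<alpha>[of r] True by simp
  next
    case False
    then have z: "G r = 0" by (simp add: G_def)
    then have "f s r = 0" for s by (simp add: f_def)
    then show ?thesis by (simp add: z)
  qed
  have Gint: "(LBINT r. G r) = \<alpha> b - \<alpha> a"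
    using \<alpha>[of b] ab by (simp add: set_lebesgue_integral_def G_def)
  have inner2: "(LBINT r. f s r) = G s * (\<alpha> b - \<alpha> s)" for s
  proof (cases "s \<in> {a..b}")
    case True
    have i1: "integrable lborel (\<lambda>r. indicator {a..s} r *\<^sub>R g r)"
      using set_integrable_subset[OF g, of "{a..s}"] True by (simp add: set_integrable_def)
    \<comment> \<open>The two integrands below differ on the diagonal, hence the exclusion of a
      single point.\<close>
    have "AE r in lborel. r \<noteq> s" by (rule AE_lborel_singleton)
    then have "(LBINT r. f s r) = (LBINT r. G s * (G r - indicator {a..s} r *\<^sub>R g r))"
    proof (intro integral_cong_AE)
      assume "AE r in lborel. r \<noteq> s"
      then show "AE r in lborel. f s r = G s * (G r - indicator {a..s} r *\<^sub>R g r)"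
        by eventually_elim (use True in \<open>auto simp: f_def G_def indicator_def\<close>)
    qed (use i1 in \<open>auto simp: f_def dest: borel_measurable_integrable\<close>)
    also have "\<dots> = G s * ((LBINT r. G r) - (LBINT r:{a..s}. g r))"
      using i1 G by (simp add: set_lebesgue_integral_def)
    finally show ?thesis using \<alpha>[of s] True Gint by simp
  next
    case False
    then have z: "G s = 0" by (simp add: G_def)
    then have "f s r = 0" for r by (simp add: f_def)
    then show ?thesis by (simp add: z)
  qed
  have I1: "integrable lborel (\<lambda>r. G r * (\<alpha> r - \<alpha> a))"
    using lborel_pair.integrable_snd[OF int] inner1 by simp
  have "integrable lborel (\<lambda>r. G r * (\<alpha> r - \<alpha> a) + G r * \<alpha> a)" using I1 G by simp
  then have I: "integrable lborel (\<lambda>r. G r * \<alpha> r)" by (simp add: algebra_simps)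
  then show "set_integrable lborel {a..b} (\<lambda>t. \<alpha> t * g t)"
    by (simp add: set_integrable_def G_def mult_ac)
  have "(LBINT r. G r * \<alpha> r) - (\<alpha> b - \<alpha> a) * \<alpha> a = (\<alpha> b - \<alpha> a) * \<alpha> b - (LBINT r. G r * \<alpha> r)"
  proof -
    have "(LBINT r. G r * (\<alpha> r - \<alpha> a)) = (LBINT r. G r * \<alpha> r) - (\<alpha> b - \<alpha> a) * \<alpha> a"
      using I G Gint by (simp add: right_diff_distrib)
    moreover have "(LBINT r. G r * (\<alpha> b - \<alpha> r)) = (\<alpha> b - \<alpha> a) * \<alpha> b - (LBINT r. G r * \<alpha> r)"
      using I G Gint by (simp add: right_diff_distrib)
    ultimately show ?thesis using F inner1 inner2 by simp
  qed
  then have "2 * (LBINT r. G r * \<alpha> r) = (\<alpha> b)\<^sup>2 - (\<alpha> a)\<^sup>2" by (simp add: power2_eq_square algebra_simps)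
  moreover have "(LBINT t:{a..b}. 2 * (\<alpha> t * g t)) = (LBINT r. 2 * (G r * \<alpha> r))"
    unfolding set_lebesgue_integral_def by (intro Bochner_Integration.integral_cong) (auto simp: G_def)
  ultimately show "(\<alpha> b)\<^sup>2 - (\<alpha> a)\<^sup>2 = (LBINT t:{a..b}. 2 * (\<alpha> t * g t))" by simp
qed

text \<open>A smooth function of time, given by \<open>\<theta> 0\<close> together with all its
  derivatives, so that differentiation is a shift of the index.\<close>

definition tower :: "(nat \<Rightarrow> real \<Rightarrow> real) \<Rightarrow> bool" where
  "tower \<theta> \<longleftrightarrow> (\<forall>n t. (\<theta> n has_real_derivative \<theta> (Suc n) t) (at t))"

lemma tower_deriv: "tower \<theta> \<Longrightarrow> (\<theta> n has_real_derivative \<theta> (Suc n) t) (at t)"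
  by (simp add: tower_def)

lemma tower_continuous: "tower \<theta> \<Longrightarrow> continuous_on S (\<theta> n)"
  by (intro continuous_at_imp_continuous_on ballI) (rule DERIV_isCont[OF tower_deriv])

lemma tower_affine:
  assumes "tower \<theta>" shows "tower (\<lambda>n t. c * e ^ n * \<theta> n (e * t + d))"
  unfolding tower_def
proof (intro allI)
  fix n t
  show "((\<lambda>t. c * e ^ n * \<theta> n (e * t + d)) has_real_derivative c * e ^ Suc n * \<theta> (Suc n) (e * t + d)) (at t)"
    by (auto intro!: derivative_eq_intros DERIV_chain2[OF tower_deriv[OF assms]])
qed

lemma tower_diff: "tower \<theta> \<Longrightarrow> tower \<theta>' \<Longrightarrow> tower (\<lambda>n t. \<theta> n t - \<theta>' n t)"
  by (auto simp: tower_def intro!: derivative_intros)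

text \<open>The cutoff restricted to a line through the origin. For a unit vector \<open>v\<close>
  this is a compactly supported smooth function of time, so no bump has to be constructed.\<close>

lemma bump_tower:
  assumes "smooth_fun (\<eta> :: real^3 \<Rightarrow> real)"
  shows "tower (\<lambda>n s. iter_dderiv (replicate n v) \<eta> (s *\<^sub>R v))"
  unfolding tower_def
proof (intro allI)
  fix n s
  let ?g = "iter_dderiv (replicate n v) \<eta>"
  have "?g differentiable (at (s *\<^sub>R v))"
    using assms by (simp add: smooth_fun_def differentiable_on_def)
  then have D: "(?g has_derivative frechet_derivative ?g (at (s *\<^sub>R v))) (at (s *\<^sub>R v))"
    by (simp add: frechet_derivative_works)
  have "((\<lambda>s. ?g (s *\<^sub>R v)) has_derivative (\<lambda>h. frechet_derivative ?g (at (s *\<^sub>R v)) (h *\<^sub>R v))) (at s)"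
    by (rule has_derivative_compose[where f="\<lambda>s. s *\<^sub>R v" and g="?g", OF _ D]) (auto intro!: derivative_eq_intros)
  moreover have "frechet_derivative ?g (at (s *\<^sub>R v)) (h *\<^sub>R v) = h * frechet_derivative ?g (at (s *\<^sub>R v)) v" for h
    using linear_frechet_derivative[OF \<open>?g differentiable (at (s *\<^sub>R v))\<close>] by (simp add: linear_cmul)
  ultimately show "((\<lambda>s. iter_dderiv (replicate n v) \<eta> (s *\<^sub>R v)) has_real_derivative
     iter_dderiv (replicate (Suc n) v) \<eta> (s *\<^sub>R v)) (at s)"
    by (simp add: has_field_derivative_def dderiv_def mult.commute[of _ "frechet_derivative _ _ _"])
qed

section \<open>Mollifiers and smoothed indicators in time\<close>

locale time_bump =
  fixes h :: "nat \<Rightarrow> real \<Rightarrow> real"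
  assumes tw: "tower h" and h0: "\<And>s. 0 \<le> h 0 s" and h1: "\<And>s. \<bar>s\<bar> \<le> 3/4 \<Longrightarrow> h 0 s = 1" and h2: "\<And>s. 1 \<le> \<bar>s\<bar> \<Longrightarrow> h 0 s = 0"
begin

text \<open>A primitive of the bump; the base point -2 lies strictly to the left of its
  support.\<close>

definition H where "H s = integral {-2..s} (h 0)"

lemma H_low: "s \<le> -1 \<Longrightarrow> H s = 0"
  unfolding H_def by (intro integral_unique has_integral_is_0) (use h2 in auto)

lemma H_deriv: "(H has_real_derivative h 0 s) (at s)"
\<comment> \<open>The fundamental theorem is used on an interval starting at -2, so it covers only
  points to the right of -2; for s < -1 the primitive is locally zero instead.\<close>
proof (cases "s < -1")
  case True
  have "((\<lambda>_. 0) has_real_derivative h 0 s) (at s)" using h2[of s] True by simp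
  then show ?thesis
    by (rule has_field_derivative_transform_within_open[where S="{..<-1}"]) (use True H_low in auto)
next
  case False
  have "((\<lambda>u. integral {-2..u} (h 0)) has_vector_derivative h 0 s) (at s within {-2..s+1})"
    by (rule integral_has_vector_derivative[OF tower_continuous[OF tw]]) (use False in auto)
  then have "(H has_vector_derivative h 0 s) (at s within {-2<..<s+1})"
    unfolding H_def[abs_def] by (rule has_vector_derivative_within_subset) auto
  moreover have "at s within {-2<..<s+1} = at s" by (rule at_within_open) (use False in auto)
  ultimately have "(H has_vector_derivative h 0 s) (at s)" by simp
  then show ?thesis by (simp add: has_real_derivative_iff_has_vector_derivative)
qed

definition "c = H 1"

lemma H_mono: "s \<le> t \<Longrightarrow> H s \<le> H t"
  by (rule DERIV_nonneg_imp_nondecreasing) (use H_deriv h0 in blast)+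

lemma H_high: "1 \<le> s \<Longrightarrow> H s = c"
proof -
  assume s: "1 \<le> s"
  show ?thesis
  proof (cases "s = 1")
    case False
    then have s: "1 < s" using s by simp
    obtain z where z: "1 < z" "z < s" "H s - H 1 = (s - 1) * h 0 z"
      using MVT2[OF s, of H "h 0"] H_deriv by blast
    then have "H s = H 1" using h2[of z] by simp
    then show ?thesis by (simp add: c_def)
  qed (simp add: c_def)
qed

lemma c_pos: "0 < c"
proof -
  obtain z where z: "-3/4 < z" "z < 3/4" "H (3/4) - H (-3/4) = (3/4 - (-3/4)) * h 0 z"
    using MVT2[of "-3/4" "3/4" H "h 0"] H_deriv by auto
  then have "H (3/4) - H (-3/4) = 3/2" using h1[of z] by simp
  moreover have "0 \<le> H (-3/4)" using H_mono[of "-1" "-3/4"] H_low[of "-1"] by simp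
  moreover have "H (3/4) \<le> c" unfolding c_def by (rule H_mono) simp
  ultimately show ?thesis by linarith
qed

definition Hs :: "nat \<Rightarrow> real \<Rightarrow> real" where "Hs n = (case n of 0 \<Rightarrow> H | Suc m \<Rightarrow> h m)"

lemma Hs_tower: "tower Hs"
  using tw H_deriv by (auto simp: tower_def Hs_def split: nat.split)

lemma H_bounds: "0 \<le> H s" "H s \<le> c"
proof -
  show "0 \<le> H s" using H_mono[of "-1" s] H_mono[of s "-1"] H_low[of "-1"] H_low[of s] by (cases "s \<le> -1") auto
  show "H s \<le> c" using H_mono[of s 1] H_high[of s] by (cases "s \<le> 1") (auto simp: c_def)
qed

text \<open>The mollifier of width \<open>e\<close> centred at \<open>a\<close>; division by
  \<open>c\<close>, the total mass of the bump, makes its integral 1.\<close>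

definition rho :: "real \<Rightarrow> real \<Rightarrow> real \<Rightarrow> real" where "rho e a t = 1 / (c * e) * h 0 ((t - a) / e)"

lemma rho_cont: "0 < e \<Longrightarrow> continuous_on S (rho e a)"
  unfolding rho_def by (intro continuous_intros continuous_on_compose2[OF tower_continuous[OF tw, of UNIV]]) auto

lemma rho_zero: "0 < e \<Longrightarrow> t \<notin> {a-e..a+e} \<Longrightarrow> rho e a t = 0"
  by (auto simp: rho_def not_le field_simps abs_if intro!: h2)

lemma rho_nonneg: "0 < e \<Longrightarrow> 0 \<le> rho e a t"
  using c_pos h0 by (simp add: rho_def)

lemma rho_integral: assumes e: "0 < e" shows "integrable lborel (rho e a)" "(LBINT t. rho e a t) = 1"
proof -
  have eq: "rho e a = (\<lambda>t. indicator {a-e..a+e} t *\<^sub>R rho e a t)"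
    using rho_zero[OF e, of _ a] by (auto simp: indicator_def fun_eq_iff)
  show "integrable lborel (rho e a)"
    by (subst eq) (rule borel_integrable_compact[OF _ rho_cont[OF e]], simp)
  have "(LBINT t. indicator {a-e..a+e} t *\<^sub>R rho e a t) = H ((a + e - a) / e) / c - H ((a - e - a) / e) / c"
  proof (rule integral_FTC_atLeastAtMost)
    fix t
    have "((\<lambda>t. H ((t - a) / e) / c) has_real_derivative (h 0 ((t - a) / e) * (1 / e)) / c) (at t)"
      using e c_pos by (auto intro!: derivative_eq_intros DERIV_chain2[OF H_deriv])
    then have "((\<lambda>t. H ((t - a) / e) / c) has_real_derivative rho e a t) (at t)"
      by (simp add: rho_def mult_ac)
    then show "((\<lambda>t. H ((t - a) / e) / c) has_vector_derivative rho e a t) (at t within {a-e..a+e})"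
      unfolding has_real_derivative_iff_has_vector_derivative by (rule has_vector_derivative_at_within)
  qed (use e rho_cont in auto)
  also have "\<dots> = 1"
  proof -
    have "(a + e - a) / e = 1" "(a - e - a) / e = -1" using e by auto
    then show ?thesis using H_low[of "-1"] H_high[of 1] c_pos by simp
  qed
  finally show "(LBINT t. rho e a t) = 1" using eq by simp
qed

lemma rho_limit:
  assumes A: "continuous_on {0<..} A" "A \<in> borel_measurable borel" and a: "0 < a"
    and e: "\<And>n. 0 < e n" "e \<longlonglongrightarrow> 0"
  shows "(\<lambda>n. LBINT t. rho (e n) a t * A t) \<longlonglongrightarrow> A a"
    and "eventually (\<lambda>n. integrable lborel (\<lambda>t. rho (e n) a t * A t)) sequentially"
proof -
  have ev0: "eventually (\<lambda>n. e n < a) sequentially" using e(2) a by (rule order_tendstoD)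
  have int: "integrable lborel (\<lambda>t. rho (e n) a t * A t)" if "e n < a" for n
  proof -
    have eq: "(\<lambda>t. rho (e n) a t * A t) = (\<lambda>t. indicator {a-e n..a+e n} t *\<^sub>R (rho (e n) a t * A t))"
      using rho_zero[OF e(1)[of n], of _ a] by (auto simp: indicator_def fun_eq_iff)
    show ?thesis
      by (subst eq, rule borel_integrable_compact)
        (use that in \<open>auto intro!: continuous_intros rho_cont e continuous_on_subset[OF A(1)]\<close>)
  qed
  show "eventually (\<lambda>n. integrable lborel (\<lambda>t. rho (e n) a t * A t)) sequentially"
    using ev0 by eventually_elim (rule int)
  show "(\<lambda>n. LBINT t. rho (e n) a t * A t) \<longlonglongrightarrow> A a"
  proof (rule tendstoI)
    fix r :: real assume r: "0 < r"
    have "isCont A a" using A(1) a by (simp add: continuous_on_eq_continuous_at)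
    then obtain d where d: "0 < d" "\<And>t. \<bar>t - a\<bar> < d \<Longrightarrow> \<bar>A t - A a\<bar> < r / 2"
      using r unfolding continuous_at_eps_delta dist_real_def by (metis half_gt_zero)
    have "eventually (\<lambda>n. e n < min d a) sequentially" using e(2) a d(1) by (intro order_tendstoD) auto
    then show "eventually (\<lambda>n. dist (LBINT t. rho (e n) a t * A t) (A a) < r) sequentially"
    proof eventually_elim
      case (elim n)
      have i: "integrable lborel (\<lambda>t. rho (e n) a t * A t)" using int elim by simp
      note ri = rho_integral[OF e(1)[of n], of a]
      have "(LBINT t. rho (e n) a t * A t) - A a = (LBINT t. rho (e n) a t * A t - rho (e n) a t * A a)"
        using i ri by simp
      moreover have "\<bar>LBINT t. rho (e n) a t * A t - rho (e n) a t * A a\<bar> \<le> (LBINT t. rho (e n) a t * (r / 2))"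
      proof (rule order_trans[OF integral_abs_bound integral_mono])
        show "integrable lborel (\<lambda>t. \<bar>rho (e n) a t * A t - rho (e n) a t * A a\<bar>)" using i ri by simp
        show "integrable lborel (\<lambda>t. rho (e n) a t * (r / 2))" using ri by simp
        fix t
        show "\<bar>rho (e n) a t * A t - rho (e n) a t * A a\<bar> \<le> rho (e n) a t * (r / 2)"
        proof (cases "t \<in> {a - e n..a + e n}")
          case True
          then have "\<bar>A t - A a\<bar> < r / 2" using elim by (intro d(2)) auto
          then have "rho (e n) a t * \<bar>A t - A a\<bar> \<le> rho (e n) a t * (r / 2)"
            by (intro mult_left_mono rho_nonneg[OF e(1)]) simp
          then show ?thesis using rho_nonneg[OF e(1), of n a t]
            by (simp add: abs_mult flip: right_diff_distrib)
        next
          case False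
          then show ?thesis using rho_zero[OF e(1) False] by simp
        qed
      qed
      ultimately show ?case using ri r by (simp add: dist_real_def)
    qed
  qed
qed

text \<open>A smoothed indicator of the interval from \<open>a\<close> to \<open>b\<close>, as a
  difference of two rescaled primitives; its derivative is a difference of mollifiers.\<close>

definition theta :: "real \<Rightarrow> real \<Rightarrow> real \<Rightarrow> nat \<Rightarrow> real \<Rightarrow> real" where
  "theta e a b n t = 1 / c * (1 / e) ^ n * Hs n (1 / e * t + - a / e) - 1 / c * (1 / e) ^ n * Hs n (1 / e * t + - b / e)"

lemma theta_tower: "tower (theta e a b)"
  unfolding theta_def by (intro tower_diff tower_affine Hs_tower)

lemma theta_0: "theta e a b 0 t = (H ((t - a) / e) - H ((t - b) / e)) / c"
  by (simp add: theta_def Hs_def diff_divide_distrib)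

lemma theta_1: "theta e a b 1 t = rho e a t - rho e b t"
  by (simp add: theta_def Hs_def rho_def diff_divide_distrib)

lemma theta_supp:
  assumes "0 < e" "a \<le> b" "t \<notin> {a - e..b + e}" shows "theta e a b n t = 0 \<or> n \<noteq> 0"
proof -
  consider "t < a - e" | "t > b + e" using assms by fastforce
  then have "theta e a b 0 t = 0"
  proof cases
    case 1
    then have "(t - a) / e \<le> -1" "(t - b) / e \<le> -1" using assms by (auto simp: field_simps)
    then show ?thesis by (simp add: theta_0 H_low)
  next
    case 2
    then have "(t - a) / e \<ge> 1" "(t - b) / e \<ge> 1" using assms by (auto simp: field_simps)
    then show ?thesis by (simp add: theta_0 H_high)
  qed
  then show ?thesis by auto
qed

lemma theta_bound: assumes "0 < e" "a \<le> b" shows "\<bar>theta e a b 0 t\<bar> \<le> 1"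
proof -
  have "H ((t - b) / e) \<le> H ((t - a) / e)" using assms by (intro H_mono divide_right_mono) auto
  then show ?thesis using H_bounds[of "(t - a) / e"] H_bounds[of "(t - b) / e"] c_pos
    by (simp add: theta_0 abs_if field_simps)
qed

lemma theta_limit:
  assumes e: "\<And>n. 0 < e n" "e \<longlonglongrightarrow> 0" and t: "t \<noteq> a" "t \<noteq> b" and ab: "a \<le> b"
  shows "(\<lambda>n. theta (e n) a b 0 t) \<longlonglongrightarrow> indicator {a..b} t"
proof -
  have lim: "(\<lambda>n. H ((t - z) / e n)) \<longlonglongrightarrow> (if t < z then 0 else c)" if z: "t \<noteq> z" for z
  proof -
    have "eventually (\<lambda>n. e n < \<bar>t - z\<bar>) sequentially" using e(2) z by (intro order_tendstoD) auto
    then have "eventually (\<lambda>n. H ((t - z) / e n) = (if t < z then 0 else c)) sequentially"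
    proof eventually_elim
      case (elim n)
      show ?case
      proof (cases "t < z")
        case True
        then have "(t - z) / e n \<le> -1" using elim e(1)[of n] by (simp add: field_simps)
        then show ?thesis using True H_low by simp
      next
        case False
        then have "(t - z) / e n \<ge> 1" using elim e(1)[of n] by (simp add: field_simps)
        then show ?thesis using False H_high by simp
      qed
    qed
    then show ?thesis by (rule tendsto_eventually)
  qed
  have "(\<lambda>n. theta (e n) a b 0 t) \<longlonglongrightarrow> ((if t < a then 0 else c) - (if t < b then 0 else c)) / c"
    unfolding theta_0 using c_pos by (intro tendsto_intros lim t) auto
  moreover have "((if t < a then 0 else c) - (if t < b then 0 else c)) / c = indicator {a..b} t"
    using c_pos t ab by (auto simp: indicator_def)
  ultimately show ?thesis by simp
qed

text \<open>Testing with smoothed indicators of shrinking width: the terms with their derivative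
  tend to values of \<open>A\<close> at the end points, by continuity, and the others to the
  integral of \<open>B\<close>, by dominated convergence. Thus the identity holds for every pair of
  times, not only almost every one.\<close>

lemma weak_derivative:
  fixes A B :: "real \<Rightarrow> real"
  assumes A: "continuous_on {0<..} A" "A \<in> borel_measurable borel"
    and B: "\<And>a b. 0 < a \<Longrightarrow> set_integrable lborel {a..b} B"
    and weak: "\<And>\<theta> a b. tower \<theta> \<Longrightarrow> 0 < a \<Longrightarrow> (\<And>t. t \<notin> {a..b} \<Longrightarrow> \<theta> 0 t = 0) \<Longrightarrow>
       (LBINT t. \<theta> 1 t * A t + \<theta> 0 t * B t) = 0"
    and ab: "0 < a" "a \<le> b"
  shows "A b - A a = (LBINT t:{a..b}. B t)"
proof -
  \<comment> \<open>Widths of at most \<open>a / 2\<close> keep all test functions supported in one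
    compact interval of positive times.\<close>
  define e where "e n = a / (2 * real (Suc n))" for n
  have e: "0 < e n" for n using ab by (simp add: e_def)
  have e2: "e n \<le> a / 2" for n unfolding e_def by (rule divide_left_mono) (use ab in auto)
  have "(\<lambda>n. (a / 2) * (1 / real (Suc n))) \<longlonglongrightarrow> (a / 2) * 0"
    by (intro tendsto_intros LIMSEQ_Suc lim_1_over_n)
  then have e0: "e \<longlonglongrightarrow> 0" by (simp add: e_def[abs_def])
  let ?I = "{a/2..b+a}"
  have BI: "integrable lborel (\<lambda>t. indicator ?I t * B t)"
    using B[of "a/2" "b+a"] ab by (simp add: set_integrable_def)
  have ts: "theta (e n) a b 0 t = 0" if "t \<notin> ?I" for n t
  proof -
    have "t \<notin> {a - e n..b + e n}" using that e2[of n] ab by auto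
    then show ?thesis using theta_supp[OF e[of n] ab(2), of t 0] by simp
  qed
  have th: "theta (e n) a b 0 t * B t = theta (e n) a b 0 t * (indicator ?I t * B t)" for n t
    using ts[of t n] by (auto simp: indicator_def)
  have [measurable]: "theta (e n) a b 0 \<in> borel_measurable borel" for n
    by (rule borel_measurable_continuous_onI[OF tower_continuous[OF theta_tower]])
  have lim1: "(\<lambda>n. LBINT t. theta (e n) a b 0 t * (indicator ?I t * B t)) \<longlonglongrightarrow> (LBINT t. indicator {a..b} t * (indicator ?I t * B t))"
  proof (rule integral_dominated_convergence[where w="\<lambda>t. \<bar>indicator ?I t * B t\<bar>"])
    show "integrable lborel (\<lambda>t. \<bar>indicator ?I t * B t\<bar>)" using BI by (rule integrable_abs)
    have "AE t in lborel. t \<noteq> a \<and> t \<noteq> b" using AE_lborel_singleton[of a] AE_lborel_singleton[of b] by eventually_elim auto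
    then show "AE t in lborel. (\<lambda>n. theta (e n) a b 0 t * (indicator ?I t * B t)) \<longlonglongrightarrow> indicator {a..b} t * (indicator ?I t * B t)"
      by eventually_elim (intro tendsto_intros theta_limit e e0 ab, auto)
    show "AE t in lborel. norm (theta (e n) a b 0 t * (indicator ?I t * B t)) \<le> \<bar>indicator ?I t * B t\<bar>" for n
      using theta_bound[OF e[of n] ab(2)] by (intro AE_I2) (simp add: abs_mult mult_left_le_one_le)
  qed (use BI in \<open>auto dest: borel_measurable_integrable\<close>)
  have BI': "integrable lborel (\<lambda>t. theta (e n) a b 0 t * B t)" for n
    unfolding th
    by (rule Bochner_Integration.integrable_bound[OF BI])
      (use borel_measurable_integrable[OF BI] theta_bound[OF e[of n] ab(2)] in \<open>auto simp: abs_mult mult_left_le_one_le\<close>)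
  have bp: "0 < b" using ab by simp
  have ev: "eventually (\<lambda>n. (LBINT t. theta (e n) a b 0 t * (indicator ?I t * B t)) = (LBINT t. rho (e n) b t * A t) - (LBINT t. rho (e n) a t * A t)) sequentially"
    using rho_limit(2)[OF A ab(1) e e0] rho_limit(2)[OF A bp e e0]
  proof (eventually_elim)
    case (elim n)
    have i: "integrable lborel (\<lambda>t. rho (e n) a t * A t)" "integrable lborel (\<lambda>t. rho (e n) b t * A t)"
      using elim bp by auto
    have "(LBINT t. theta (e n) a b 1 t * A t + theta (e n) a b 0 t * B t) = 0"
      by (rule weak[OF theta_tower, of "a/2" "b+a"])
        (use ts ab in auto)
    moreover have "(LBINT t. theta (e n) a b 1 t * A t + theta (e n) a b 0 t * B t)
       = ((LBINT t. rho (e n) a t * A t) - (LBINT t. rho (e n) b t * A t)) + (LBINT t. theta (e n) a b 0 t * B t)"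
      using i BI'[of n] unfolding theta_1 left_diff_distrib by simp
    ultimately show ?case unfolding th[symmetric] by simp
  qed
  have "(\<lambda>n. (LBINT t. rho (e n) b t * A t) - (LBINT t. rho (e n) a t * A t)) \<longlonglongrightarrow> A b - A a"
    using ab by (intro tendsto_intros rho_limit(1)[OF A _ e e0]) auto
  then have "(\<lambda>n. LBINT t. theta (e n) a b 0 t * (indicator ?I t * B t)) \<longlonglongrightarrow> A b - A a"
    by (rule Lim_transform_eventually) (use ev in \<open>eventually_elim, simp\<close>)
  then have "A b - A a = (LBINT t. indicator {a..b} t * (indicator ?I t * B t))"
    using lim1 LIMSEQ_unique by blast
  also have "\<dots> = (LBINT t:{a..b}. B t)"
    unfolding set_lebesgue_integral_def
    by (intro Bochner_Integration.integral_cong) (use ab in \<open>auto simp: indicator_def\<close>)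
  finally show ?thesis .
qed

text \<open>Now the mollifier itself is the test function, and the limit evaluates
  \<open>A\<close>.\<close>

lemma weak_zero:
  fixes A :: "real \<Rightarrow> real"
  assumes A: "continuous_on {0<..} A" "A \<in> borel_measurable borel"
    and weak: "\<And>\<theta> a b. tower \<theta> \<Longrightarrow> 0 < a \<Longrightarrow> (\<And>t. t \<notin> {a..b} \<Longrightarrow> \<theta> 0 t = 0) \<Longrightarrow> (LBINT t. \<theta> 0 t * A t) = 0"
    and a: "0 < a"
  shows "A a = 0"
proof -
  define e where "e n = a / (2 * real (Suc n))" for n
  have e: "0 < e n" for n using a by (simp add: e_def)
  have e2: "e n \<le> a / 2" for n unfolding e_def by (rule divide_left_mono) (use a in auto)
  have "(\<lambda>n. (a / 2) * (1 / real (Suc n))) \<longlonglongrightarrow> (a / 2) * 0"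
    by (intro tendsto_intros LIMSEQ_Suc lim_1_over_n)
  then have e0: "e \<longlonglongrightarrow> 0" by (simp add: e_def[abs_def])
  have "(LBINT t. rho (e n) a t * A t) = 0" for n
  proof -
    let ?th = "\<lambda>m t. 1 / (c * e n) * (1 / e n) ^ m * h m (1 / e n * t + - a / e n)"
    have t0: "?th 0 t = rho (e n) a t" for t by (simp add: rho_def diff_divide_distrib)
    have "(LBINT t. ?th 0 t * A t) = 0"
    proof (rule weak[OF tower_affine[OF tw], of "a/2" "2*a"])
      fix t assume "t \<notin> {a/2..2*a}"
      then show "?th 0 t = 0" unfolding t0 using e[of n] e2[of n] a by (intro rho_zero) auto
    qed (use a in auto)
    then show ?thesis by (simp only: t0)
  qed
  then show ?thesis using rho_limit(1)[OF A a e e0] by (simp add: LIMSEQ_const_iff)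
qed

end

section \<open>Plane-wave test functions\<close>

text \<open>Sums of products of a derivative of \<theta> with a shifted cosine. A sine is a cosine
  with another shift, so the class is closed under directional derivatives; this is how the test
  functions are seen to be smooth.\<close>

inductive sep :: "(nat \<Rightarrow> real \<Rightarrow> real) \<Rightarrow> real^3 \<Rightarrow> (real \<times> (real^3) \<Rightarrow> 'b::real_normed_vector) \<Rightarrow> bool" for \<theta> \<xi> where
  sep_base: "sep \<theta> \<xi> (\<lambda>z. (\<theta> n (fst z) * cos (\<xi> \<bullet> snd z + \<phi>)) *\<^sub>R v)"
| sep_add: "sep \<theta> \<xi> f \<Longrightarrow> sep \<theta> \<xi> g \<Longrightarrow> sep \<theta> \<xi> (\<lambda>z. f z + g z)"

lemma has_derivative_base:
  assumes "tower \<theta>"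
  shows "((\<lambda>z. (\<theta> n (fst z) * cos (\<xi> \<bullet> snd z + \<phi>)) *\<^sub>R v) has_derivative
    (\<lambda>e. (\<theta> (Suc n) (fst z) * fst e * cos (\<xi> \<bullet> snd z + \<phi>) - \<theta> n (fst z) * (sin (\<xi> \<bullet> snd z + \<phi>) * (\<xi> \<bullet> snd e))) *\<^sub>R v)) (at z)"
proof -
  have "(\<theta> n has_derivative (\<lambda>h. \<theta> (Suc n) (fst z) * h)) (at (fst z))"
    using tower_deriv[OF assms] by (simp add: has_field_derivative_def)
  moreover have "(fst has_derivative fst) (at z)" by (auto intro!: derivative_eq_intros)
  ultimately have 1: "((\<lambda>z. \<theta> n (fst z)) has_derivative (\<lambda>e. \<theta> (Suc n) (fst z) * fst e)) (at z)"
    using has_derivative_compose[of fst fst z UNIV "\<theta> n"] by blast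
  have 2: "((\<lambda>z. cos (\<xi> \<bullet> snd z + \<phi>)) has_derivative (\<lambda>e. - (sin (\<xi> \<bullet> snd z + \<phi>) * (\<xi> \<bullet> snd e)))) (at z)"
    by (auto intro!: derivative_eq_intros)
  show ?thesis
    by (rule has_derivative_eq_rhs[OF has_derivative_scaleR_left[OF has_derivative_mult[OF 1 2]]])
      (auto simp: fun_eq_iff algebra_simps)
qed

lemma dderiv_eq: "(f has_derivative D) (at z) \<Longrightarrow> dderiv e f z = D e"
  by (simp add: dderiv_def frechet_derivative_at[symmetric])

lemma dderiv_base:
  assumes "tower \<theta>"
  shows "dderiv e (\<lambda>z. (\<theta> n (fst z) * cos (\<xi> \<bullet> snd z + \<phi>)) *\<^sub>R v) =
    (\<lambda>z. (\<theta> (Suc n) (fst z) * fst e * cos (\<xi> \<bullet> snd z + \<phi>) - \<theta> n (fst z) * (sin (\<xi> \<bullet> snd z + \<phi>) * (\<xi> \<bullet> snd e))) *\<^sub>R v)"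
  by (rule ext) (rule dderiv_eq[OF has_derivative_base[OF assms]])

lemma cos_shift: "cos (x + (\<phi> + pi / 2)) = - sin (x + \<phi>)"
  using minus_sin_cos_eq[of "x + \<phi>"] by (simp add: add.assoc)

lemma dderiv_base':
  assumes "tower \<theta>"
  shows "dderiv e (\<lambda>z. (\<theta> n (fst z) * cos (\<xi> \<bullet> snd z + \<phi>)) *\<^sub>R v) =
    (\<lambda>z. (\<theta> (Suc n) (fst z) * cos (\<xi> \<bullet> snd z + \<phi>)) *\<^sub>R (fst e *\<^sub>R v) + (\<theta> n (fst z) * cos (\<xi> \<bullet> snd z + (\<phi> + pi / 2))) *\<^sub>R ((\<xi> \<bullet> snd e) *\<^sub>R v))"
  unfolding dderiv_base[OF assms] cos_shift by (auto simp: fun_eq_iff algebra_simps)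

lemma sep_differentiable:
  assumes "sep \<theta> \<xi> f" "tower \<theta>" shows "f differentiable (at z)"
  using assms(1)
proof induction
  case (sep_base n \<phi> v)
  show ?case using has_derivative_base[OF assms(2)] by (rule differentiableI)
qed (rule differentiable_add)

lemma sep_dderiv:
  assumes "sep \<theta> \<xi> f" "tower \<theta>" shows "sep \<theta> \<xi> (dderiv e f)"
  using assms(1)
proof induction
  case (sep_base n \<phi> v)
  show ?case unfolding dderiv_base'[OF assms(2)] by (intro sep.intros)
next
  case (sep_add f g)
  have "dderiv e (\<lambda>z. f z + g z) = (\<lambda>z. dderiv e f z + dderiv e g z)"
  proof
    fix z
    have "(f has_derivative frechet_derivative f (at z)) (at z)" "(g has_derivative frechet_derivative g (at z)) (at z)"
      using sep_differentiable[OF sep_add(1) assms(2)] sep_differentiable[OF sep_add(2) assms(2)]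
      by (simp_all add: frechet_derivative_works)
    from dderiv_eq[OF has_derivative_add[OF this]]
    show "dderiv e (\<lambda>z. f z + g z) z = dderiv e f z + dderiv e g z" by (simp add: dderiv_def)
  qed
  then show ?case using sep_add by (simp add: sep.sep_add)
qed

lemma sep_smooth:
  assumes "sep \<theta> \<xi> f" "tower \<theta>" shows "smooth_fun f"
proof -
  have "sep \<theta> \<xi> (iter_dderiv es f)" for es
    by (induction es) (auto intro: sep_dderiv assms)
  then show ?thesis
    unfolding smooth_fun_def differentiable_on_def using sep_differentiable[OF _ assms(2)] by blast
qed

text \<open>The phases 0 and pi/2 extract the real and the imaginary part of a Fourier mode.\<close>

definition wave :: "(nat \<Rightarrow> real \<Rightarrow> real) \<Rightarrow> real^3 \<Rightarrow> real \<Rightarrow> 'b \<Rightarrow> real \<times> (real^3) \<Rightarrow> 'b::real_normed_vector" where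
  "wave \<theta> \<xi> \<phi> v z = (\<theta> 0 (fst z) * cos (\<xi> \<bullet> snd z + \<phi>)) *\<^sub>R v"

lemma wave_eq: "wave \<theta> \<xi> \<phi> v = (\<lambda>z. (\<theta> 0 (fst z) * cos (\<xi> \<bullet> snd z + \<phi>)) *\<^sub>R v)"
  by (simp add: wave_def fun_eq_iff)

lemma dt_wave: "tower \<theta> \<Longrightarrow> dt (wave \<theta> \<xi> \<phi> v) (t, x) = (\<theta> 1 t * cos (\<xi> \<bullet> x + \<phi>)) *\<^sub>R v"
  unfolding wave_eq dderiv_base by simp

lemma dx_wave: "tower \<theta> \<Longrightarrow> dx w (wave \<theta> \<xi> \<phi> v) = wave \<theta> \<xi> (\<phi> + pi / 2) ((\<xi> \<bullet> w) *\<^sub>R v)"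
  unfolding wave_eq dderiv_base' by (simp add: fun_eq_iff)

lemma norm_sq_cart: "\<xi> \<bullet> (\<xi>::real^3) = (\<Sum>j\<in>UNIV. (\<xi> \<bullet> axis j 1) * (\<xi> \<bullet> axis j 1))"
  by (simp add: inner_vec_def[of \<xi> \<xi>] inner_axis)

lemma laplace_wave: "tower \<theta> \<Longrightarrow> laplace_x (wave \<theta> \<xi> \<phi> v) (t, x) = - ((\<xi> \<bullet> \<xi>) * \<theta> 0 t * cos (\<xi> \<bullet> x + \<phi>)) *\<^sub>R v"
proof -
  assume t: "tower \<theta>"
  have c: "cos (\<xi> \<bullet> x + (\<phi> + pi / 2 + pi / 2)) = - cos (\<xi> \<bullet> x + \<phi>)"
    unfolding cos_shift[of _ "\<phi> + pi/2"] by (simp add: sin_add cos_add)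
  have "laplace_x (wave \<theta> \<xi> \<phi> v) (t, x) = (\<Sum>j\<in>UNIV. ((\<xi> \<bullet> axis j 1) * (\<xi> \<bullet> axis j 1)) *\<^sub>R (- (\<theta> 0 t * cos (\<xi> \<bullet> x + \<phi>)) *\<^sub>R v))"
    unfolding laplace_x_def dx_wave[OF t] wave_def fst_conv snd_conv c by (simp add: mult_ac)
  also have "\<dots> = (\<xi> \<bullet> \<xi>) *\<^sub>R (- (\<theta> 0 t * cos (\<xi> \<bullet> x + \<phi>)) *\<^sub>R v)"
    unfolding norm_sq_cart[of \<xi>] by (rule scaleR_sum_left[symmetric])
  finally show ?thesis by (simp add: mult.assoc)
qed

text \<open>Polarisations orthogonal to the wave vector are chosen because their waves do not see
  the pressure.\<close>

lemma div_wave: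
  assumes "tower \<theta>" "\<xi> \<bullet> v = 0" shows "div_x (wave \<theta> \<xi> \<phi> v) = (\<lambda>z. 0)"
proof
  fix z
  have "div_x (wave \<theta> \<xi> \<phi> v) z = (\<Sum>j\<in>UNIV. (\<theta> 0 (fst z) * cos (\<xi> \<bullet> snd z + (\<phi> + pi / 2))) * (\<xi> $ j * v $ j))"
    unfolding div_x_def dx_wave[OF assms(1)] by (simp add: wave_def inner_axis mult_ac)
  also have "\<dots> = (\<theta> 0 (fst z) * cos (\<xi> \<bullet> snd z + (\<phi> + pi / 2))) * (\<xi> \<bullet> v)"
    by (simp add: inner_vec_def sum_distrib_left)
  finally show "div_x (wave \<theta> \<xi> \<phi> v) z = 0" using assms by simp
qed

lemma wave_test:
  assumes "tower \<theta>" "0 < L" "0 < a" "\<And>t. t \<notin> {a..b} \<Longrightarrow> \<theta> 0 t = 0"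
  shows "wave \<theta> ((2 * pi / L) *\<^sub>R freq k) \<phi> v \<in> test_space L"
proof -
  let ?\<xi> = "(2 * pi / L) *\<^sub>R freq k"
  have "sep \<theta> ?\<xi> (wave \<theta> ?\<xi> \<phi> v)" unfolding wave_eq by (rule sep.intros)
  then have "smooth_fun (wave \<theta> ?\<xi> \<phi> v)" by (rule sep_smooth) fact
  moreover have "wave \<theta> ?\<xi> \<phi> v (t, x + axis j L) = wave \<theta> ?\<xi> \<phi> v (t, x)" for t x j
  proof -
    have "?\<xi> \<bullet> axis j L = 2 * pi * real_of_int (k $ j)" using assms(2) by (simp add: inner_axis freq_def)
    then have "?\<xi> \<bullet> (x + axis j L) + \<phi> = (?\<xi> \<bullet> x + \<phi>) + 2 * pi * real_of_int (k $ j)"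
      by (simp only: inner_add_right)
    then have "cos (?\<xi> \<bullet> (x + axis j L) + \<phi>) = cos (?\<xi> \<bullet> x + \<phi>)"
      by (simp only:) (simp add: cos_add cos_int_2pin sin_int_2pin)
    then show ?thesis by (simp add: wave_def)
  qed
  ultimately have "wave \<theta> ?\<xi> \<phi> v \<in> test_funs L a b"
    using assms(4) by (auto simp: test_funs_def wave_def)
  then show ?thesis using assms(3) by (auto simp: test_space_def)
qed

section \<open>Pairings of a field with plane waves\<close>

lemma L2_torus_comp: "g \<in> L2_torus L \<Longrightarrow> (\<lambda>x. complex_of_real (g x \<bullet> v)) \<in> L2c L"
proof -
  assume g: "g \<in> L2_torus L"
  then have [measurable]: "g \<in> borel_measurable (torus L)" and i: "integrable (torus L) (\<lambda>x. (norm (g x))\<^sup>2)"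
    by (auto simp: L2_torus_def)
  have "integrable (torus L) (\<lambda>x. (cmod (complex_of_real (g x \<bullet> v)))\<^sup>2)"
  proof (rule Bochner_Integration.integrable_bound)
    show "integrable (torus L) (\<lambda>x. (norm v)\<^sup>2 * (norm (g x))\<^sup>2)" using i by simp
    show "AE x in torus L. norm ((cmod (complex_of_real (g x \<bullet> v)))\<^sup>2) \<le> norm ((norm v)\<^sup>2 * (norm (g x))\<^sup>2)"
    proof (rule AE_I2)
      fix x
      have "(cmod (complex_of_real (g x \<bullet> v)))\<^sup>2 \<le> (norm (g x) * norm v)\<^sup>2"
        unfolding norm_of_real using Cauchy_Schwarz_ineq2[of "g x" v] by (intro power_mono) auto
      then show "norm ((cmod (complex_of_real (g x \<bullet> v)))\<^sup>2) \<le> norm ((norm v)\<^sup>2 * (norm (g x))\<^sup>2)"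
        by (simp add: power_mult_distrib mult.commute)
    qed
  qed measurable
  then show ?thesis by (simp add: L2c_def)
qed

text \<open>The pairing of a field with a plane wave. Up to sign, \<open>gm\<close> below is the
  pairing of the tensor product of the field with itself against the gradient of that wave.\<close>

definition al :: "real \<Rightarrow> (real^3 \<Rightarrow> real^3) \<Rightarrow> real^3 \<Rightarrow> real \<Rightarrow> real^3 \<Rightarrow> real" where
  "al L g \<xi> \<phi> v = (LINT x|torus L. cos (\<xi> \<bullet> x + \<phi>) * (g x \<bullet> v))"

definition gm :: "real \<Rightarrow> (real^3 \<Rightarrow> real^3) \<Rightarrow> real^3 \<Rightarrow> real \<Rightarrow> real^3 \<Rightarrow> real" where
  "gm L g \<xi> \<phi> v = (LINT x|torus L. sin (\<xi> \<bullet> x + \<phi>) * ((\<xi> \<bullet> g x) * (g x \<bullet> v)))"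

lemma torus_trig_measurable [measurable]:
  "(\<lambda>x. cos (\<xi> \<bullet> x + \<phi>)) \<in> borel_measurable (torus L)" "(\<lambda>x. sin (\<xi> \<bullet> x + \<phi>)) \<in> borel_measurable (torus L)"
  by (auto intro!: continuous_measurable_torus continuous_intros)

lemma al_integrable:
  assumes "0 < L" "g \<in> L2_torus L"
  shows "integrable (torus L) (\<lambda>x. cos (\<xi> \<bullet> x + \<phi>) * (g x \<bullet> v))"
proof (rule Bochner_Integration.integrable_bound)
  note L2 = L2_torus_comp[OF assms(2), of v]
  show "integrable (torus L) (\<lambda>x. complex_of_real (g x \<bullet> v))" by (rule L2c_integrable[OF assms(1) L2])
  have [measurable]: "g \<in> borel_measurable (torus L)" using assms by (simp add: L2_torus_def)
  show "(\<lambda>x. cos (\<xi> \<bullet> x + \<phi>) * (g x \<bullet> v)) \<in> borel_measurable (torus L)" by measurable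
  show "AE x in torus L. norm (cos (\<xi> \<bullet> x + \<phi>) * (g x \<bullet> v)) \<le> norm (complex_of_real (g x \<bullet> v))"
    by (intro AE_I2) (simp add: abs_mult mult_left_le_one_le)
qed

lemma gm_integrable:
  assumes "g \<in> L2_torus L"
  shows "integrable (torus L) (\<lambda>x. sin (\<xi> \<bullet> x + \<phi>) * ((\<xi> \<bullet> g x) * (g x \<bullet> v)))"
proof (rule Bochner_Integration.integrable_bound)
  show "integrable (torus L) (\<lambda>x. norm \<xi> * norm v * (norm (g x))\<^sup>2)" using assms by (simp add: L2_torus_def)
  have [measurable]: "g \<in> borel_measurable (torus L)" using assms by (simp add: L2_torus_def)
  show "(\<lambda>x. sin (\<xi> \<bullet> x + \<phi>) * ((\<xi> \<bullet> g x) * (g x \<bullet> v))) \<in> borel_measurable (torus L)" by measurable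
  show "AE x in torus L. norm (sin (\<xi> \<bullet> x + \<phi>) * ((\<xi> \<bullet> g x) * (g x \<bullet> v))) \<le> norm (norm \<xi> * norm v * (norm (g x))\<^sup>2)"
  proof (rule AE_I2)
    fix x
    have "\<bar>(\<xi> \<bullet> g x) * (g x \<bullet> v)\<bar> \<le> (norm \<xi> * norm (g x)) * (norm (g x) * norm v)"
      unfolding abs_mult by (intro mult_mono Cauchy_Schwarz_ineq2) auto
    moreover have "norm (sin (\<xi> \<bullet> x + \<phi>) * ((\<xi> \<bullet> g x) * (g x \<bullet> v))) \<le> \<bar>(\<xi> \<bullet> g x) * (g x \<bullet> v)\<bar>"
      by (simp add: abs_mult[of "sin _"] mult_left_le_one_le)
    ultimately show "norm (sin (\<xi> \<bullet> x + \<phi>) * ((\<xi> \<bullet> g x) * (g x \<bullet> v))) \<le> norm (norm \<xi> * norm v * (norm (g x))\<^sup>2)"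
      by (simp add: power2_eq_square mult_ac)
  qed
qed

text \<open>A transversal plane wave turns the momentum equation into a scalar equation in time: the
  pressure term vanishes and the Laplacian acts as multiplication by minus the square of the wave
  vector.\<close>

lemma momentum_wave:
  assumes L: "0 < L" and p: "distribution L p" "momentum_eq L \<nu> f p u" and u: "\<And>t. 0 \<le> t \<Longrightarrow> u t \<in> L2_torus L"
    and th: "tower \<theta>" "0 < a" "\<And>t. t \<notin> {a..b} \<Longrightarrow> \<theta> 0 t = 0"
    and \<xi>: "\<xi> = (2 * pi / L) *\<^sub>R freq k" "\<xi> \<bullet> v = 0"
  shows "(LBINT t:{0<..}. - \<theta> 1 t * al L (u t) \<xi> \<phi> v + \<theta> 0 t * (gm L (u t) \<xi> \<phi> v + \<nu> * (\<xi> \<bullet> \<xi>) * al L (u t) \<xi> \<phi> v)) = f (wave \<theta> \<xi> \<phi> v)"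
proof -
  have ts: "wave \<theta> \<xi> \<phi> v \<in> test_space L" unfolding \<xi>(1) by (rule wave_test[OF th(1) L th(2,3)])
  \<comment> \<open>Homogeneity of a distribution is given on test functions only, so the zero
    function must be recognised as one before p(0) = 0 follows.\<close>
  have z: "(\<lambda>z. 0::real) \<in> test_space L"
  proof -
    have "(\<lambda>z. 0 :: real) = wave (\<lambda>_ _. 0) ((2 * pi / 1) *\<^sub>R freq 0) 0 0" by (simp add: wave_eq)
    moreover have "smooth_fun (wave (\<lambda>_ _. 0) 0 0 (0::real))"
      unfolding wave_eq by (rule sep_smooth[where \<theta>="\<lambda>_ _. 0" and \<xi>=0, OF sep_base]) (simp add: tower_def)
    ultimately have "(\<lambda>z. 0 :: real) \<in> test_funs L 1 1" by (simp add: test_funs_def freq_def wave_eq zero_vec_def)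
    then show ?thesis by (auto simp: test_space_def intro!: bexI[of _ 1] exI[of _ 1])
  qed
  have "p (\<lambda>z. 0 *\<^sub>R (0::real)) = 0 * p (\<lambda>z. 0)"
  proof -
    have "\<forall>\<psi>\<in>test_space L. \<forall>c. p (\<lambda>z. c *\<^sub>R \<psi> z) = c * p \<psi>"
      using p(1) unfolding distribution_def by (elim conjE)
    from bspec[OF this z, THEN spec, of 0] show ?thesis .
  qed
  then have p0: "p (div_x (wave \<theta> \<xi> \<phi> v)) = 0" by (simp add: div_wave[OF th(1) \<xi>(2)])
  have "(LINT x|torus L. - (u t x \<bullet> dt (wave \<theta> \<xi> \<phi> v) (t, x)) - (u t x \<bullet> dx (u t x) (wave \<theta> \<xi> \<phi> v) (t, x)) - \<nu> * (u t x \<bullet> laplace_x (wave \<theta> \<xi> \<phi> v) (t, x)))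
    = - \<theta> 1 t * al L (u t) \<xi> \<phi> v + \<theta> 0 t * (gm L (u t) \<xi> \<phi> v + \<nu> * (\<xi> \<bullet> \<xi>) * al L (u t) \<xi> \<phi> v)" if t: "0 < t" for t
  proof -
    have ut: "u t \<in> L2_torus L" using u t by simp
    have "(LINT x|torus L. - (u t x \<bullet> dt (wave \<theta> \<xi> \<phi> v) (t, x)) - (u t x \<bullet> dx (u t x) (wave \<theta> \<xi> \<phi> v) (t, x)) - \<nu> * (u t x \<bullet> laplace_x (wave \<theta> \<xi> \<phi> v) (t, x)))
      = (LINT x|torus L. (- \<theta> 1 t + \<nu> * (\<xi> \<bullet> \<xi>) * \<theta> 0 t) * (cos (\<xi> \<bullet> x + \<phi>) * (u t x \<bullet> v)) + \<theta> 0 t * (sin (\<xi> \<bullet> x + \<phi>) * ((\<xi> \<bullet> u t x) * (u t x \<bullet> v))))"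
    proof (rule Bochner_Integration.integral_cong[OF refl])
      fix x
      have e3: "dx (u t x) (wave \<theta> \<xi> \<phi> v) (t, x) = - (\<theta> 0 t * sin (\<xi> \<bullet> x + \<phi>) * (\<xi> \<bullet> u t x)) *\<^sub>R v"
        unfolding dx_wave[OF th(1)] wave_def fst_conv snd_conv cos_shift by simp
      show "- (u t x \<bullet> dt (wave \<theta> \<xi> \<phi> v) (t, x)) - (u t x \<bullet> dx (u t x) (wave \<theta> \<xi> \<phi> v) (t, x)) - \<nu> * (u t x \<bullet> laplace_x (wave \<theta> \<xi> \<phi> v) (t, x))
        = (- \<theta> 1 t + \<nu> * (\<xi> \<bullet> \<xi>) * \<theta> 0 t) * (cos (\<xi> \<bullet> x + \<phi>) * (u t x \<bullet> v)) + \<theta> 0 t * (sin (\<xi> \<bullet> x + \<phi>) * ((\<xi> \<bullet> u t x) * (u t x \<bullet> v)))"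
        unfolding e3 dt_wave[OF th(1)] laplace_wave[OF th(1)] inner_scaleR_right by (simp add: algebra_simps)
    qed
    also have "\<dots> = (- \<theta> 1 t + \<nu> * (\<xi> \<bullet> \<xi>) * \<theta> 0 t) * al L (u t) \<xi> \<phi> v + \<theta> 0 t * gm L (u t) \<xi> \<phi> v"
      using al_integrable[OF L ut, of \<xi> \<phi> v] gm_integrable[OF ut, of \<xi> \<phi> v] by (simp add: al_def gm_def)
    finally show ?thesis by (simp add: algebra_simps)
  qed
  then have "(LBINT t:{0<..}. (LINT x|torus L. - (u t x \<bullet> dt (wave \<theta> \<xi> \<phi> v) (t, x)) - (u t x \<bullet> dx (u t x) (wave \<theta> \<xi> \<phi> v) (t, x)) - \<nu> * (u t x \<bullet> laplace_x (wave \<theta> \<xi> \<phi> v) (t, x))))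
    = (LBINT t:{0<..}. - \<theta> 1 t * al L (u t) \<xi> \<phi> v + \<theta> 0 t * (gm L (u t) \<xi> \<phi> v + \<nu> * (\<xi> \<bullet> \<xi>) * al L (u t) \<xi> \<phi> v))"
    by (intro set_lebesgue_integral_cong) auto
  moreover have "(LBINT t:{0<..}. (LINT x|torus L. - (u t x \<bullet> dt (wave \<theta> \<xi> \<phi> v) (t, x)) - (u t x \<bullet> dx (u t x) (wave \<theta> \<xi> \<phi> v) (t, x)) - \<nu> * (u t x \<bullet> laplace_x (wave \<theta> \<xi> \<phi> v) (t, x))))
     - p (div_x (wave \<theta> \<xi> \<phi> v)) = f (wave \<theta> \<xi> \<phi> v)"
    using p(2) ts unfolding momentum_eq_def by blast
  ultimately show ?thesis using p0 by simp
qed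

lemma divergence_wave:
  assumes L: "0 < L" and d: "divergence_free L u"
    and th: "tower \<theta>" "0 < a" "\<And>t. t \<notin> {a..b} \<Longrightarrow> \<theta> 0 t = 0"
    and \<xi>: "\<xi> = (2 * pi / L) *\<^sub>R freq k"
  shows "(LBINT t:{0<..}. \<theta> 0 t * al L (u t) \<xi> \<phi> \<xi>) = 0"
proof -
  \<comment> \<open>The phase is lowered by pi/2 because differentiation in space raises it by
    pi/2.\<close>
  have ts: "wave \<theta> \<xi> (\<phi> - pi / 2) (1::real) \<in> test_space L" unfolding \<xi>(1) by (rule wave_test[OF th(1) L th(2,3)])
  have "dx (u t x) (wave \<theta> \<xi> (\<phi> - pi / 2) (1::real)) (t, x) = \<theta> 0 t * (cos (\<xi> \<bullet> x + \<phi>) * (u t x \<bullet> \<xi>))" for t x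
    unfolding dx_wave[OF th(1)] wave_def by (simp add: inner_commute)
  then have "(LINT x|torus L. dx (u t x) (wave \<theta> \<xi> (\<phi> - pi / 2) (1::real)) (t, x)) = \<theta> 0 t * al L (u t) \<xi> \<phi> \<xi>" for t
    by (simp add: al_def)
  moreover have "(LBINT t:{0<..}. (LINT x|torus L. dx (u t x) (wave \<theta> \<xi> (\<phi> - pi / 2) (1::real)) (t, x))) = 0"
    using d ts unfolding divergence_free_def by blast
  ultimately show ?thesis by simp
qed

section \<open>Littlewood-Paley blocks\<close>

definition uc :: "(real^3 \<Rightarrow> real^3) \<Rightarrow> 3 \<Rightarrow> real^3 \<Rightarrow> complex" where
  "uc g i x = complex_of_real (g x $ i)"

lemma fourier_coeff_fc: "fourier_coeff L g k $ i = fc L (uc g i) k"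
  by (simp add: fourier_coeff_def fc_def ek_minus uc_def[abs_def])

lemma cnj_fc_uc: "cnj (fc L (uc g i) k) = fc L (uc g i) (- k)"
proof -
  have "cnj (LINT x|torus L. uc g i x * ek L (- k) x) = (LINT x|torus L. cnj (uc g i x * ek L (- k) x))"
    by (rule Bochner_Integration.integral_cnj[symmetric])
  then show ?thesis by (simp add: fc_def uc_def cnj_ek)
qed

locale cutoff =
  fixes \<eta> :: "real^3 \<Rightarrow> real"
  assumes eta: "lp_cutoff \<eta>"
begin

lemma eta_smooth: "smooth_fun \<eta>" and eta_one: "norm \<xi> \<le> 3/4 \<Longrightarrow> \<eta> \<xi> = 1" and eta_zero: "1 \<le> norm \<xi> \<Longrightarrow> \<eta> \<xi> = 0"
  and eta_nonneg: "0 \<le> \<eta> \<xi>"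
  using eta unfolding lp_cutoff_def by blast+

lemma eta_continuous: "continuous_on UNIV \<eta>"
proof -
  have "\<eta> differentiable_on UNIV" using eta_smooth unfolding smooth_fun_def by (metis iter_dderiv.simps(1))
  then show ?thesis by (rule differentiable_imp_continuous_on)
qed

lemma eta_bounded: "\<exists>M. \<forall>\<xi>. \<eta> \<xi> \<le> M"
proof -
  have "compact (\<eta> ` cball 0 1)" by (intro compact_continuous_image continuous_on_subset[OF eta_continuous]) auto
  then have "bounded (\<eta> ` cball 0 1)" by (rule compact_imp_bounded)
  then obtain M where "\<forall>y\<in>\<eta> ` cball 0 1. norm y \<le> M" by (auto simp: bounded_iff)
  then have "\<eta> \<xi> \<le> max M 0" for \<xi> using eta_zero[of \<xi>] by (cases "norm \<xi> \<le> 1") force+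
  then show ?thesis by blast
qed

text \<open>The definition of the cutoff states no upper bound in the transition region 3/4 <
  |\<xi>| < 1; compactness supplies one.\<close>

definition "M = (SOME M. 1 \<le> M \<and> (\<forall>\<xi>. \<eta> \<xi> \<le> M))"

lemma M: "1 \<le> M" "\<eta> \<xi> \<le> M"
proof -
  obtain M' where M': "\<And>\<xi>. \<eta> \<xi> \<le> M'" using eta_bounded by blast
  have "1 \<le> max 1 M' \<and> (\<forall>\<xi>. \<eta> \<xi> \<le> max 1 M')" using M' by (auto simp: le_max_iff_disj)
  then have "1 \<le> M \<and> (\<forall>\<xi>. \<eta> \<xi> \<le> M)" unfolding M_def by (rule someI)
  then show "1 \<le> M" "\<eta> \<xi> \<le> M" by auto
qed

text \<open>The multiplier of a partial sum. The blocks telescope, and the sum up to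
  \<open>n\<close> has multiplier \<open>low (Suc n)\<close>, which equals 1 up to 3/4 * 2^(n+1),
  that is, slightly beyond 2^n.\<close>

definition low :: "nat \<Rightarrow> real^3 \<Rightarrow> real" where "low n \<xi> = \<eta> ((1 / 2 ^ n) *\<^sub>R \<xi>)"

lemma low_one: "norm \<xi> \<le> 3/4 * 2 ^ n \<Longrightarrow> low n \<xi> = 1"
  unfolding low_def by (rule eta_one) (simp add: field_simps)

lemma low_zero: "2 ^ n \<le> norm \<xi> \<Longrightarrow> low n \<xi> = 0"
  unfolding low_def by (rule eta_zero) (simp add: field_simps)

lemma low_bounds: "0 \<le> low n \<xi>" "low n \<xi> \<le> M"
  unfolding low_def by (rule eta_nonneg, rule M(2))

lemma lp_mult_nat: "lp_mult \<eta> (int p) \<xi> = low (Suc p) \<xi> - low p \<xi>"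
proof -
  have "int p \<noteq> -1" by simp
  moreover have "(2::real) powi (- int p) = 1 / 2 ^ p" by (simp add: power_int_minus inverse_eq_divide)
  moreover have "(1 / 2) *\<^sub>R (1 / 2 ^ p) *\<^sub>R \<xi> = (1 / 2 ^ Suc p) *\<^sub>R \<xi>" by simp
  ultimately show ?thesis unfolding lp_mult_def low_def Let_def by (simp only: if_False)
qed

lemma lp_mult_m1: "lp_mult \<eta> (-1) \<xi> = low 0 \<xi>"
  by (simp add: lp_mult_def low_def)

lemma sum_lp_mult: "(\<Sum>p\<in>{-1..int n}. lp_mult \<eta> p \<xi>) = low (Suc n) \<xi>"
proof (induction n)
  case 0
  have "{-1..int 0} = {-1, 0}" by auto
  then show ?case using lp_mult_nat[of 0] by (simp add: lp_mult_m1)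
next
  case (Suc n)
  have "{-1..int (Suc n)} = insert (int (Suc n)) {-1..int n}" by auto
  then have "(\<Sum>p\<in>{-1..int (Suc n)}. lp_mult \<eta> p \<xi>) = lp_mult \<eta> (int (Suc n)) \<xi> + low (Suc n) \<xi>"
    using Suc by simp
  then show ?case by (simp only: lp_mult_nat)
qed

lemma lp_mult_support:
  assumes "lp_mult \<eta> (int p) \<xi> \<noteq> 0" shows "3/4 * 2 ^ p \<le> norm \<xi>" "norm \<xi> \<le> 2 * 2 ^ p"
proof -
  show "3/4 * 2 ^ p \<le> norm \<xi>"
  proof (rule ccontr)
    assume n: "\<not> ?thesis"
    then have "norm \<xi> \<le> 3/4 * 2 ^ p" by simp
    moreover from this have "norm \<xi> \<le> 3/4 * 2 ^ Suc p" by (rule order_trans) simp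
    ultimately have "low (Suc p) \<xi> = 1" "low p \<xi> = 1" by (auto simp only: low_one)
    then show False using assms by (simp add: lp_mult_nat)
  qed
  show "norm \<xi> \<le> 2 * 2 ^ p"
  proof (rule ccontr)
    assume "\<not> ?thesis"
    then have n: "2 ^ Suc p \<le> norm \<xi>" by simp
    have "2 ^ p \<le> norm \<xi>" by (rule order_trans[OF _ n]) simp
    with n have "low (Suc p) \<xi> = 0" "low p \<xi> = 0" by (auto simp only: low_zero)
    then show False using assms by (simp add: lp_mult_nat)
  qed
qed

lemma lp_mult_cases: "-1 \<le> q \<Longrightarrow> q = -1 \<or> (\<exists>p. q = int p)"
  using zero_le_imp_eq_int[of q] by (cases "q = -1") auto

lemma lp_mult_bound: assumes "-1 \<le> q" shows "(lp_mult \<eta> q \<xi>)\<^sup>2 \<le> M\<^sup>2"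
proof -
  have "\<bar>lp_mult \<eta> q \<xi>\<bar> \<le> M"
    using lp_mult_cases[OF assms]
  proof
    assume "q = -1"
    then show ?thesis using low_bounds[of 0 \<xi>] by (simp add: lp_mult_m1)
  next
    assume "\<exists>p. q = int p"
    then obtain p where "q = int p" by blast
    then show ?thesis using low_bounds[of p \<xi>] low_bounds[of "Suc p" \<xi>] unfolding lp_mult_nat by (auto simp: lp_mult_nat)
  qed
  then have "\<bar>lp_mult \<eta> q \<xi>\<bar>\<^sup>2 \<le> M\<^sup>2" by (intro power_mono) auto
  then show ?thesis by (simp only: power2_abs)
qed

definition bl :: "int \<Rightarrow> (int^3) set" where "bl q = {k. norm (freq k) \<le> 2 * 2 powi q}"

lemma finite_bl [simp]: "finite (bl q)" by (simp add: bl_def)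

lemma bl_nat: "bl (int p) = {k. norm (freq k) \<le> 2 * 2 ^ p}" by (simp add: bl_def)

lemma lp_mult_outside: assumes "-1 \<le> q" "k \<notin> bl q" shows "lp_mult \<eta> q (freq k) = 0"
proof -
  from lp_mult_cases[OF assms(1)] show ?thesis
  proof
    assume q: "q = -1"
    then have "1 \<le> norm (freq k)" using assms(2) by (simp add: bl_def)
    then show ?thesis using low_zero[of 0 "freq k"] q by (simp add: lp_mult_m1)
  next
    assume "\<exists>p. q = int p"
    then obtain p where p: "q = int p" by blast
    then show ?thesis using lp_mult_support(2)[of p "freq k"] assms(2) by (auto simp: bl_nat)
  qed
qed

text \<open>The multiplier vanishes outside \<open>bl q\<close>, so the infinite sum is a finite one
  and the block is a trigonometric polynomial.\<close>

lemma lp_block_nth: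
  assumes "-1 \<le> q"
  shows "lp_block \<eta> L g q x $ i = tp L (bl q) (\<lambda>k. complex_of_real (lp_mult \<eta> q (freq k)) * fc L (uc g i) k) x"
proof -
  have "lp_block \<eta> L g q x = (\<Sum>k\<in>bl q. (complex_of_real (lp_mult \<eta> q (freq k)) * ek L k x) *s fourier_coeff L g k)"
    unfolding lp_block_def ek_def[symmetric]
    by (subst infsum_finite[symmetric], simp) (rule infsum_cong_neutral, auto simp: lp_mult_outside[OF assms])
  then show ?thesis by (simp add: tp_def sum_component fourier_coeff_fc mult_ac)
qed

lemma lp_low_nth:
  "lp_low \<eta> L g (enat n) x $ i = tp L (bl (int n)) (\<lambda>k. complex_of_real (low (Suc n) (freq k)) * fc L (uc g i) k) x"
proof -
  have sub: "bl p \<subseteq> bl (int n)" if "p \<in> {-1..int n}" for p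
  proof -
    have "(2::real) powi p \<le> 2 powi (int n)" using that by (intro power_int_increasing) auto
    then show ?thesis by (auto simp: bl_def)
  qed
  have "lp_low \<eta> L g (enat n) x $ i = (\<Sum>p\<in>{-1..int n}. tp L (bl p) (\<lambda>k. complex_of_real (lp_mult \<eta> p (freq k)) * fc L (uc g i) k) x)"
    by (simp add: lp_low_def sum_component lp_block_nth)
  also have "\<dots> = (\<Sum>p\<in>{-1..int n}. tp L (bl (int n)) (\<lambda>k. complex_of_real (lp_mult \<eta> p (freq k)) * fc L (uc g i) k) x)"
    unfolding tp_def using sub by (intro sum.cong refl sum.mono_neutral_left) (auto simp: lp_mult_outside)
  also have "\<dots> = tp L (bl (int n)) (\<lambda>k. complex_of_real (\<Sum>p\<in>{-1..int n}. lp_mult \<eta> p (freq k)) * fc L (uc g i) k) x"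
    unfolding tp_def by (subst sum.swap) (simp add: sum_distrib_right)
  finally show ?thesis by (simp only: sum_lp_mult)
qed

lemma lp_block_measurable [measurable]: assumes "-1 \<le> q" shows "lp_block \<eta> L g q \<in> borel_measurable (torus L')"
proof -
  have "continuous_on UNIV (\<lambda>x. \<chi> i. lp_block \<eta> L g q x $ i)"
    unfolding lp_block_nth[OF assms] by (intro continuous_on_vec_lambda continuous_tp)
  then show ?thesis by (intro continuous_measurable_torus) simp
qed

text \<open>A component is pointwise bounded by the vector. \<open>Lr_bound\<close> normalises by
  the volume, which contributes the factor L^(-3/r), and 2/3 of \<open>three_over r\<close> is its
  parameter \<theta> = 2/r.\<close>

lemma Lr_norm_block:
  assumes L: "0 < L" and q: "-1 \<le> q" and r: "2 \<le> r" and R: "Lr_norm L r (lp_block \<eta> L g q) \<le> R" "0 < R"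
  shows "Lr_bound L (2/3 * three_over r) (R * L powr (- three_over r))
    (tp L (bl q) (\<lambda>k. complex_of_real (lp_mult \<eta> q (freq k)) * fc L (uc g i) k))"
proof -
  let ?B = "lp_block \<eta> L g q"
  let ?c = "tp L (bl q) (\<lambda>k. complex_of_real (lp_mult \<eta> q (freq k)) * fc L (uc g i) k)"
  have comp: "cmod (?c x) \<le> norm (?B x)" for x
    unfolding lp_block_nth[OF q, symmetric] by (rule Finite_Cartesian_Product.norm_nth_le)
  note [measurable] = lp_block_measurable[OF q]
  obtain K where K: "\<And>x. norm (?B x) \<le> K"
  proof
    fix x
    have "norm (?B x) \<le> (\<Sum>i\<in>UNIV. cmod (?B x $ i))" unfolding norm_vec_def by (rule L2_set_le_sum) simp
    also have "\<dots> \<le> (\<Sum>i\<in>UNIV. \<Sum>k\<in>bl q. cmod (complex_of_real (lp_mult \<eta> q (freq k)) * fc L (uc g i) k))"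
      unfolding lp_block_nth[OF q] by (intro sum_mono norm_tp_le)
    finally show "norm (?B x) \<le> (\<Sum>i\<in>UNIV. \<Sum>k\<in>bl q. cmod (complex_of_real (lp_mult \<eta> q (freq k)) * fc L (uc g i) k))" .
  qed
  show ?thesis
  proof (cases "r = \<infinity>")
    case True
    have ae: "AE x in torus L. ereal (norm (?B x)) \<le> esssup (torus L) (\<lambda>x. ereal (norm (?B x)))"
      by (rule esssup_AE)
    have "esssup (torus L) (\<lambda>x. ereal (norm (?B x))) \<le> ereal K"
      by (rule esssup_I) (use K in auto)
    \<comment> \<open>\<open>real_of_ereal\<close> sends infinity to 0, so the essential supremum
      must be known to be finite before its real value bounds anything.\<close>
    then have fin: "esssup (torus L) (\<lambda>x. ereal (norm (?B x))) \<noteq> \<infinity>" by auto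
    have "AE x in torus L. cmod (?c x) \<le> R"
      using ae
    proof eventually_elim
      case (elim x)
      have "norm (?B x) \<le> real_of_ereal (esssup (torus L) (\<lambda>x. ereal (norm (?B x))))"
        using elim fin by (cases "esssup (torus L) (\<lambda>x. ereal (norm (?B x)))") auto
      also have "\<dots> \<le> R" using R True by (simp add: Lr_norm_def)
      finally show ?case using comp[of x] by simp
    qed
    then show ?thesis using True L by (simp add: Lr_bound_def three_over_def)
  next
    case False
    then obtain \<rho> where rho: "r = ereal \<rho>" "2 \<le> \<rho>" using r by (cases r) auto
    have t: "three_over r = 3 / \<rho>" using rho by (simp add: three_over_def numeral_eq_ereal)
    have int: "integrable (torus L) (\<lambda>x. norm (?B x) powr \<rho>)"
      by (rule bounded_integrable_torus[OF L, of _ "K powr \<rho>"]) (use K rho in \<open>auto intro!: powr_mono2\<close>)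
    let ?I = "LINT x|torus L. norm (?B x) powr \<rho>"
    have I0: "0 \<le> ?I" by simp
    have "?I powr (1 / \<rho>) \<le> R" using R rho by (simp add: Lr_norm_def)
    then have "(?I powr (1 / \<rho>)) powr \<rho> \<le> R powr \<rho>" using rho by (intro powr_mono2) auto
    then have I: "?I \<le> R powr \<rho>" using rho I0 by (simp add: powr_powr)
    have "(LINT x|torus L. cmod (?c x) powr \<rho>) \<le> ?I"
    proof (rule integral_mono[OF _ int])
      have "cmod (?c x) \<le> K" for x using comp K order_trans by blast
      then show "integrable (torus L) (\<lambda>x. cmod (?c x) powr \<rho>)"
        by (intro bounded_integrable_torus[OF L, of _ "K powr \<rho>"]) (use rho in \<open>auto intro!: powr_mono2\<close>)
      show "cmod (?c x) powr \<rho> \<le> norm (?B x) powr \<rho>" for x using comp rho by (intro powr_mono2) auto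
    qed
    also have "\<dots> \<le> R powr \<rho>" by (rule I)
    also have "\<dots> = L^3 * (R * L powr (- (3 / \<rho>))) powr \<rho>"
    proof -
      have "(R * L powr (- (3 / \<rho>))) powr \<rho> = R powr \<rho> * L powr (- 3)"
        using R L rho by (simp add: powr_mult powr_powr)
      then show ?thesis using L by (simp add: powr_minus)
    qed
    finally show ?thesis unfolding Lr_bound_def t using rho(2) by simp
  qed
qed

lemma L2_norm_block:
  assumes L: "0 < L" and q: "-1 \<le> q"
  shows "(Lr_norm L 2 (lp_block \<eta> L g q))\<^sup>2 = L^3 * (\<Sum>i\<in>UNIV. \<Sum>k\<in>bl q. (lp_mult \<eta> q (freq k))\<^sup>2 * (cmod (fc L (uc g i) k))\<^sup>2)"
proof -
  let ?B = "lp_block \<eta> L g q"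
  have "real_of_ereal 2 = 2" by (subst numeral_eq_ereal) simp
  then have "Lr_norm L 2 ?B = (LINT x|torus L. norm (?B x) powr 2) powr (1 / 2)" by (simp add: Lr_norm_def)
  also have "\<dots> = sqrt (LINT x|torus L. (norm (?B x))\<^sup>2)"
    by (simp add: powr_half_sqrt)
  finally have "(Lr_norm L 2 ?B)\<^sup>2 = (LINT x|torus L. (norm (?B x))\<^sup>2)" by simp
  also have "\<dots> = (LINT x|torus L. (\<Sum>i\<in>UNIV. (cmod (?B x $ i))\<^sup>2))"
    by (simp add: norm_vec_def L2_set_def sum_nonneg)
  also have "\<dots> = (\<Sum>i\<in>UNIV. LINT x|torus L. (cmod (?B x $ i))\<^sup>2)"
    unfolding lp_block_nth[OF q] by (rule Bochner_Integration.integral_sum) (intro L2c_int L2c_tp L)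
  also have "\<dots> = L^3 * (\<Sum>i\<in>UNIV. \<Sum>k\<in>bl q. (lp_mult \<eta> q (freq k))\<^sup>2 * (cmod (fc L (uc g i) k))\<^sup>2)"
    unfolding lp_block_nth[OF q] parseval_tp[OF L finite_bl] by (simp add: norm_mult power_mult_distrib sum_distrib_left)
  finally show ?thesis .
qed

text \<open>At a frequency of level a the multipliers of the blocks a and a + 1 add up to 1, so
  their squares add up to at least 1/2. This is the nontrivial half of the equivalence of block sums
  with weighted sums over single frequencies.\<close>

lemma low_frequency_gap:
  assumes "k \<noteq> 0" shows "(norm (freq k))\<^sup>2 \<le> 16 * (\<Sum>p\<in>{lev k, Suc (lev k)}. 4 ^ p * (lp_mult \<eta> (int p) (freq k))\<^sup>2)"
proof -
  let ?a = "lev k"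
  have b: "2 ^ ?a \<le> norm (freq k)" "norm (freq k) < 2 * 2 ^ ?a" using lev_bounds[OF assms] by auto
  have "low (Suc (Suc ?a)) (freq k) = 1" by (rule low_one) (use b in simp)
  moreover have "low ?a (freq k) = 0" by (rule low_zero[OF b(1)])
  ultimately have s: "lp_mult \<eta> (int ?a) (freq k) + lp_mult \<eta> (int (Suc ?a)) (freq k) = 1"
    by (simp only: lp_mult_nat)
  have "(norm (freq k))\<^sup>2 \<le> (2 * 2 ^ ?a)\<^sup>2" using b by (intro power_mono) auto
  also have "\<dots> = 4 * 4 ^ ?a" by (simp add: power_mult_distrib power2_eq_square flip: power_mult_distrib)
  finally have n: "(norm (freq k))\<^sup>2 \<le> 4 * 4 ^ ?a" .
  define X Y where "X = lp_mult \<eta> (int ?a) (freq k)" and "Y = lp_mult \<eta> (int (Suc ?a)) (freq k)"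
  have "1 \<le> 2 * (X\<^sup>2 + Y\<^sup>2)"
  proof -
    have "(X + Y)\<^sup>2 \<le> 2 * (X\<^sup>2 + Y\<^sup>2)" using sum_squares_bound[of X Y] by (simp add: power2_sum)
    then show ?thesis using s by (simp add: X_def Y_def)
  qed
  then have "1 \<le> 4 * (X\<^sup>2 + 4 * Y\<^sup>2)"
  proof -
    have aux: "1 \<le> 4 * (a + 4 * b)" if "1 \<le> 2 * (a + b)" "0 \<le> a" "0 \<le> b" for a b :: real
      using that by (simp add: distrib_left)
    show ?thesis by (rule aux[OF \<open>1 \<le> 2 * (X\<^sup>2 + Y\<^sup>2)\<close> zero_le_power2 zero_le_power2])
  qed
  then have "4 * 4 ^ ?a * 1 \<le> 4 * 4 ^ ?a * (4 * (X\<^sup>2 + 4 * Y\<^sup>2))"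
    by (intro mult_left_mono) simp_all
  also have "\<dots> = 16 * (4 ^ ?a * X\<^sup>2 + 4 ^ Suc ?a * Y\<^sup>2)" by (simp add: algebra_simps)
  finally show ?thesis using n by (simp add: X_def Y_def)
qed

lemma lam_sq: "0 < L \<Longrightarrow> lam L (int p) powr 2 = 4 ^ p / L\<^sup>2"
  by (simp add: lam_def powr_numeral power_divide power2_eq_square flip: power_mult_distrib)

text \<open>Each frequency is charged to its two blocks; after exchanging the sums, \<open>F\<close>
  can be enlarged to full blocks.\<close>

lemma H1_bound:
  assumes L: "0 < L" and s: "in_Hs \<eta> L 1 g" and F: "finite F" "0 \<notin> F"
  shows "(\<Sum>k\<in>F. (norm (freq k))\<^sup>2 * (\<Sum>i\<in>UNIV. (cmod (fc L (uc g i) k))\<^sup>2)) \<le> 16 / L * (Hs_norm \<eta> L 1 g)\<^sup>2"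
proof -
  define e where "e k = (\<Sum>i\<in>UNIV. (cmod (fc L (uc g i) k))\<^sup>2)" for k
  have e0: "0 \<le> e k" for k by (simp add: e_def sum_nonneg)
  define P where "P = {p. p \<le> Suc (Max (insert 0 (lev ` F)))}"
  have Pf: "finite P" by (simp add: P_def)
  have pk: "{lev k, Suc (lev k)} \<subseteq> P" if "k \<in> F" for k
  proof -
    have "lev k \<le> Max (insert 0 (lev ` F))" by (rule Max_ge) (use that F in auto)
    then show ?thesis by (simp add: P_def)
  qed
  have "(\<Sum>k\<in>F. (norm (freq k))\<^sup>2 * e k) \<le> (\<Sum>k\<in>F. (16 * (\<Sum>p\<in>P. 4 ^ p * (lp_mult \<eta> (int p) (freq k))\<^sup>2)) * e k)"
  proof (intro sum_mono mult_right_mono e0)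
    fix k assume k: "k \<in> F"
    then have "(norm (freq k))\<^sup>2 \<le> 16 * (\<Sum>p\<in>{lev k, Suc (lev k)}. 4 ^ p * (lp_mult \<eta> (int p) (freq k))\<^sup>2)"
      using F by (intro low_frequency_gap) auto
    also have "\<dots> \<le> 16 * (\<Sum>p\<in>P. 4 ^ p * (lp_mult \<eta> (int p) (freq k))\<^sup>2)"
      by (intro mult_left_mono sum_mono2 Pf pk k) auto
    finally show "(norm (freq k))\<^sup>2 \<le> 16 * (\<Sum>p\<in>P. 4 ^ p * (lp_mult \<eta> (int p) (freq k))\<^sup>2)" .
  qed
  also have "\<dots> = 16 * (\<Sum>p\<in>P. 4 ^ p * (\<Sum>k\<in>F. (lp_mult \<eta> (int p) (freq k))\<^sup>2 * e k))"
    unfolding sum_distrib_left sum_distrib_right by (subst sum.swap) (simp add: mult_ac)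
  also have "\<dots> \<le> 16 * (\<Sum>p\<in>P. 4 ^ p * (\<Sum>k\<in>bl (int p). (lp_mult \<eta> (int p) (freq k))\<^sup>2 * e k))"
  proof (intro mult_left_mono sum_mono)
    fix p
    have "(\<Sum>k\<in>F. (lp_mult \<eta> (int p) (freq k))\<^sup>2 * e k) = (\<Sum>k\<in>F \<inter> bl (int p). (lp_mult \<eta> (int p) (freq k))\<^sup>2 * e k)"
      using F by (intro sum.mono_neutral_right) (auto simp: lp_mult_outside)
    also have "\<dots> \<le> (\<Sum>k\<in>bl (int p). (lp_mult \<eta> (int p) (freq k))\<^sup>2 * e k)"
      using e0 by (intro sum_mono2) auto
    finally show "(\<Sum>k\<in>F. (lp_mult \<eta> (int p) (freq k))\<^sup>2 * e k) \<le> (\<Sum>k\<in>bl (int p). (lp_mult \<eta> (int p) (freq k))\<^sup>2 * e k)" .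
  qed auto
  also have "\<dots> = 16 * (\<Sum>p\<in>P. Hs_term \<eta> L 1 g (int p) / L)"
  proof -
    have "4 ^ p * (\<Sum>k\<in>bl (int p). (lp_mult \<eta> (int p) (freq k))\<^sup>2 * e k) = Hs_term \<eta> L 1 g (int p) / L" for p
    proof -
      have "(\<Sum>k\<in>bl (int p). (lp_mult \<eta> (int p) (freq k))\<^sup>2 * e k)
         = (\<Sum>i\<in>UNIV. \<Sum>k\<in>bl (int p). (lp_mult \<eta> (int p) (freq k))\<^sup>2 * (cmod (fc L (uc g i) k))\<^sup>2)"
        unfolding e_def sum_distrib_left by (rule sum.swap)
      then have "Hs_term \<eta> L 1 g (int p) = (4 ^ p / L\<^sup>2) * (L^3 * (\<Sum>k\<in>bl (int p). (lp_mult \<eta> (int p) (freq k))\<^sup>2 * e k))"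
        using L2_norm_block[OF L, of "int p" g] lam_sq[OF L, of p] by (simp add: Hs_term_def)
      then show ?thesis using L by (simp add: power2_eq_square power3_eq_cube)
    qed
    then show ?thesis by simp
  qed
  also have "\<dots> = 16 / L * (\<Sum>q\<in>int ` P. Hs_term \<eta> L 1 g q)"
    by (subst sum.reindex) (auto simp: sum_distrib_left sum_divide_distrib)
  also have "\<dots> \<le> 16 / L * (\<Sum>\<^sub>\<infinity>q\<in>{-1..}. Hs_term \<eta> L 1 g q)"
  proof -
    have sm: "Hs_term \<eta> L 1 g summable_on {-1..}" using s by (simp add: in_Hs_def)
    have "0 \<le> Hs_term \<eta> L 1 g q" for q by (simp add: Hs_term_def)
    then show ?thesis using L Pf
      by (intro mult_left_mono finite_sum_le_infsum[OF sm]) auto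
  qed
  also have "(\<Sum>\<^sub>\<infinity>q\<in>{-1..}. Hs_term \<eta> L 1 g q) = (Hs_norm \<eta> L 1 g)\<^sup>2"
    unfolding Hs_norm_def by (subst real_sqrt_pow2) (auto intro!: infsum_nonneg simp: Hs_term_def)
  finally show ?thesis by (simp add: e_def)
qed

text \<open>A divergent sum has the value 0, which is covered by \<open>0 \<le> B\<close>.\<close>

lemma infsum_le_bound:
  fixes f :: "'a \<Rightarrow> real"
  assumes "\<And>x. x \<in> A \<Longrightarrow> 0 \<le> f x" "\<And>F. finite F \<Longrightarrow> F \<subseteq> A \<Longrightarrow> sum f F \<le> B" "0 \<le> B"
  shows "infsum f A \<le> B"
proof (cases "f summable_on A")
  case True then show ?thesis using assms(2) by (intro infsum_le_finite_sums) auto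
next
  case False then show ?thesis using assms(3) by (simp add: infsum_not_exists)
qed

text \<open>On block \<open>q\<close> the norm of \<open>k\<close> is at most 2 * 2^q, so the energy
  with weight 1/|k| controls the squared norm of the block up to a factor of order 2^q. Against the
  power -5/2 of \<open>lam L q\<close> this leaves the summable 2^(-3q/2).\<close>

lemma Hs_neg_bound:
  assumes L: "0 < L" and E: "0 \<le> E" and z: "\<And>i. fc L (uc g i) 0 = 0"
    and b: "\<And>F. finite F \<Longrightarrow> 0 \<notin> F \<Longrightarrow> (\<Sum>k\<in>F. (\<Sum>i\<in>UNIV. (cmod (fc L (uc g i) k))\<^sup>2) / norm (freq k)) \<le> E"
  shows "(Hs_norm \<eta> L (-5/4) g)\<^sup>2 \<le> 24 * M\<^sup>2 * L^3 * L powr (5/2) * E"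
proof -
  define e where "e k = (\<Sum>i\<in>UNIV. (cmod (fc L (uc g i) k))\<^sup>2)" for k
  have e0: "0 \<le> e k" for k by (simp add: e_def sum_nonneg)
  have ez: "e 0 = 0" by (simp add: e_def z)
  define \<rho> where "\<rho> = (2::real) powr (-3/2)"
  have rho: "0 \<le> \<rho>" "\<rho> \<le> 1/2"
  proof -
    have "\<rho> \<le> 2 powr (-1)" unfolding \<rho>_def by (intro powr_mono) auto
    then show "\<rho> \<le> 1/2" by (simp add: powr_minus)
  qed (simp add: \<rho>_def)
  let ?C = "2 * M\<^sup>2 * L^3 * L powr (5/2) * E"
  have C: "0 \<le> ?C" using E L by simp
  have t: "Hs_term \<eta> L (-5/4) g q \<le> ?C * (2 powr (3/2) * \<rho> ^ nat (q + 1))" if q: "-1 \<le> q" for q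
  proof -
    have "(\<Sum>i\<in>UNIV. \<Sum>k\<in>bl q. (lp_mult \<eta> q (freq k))\<^sup>2 * (cmod (fc L (uc g i) k))\<^sup>2)
       = (\<Sum>k\<in>bl q. (lp_mult \<eta> q (freq k))\<^sup>2 * e k)"
      unfolding e_def sum_distrib_left by (rule sum.swap)
    also have "\<dots> \<le> (\<Sum>k\<in>bl q. M\<^sup>2 * e k)"
      by (intro sum_mono mult_right_mono lp_mult_bound q e0)
    also have "\<dots> = M\<^sup>2 * (\<Sum>k\<in>bl q - {0}. e k)"
      unfolding sum_distrib_left by (rule sum.mono_neutral_right) (auto simp: ez)
    also have "\<dots> \<le> M\<^sup>2 * (\<Sum>k\<in>bl q - {0}. (2 * 2 powi q) * (e k / norm (freq k)))"
    proof (intro mult_left_mono sum_mono)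
      fix k assume k: "k \<in> bl q - {0}"
      then have n: "0 < norm (freq k)" "norm (freq k) \<le> 2 * 2 powi q" by (auto simp: bl_def)
      have "e k = norm (freq k) * (e k / norm (freq k))" using n by simp
      also have "\<dots> \<le> (2 * 2 powi q) * (e k / norm (freq k))" using n e0 by (intro mult_right_mono) auto
      finally show "e k \<le> (2 * 2 powi q) * (e k / norm (freq k))" .
    qed simp
    also have "\<dots> \<le> M\<^sup>2 * ((2 * 2 powi q) * E)"
      unfolding sum_distrib_left[symmetric] using b[of "bl q - {0}"] by (intro mult_left_mono) (auto simp: e_def)
    finally have "Hs_term \<eta> L (-5/4) g q \<le> lam L q powr (-5/2) * (L^3 * (M\<^sup>2 * ((2 * 2 powi q) * E)))"
      unfolding Hs_term_def L2_norm_block[OF L q] using L by (simp add: mult_left_mono)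
    also have "lam L q powr (-5/2) = 2 powr (-5/2 * real_of_int q) * L powr (5/2)"
    proof -
      have e: "lam L q = 2 powr real_of_int q * L powr (-1)"
        using L by (simp add: lam_def powr_real_of_int' powr_minus divide_inverse)
      show ?thesis unfolding e powr_mult powr_powr by (simp add: mult.commute)
    qed
    also have "2 powr (-5/2 * real_of_int q) * L powr (5/2) * (L^3 * (M\<^sup>2 * ((2 * 2 powi q) * E))) = ?C * (2 powr (3/2) * \<rho> ^ nat (q + 1))"
    proof -
      have "\<rho> ^ nat (q + 1) = 2 powr (-3/2 * (real_of_int q + 1))"
        unfolding \<rho>_def using q by (simp add: powr_power mult.commute)
      then have "2 powr (3/2) * \<rho> ^ nat (q + 1) = 2 powr (-3/2 * real_of_int q)"
        by (simp add: distrib_left flip: powr_add)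
      moreover have "2 powr (-5/2 * real_of_int q) * 2 powi q = (2::real) powr (-3/2 * real_of_int q)"
        by (simp add: powr_real_of_int'[symmetric] flip: powr_add)
      ultimately show ?thesis by (simp add: mult_ac)
    qed
    finally show ?thesis .
  qed
  have "(\<Sum>\<^sub>\<infinity>q\<in>{-1..}. Hs_term \<eta> L (-5/4) g q) \<le> 12 * ?C"
  proof (rule infsum_le_bound)
    fix F :: "int set" assume F: "finite F" "F \<subseteq> {-1..}"
    have "sum (Hs_term \<eta> L (-5/4) g) F \<le> (\<Sum>q\<in>F. ?C * (2 powr (3/2) * \<rho> ^ nat (q + 1)))"
      using F by (intro sum_mono t) auto
    also have "\<dots> = ?C * (2 powr (3/2) * (\<Sum>q\<in>F. \<rho> ^ nat (q + 1)))" by (simp add: sum_distrib_left)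
    also have "(\<Sum>q\<in>F. \<rho> ^ nat (q + 1)) = (\<Sum>n\<in>(\<lambda>q. nat (q + 1)) ` F. \<rho> ^ n)"
    proof -
      have "inj_on (\<lambda>q. nat (q + 1)) F"
      proof (rule inj_onI)
        fix x y assume "x \<in> F" "y \<in> F" "nat (x + 1) = nat (y + 1)"
        moreover from this have "-1 \<le> x" "-1 \<le> y" using F by auto
        ultimately show "x = y" by linarith
      qed
      then show ?thesis by (simp add: sum.reindex)
    qed
    also have "?C * (2 powr (3/2) * (\<Sum>n\<in>(\<lambda>q. nat (q + 1)) ` F. \<rho> ^ n)) \<le> ?C * (2 powr 2 * 2)"
    proof (intro mult_left_mono mult_mono C)
      show "(2::real) powr (3/2) \<le> 2 powr 2" by (intro powr_mono) auto
      have "(\<Sum>n\<in>(\<lambda>q. nat (q + 1)) ` F. \<rho> ^ n) \<le> 1 / (1 - \<rho>)"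
        by (rule geometric_sum_le) (use rho F in auto)
      also have "\<dots> \<le> 2" using rho by (simp add: divide_le_eq)
      finally show "(\<Sum>n\<in>(\<lambda>q. nat (q + 1)) ` F. \<rho> ^ n) \<le> 2" .
    qed (use rho in \<open>auto intro!: sum_nonneg\<close>)
    also have "\<dots> \<le> 12 * ?C" using mult_right_mono[OF _ C, of 8 12] by simp
    finally show "sum (Hs_term \<eta> L (-5/4) g) F \<le> 12 * ?C" .
  qed (use C in \<open>auto simp: Hs_term_def\<close>)
  moreover have "(Hs_norm \<eta> L (-5/4) g)\<^sup>2 = (\<Sum>\<^sub>\<infinity>q\<in>{-1..}. Hs_term \<eta> L (-5/4) g q)"
    unfolding Hs_norm_def by (subst real_sqrt_pow2) (auto intro!: infsum_nonneg simp: Hs_term_def)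
  ultimately show ?thesis by simp
qed

end

section \<open>The gradient of the low part and the data contained in the wavenumber\<close>

lemma ek_has_derivative:
  "(ek L k has_derivative (\<lambda>h. ek L k x * (\<i> * complex_of_real (2 * pi / L * (freq k \<bullet> h))))) (at x)"
proof -
  have 1: "((\<lambda>x. \<i> * complex_of_real (2 * pi / L * (freq k \<bullet> x))) has_derivative (\<lambda>h. \<i> * complex_of_real (2 * pi / L * (freq k \<bullet> h)))) (at x)"
    by (intro has_derivative_mult_right has_derivative_of_real has_derivative_inner_right has_derivative_ident)
  have 2: "(exp has_derivative (\<lambda>h. h * exp z)) (at z)" for z :: complex
    by (rule has_derivative_eq_rhs[OF DERIV_exp[of z, unfolded has_field_derivative_def]]) (simp add: fun_eq_iff)
  show ?thesis
    using has_derivative_compose[OF 1 2] by (simp add: ek_def[abs_def] mult.commute)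
qed

lemma bounded_linear_smult_vec: "bounded_linear (\<lambda>z::complex. z *s (w::complex^'n))"
  by (rule linear_conv_bounded_linear[THEN iffD1]) (auto intro!: linearI simp: vec_eq_iff distrib_right)

lemma cancel_reciprocal_factors:
  fixes a b c d N K :: real
  assumes "(a * b) * (c * d * N) \<le> (a * b) * K" "a * c = 1" "b * d = 1"
  shows "N \<le> K * a * b"
proof -
  have "(a * b) * (c * d * N) = (a * c) * (b * d) * N" by (simp only: mult_ac)
  then show ?thesis using assms by (simp add: mult_ac)
qed

text \<open>The ratio between the wave vector and the lattice point that indexes it.\<close>

definition kap :: "real \<Rightarrow> real" where "kap L = 2 * pi / L"

context cutoff begin

definition lowc :: "real \<Rightarrow> (real^3 \<Rightarrow> real^3) \<Rightarrow> nat \<Rightarrow> 3 \<Rightarrow> int^3 \<Rightarrow> complex" where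
  "lowc L g n i k = complex_of_real (low (Suc n) (freq k)) * fc L (uc g i) k"

definition blockc :: "real \<Rightarrow> (real^3 \<Rightarrow> real^3) \<Rightarrow> 3 \<Rightarrow> nat \<Rightarrow> int^3 \<Rightarrow> complex" where
  "blockc L g i p k = complex_of_real (lp_mult \<eta> (int p) (freq k)) * fc L (uc g i) k"

lemma grad_lp_low:
  "grad (lp_low \<eta> L g (enat n)) x $ l $ i = \<i> * complex_of_real (kap L) * tp L (bl (int n)) (\<lambda>k. fk k l * lowc L g n i k) x"
proof -
  let ?w = "\<lambda>k. \<chi> i. lowc L g n i k"
  have e: "lp_low \<eta> L g (enat n) = (\<lambda>x. \<Sum>k\<in>bl (int n). ek L k x *s ?w k)"
    by (rule ext) (simp add: vec_eq_iff lp_low_nth tp_def sum_component lowc_def mult.commute)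
  have "((\<lambda>x. \<Sum>k\<in>bl (int n). ek L k x *s ?w k) has_derivative
     (\<lambda>h. \<Sum>k\<in>bl (int n). (ek L k x * (\<i> * complex_of_real (2 * pi / L * (freq k \<bullet> h)))) *s ?w k)) (at x)"
    by (intro has_derivative_sum bounded_linear.has_derivative[OF bounded_linear_smult_vec] ek_has_derivative)
  from dderiv_eq[OF this, of "axis l 1"]
  have "dderiv (axis l 1) (lp_low \<eta> L g (enat n)) x = (\<Sum>k\<in>bl (int n). (ek L k x * (\<i> * complex_of_real (2 * pi / L * (freq k \<bullet> axis l 1)))) *s ?w k)"
    by (simp only: e)
  then show ?thesis
    by (simp add: grad_def sum_component tp_def fk_def kap_def inner_axis sum_distrib_left mult_ac)
qed

text \<open>Let x = 1 - 2^(s - \<sigma> - 3/r), which lies between 0 and 1. Then 1 / (1 + x^(-2)) <=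
  x, and x <= 1 - 2^(-\<gamma>) since the exponent is at least -\<gamma>. So the quadratic
  expression in the constant covers the one geometric series of
  \<open>high_estimate\<close>.\<close>

lemma c_const_bounds:
  assumes "(r, \<delta>) \<in> wn_params" "0 < c\<^sub>0"
  defines "\<gamma> \<equiv> \<delta> / 2 + three_over r"
  shows "0 \<le> three_over r" "2/3 * three_over r \<le> 1" "0 < \<gamma>" "0 < c_const c\<^sub>0 r \<delta>"
    "c_const c\<^sub>0 r \<delta> \<le> (1 - 2 powr (- \<gamma>)) / (2 * c\<^sub>0)" "c_const c\<^sub>0 r \<delta> \<le> 1 / (2 * c\<^sub>0)"
proof -
  have r: "2 \<le> r" "0 \<le> \<delta>" "\<delta> \<le> 3" "(r, \<delta>) \<noteq> (\<infinity>, 0)" using assms by (auto simp: wn_params_def)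
  have t: "0 \<le> three_over r \<and> 2/3 * three_over r \<le> 1 \<and> (r = \<infinity> \<or> 0 < three_over r)"
  proof (cases "r = \<infinity>")
    case True then show ?thesis by (simp add: three_over_def)
  next
    case False
    then obtain \<rho> where rho: "r = ereal \<rho>" "2 \<le> \<rho>" using r by (cases r) auto
    have "three_over r = 3 / \<rho>" using rho by (simp add: three_over_def numeral_eq_ereal)
    moreover have "0 < 3 / \<rho>" "2 / 3 * (3 / \<rho>) \<le> 1" using rho by (auto simp: field_simps)
    ultimately show ?thesis by simp
  qed
  then show t1: "0 \<le> three_over r" "2/3 * three_over r \<le> 1" by auto
  show g: "0 < \<gamma>"
  proof (cases "r = \<infinity>")
    case True then have "\<delta> > 0" using r by (auto simp: less_le)
    then show ?thesis using t by (simp add: \<gamma>_def add_pos_nonneg)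
  next
    case False then show ?thesis using t r by (auto simp: \<gamma>_def intro!: add_nonneg_pos)
  qed
  define e where "e = min (- 1/2 + \<delta>/4) 0 - (\<delta> - 1) / 2 - three_over r"
  have e1: "- \<gamma> \<le> e" using r by (auto simp: e_def \<gamma>_def min_def field_simps)
  have e2: "e < 0"
  proof (cases "r = \<infinity>")
    case True then have "\<delta> > 0" using r by (auto simp: less_le)
    then show ?thesis using t by (auto simp: e_def min_def field_simps)
  next
    case False then have "0 < three_over r" using t by simp
    then show ?thesis using r by (auto simp: e_def min_def field_simps)
  qed
  define x where "x = 1 - 2 powr e"
  have x: "0 < x" "x < 1" using powr_less_mono[OF e2, of 2] by (auto simp: x_def)
  have xy: "x \<le> 1 - 2 powr (- \<gamma>)" using powr_mono[OF e1, of 2] by (simp add: x_def)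
  have c: "c_const c\<^sub>0 r \<delta> = 1 / (2 * c\<^sub>0 * (1 + 1 / x\<^sup>2))" by (simp add: c_const_def Let_def x_def e_def)
  have p: "1 \<le> 1 + 1 / x\<^sup>2" using x by simp
  show "0 < c_const c\<^sub>0 r \<delta>" unfolding c using assms(2) order_less_le_trans[OF zero_less_one p] by simp
  have "1 / (1 + 1 / x\<^sup>2) \<le> x"
  proof -
    have "1 \<le> x * (1 + 1 / x\<^sup>2)"
    proof -
      have a: "1 \<le> 1 / x" using x by simp
      have e: "x * (1 + 1 / x\<^sup>2) = x + 1 / x" using x by (simp add: power2_eq_square field_simps)
      show ?thesis unfolding e using a x(1) by linarith
    qed
    then show ?thesis by (subst pos_divide_le_eq[OF order_less_le_trans[OF zero_less_one p]])
  qed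
  then have "1 / (1 + 1 / x\<^sup>2) / (2 * c\<^sub>0) \<le> (1 - 2 powr (- \<gamma>)) / (2 * c\<^sub>0)"
    using assms(2) xy by (intro divide_right_mono) auto
  then show "c_const c\<^sub>0 r \<delta> \<le> (1 - 2 powr (- \<gamma>)) / (2 * c\<^sub>0)" unfolding c by (simp add: mult.commute)
  then show "c_const c\<^sub>0 r \<delta> \<le> 1 / (2 * c\<^sub>0)"
    by (rule order_trans) (use assms(2) in \<open>auto intro!: divide_right_mono\<close>)
qed

text \<open>The index \<open>q\<close> and the parameters (r, \<delta>) may differ between the two
  solutions and \<open>q\<close> may be smaller than \<open>Q\<close>; for the vanishing of low
  modes only q <= Q matters.\<close>

lemma wavenumber_data:
  assumes L: "0 < L" and nu: "0 < \<nu>" and c0: "0 < c\<^sub>0" and w: "wavenumber \<eta> L \<nu> c\<^sub>0 g \<le> lam_ext L (enat Q)"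
  obtains q \<theta> \<delta> \<gamma> B S where "q \<le> Q"
    "\<And>i. high L \<theta> \<delta> \<gamma> B q (blockc L g i)" "B / (1 - 2 powr (- \<gamma>)) \<le> \<nu> / (2 * L * c\<^sub>0)"
    "\<And>i l. AE x in torus L. cmod (tp L (bl (int q)) (\<lambda>k. fk k l * lowc L g q i k) x) \<le> S" "0 < S" "S \<le> \<nu> / (L * c\<^sub>0) * 4 ^ q"
proof -
  have lamn: "lam L (int n) = 2 ^ n / L" for n by (simp add: lam_def)
  \<comment> \<open>The infimum lies strictly below the next value
    \<open>lam L (int (Suc Q))\<close>, so some pair of parameters and some index below
    \<open>Suc Q\<close> satisfy the conditions; whether the infimum is attained need not be
    discussed.\<close>
  have lamlt: "lam L (int Q) < lam L (int (Suc Q))"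
    unfolding lamn using L by (intro divide_strict_right_mono) auto
  have "wavenumber \<eta> L \<nu> c\<^sub>0 g \<le> ereal (lam L (int Q))" using w by (simp add: lam_ext_def)
  also have "\<dots> < ereal (lam L (int (Suc Q)))" using lamlt by simp
  finally obtain r \<delta> where rd: "(r, \<delta>) \<in> wn_params" "wavenumber_rd \<eta> L \<nu> c\<^sub>0 r \<delta> g < ereal (lam L (int (Suc Q)))"
    unfolding wavenumber_def by (auto simp: INF_less_iff)
  let ?c = "c_const c\<^sub>0 r \<delta>"
  obtain q :: nat where q: "ereal (lam L (int q)) < ereal (lam L (int (Suc Q)))"
    "\<forall>p > int q. (L * lam L (p - int q)) powr (three_over r - 1/2 + \<delta>/2) * lam L (int q) powr (- 1 + three_over r) * Lr_norm L r (lp_block \<eta> L g p) < ?c * \<nu>"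
    "lam L (int q) powr (- 2) * Lr_norm L \<infinity> (grad (lp_low \<eta> L g (enat q))) < ?c * \<nu>"
    using rd(2) unfolding wavenumber_rd_def by (auto simp: Inf_less_iff)
  define t where "t = three_over r"
  define \<gamma> where "\<gamma> = \<delta> / 2 + t"
  note cc = c_const_bounds[OF rd(1) c0, folded t_def, folded \<gamma>_def]
  have rp: "2 \<le> r" "0 \<le> \<delta>" "\<delta> \<le> 3" using rd(1) by (auto simp: wn_params_def)
  have qQ: "q \<le> Q"
  proof -
    have "(2::real) ^ q < 2 ^ Suc Q" using q(1) L unfolding lamn by (simp add: divide_less_cancel)
    from pow2_less_cancel[OF this] show ?thesis by simp
  qed
  define B where "B = \<nu> / L * ?c"
  have B: "0 < B" using nu L cc by (simp add: B_def)
  have high: "high L (2/3 * t) \<delta> \<gamma> B q (blockc L g i)" for i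
  proof
    show "0 < L" "0 \<le> 2/3 * t" "2/3 * t \<le> 1" "0 \<le> \<delta>" "\<delta> \<le> 3" "0 < \<gamma>" "0 < B" using L cc rp B by auto
    show "\<gamma> = \<delta> / 2 + 3 * (2 / 3 * t) / 2" by (simp add: \<gamma>_def)
    fix p assume p: "q < p"
    show "3 / 4 * 2 ^ p \<le> norm (freq k) \<and> norm (freq k) \<le> 2 * 2 ^ p" if "blockc L g i p k \<noteq> 0" for k
      using lp_mult_support[of p "freq k"] that by (auto simp: blockc_def)
    let ?l = "lam L (int q)"
    define X where "X = (2::real) powr (real p - real q)"
    have Xp: "X > 0" by (simp add: X_def)
    have lq: "?l = 2 powr real q / L" by (simp add: lam_def powr_realpow)
    have lp: "?l > 0" using L by (simp add: lq)
    have LX: "L * lam L (int p - int q) = X"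
    proof -
      have e: "int p - int q = int (p - q)" using p by simp
      have "X = 2 powr real (p - q)" using p by (simp add: X_def)
      then have "X = 2 ^ (p - q)" by (simp only: two_powr_nat)
      then show ?thesis unfolding e lamn using L by simp
    qed
    \<comment> \<open>The block condition solved for the norm: both powers change sides with
      opposite exponents, where t - 1/2 + \<delta>/2 = \<gamma> - 1/2.\<close>
    define R where "R = ?c * \<nu> * X powr (1/2 - \<gamma>) * ?l powr (1 - t)"
    have Rp: "R > 0" using cc nu Xp lp by (simp add: R_def)
    have "X powr (t - 1/2 + \<delta>/2) * ?l powr (- 1 + t) * Lr_norm L r (lp_block \<eta> L g (int p)) < ?c * \<nu>"
      using q(2) p LX by (auto simp: t_def)
    then have le: "(X powr (1/2 - \<gamma>) * ?l powr (1 - t)) * (X powr (t - 1/2 + \<delta>/2) * ?l powr (- 1 + t) * Lr_norm L r (lp_block \<eta> L g (int p))) \<le> (X powr (1/2 - \<gamma>) * ?l powr (1 - t)) * (?c * \<nu>)"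
      by (intro mult_left_mono) auto
    have c1: "X powr (1/2 - \<gamma>) * X powr (t - 1/2 + \<delta>/2) = 1"
      unfolding powr_add[symmetric] using Xp by (simp add: \<gamma>_def)
    have c2: "?l powr (1 - t) * ?l powr (- 1 + t) = 1"
      unfolding powr_add[symmetric] using lp by simp
    have "Lr_norm L r (lp_block \<eta> L g (int p)) \<le> R"
      unfolding R_def by (rule cancel_reciprocal_factors[OF le c1 c2])
    from Lr_norm_block[OF L _ rp(1) this Rp, of i]
    have "Lr_bound L (2/3 * t) (R * L powr (- t)) (tp L (bl (int p)) (blockc L g i p))"
      by (simp add: t_def blockc_def[abs_def])
    moreover have "R * L powr (- t) = B * 2 powr (real q * (1 / 2 + \<delta> / 2) + real p * (1 / 2 - \<gamma>))"
    proof -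
      have 1: "X powr (1/2 - \<gamma>) = 2 powr ((real p - real q) * (1/2 - \<gamma>))" by (simp add: X_def powr_powr)
      have 2: "?l powr (1 - t) * L powr (- t) = 2 powr (real q * (1 - t)) / L"
      proof -
        have h1: "?l powr (1 - t) = 2 powr (real q * (1 - t)) / L powr (1 - t)" by (simp add: lq powr_divide powr_powr)
        have h2: "L powr (- t) / L powr (1 - t) = 1 / L"
          unfolding powr_diff[symmetric] using L by (simp add: powr_minus divide_inverse)
        have "a / b * c = a * (c / b)" for a b c :: real by simp
        then have "?l powr (1 - t) * L powr (- t) = 2 powr (real q * (1 - t)) * (1 / L)" unfolding h1 h2[symmetric] .
        then show ?thesis by simp
      qed
      have 3: "2 powr ((real p - real q) * (1/2 - \<gamma>)) * 2 powr (real q * (1 - t)) = 2 powr (real q * (1 / 2 + \<delta> / 2) + real p * (1 / 2 - \<gamma>))"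
        unfolding powr_add[symmetric] by (rule arg_cong[where f="\<lambda>z. 2 powr z"]) (simp add: \<gamma>_def field_simps)
      have "R * L powr (- t) = ?c * \<nu> * X powr (1/2 - \<gamma>) * (?l powr (1 - t) * L powr (- t))" by (simp add: R_def)
      also have "\<dots> = ?c * \<nu> / L * (2 powr ((real p - real q) * (1/2 - \<gamma>)) * 2 powr (real q * (1 - t)))"
        unfolding 1 2 by simp
      finally show ?thesis unfolding 3 by (simp add: B_def mult_ac)
    qed
    ultimately show "Lr_bound L (2/3 * t) (B * 2 powr (real q * (1 / 2 + \<delta> / 2) + real p * (1 / 2 - \<gamma>))) (tp L {k. norm (freq k) \<le> 2 * 2 ^ p} (blockc L g i p))"
      by (simp only: bl_nat)
  qed
  have y: "0 < 1 - 2 powr (- \<gamma>)" using powr_less_mono[of "- \<gamma>" 0 2] cc by simp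
  have BB: "B / (1 - 2 powr (- \<gamma>)) \<le> \<nu> / (2 * L * c\<^sub>0)"
  proof -
    have "B \<le> \<nu> / L * ((1 - 2 powr (- \<gamma>)) / (2 * c\<^sub>0))" unfolding B_def using cc nu L by (intro mult_left_mono) auto
    also have "\<dots> = \<nu> / (2 * L * c\<^sub>0) * (1 - 2 powr (- \<gamma>))" by simp
    finally show ?thesis using y by (simp add: divide_le_eq)
  qed
  define S where "S = \<nu> / (L * c\<^sub>0) * 4 ^ q"
  have S: "0 < S" using nu L c0 by (simp add: S_def)
  have gr: "AE x in torus L. cmod (tp L (bl (int q)) (\<lambda>k. fk k l * lowc L g q i k) x) \<le> S" for i l
  proof -
    let ?G = "grad (lp_low \<eta> L g (enat q))"
    have Gm: "continuous_on UNIV ?G"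
    proof -
      have "?G = (\<lambda>x. \<chi> l. \<chi> i. \<i> * complex_of_real (kap L) * tp L (bl (int q)) (\<lambda>k. fk k l * lowc L g q i k) x)"
        by (simp add: fun_eq_iff vec_eq_iff grad_lp_low)
      then show ?thesis by (simp only:) (intro continuous_on_vec_lambda continuous_intros continuous_tp)
    qed
    obtain K where K: "\<And>x. norm (?G x) \<le> K"
    proof
      fix x
      have "norm (?G x) \<le> (\<Sum>l\<in>UNIV. norm (?G x $ l))" unfolding norm_vec_def[of "?G x"] by (rule L2_set_le_sum) simp
      also have "\<dots> \<le> (\<Sum>l\<in>UNIV. \<Sum>i\<in>UNIV. cmod (?G x $ l $ i))"
        by (intro sum_mono) (unfold norm_vec_def[of "?G x $ _"], rule L2_set_le_sum, simp)
      also have "\<dots> \<le> (\<Sum>l\<in>UNIV. \<Sum>i\<in>UNIV. cmod (\<i> * complex_of_real (kap L)) * (\<Sum>k\<in>bl (int q). cmod (fk k l * lowc L g q i k)))"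
        unfolding grad_lp_low norm_mult[of "\<i> * complex_of_real (kap L)"] by (intro sum_mono mult_left_mono norm_tp_le) auto
      finally show "norm (?G x) \<le> (\<Sum>l\<in>UNIV. \<Sum>i\<in>UNIV. cmod (\<i> * complex_of_real (kap L)) * (\<Sum>k\<in>bl (int q). cmod (fk k l * lowc L g q i k)))" .
    qed
    let ?e = "esssup (torus L) (\<lambda>x. ereal (norm (?G x)))"
    have [measurable]: "?G \<in> borel_measurable (torus L)" by (rule continuous_measurable_torus[OF Gm])
    have "?e \<le> ereal K" by (rule esssup_I) (use K in auto)
    then have fin: "?e \<noteq> \<infinity>" by auto
    have lq: "lam L (int q) powr (- 2) = L\<^sup>2 / 4 ^ q"
    proof -
      have "lam L (int q) > 0" using L by (simp add: lam_def)
      then have "lam L (int q) powr (- 2) = 1 / lam L (int q) powr 2" by (simp only: powr_minus inverse_eq_divide)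
      then show ?thesis using lam_sq[OF L, of q] by simp
    qed
    have "L\<^sup>2 / 4 ^ q * real_of_ereal ?e < ?c * \<nu>" using q(3) by (simp add: Lr_norm_def lq)
    then have e: "real_of_ereal ?e \<le> ?c * \<nu> * 4 ^ q / L\<^sup>2" using L by (simp add: field_simps less_imp_le)
    have "AE x in torus L. ereal (norm (?G x)) \<le> ?e" by (rule esssup_AE)
    then show ?thesis
    proof eventually_elim
      case (elim x)
      have kp: "0 < kap L" using L by (simp add: kap_def)
      have "kap L * cmod (tp L (bl (int q)) (\<lambda>k. fk k l * lowc L g q i k) x) = cmod (?G x $ l $ i)"
        unfolding grad_lp_low using kp by (simp add: norm_mult)
      also have "\<dots> \<le> norm (?G x $ l)" by (rule Finite_Cartesian_Product.norm_nth_le)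
      also have "\<dots> \<le> norm (?G x)" by (rule Finite_Cartesian_Product.norm_nth_le)
      also have "\<dots> \<le> real_of_ereal ?e" using elim fin by (cases ?e) auto
      also have "\<dots> \<le> ?c * \<nu> * 4 ^ q / L\<^sup>2" by (rule e)
      also have "\<dots> \<le> 1 / (2 * c\<^sub>0) * \<nu> * 4 ^ q / L\<^sup>2" using cc nu by (intro divide_right_mono mult_right_mono) auto
      \<comment> \<open>There is room here: of the factor 2 pi in \<open>kap L\<close> only 1/2 <= 2
        pi is used.\<close>
      also have "\<dots> \<le> kap L * S"
      proof -
        have "1 / 2 \<le> 2 * pi" using pi_gt3 by simp
        then have "1 / 2 * (\<nu> * 4 ^ q / (c\<^sub>0 * L\<^sup>2)) \<le> 2 * pi * (\<nu> * 4 ^ q / (c\<^sub>0 * L\<^sup>2))"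
          using nu c0 by (intro mult_right_mono) auto
        then show ?thesis using L c0 by (simp add: S_def kap_def power2_eq_square mult_ac)
      qed
      finally show ?case using kp by simp
    qed
  qed
  show ?thesis by (rule that[OF qQ high BB gr S]) (simp add: S_def)
qed

end

section \<open>The nonlinear term at a fixed time\<close>

lemma trisum_add: "trisum X Y (\<lambda>n. a n + b n) f g = trisum X Y a f g + trisum X Y b f g"
  by (simp add: trisum_def distrib_right sum.distrib)

lemma trisum_sum: "trisum X Y (\<lambda>n. \<Sum>p\<in>I. a p n) f g = (\<Sum>p\<in>I. trisum X Y (a p) f g)"
proof -
  have "trisum X Y (\<lambda>n. \<Sum>p\<in>I. a p n) f g = (\<Sum>k\<in>X. \<Sum>p\<in>I. \<Sum>m\<in>Y. a p (k - m) * f m * g k)"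
    unfolding trisum_def sum_distrib_right by (intro sum.cong refl sum.swap)
  also have "\<dots> = (\<Sum>p\<in>I. trisum X Y (a p) f g)" unfolding trisum_def by (rule sum.swap)
  finally show ?thesis .
qed

lemma trisum_split_right:
  assumes "finite Y" "Z \<subseteq> Y" shows "trisum X Y a f g = trisum X Z a f g + trisum X (Y - Z) a f g"
  unfolding trisum_def sum.distrib[symmetric] by (intro sum.cong refl sum.subset_diff[OF assms(2,1), THEN trans] add.commute)

lemma trisum_restrict:
  assumes "finite X" "X \<subseteq> X'" "finite X'" shows "trisum X Y a f g = trisum X' Y a f (\<lambda>k. if k \<in> X then g k else 0)"
  unfolding trisum_def by (rule sum.mono_neutral_cong_left[OF assms(3,2)]) auto

context cutoff begin

lemma low_even: "low n (- \<xi>) = low n \<xi>"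
proof -
  have "norm ((1 / 2 ^ n) *\<^sub>R (- \<xi>)) = norm ((1 / 2 ^ n) *\<^sub>R \<xi>)" by simp
  then show ?thesis unfolding low_def using eta unfolding lp_cutoff_def by blast
qed

lemma lowc_outside: "2 * 2 ^ q < norm (freq n) \<Longrightarrow> lowc L g q i n = 0"
  using low_zero[of "Suc q" "freq n"] by (simp add: lowc_def)

text \<open>Separates the low modes, to which the gradient condition applies, from the blocks, to
  which the block condition applies.\<close>

lemma lowc_telescope:
  assumes "q \<le> P" shows "lowc L g P i = (\<lambda>n. lowc L g q i n + (\<Sum>p\<in>{q<..P}. blockc L g i p n))"
  using assms
proof (induction P rule: dec_induct)
  case base then show ?case by (simp add: fun_eq_iff)
next
  case (step P)
  have e: "{q<..Suc P} = insert (Suc P) {q<..P}" using step by auto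
  have s: "lowc L g (Suc P) i n = lowc L g P i n + blockc L g i (Suc P) n" for n
    by (simp only: lowc_def blockc_def lp_mult_nat of_real_diff left_diff_distrib) simp
  show ?case unfolding fun_eq_iff s step.IH e by (simp add: add_ac)
qed

end

text \<open>One instant of time. \<open>N\<close> is the cutoff; \<open>D\<close> bounds the
  dissipation, \<open>R\<close> the squared norm of order 1 beyond the cutoff and \<open>E\<close>
  the truncated energy, while \<open>h\<close> will bound the norm of order 1 of \<open>u\<close>.
  All are bounds on finite sums, so no convergence is involved.\<close>

locale slice = cutoff +
  fixes L \<nu> c0 N D R E h :: real and Q :: nat and W :: "3 \<Rightarrow> int^3 \<Rightarrow> complex"
  assumes L: "0 < L" and nu: "0 < \<nu>" and c0: "0 < c0" and N: "0 \<le> N"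
    and W0: "\<And>l k. norm (freq k) < 2 ^ Q \<Longrightarrow> W l k = 0"
    and D: "\<And>G. finite G \<Longrightarrow> (\<Sum>k\<in>G. norm (freq k) * (\<Sum>l\<in>UNIV. (cmod (W l k))\<^sup>2)) \<le> D"
    and R: "\<And>G. finite G \<Longrightarrow> (\<And>m. m \<in> G \<Longrightarrow> N < norm (freq m)) \<Longrightarrow> (\<Sum>m\<in>G. (norm (freq m))\<^sup>2 * (\<Sum>l\<in>UNIV. (cmod (W l m))\<^sup>2)) \<le> R"
    and E: "(\<Sum>k | k \<noteq> 0 \<and> norm (freq k) \<le> N. (\<Sum>l\<in>UNIV. (cmod (W l k))\<^sup>2) / norm (freq k)) \<le> E"
    and h: "0 \<le> h"
begin

text \<open>The output frequencies. \<open>A K\<close> contains the frequencies at which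
  \<open>W\<close> may be nonzero and which interact with \<open>F\<close> through coefficients
  supported in |n| <= K; \<open>F'\<close> is the part of \<open>F\<close> on which \<open>W\<close>
  may be nonzero.\<close>

definition F where "F = {k::int^3. k \<noteq> 0 \<and> norm (freq k) \<le> N}"
definition A where "A K = {k::int^3. 2 ^ Q \<le> norm (freq k) \<and> norm (freq k) \<le> N + K}"
definition F' where "F' = {k::int^3. 2 ^ Q \<le> norm (freq k) \<and> norm (freq k) \<le> N}"
text \<open>The test coefficient: \<open>fk k i\<close> stems from the derivative in the
  nonlinearity, the reciprocal norm is the weight of the energy.\<close>

definition gg where "gg i l k = fk k i * cnj (W l k) / complex_of_real (norm (freq k))"

lemma fins [simp]: "finite F" "finite F'" "finite (A K)"
  unfolding F_def F'_def A_def
  by (rule finite_subset[OF _ finite_freq_ball[of N]], force, rule finite_subset[OF _ finite_freq_ball[of N]], force,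
      rule finite_subset[OF _ finite_freq_ball[of "N + K"]], force)

lemma pow_le_0 [simp]: "(2::real) ^ n \<le> 0 \<longleftrightarrow> False"
  by (simp add: not_le)

lemma nz: "2 ^ Q \<le> norm (freq k) \<Longrightarrow> k \<noteq> 0"
  by auto

lemma pow_Q: "q \<le> Q \<Longrightarrow> 2 ^ Q \<le> norm (freq k) \<Longrightarrow> 2 ^ q \<le> norm (freq k)"
  by (rule order_trans[OF power_increasing]) auto

lemma F'_sub: "0 \<le> K \<Longrightarrow> F' \<subseteq> A K" "F' \<subseteq> F" by (auto simp: F'_def A_def F_def nz)

lemma gg_le: "cmod (gg i l k) \<le> cmod (W l k)"
proof (cases "k = 0")
  case False
  have "cmod (fk k i) / norm (freq k) \<le> 1" using cmod_fk_le[of k i] False by (simp add: divide_le_eq)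
  then have "cmod (fk k i) / norm (freq k) * cmod (W l k) \<le> 1 * cmod (W l k)" by (rule mult_right_mono) simp
  then show ?thesis by (simp add: gg_def norm_mult norm_divide)
qed (simp add: gg_def)

lemma gg_zero: "norm (freq k) < 2 ^ Q \<Longrightarrow> gg i l k = 0" by (simp add: gg_def W0)

lemma trisum_F: "trisum F Y a f (gg i l) = trisum F' Y a f (gg i l)"
  unfolding trisum_def
proof (rule sum.mono_neutral_right[OF fins(1) F'_sub(2)], rule ballI)
  fix k assume "k \<in> F - F'"
  then have "gg i l k = 0" by (intro gg_zero) (auto simp: F_def F'_def)
  then show "(\<Sum>m\<in>Y. a (k - m) * f m * gg i l k) = 0" by simp
qed

definition "Dl l G = (\<Sum>k\<in>G. norm (freq k) * (cmod (W l k))\<^sup>2)"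

lemma Dl_sum: "finite G \<Longrightarrow> (\<Sum>l\<in>UNIV. Dl l G) \<le> D"
  using D[of G] unfolding Dl_def sum_distrib_left by (subst sum.swap)

lemma Dl_nonneg: "0 \<le> Dl l G" by (simp add: Dl_def sum_nonneg)

lemma D_nonneg: "0 \<le> D" using D[of "{}"] by simp
lemma E_nonneg: "0 \<le> E" by (rule order_trans[OF _ E]) (auto intro!: sum_nonneg divide_nonneg_nonneg)
lemma R_nonneg: "0 \<le> R" using R[of "{}"] by simp

text \<open>The output coefficient is extended by zero from \<open>F'\<close> to \<open>A K\<close>,
  because \<open>high_estimate\<close> works with one set for both frequencies; passing from
  \<open>W\<close> to \<open>gg\<close> does not increase the modulus.\<close>

lemma high_part:
  assumes K: "0 \<le> K" and hi: "high L \<theta> \<delta> \<gamma> B q \<alpha>" and q: "q \<le> Q" and B: "B / (1 - 2 powr (- \<gamma>)) \<le> \<nu> / (2 * L * c0)"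
  shows "cmod (\<Sum>p\<in>{q<..P}. trisum F' (A K) (\<alpha> p) (W j) (gg i l)) \<le> 1152 * (\<nu> / (L * c0)) * (Dl j (A K) + Dl l (A K))"
proof -
  interpret high L \<theta> \<delta> \<gamma> B q \<alpha> by (rule hi)
  let ?g = "\<lambda>k. if k \<in> F' then gg i l k else 0"
  have A: "k \<in> A K \<Longrightarrow> k \<noteq> 0 \<and> 2 ^ q \<le> norm (freq k)" for k using nz pow_Q[OF q] by (auto simp: A_def)
  have "cmod (\<Sum>p\<in>{q<..P}. trisum F' (A K) (\<alpha> p) (W j) (gg i l)) = cmod (\<Sum>p\<in>{q<..P}. trisum (A K) (A K) (\<alpha> p) (W j) ?g)"
    by (subst trisum_restrict[OF fins(2) F'_sub(1)[OF K] fins(3)]) rule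
  also have "\<dots> \<le> 2304 * B / (1 - 2 powr (- \<gamma>)) * ((\<Sum>k\<in>A K. norm (freq k) * (cmod (W j k))\<^sup>2) + (\<Sum>k\<in>A K. norm (freq k) * (cmod (?g k))\<^sup>2))"
    by (rule high_estimate[OF fins(3) A])
  also have "\<dots> = 2304 * (B / (1 - 2 powr (- \<gamma>))) * (Dl j (A K) + (\<Sum>k\<in>A K. norm (freq k) * (cmod (?g k))\<^sup>2))"
    by (simp add: Dl_def)
  also have "\<dots> \<le> 2304 * (\<nu> / (2 * L * c0)) * (Dl j (A K) + Dl l (A K))"
  proof (rule mult_mono)
    show "2304 * (B / (1 - 2 powr (- \<gamma>))) \<le> 2304 * (\<nu> / (2 * L * c0))" by (rule mult_left_mono[OF B]) simp
    show "Dl j (A K) + (\<Sum>k\<in>A K. norm (freq k) * (cmod (?g k))\<^sup>2) \<le> Dl j (A K) + Dl l (A K)"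
      unfolding Dl_def by (intro add_left_mono sum_mono mult_left_mono power_mono) (auto simp: gg_le)
    show "0 \<le> 2304 * (\<nu> / (2 * L * c0))" using L c0 nu by simp
    show "0 \<le> Dl j (A K) + (\<Sum>k\<in>A K. norm (freq k) * (cmod (?g k))\<^sup>2)"
      using Dl_nonneg by (intro add_nonneg_nonneg sum_nonneg) auto
  qed
  finally show ?thesis by simp
qed

text \<open>Transport pairs component \<open>l\<close> with itself, stretching pairs
  \<open>i\<close> with \<open>l\<close>. Either way the nine bounds add up to six times the total
  dissipation, and 6 * 1152 = 6912.\<close>

lemma high_total:
  assumes K: "0 \<le> K" and x: "\<And>i l. cmod (x i l) \<le> 1152 * (\<nu> / (L * c0)) * (Dl (j i l) (A K) + Dl l (A K))"
    and j: "j = (\<lambda>i l. l) \<or> j = (\<lambda>i l. i)"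
  shows "cmod (\<Sum>l\<in>UNIV. \<Sum>i\<in>(UNIV::3 set). x i l) \<le> 6912 * (\<nu> / (L * c0)) * D"
proof -
  let ?C = "1152 * (\<nu> / (L * c0))"
  have C: "0 \<le> ?C" using L c0 nu by simp
  have "cmod (\<Sum>l\<in>UNIV. \<Sum>i\<in>UNIV. x i l) \<le> (\<Sum>l\<in>UNIV. \<Sum>i\<in>(UNIV::3 set). ?C * (Dl (j i l) (A K) + Dl l (A K)))"
    by (intro order_trans[OF norm_sum] sum_mono x)
  also have "\<dots> = ?C * (\<Sum>l\<in>UNIV. \<Sum>i\<in>(UNIV::3 set). Dl (j i l) (A K) + Dl l (A K))" by (simp only: sum_distrib_left)
  also have "(\<Sum>l\<in>UNIV. \<Sum>i\<in>(UNIV::3 set). Dl (j i l) (A K) + Dl l (A K)) = 6 * (\<Sum>l\<in>UNIV. Dl l (A K))"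
    using j by (auto simp: sum.distrib sum_distrib_left[symmetric])
  also have "?C * (6 * (\<Sum>l\<in>UNIV. Dl l (A K))) \<le> ?C * (6 * D)" by (intro mult_left_mono Dl_sum C) auto
  finally show ?thesis by simp
qed

text \<open>The two powers of |k| between the weights 1/|k| and |k| are worth 4^q, exactly the
  growth that \<open>wavenumber_data\<close> allows for the gradient.\<close>

lemma inv_weight:
  assumes "q \<le> Q" shows "(\<Sum>k\<in>F'. (cmod (W l k))\<^sup>2 / norm (freq k)) \<le> Dl l F' / 4 ^ q"
  unfolding Dl_def sum_divide_distrib
proof (rule sum_mono)
  fix k assume "k \<in> F'"
  then have k: "2 ^ Q \<le> norm (freq k)" by (simp add: F'_def)
  have kp: "norm (freq k) > 0" using nz[OF k] by simp
  have "(2 ^ q)\<^sup>2 \<le> (norm (freq k))\<^sup>2" by (intro power_mono pow_Q[OF assms k]) auto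
  moreover have "(2 ^ q)\<^sup>2 = (4::real) ^ q" by (simp add: power2_eq_square flip: power_mult_distrib)
  ultimately have "(cmod (W l k))\<^sup>2 * 4 ^ q \<le> (cmod (W l k))\<^sup>2 * (norm (freq k) * norm (freq k))"
    by (intro mult_left_mono) (auto simp: power2_eq_square)
  then show "(cmod (W l k))\<^sup>2 / norm (freq k) \<le> norm (freq k) * (cmod (W l k))\<^sup>2 / 4 ^ q"
    using kp by (simp add: field_simps)
qed

text \<open>Three contributions: low modes acting within \<open>F'\<close>, treated by the
  commutator; low modes linking \<open>F'\<close> to frequencies beyond the cutoff, treated by
  \<open>cross_estimate\<close>; and the high blocks. The constants are 6912 + 5, with 9/2 rounded
  up, and 9 * 25 = 225.\<close>

lemma transport:
  assumes K: "0 \<le> K" and qQ: "q \<le> Q" and qP: "q \<le> P"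
    and hi: "\<And>i. high L \<theta> \<delta> \<gamma> B q (blockc L g i)" and B: "B / (1 - 2 powr (- \<gamma>)) \<le> \<nu> / (2 * L * c0)"
    and gr: "\<And>i l. AE x in torus L. cmod (tp L (bl (int q)) (\<lambda>k. fk k l * lowc L g q i k) x) \<le> S"
    and S: "0 < S" "S \<le> \<nu> / (L * c0) * 4 ^ q"
    and div: "\<And>n. (\<Sum>i\<in>UNIV. fk n i * fc L (uc g i) n) = 0" and mean: "\<And>i. fc L (uc g i) 0 = 0"
    and hg: "\<And>G. finite G \<Longrightarrow> (\<Sum>n\<in>G. (norm (freq n))\<^sup>2 * (\<Sum>i\<in>UNIV. (cmod (fc L (uc g i) n))\<^sup>2)) \<le> h\<^sup>2"
  shows "\<bar>Im (\<Sum>l\<in>UNIV. \<Sum>i\<in>UNIV. trisum F (A K) (lowc L g P i) (W l) (gg i l))\<bar>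
    \<le> 6917 * (\<nu> / (L * c0)) * D + 225 * M * h * sqrt R * sqrt E"
proof -
  let ?U = "lowc L g q"
  have U0: "n \<notin> bl (int q) \<Longrightarrow> ?U i n = 0" for i n by (simp add: bl_nat lowc_outside)
  have Udiv: "(\<Sum>i\<in>UNIV. fk n i * ?U i n) = 0" for n
  proof -
    have "(\<Sum>i\<in>UNIV. fk n i * ?U i n) = complex_of_real (low (Suc q) (freq n)) * (\<Sum>i\<in>UNIV. fk n i * fc L (uc g i) n)"
      by (simp add: lowc_def sum_distrib_left mult_ac)
    then show ?thesis using div by simp
  qed
  have Ure: "cnj (?U i n) = ?U i (- n)" for i n by (simp add: lowc_def cnj_fc_uc low_even)
  have split: "trisum F (A K) (lowc L g P i) (W l) (gg i l)
     = (trisum F' F' (?U i) (W l) (gg i l) + trisum F' (A K - F') (?U i) (W l) (gg i l))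
       + (\<Sum>p\<in>{q<..P}. trisum F' (A K) (blockc L g i p) (W l) (gg i l))" for i l
    unfolding trisum_F lowc_telescope[OF qP] trisum_add trisum_sum
    by (subst trisum_split_right[OF fins(3) F'_sub(1)[OF K]]) rule
  let ?X = "\<Sum>l\<in>UNIV. \<Sum>i\<in>UNIV. trisum F' F' (?U i) (W l) (gg i l)"
  let ?Y = "\<Sum>l\<in>UNIV. \<Sum>i\<in>UNIV. trisum F' (A K - F') (?U i) (W l) (gg i l)"
  let ?Z = "\<Sum>l\<in>UNIV. \<Sum>i\<in>UNIV. (\<Sum>p\<in>{q<..P}. trisum F' (A K) (blockc L g i p) (W l) (gg i l))"
  have sp: "(\<Sum>l\<in>UNIV. \<Sum>i\<in>UNIV. trisum F (A K) (lowc L g P i) (W l) (gg i l)) = ?X + ?Y + ?Z"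
    unfolding split by (simp only: sum.distrib)
  have Z: "cmod ?Z \<le> 6912 * (\<nu> / (L * c0)) * D"
    by (rule high_total[OF K high_part[OF K hi qQ B]]) simp
  have X: "\<bar>Im ?X\<bar> \<le> 5 * (\<nu> / (L * c0)) * D"
  proof -
    have "\<bar>Im (\<Sum>i\<in>UNIV. trisum F' F' (?U i) (W l) (gg i l))\<bar> \<le> 9 / 2 * (\<nu> / (L * c0)) * Dl l F'" for l
    proof -
      have "\<bar>Im (\<Sum>i\<in>UNIV. trisum F' F' (?U i) (W l) (gg i l))\<bar> \<le> 9 / 2 * S * (\<Sum>k\<in>F'. (cmod (W l k))\<^sup>2 / norm (freq k))"
        unfolding gg_def
        by (rule commutator_estimate[OF L S(1) finite_bl[of "int q"] U0 fins(2) _ Udiv Ure gr]) (auto simp: F'_def dest: nz)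
      also have "\<dots> \<le> 9 / 2 * (\<nu> / (L * c0) * 4 ^ q) * (Dl l F' / 4 ^ q)"
        using S by (intro mult_mono inv_weight[OF qQ]) (auto intro!: sum_nonneg)
      finally show ?thesis by simp
    qed
    moreover have "Im ?X = (\<Sum>l\<in>UNIV. Im (\<Sum>i\<in>UNIV. trisum F' F' (?U i) (W l) (gg i l)))" by (rule Im_sum)
    ultimately have "\<bar>Im ?X\<bar> \<le> (\<Sum>l\<in>UNIV. 9 / 2 * (\<nu> / (L * c0)) * Dl l F')"
      by (simp only:) (intro order_trans[OF sum_abs] sum_mono)
    also have "\<dots> = 9 / 2 * (\<nu> / (L * c0)) * (\<Sum>l\<in>UNIV. Dl l F')" by (simp only: sum_distrib_left)
    also have "\<dots> \<le> 9 / 2 * (\<nu> / (L * c0)) * D" using L c0 nu by (intro mult_left_mono Dl_sum) auto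
    also have "\<dots> \<le> 5 * (\<nu> / (L * c0)) * D" using L c0 nu D_nonneg by (intro mult_right_mono) auto
    finally show ?thesis .
  qed
  have Y: "cmod ?Y \<le> 225 * M * h * sqrt R * sqrt E"
  proof -
    have "cmod (trisum F' (A K - F') (?U i) (W l) (gg i l)) \<le> 25 * (M * h) * sqrt R * sqrt E" for i l
    proof -
      have "cmod (trisum F' (A K - F') (?U i) (W l) (gg i l)) \<le> 25 * (M * h) * sqrt (\<Sum>m\<in>A K - F'. (norm (freq m))\<^sup>2 * (cmod (W l m))\<^sup>2) * sqrt (\<Sum>k\<in>F'. (cmod (gg i l k))\<^sup>2 / norm (freq k))"
      proof (rule cross_estimate[where N=N and q=q])
        show "k \<in> F' \<Longrightarrow> k \<noteq> 0 \<and> norm (freq k) \<le> N" for k by (auto simp: F'_def dest: nz)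
        show "m \<in> A K - F' \<Longrightarrow> N < norm (freq m) \<and> 2 ^ q \<le> norm (freq m)" for m
          using pow_Q[OF qQ, of m] by (auto simp: A_def F'_def)
        show "2 * 2 ^ q < norm (freq n) \<Longrightarrow> ?U i n = 0" for n by (rule lowc_outside)
        show "?U i 0 = 0" by (simp add: lowc_def mean)
        show "0 \<le> M * h" using M(1) h by simp
        have "(\<Sum>n | norm (freq n) \<le> 2 * 2 ^ q. (norm (freq n))\<^sup>2 * (cmod (?U i n))\<^sup>2)
           \<le> (\<Sum>n | norm (freq n) \<le> 2 * 2 ^ q. M\<^sup>2 * ((norm (freq n))\<^sup>2 * (\<Sum>i\<in>UNIV. (cmod (fc L (uc g i) n))\<^sup>2)))"
        proof (rule sum_mono)
          fix n
          have "(cmod (?U i n))\<^sup>2 = (low (Suc q) (freq n))\<^sup>2 * (cmod (fc L (uc g i) n))\<^sup>2" by (simp add: lowc_def norm_mult power_mult_distrib)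
          also have "\<dots> \<le> M\<^sup>2 * (\<Sum>i\<in>UNIV. (cmod (fc L (uc g i) n))\<^sup>2)"
            by (intro mult_mono power_mono low_bounds member_le_sum) auto
          finally have "(norm (freq n))\<^sup>2 * (cmod (?U i n))\<^sup>2 \<le> (norm (freq n))\<^sup>2 * (M\<^sup>2 * (\<Sum>i\<in>UNIV. (cmod (fc L (uc g i) n))\<^sup>2))"
            by (rule mult_left_mono) simp
          then show "(norm (freq n))\<^sup>2 * (cmod (?U i n))\<^sup>2 \<le> M\<^sup>2 * ((norm (freq n))\<^sup>2 * (\<Sum>i\<in>UNIV. (cmod (fc L (uc g i) n))\<^sup>2))"
            by (simp add: mult_ac)
        qed
        also have "\<dots> \<le> M\<^sup>2 * h\<^sup>2" unfolding sum_distrib_left[symmetric] by (intro mult_left_mono hg) auto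
        finally show "(\<Sum>n | norm (freq n) \<le> 2 * 2 ^ q. (norm (freq n))\<^sup>2 * (cmod (?U i n))\<^sup>2) \<le> (M * h)\<^sup>2"
          by (simp add: power_mult_distrib)
      qed simp_all
      also have "\<dots> \<le> 25 * (M * h) * sqrt R * sqrt E"
      proof (intro mult_mono mult_left_mono real_sqrt_le_mono)
        have "(\<Sum>m\<in>A K - F'. (norm (freq m))\<^sup>2 * (cmod (W l m))\<^sup>2) \<le> (\<Sum>m\<in>A K - F'. (norm (freq m))\<^sup>2 * (\<Sum>l\<in>UNIV. (cmod (W l m))\<^sup>2))"
          by (intro sum_mono mult_left_mono member_le_sum) auto
        also have "\<dots> \<le> R" by (rule R) (auto simp: A_def F'_def)
        finally show "(\<Sum>m\<in>A K - F'. (norm (freq m))\<^sup>2 * (cmod (W l m))\<^sup>2) \<le> R" .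
        have "(\<Sum>k\<in>F'. (cmod (gg i l k))\<^sup>2 / norm (freq k)) \<le> (\<Sum>k\<in>F'. (\<Sum>l\<in>UNIV. (cmod (W l k))\<^sup>2) / norm (freq k))"
        proof (intro sum_mono divide_right_mono)
          fix k
          have "(cmod (gg i l k))\<^sup>2 \<le> (cmod (W l k))\<^sup>2" by (intro power_mono gg_le) auto
          also have "\<dots> \<le> (\<Sum>l\<in>UNIV. (cmod (W l k))\<^sup>2)" by (intro member_le_sum) auto
          finally show "(cmod (gg i l k))\<^sup>2 \<le> (\<Sum>l\<in>UNIV. (cmod (W l k))\<^sup>2)" .
        qed simp
        also have "\<dots> \<le> (\<Sum>k\<in>F. (\<Sum>l\<in>UNIV. (cmod (W l k))\<^sup>2) / norm (freq k))"
          by (rule sum_mono2[OF fins(1) F'_sub(2)]) (auto intro!: sum_nonneg divide_nonneg_nonneg)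
        also have "\<dots> \<le> E" using E by (simp add: F_def)
        finally show "(\<Sum>k\<in>F'. (cmod (gg i l k))\<^sup>2 / norm (freq k)) \<le> E" .
      qed (use M(1) h R_nonneg in \<open>auto intro!: sum_nonneg\<close>)
      finally show ?thesis .
    qed
    then have "cmod ?Y \<le> (\<Sum>l\<in>(UNIV::3 set). \<Sum>i\<in>(UNIV::3 set). 25 * (M * h) * sqrt R * sqrt E)"
      by (intro order_trans[OF norm_sum] sum_mono)
    then show ?thesis by simp
  qed
  have "\<bar>Im (?X + ?Y + ?Z)\<bar> \<le> \<bar>Im ?X\<bar> + cmod ?Y + cmod ?Z"
    using abs_Im_le_cmod[of ?Y] abs_Im_le_cmod[of ?Z] by simp
  note tri = this
  define zz where "zz = \<nu> / (L * c0) * D"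
  have z: "a * (\<nu> / (L * c0)) * D = a * zz" for a by (simp add: zz_def)
  show ?thesis unfolding sp z using tri X[unfolded z] Y Z[unfolded z] by linarith
qed

text \<open>Here the derivative can be moved from the output to the low modes because
  \<open>W\<close> is divergence free; the gradient bound then applies directly, without a
  commutator. The constant is 6912 + 9.\<close>

lemma stretch:
  assumes K: "0 \<le> K" and qQ: "q \<le> Q" and qP: "q \<le> P"
    and hi: "\<And>i. high L \<theta> \<delta> \<gamma> B q (blockc L g i)" and B: "B / (1 - 2 powr (- \<gamma>)) \<le> \<nu> / (2 * L * c0)"
    and gr: "\<And>i l. AE x in torus L. cmod (tp L (bl (int q)) (\<lambda>k. fk k l * lowc L g q i k) x) \<le> S"
    and S: "0 < S" "S \<le> \<nu> / (L * c0) * 4 ^ q"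
    and div: "\<And>n. (\<Sum>i\<in>UNIV. fk n i * W i n) = 0"
  shows "cmod (\<Sum>l\<in>UNIV. \<Sum>i\<in>UNIV. trisum F (A K) (lowc L g P l) (W i) (gg i l)) \<le> 6921 * (\<nu> / (L * c0)) * D"
proof -
  let ?U = "lowc L g q"
  let ?V = "\<lambda>l k. cnj (W l k) / complex_of_real (norm (freq k))"
  have U0: "n \<notin> bl (int q) \<Longrightarrow> fk n i * ?U l n = 0" for i l n by (simp add: bl_nat lowc_outside)
  have split: "trisum F (A K) (lowc L g P l) (W i) (gg i l)
     = trisum F' (A K) (?U l) (W i) (gg i l)
       + (\<Sum>p\<in>{q<..P}. trisum F' (A K) (blockc L g l p) (W i) (gg i l))" for i l
    unfolding trisum_F lowc_telescope[OF qP] trisum_add trisum_sum ..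
  let ?X = "\<Sum>l\<in>UNIV. \<Sum>i\<in>UNIV. trisum F' (A K) (?U l) (W i) (gg i l)"
  let ?Z = "\<Sum>l\<in>UNIV. \<Sum>i\<in>UNIV. (\<Sum>p\<in>{q<..P}. trisum F' (A K) (blockc L g l p) (W i) (gg i l))"
  have sp: "(\<Sum>l\<in>UNIV. \<Sum>i\<in>UNIV. trisum F (A K) (lowc L g P l) (W i) (gg i l)) = ?X + ?Z"
    unfolding split by (simp only: sum.distrib)
  have Z: "cmod ?Z \<le> 6912 * (\<nu> / (L * c0)) * D"
    by (rule high_total[OF K high_part[OF K hi qQ B], where j="\<lambda>i l. i"]) simp
  \<comment> \<open>In k = (k - m) + m the part with \<open>m\<close> vanishes by the divergence
    condition on \<open>W\<close>.\<close>
  have X1: "(\<Sum>i\<in>UNIV. trisum F' (A K) (?U l) (W i) (gg i l)) = (\<Sum>i\<in>UNIV. trisum F' (A K) (\<lambda>n. fk n i * ?U l n) (W i) (?V l))" for l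
  proof -
    have "(\<Sum>i\<in>UNIV. trisum F' (A K) (?U l) (W i) (gg i l)) - (\<Sum>i\<in>UNIV. trisum F' (A K) (\<lambda>n. fk n i * ?U l n) (W i) (?V l))
      = (\<Sum>i\<in>UNIV. \<Sum>k\<in>F'. \<Sum>m\<in>A K. fk m i * W i m * (?U l (k - m) * ?V l k))"
      unfolding trisum_def sum_subtractf[symmetric] by (intro sum.cong refl) (simp add: gg_def fk_diff algebra_simps)
    also have "\<dots> = (\<Sum>k\<in>F'. \<Sum>m\<in>A K. \<Sum>i\<in>UNIV. fk m i * W i m * (?U l (k - m) * ?V l k))"
      by (subst sum.swap) (intro sum.cong refl sum.swap)
    also have "\<dots> = (\<Sum>k\<in>F'. \<Sum>m\<in>A K. (\<Sum>i\<in>UNIV. fk m i * W i m) * (?U l (k - m) * ?V l k))"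
      by (simp only: sum_distrib_right)
    also have "\<dots> = 0" by (simp add: div)
    finally show ?thesis by simp
  qed
  have t: "cmod (trisum F' (A K) (\<lambda>n. fk n i * ?U l n) (W i) (?V l)) \<le> \<nu> / (L * c0) * D" for i l
  proof -
    have "cmod (trisum F' (A K) (\<lambda>n. fk n i * ?U l n) (W i) (?V l)) \<le> S * l2n (A K) (W i) * l2n F' (?V l)"
      by (rule trisum_sup[OF L S(1) finite_bl[of "int q"] U0 fins(2,3) gr])
    \<comment> \<open>The gain 4^(-q) is shared: the input, without weight, is worth 2^(-q/2), and
      the output, with weight 1/|k|, is worth 8^(-q/2).\<close>
    also have "\<dots> \<le> (\<nu> / (L * c0) * 4 ^ q) * sqrt (D / 2 ^ q) * sqrt (D / 8 ^ q)"
    proof (intro mult_mono S)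
      have Dl1: "Dl i G \<le> D" if "finite G" for i G
        using Dl_sum[OF that] member_le_sum[of i UNIV "\<lambda>l. Dl l G"] Dl_nonneg by force
      show "l2n (A K) (W i) \<le> sqrt (D / 2 ^ q)"
        unfolding l2n_def
      proof (rule real_sqrt_le_mono)
        have "(\<Sum>k\<in>A K. (cmod (W i k))\<^sup>2) \<le> (\<Sum>k\<in>A K. norm (freq k) * (cmod (W i k))\<^sup>2 / 2 ^ q)"
        proof (rule sum_mono)
          fix k assume "k \<in> A K"
          then have "2 ^ q \<le> norm (freq k)" using pow_Q[OF qQ] by (auto simp: A_def)
          then have "2 ^ q * (cmod (W i k))\<^sup>2 \<le> norm (freq k) * (cmod (W i k))\<^sup>2" by (rule mult_right_mono) simp
          then show "(cmod (W i k))\<^sup>2 \<le> norm (freq k) * (cmod (W i k))\<^sup>2 / 2 ^ q" by (simp add: field_simps)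
        qed
        also have "\<dots> = Dl i (A K) / 2 ^ q" by (simp add: Dl_def sum_divide_distrib)
        also have "\<dots> \<le> D / 2 ^ q" by (intro divide_right_mono Dl1) auto
        finally show "(\<Sum>k\<in>A K. (cmod (W i k))\<^sup>2) \<le> D / 2 ^ q" .
      qed
      show "l2n F' (?V l) \<le> sqrt (D / 8 ^ q)"
        unfolding l2n_def
      proof (rule real_sqrt_le_mono)
        have "(\<Sum>k\<in>F'. (cmod (?V l k))\<^sup>2) \<le> (\<Sum>k\<in>F'. norm (freq k) * (cmod (W l k))\<^sup>2 / 8 ^ q)"
        proof (rule sum_mono)
          fix k assume "k \<in> F'"
          then have k: "2 ^ q \<le> norm (freq k)" using pow_Q[OF qQ] by (auto simp: F'_def)
          then have kp: "0 < norm (freq k)" using zero_less_power[of "2::real" q] by linarith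
          have "(2 ^ q)^3 \<le> (norm (freq k))^3" using k by (intro power_mono) auto
          moreover have "(2 ^ q)^3 = (8::real) ^ q" by (simp add: power3_eq_cube flip: power_mult_distrib)
          ultimately have "(cmod (W l k))\<^sup>2 * 8 ^ q \<le> (cmod (W l k))\<^sup>2 * (norm (freq k))^3" by (intro mult_left_mono) auto
          then have "(cmod (W l k))\<^sup>2 / (norm (freq k))\<^sup>2 \<le> norm (freq k) * (cmod (W l k))\<^sup>2 / 8 ^ q"
            using kp by (simp add: field_simps power2_eq_square power3_eq_cube)
          then show "(cmod (?V l k))\<^sup>2 \<le> norm (freq k) * (cmod (W l k))\<^sup>2 / 8 ^ q"
            by (simp add: norm_divide power_divide)
        qed
        also have "\<dots> = Dl l F' / 8 ^ q" by (simp add: Dl_def sum_divide_distrib)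
        also have "\<dots> \<le> D / 8 ^ q" by (intro divide_right_mono Dl1) auto
        finally show "(\<Sum>k\<in>F'. (cmod (?V l k))\<^sup>2) \<le> D / 8 ^ q" .
      qed
    qed (use S D_nonneg L c0 nu in auto)
    also have "\<dots> = \<nu> / (L * c0) * D"
    proof -
      have "sqrt (D / 2 ^ q) * sqrt (D / 8 ^ q) = D / 4 ^ q"
      proof -
        have "(2::real) ^ q * 8 ^ q = (4 ^ q)\<^sup>2" by (simp add: power2_eq_square flip: power_mult_distrib)
        then have "sqrt (D / 2 ^ q) * sqrt (D / 8 ^ q) = sqrt ((D / 4 ^ q)\<^sup>2)"
          by (simp add: power_divide power2_eq_square flip: real_sqrt_mult)
        then show ?thesis using D_nonneg by simp
      qed
      then show ?thesis by (simp add: mult.assoc)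
    qed
    finally show ?thesis .
  qed
  have X: "cmod ?X \<le> 9 * (\<nu> / (L * c0) * D)"
  proof -
    have "cmod ?X \<le> (\<Sum>l\<in>(UNIV::3 set). \<Sum>i\<in>(UNIV::3 set). \<nu> / (L * c0) * D)"
      unfolding X1 by (intro order_trans[OF norm_sum] sum_mono t)
    then show ?thesis by simp
  qed
  define zz where "zz = \<nu> / (L * c0) * D"
  have z: "a * (\<nu> / (L * c0)) * D = a * zz" for a by (simp add: zz_def)
  show ?thesis unfolding sp z using norm_triangle_ineq[of ?X ?Z] X[folded zz_def] Z[unfolded z] by linarith
qed

end

section \<open>Fourier coefficients of products and passage to the limit\<close>

context fixes L :: real assumes L: "0 < L" begin

lemma fc_tp_mult:
  assumes "finite H" "g \<in> L2c L"
  shows "fc L (\<lambda>x. tp L H a x * g x) k = (\<Sum>n\<in>H. a n * fc L g (k - n))"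
proof -
  have "fc L (\<lambda>x. tp L H a x * g x) k = fc L (\<lambda>x. \<Sum>n\<in>H. a n * (g x * ek L n x)) k"
    unfolding tp_def sum_distrib_right by (simp only: mult_ac)
  also have "\<dots> = (\<Sum>n\<in>H. fc L (\<lambda>x. a n * (g x * ek L n x)) k)"
    by (rule fc_sum[OF L]) (intro L2c_cmult L2c_bounded_mult[OF assms(2), of _ 1] ek_measurable, simp)
  also have "\<dots> = (\<Sum>n\<in>H. a n * fc L g (k - n))"
  proof (intro sum.cong refl)
    fix n
    have "fc L (\<lambda>x. g x * ek L n x) k = fc L g (k - n)"
      unfolding fc_def by (simp add: mult.assoc flip: ek_add)
    then show "fc L (\<lambda>x. a n * (g x * ek L n x)) k = a n * fc L g (k - n)" by (simp only: fc_cmult[OF L])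
  qed
  finally show ?thesis .
qed

lemma fc_mult_integrable: "f \<in> L2c L \<Longrightarrow> g \<in> L2c L \<Longrightarrow> integrable (torus L) (\<lambda>x. (f x * g x) * ek L k x)"
  using L2c_mult_integrable[of f L "\<lambda>x. g x * ek L k x"] L2c_bounded_mult[of g L "ek L k" 1] by (simp add: mult.assoc)

lemma fc_mult_le:
  assumes f: "f \<in> L2c L" and g: "g \<in> L2c L" and d: "d > 0"
  shows "cmod (fc L (\<lambda>x. f x * g x) k) \<le> ((LINT x|torus L. (cmod (f x))\<^sup>2) / d + d * (LINT x|torus L. (cmod (g x))\<^sup>2)) / (2 * L^3)"
proof -
  have "cmod (LINT x|torus L. (f x * g x) * ek L (- k) x) \<le> (LINT x|torus L. cmod ((f x * g x) * ek L (- k) x))"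
    by (rule integral_norm_bound)
  also have "\<dots> \<le> (LINT x|torus L. ((cmod (f x))\<^sup>2 / d + d * (cmod (g x))\<^sup>2) / 2)"
  proof (rule integral_mono)
    show "integrable (torus L) (\<lambda>x. cmod ((f x * g x) * ek L (- k) x))" using fc_mult_integrable[OF f g] by (rule integrable_norm)
    show "integrable (torus L) (\<lambda>x. ((cmod (f x))\<^sup>2 / d + d * (cmod (g x))\<^sup>2) / 2)" using L2c_int[OF f] L2c_int[OF g] by simp
    fix x
    have "0 \<le> (cmod (f x) - d * cmod (g x))\<^sup>2 / d" using d by simp
    also have "\<dots> = (cmod (f x))\<^sup>2 / d + d * (cmod (g x))\<^sup>2 - 2 * (cmod (f x) * cmod (g x))"
      using d by (simp add: power2_eq_square field_simps)
    finally show "cmod ((f x * g x) * ek L (- k) x) \<le> ((cmod (f x))\<^sup>2 / d + d * (cmod (g x))\<^sup>2) / 2"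
      by (simp add: norm_mult)
  qed
  also have "\<dots> = ((LINT x|torus L. (cmod (f x))\<^sup>2) / d + d * (LINT x|torus L. (cmod (g x))\<^sup>2)) / 2"
    using L2c_int[OF f] L2c_int[OF g] by simp
  finally have "cmod (LINT x|torus L. (f x * g x) * ek L (- k) x) / L^3 \<le> ((LINT x|torus L. (cmod (f x))\<^sup>2) / d + d * (LINT x|torus L. (cmod (g x))\<^sup>2)) / 2 / L^3"
    using L by (intro divide_right_mono) auto
  then show ?thesis using L by (simp add: fc_def norm_divide norm_power)
qed

text \<open>Young's inequality with a free weight: mean-square convergence of one factor suffices
  when the other is fixed.\<close>

lemma fc_mult_limit:
  assumes f: "\<And>P. f P \<in> L2c L" and f0: "f0 \<in> L2c L" and g: "g \<in> L2c L"
    and lim: "(\<lambda>P. LINT x|torus L. (cmod (f0 x - f P x))\<^sup>2) \<longlonglongrightarrow> 0"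
  shows "(\<lambda>P. fc L (\<lambda>x. f P x * g x) k) \<longlonglongrightarrow> fc L (\<lambda>x. f0 x * g x) k"
proof (rule tendstoI)
  fix e :: real assume e: "0 < e"
  let ?G = "LINT x|torus L. (cmod (g x))\<^sup>2"
  \<comment> \<open>With this weight the fixed factor contributes at most \<open>e / 2\<close>; the
    added 1 avoids a division by zero.\<close>
  define d where "d = e * L^3 / (?G + 1)"
  have G: "0 \<le> ?G" by simp
  then have d: "0 < d" using e L by (simp add: d_def add_nonneg_pos)
  have dG: "d * ?G \<le> e * L^3"
  proof -
    have "d * ?G \<le> d * (?G + 1)" using d by simp
    also have "\<dots> = e * L^3" using G by (simp add: d_def add_nonneg_eq_0_iff)
    finally show ?thesis .
  qed
  have "eventually (\<lambda>P. (LINT x|torus L. (cmod (f0 x - f P x))\<^sup>2) < e * L^3 * d) sequentially"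
    using lim by (rule order_tendstoD) (use e L d in simp)
  then show "eventually (\<lambda>P. dist (fc L (\<lambda>x. f P x * g x) k) (fc L (\<lambda>x. f0 x * g x) k) < e) sequentially"
  proof eventually_elim
    case (elim P)
    have "fc L (\<lambda>x. f0 x * g x) k - fc L (\<lambda>x. f P x * g x) k = fc L (\<lambda>x. (f0 x - f P x) * g x) k"
      using fc_mult_integrable[OF f0 g, of "- k"] fc_mult_integrable[OF f[of P] g, of "- k"]
      by (simp add: fc_def left_diff_distrib diff_divide_distrib)
    then have "dist (fc L (\<lambda>x. f P x * g x) k) (fc L (\<lambda>x. f0 x * g x) k) = cmod (fc L (\<lambda>x. (f0 x - f P x) * g x) k)"
      by (simp add: dist_norm norm_minus_commute)
    also have "\<dots> \<le> ((LINT x|torus L. (cmod (f0 x - f P x))\<^sup>2) / d + d * ?G) / (2 * L^3)"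
      by (rule fc_mult_le[OF L2c_diff[OF f0 f] g d])
    also have "\<dots> < (e * L^3 + e * L^3) / (2 * L^3)"
      using elim dG d L by (intro divide_strict_right_mono add_less_le_mono) (auto simp: divide_less_eq)
    also have "\<dots> = e" using L by simp
    finally show ?case .
  qed
qed

end

lemma uc_L2c: "g \<in> L2_torus L \<Longrightarrow> uc g i \<in> L2c L"
  using L2_torus_comp[of g L "axis i 1"] by (simp add: inner_axis uc_def[abs_def])

context cutoff begin

text \<open>The smooth cutoff is not an orthogonal projection. Besides the Parseval defect there is
  an error from the frequencies between the region where the multiplier is 1 and the edge of the
  spectrum, amplified by at most 1 + M; these frequencies again belong to a Parseval tail.\<close>

lemma lowc_limit:
  assumes L: "0 < L" and g: "g \<in> L2_torus L"
  shows "(\<lambda>P. LINT x|torus L. (cmod (uc g i x - tp L (bl (int P)) (lowc L g P i) x))\<^sup>2) \<longlonglongrightarrow> 0"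
proof (rule tendstoI)
  fix e :: real assume e: "0 < e"
  note f = uc_L2c[OF g, of i]
  define C where "C = 1 + (1 + M)\<^sup>2"
  have C: "C > 0" unfolding C_def by (rule add_pos_nonneg) auto
  obtain F0 where F0: "finite F0" "\<And>G. finite G \<Longrightarrow> F0 \<subseteq> G \<Longrightarrow>
     (LINT x|torus L. (cmod (uc g i x))\<^sup>2) - L^3 * (\<Sum>k\<in>G. (cmod (fc L (uc g i) k))\<^sup>2) < e / C"
    by (rule parseval_tail[OF L f, of "e / C"]) (use e C in auto)
  obtain P0 where P0: "\<And>k. k \<in> F0 \<Longrightarrow> norm (freq k) \<le> 2 ^ P0"
  proof -
    obtain P0 where P0: "(\<Sum>k\<in>F0. norm (freq k)) < 2 ^ P0" using real_arch_pow[of 2] by auto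
    show ?thesis
    proof
      fix k assume "k \<in> F0"
      then have "norm (freq k) \<le> (\<Sum>k\<in>F0. norm (freq k))" using F0(1) by (intro member_le_sum) auto
      then show "norm (freq k) \<le> 2 ^ P0" using P0 by simp
    qed
  qed
  have "(LINT x|torus L. (cmod (uc g i x - tp L (bl (int P)) (lowc L g P i) x))\<^sup>2) < e" if P: "P0 \<le> P" for P
  proof -
    define a where "a k = (cmod (fc L (uc g i) k))\<^sup>2" for k
    define G where "G = {k::int^3. norm (freq k) \<le> 3/4 * 2 ^ Suc P}"
    have G: "finite G" unfolding G_def by (rule finite_subset[OF _ finite_freq_ball[of "3/4 * 2 ^ Suc P"]]) auto
    have "(3/4 * 2 ^ Suc P :: real) \<le> 2 * 2 ^ P" by simp
    then have "G \<subseteq> bl (int P)" unfolding G_def bl_nat by (meson Collect_mono order_trans)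
    note G = G this
    have "(2::real) ^ P0 \<le> 2 ^ P" using P by (intro power_increasing) auto
    moreover have "(2::real) ^ P \<le> 3/4 * 2 ^ Suc P" by simp
    ultimately have FG: "F0 \<subseteq> G" using P0 unfolding G_def by (smt (verit) mem_Collect_eq subsetI)
    let ?I = "LINT x|torus L. (cmod (uc g i x))\<^sup>2"
    have tG: "?I - L^3 * sum a G < e / C" using F0(2)[OF G(1) FG] by (simp add: a_def)
    have tb: "L^3 * sum a (bl (int P)) \<le> ?I" using bessel[OF L f finite_bl] by (simp add: a_def)
    have Gb: "sum a G \<le> sum a (bl (int P))" using G by (intro sum_mono2) (auto simp: a_def)
    have "(\<Sum>k\<in>bl (int P). (cmod (fc L (uc g i) k - lowc L g P i k))\<^sup>2) \<le> (\<Sum>k\<in>bl (int P) - G. (1 + M)\<^sup>2 * a k)"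
    proof -
      have t: "(cmod (fc L (uc g i) k - lowc L g P i k))\<^sup>2 = (1 - low (Suc P) (freq k))\<^sup>2 * a k" for k
      proof -
        have "fc L (uc g i) k - lowc L g P i k = complex_of_real (1 - low (Suc P) (freq k)) * fc L (uc g i) k"
          by (simp add: lowc_def left_diff_distrib)
        then show ?thesis by (simp only: norm_mult norm_of_real power_mult_distrib power2_abs a_def)
      qed
      have "(\<Sum>k\<in>bl (int P). (1 - low (Suc P) (freq k))\<^sup>2 * a k) = (\<Sum>k\<in>bl (int P) - G. (1 - low (Suc P) (freq k))\<^sup>2 * a k)"
        by (rule sum.mono_neutral_right) (use low_one in \<open>auto simp: G_def\<close>)
      also have "\<dots> \<le> (\<Sum>k\<in>bl (int P) - G. (1 + M)\<^sup>2 * a k)"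
      proof (intro sum_mono mult_right_mono)
        fix k
        have "\<bar>1 - low (Suc P) (freq k)\<bar> \<le> 1 + M" using low_bounds[of "Suc P" "freq k"] by (simp add: abs_le_iff)
        then have "\<bar>1 - low (Suc P) (freq k)\<bar>\<^sup>2 \<le> (1 + M)\<^sup>2" by (intro power_mono) auto
        then show "(1 - low (Suc P) (freq k))\<^sup>2 \<le> (1 + M)\<^sup>2" by simp
      qed (simp add: a_def)
      finally show ?thesis by (simp only: t)
    qed
    also have "\<dots> = (1 + M)\<^sup>2 * (sum a (bl (int P)) - sum a G)"
      using G by (simp add: sum_diff flip: sum_distrib_left)
    finally have "L^3 * (\<Sum>k\<in>bl (int P). (cmod (fc L (uc g i) k - lowc L g P i k))\<^sup>2) \<le> L^3 * ((1 + M)\<^sup>2 * (sum a (bl (int P)) - sum a G))"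
      by (rule mult_left_mono) (use L in simp)
    then have s: "L^3 * (\<Sum>k\<in>bl (int P). (cmod (fc L (uc g i) k - lowc L g P i k))\<^sup>2) \<le> (1 + M)\<^sup>2 * (L^3 * sum a (bl (int P)) - L^3 * sum a G)"
      by (simp add: right_diff_distrib mult_ac)
    have "(LINT x|torus L. (cmod (uc g i x - tp L (bl (int P)) (lowc L g P i) x))\<^sup>2) \<le>
       (?I - L^3 * sum a (bl (int P))) + (1 + M)\<^sup>2 * (L^3 * sum a (bl (int P)) - L^3 * sum a G)"
      unfolding L2_expand[OF L f finite_bl] using s by (simp add: a_def)
    also have "\<dots> \<le> (?I - L^3 * sum a G) + (1 + M)\<^sup>2 * (?I - L^3 * sum a G)"
      using tb Gb L by (intro add_mono mult_left_mono) auto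
    also have "\<dots> = C * (?I - L^3 * sum a G)" by (simp add: C_def distrib_right)
    also have "\<dots> < C * (e / C)" using tG C by (rule mult_strict_left_mono)
    finally show ?thesis using C by simp
  qed
  then show "eventually (\<lambda>P. dist (LINT x|torus L. (cmod (uc g i x - tp L (bl (int P)) (lowc L g P i) x))\<^sup>2) 0 < e) sequentially"
    by (auto simp: eventually_sequentially intro!: exI[of _ P0])
qed

end

context slice begin

text \<open>For \<open>k\<close> in \<open>F\<close> and \<open>n\<close> in the spectrum of the low
  part, \<open>k - n\<close> has norm at most N + 2 * 2^P. So \<open>A (2 * 2 ^ P)\<close> contains
  all such frequencies at which \<open>W\<close> may be nonzero.\<close>

lemma trisum_fc:
  assumes g: "g \<in> L2_torus L" and w: "w \<in> L2c L" "\<And>k. fc L w k = W j k"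
  shows "(\<Sum>k\<in>F. fc L (\<lambda>x. tp L (bl (int P)) (lowc L g P i) x * w x) k * y k) = trisum F (A (2 * 2 ^ P)) (lowc L g P i) (W j) y"
  unfolding trisum_def sum_distrib_right[symmetric]
proof (intro sum.cong refl arg_cong2[where f="(*)"])
  fix k assume k: "k \<in> F"
  let ?a = "lowc L g P i" and ?A = "A (2 * 2 ^ P)" and ?B = "(\<lambda>n. k - n) ` bl (int P)"
  have a0: "m \<notin> ?B \<Longrightarrow> ?a (k - m) = 0" for m
  proof -
    assume "m \<notin> ?B"
    moreover have "k - m \<in> bl (int P) \<Longrightarrow> m \<in> ?B" by (rule image_eqI[of _ _ "k - m"]) simp_all
    ultimately have "k - m \<notin> bl (int P)" by blast
    then show ?thesis by (simp add: bl_nat lowc_outside)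
  qed
  have w0: "m \<in> ?B \<Longrightarrow> m \<notin> ?A \<Longrightarrow> W j m = 0" for m
  proof -
    assume m: "m \<in> ?B" "m \<notin> ?A"
    then obtain n where n: "n \<in> bl (int P)" "m = k - n" by auto
    have "norm (freq m) \<le> norm (freq k) + norm (freq n)" unfolding n(2) freq_diff by (rule norm_triangle_ineq4)
    also have "\<dots> \<le> N + 2 * 2 ^ P" using k n by (simp add: F_def bl_nat)
    finally show ?thesis using m by (intro W0) (auto simp: A_def)
  qed
  have "fc L (\<lambda>x. tp L (bl (int P)) ?a x * w x) k = (\<Sum>n\<in>bl (int P). ?a n * W j (k - n))"
    by (simp add: fc_tp_mult[OF L finite_bl w(1)] w(2))
  also have "\<dots> = (\<Sum>m\<in>?B. ?a (k - m) * W j m)" by (subst sum.reindex) (auto simp: inj_on_def)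
  also have "\<dots> = (\<Sum>m\<in>?B \<inter> ?A. ?a (k - m) * W j m)" by (rule sum.mono_neutral_right) (use w0 in auto)
  also have "\<dots> = (\<Sum>m\<in>?A. ?a (k - m) * W j m)" by (rule sum.mono_neutral_left) (use a0 in auto)
  finally show "fc L (\<lambda>x. tp L (bl (int P)) ?a x * w x) k = (\<Sum>m\<in>?A. ?a (k - m) * W j m)" .
qed

text \<open>The difference of the products is u_i w_l + w_i v_l: transport by \<open>u\<close> and
  stretching of \<open>v\<close>. One factor is truncated at \<open>P\<close> to obtain finite sums;
  the bounds do not depend on \<open>P\<close> and survive the limit.\<close>

lemma nonlinear_estimate:
  assumes u: "u \<in> L2_torus L" and v: "v \<in> L2_torus L"
    and Wd: "\<And>i k. W i k = fc L (uc u i) k - fc L (uc v i) k"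
    and wu: "wavenumber \<eta> L \<nu> c0 u \<le> lam_ext L (enat Q)" and wv: "wavenumber \<eta> L \<nu> c0 v \<le> lam_ext L (enat Q)"
    and du: "\<And>n. (\<Sum>i\<in>UNIV. fk n i * fc L (uc u i) n) = 0" and dv: "\<And>n. (\<Sum>i\<in>UNIV. fk n i * fc L (uc v i) n) = 0"
    and mean: "\<And>i. fc L (uc u i) 0 = 0"
    and hg: "\<And>G. finite G \<Longrightarrow> (\<Sum>n\<in>G. (norm (freq n))\<^sup>2 * (\<Sum>i\<in>UNIV. (cmod (fc L (uc u i) n))\<^sup>2)) \<le> h\<^sup>2"
  shows "\<bar>Im (\<Sum>l\<in>UNIV. \<Sum>i\<in>UNIV. \<Sum>k\<in>F. (fc L (\<lambda>x. uc u i x * uc u l x) k - fc L (\<lambda>x. uc v i x * uc v l x) k) * gg i l k)\<bar>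
     \<le> 13838 * (\<nu> / (L * c0)) * D + 225 * M * h * sqrt R * sqrt E"
proof -
  define w where "w i x = uc u i x - uc v i x" for i x
  have wL: "w i \<in> L2c L" for i unfolding w_def[abs_def] by (intro L2c_diff uc_L2c u v)
  have fw: "fc L (w i) k = W i k" for i k unfolding w_def[abs_def] Wd by (rule fc_diff[OF L]) (intro uc_L2c u v)+
  have dW: "(\<Sum>i\<in>UNIV. fk n i * W i n) = 0" for n
    using du[of n] dv[of n] by (simp add: Wd right_diff_distrib sum_subtractf)
  obtain q \<theta> \<delta> \<gamma> B S where U: "q \<le> Q" "\<And>i. high L \<theta> \<delta> \<gamma> B q (blockc L u i)" "B / (1 - 2 powr (- \<gamma>)) \<le> \<nu> / (2 * L * c0)"
    "\<And>i l. AE x in torus L. cmod (tp L (bl (int q)) (\<lambda>k. fk k l * lowc L u q i k) x) \<le> S" "0 < S" "S \<le> \<nu> / (L * c0) * 4 ^ q"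
    by (rule wavenumber_data[OF L nu c0 wu]) (rule that)
  obtain q' \<theta>' \<delta>' \<gamma>' B' S' where V: "q' \<le> Q" "\<And>i. high L \<theta>' \<delta>' \<gamma>' B' q' (blockc L v i)" "B' / (1 - 2 powr (- \<gamma>')) \<le> \<nu> / (2 * L * c0)"
    "\<And>i l. AE x in torus L. cmod (tp L (bl (int q')) (\<lambda>k. fk k l * lowc L v q' i k) x) \<le> S'" "0 < S'" "S' \<le> \<nu> / (L * c0) * 4 ^ q'"
    by (rule wavenumber_data[OF L nu c0 wv]) (rule that)
  let ?T1 = "\<lambda>P. \<Sum>l\<in>UNIV. \<Sum>i\<in>UNIV. \<Sum>k\<in>F. fc L (\<lambda>x. tp L (bl (int P)) (lowc L u P i) x * w l x) k * gg i l k"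
  let ?T2 = "\<lambda>P. \<Sum>l\<in>UNIV. \<Sum>i\<in>UNIV. \<Sum>k\<in>F. fc L (\<lambda>x. tp L (bl (int P)) (lowc L v P l) x * w i x) k * gg i l k"
  let ?S1 = "\<Sum>l\<in>UNIV. \<Sum>i\<in>UNIV. \<Sum>k\<in>F. fc L (\<lambda>x. uc u i x * w l x) k * gg i l k"
  let ?S2 = "\<Sum>l\<in>UNIV. \<Sum>i\<in>UNIV. \<Sum>k\<in>F. fc L (\<lambda>x. uc v l x * w i x) k * gg i l k"
  have L1: "?T1 \<longlonglongrightarrow> ?S1"
    by (intro tendsto_sum tendsto_mult_right fc_mult_limit[OF L] L2c_tp L uc_L2c u wL lowc_limit)
  have L2: "?T2 \<longlonglongrightarrow> ?S2"
    by (intro tendsto_sum tendsto_mult_right fc_mult_limit[OF L] L2c_tp L uc_L2c v wL lowc_limit)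
  have b1: "\<bar>Im (?T1 P)\<bar> \<le> 6917 * (\<nu> / (L * c0)) * D + 225 * M * h * sqrt R * sqrt E" if "q \<le> P" for P
    unfolding trisum_fc[OF u wL fw]
    by (rule transport[OF _ U(1) that U(2,3,4,5,6) du mean hg]) simp_all
  have b2: "\<bar>Im (?T2 P)\<bar> \<le> 6921 * (\<nu> / (L * c0)) * D" if "q' \<le> P" for P
    unfolding trisum_fc[OF v wL fw]
    by (rule order_trans[OF abs_Im_le_cmod stretch[OF _ V(1) that V(2,3,4,5,6) dW]]) simp_all
  have B1: "\<bar>Im ?S1\<bar> \<le> 6917 * (\<nu> / (L * c0)) * D + 225 * M * h * sqrt R * sqrt E"
    by (rule tendsto_upperbound[OF tendsto_rabs[OF tendsto_Im[OF L1]]]) (use b1 in \<open>auto simp: eventually_sequentially\<close>)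
  have B2: "\<bar>Im ?S2\<bar> \<le> 6921 * (\<nu> / (L * c0)) * D"
    by (rule tendsto_upperbound[OF tendsto_rabs[OF tendsto_Im[OF L2]]]) (use b2 in \<open>auto simp: eventually_sequentially\<close>)
  have split: "fc L (\<lambda>x. uc u i x * uc u l x) k - fc L (\<lambda>x. uc v i x * uc v l x) k = fc L (\<lambda>x. uc u i x * w l x) k + fc L (\<lambda>x. uc v l x * w i x) k" for i l k
  proof -
    note I = fc_mult_integrable[OF L uc_L2c[OF u] uc_L2c[OF u], of i l "- k"] fc_mult_integrable[OF L uc_L2c[OF v] uc_L2c[OF v], of i l "- k"]
      fc_mult_integrable[OF L uc_L2c[OF u] wL, of i l "- k"] fc_mult_integrable[OF L uc_L2c[OF v] wL, of l i "- k"]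
    have e: "uc u i x * uc u l x * ek L (- k) x - uc v i x * uc v l x * ek L (- k) x = uc u i x * w l x * ek L (- k) x + uc v l x * w i x * ek L (- k) x" for x
      by (simp add: w_def algebra_simps)
    have "(LINT x|torus L. uc u i x * uc u l x * ek L (- k) x) - (LINT x|torus L. uc v i x * uc v l x * ek L (- k) x)
      = (LINT x|torus L. uc u i x * w l x * ek L (- k) x) + (LINT x|torus L. uc v l x * w i x * ek L (- k) x)"
      unfolding Bochner_Integration.integral_diff[OF I(1,2), symmetric] Bochner_Integration.integral_add[OF I(3,4), symmetric] e ..
    then show ?thesis by (simp add: fc_def flip: diff_divide_distrib add_divide_distrib)
  qed
  have S: "(\<Sum>l\<in>UNIV. \<Sum>i\<in>UNIV. \<Sum>k\<in>F. (fc L (\<lambda>x. uc u i x * uc u l x) k - fc L (\<lambda>x. uc v i x * uc v l x) k) * gg i l k) = ?S1 + ?S2"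
    unfolding split distrib_right by (simp only: sum.distrib)
  define zz where "zz = \<nu> / (L * c0) * D"
  have z: "a * (\<nu> / (L * c0)) * D = a * zz" for a by (simp add: zz_def)
  have "\<bar>Im (?S1 + ?S2)\<bar> \<le> \<bar>Im ?S1\<bar> + \<bar>Im ?S2\<bar>" by simp
  also have "\<dots> \<le> (6917 * zz + 225 * M * h * sqrt R * sqrt E) + 6921 * zz"
    using B1 B2 unfolding z by (rule add_mono)
  finally show ?thesis unfolding S z by simp
qed

end

section \<open>Evolution of the Fourier modes\<close>

lemma fc_Re_Im:
  assumes L: "0 < L" and h: "integrable (torus L) h" and \<xi>: "\<xi> = (2 * pi / L) *\<^sub>R freq k"
  shows "L^3 * Re (fc L (\<lambda>x. complex_of_real (h x)) k) = (LINT x|torus L. cos (\<xi> \<bullet> x) * h x)"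
    "L^3 * Im (fc L (\<lambda>x. complex_of_real (h x)) k) = - (LINT x|torus L. sin (\<xi> \<bullet> x) * h x)"
proof -
  let ?g = "\<lambda>x. complex_of_real (h x) * ek L (- k) x"
  have "integrable (torus L) ?g"
  proof (rule Bochner_Integration.integrable_bound[OF h])
    have [measurable]: "h \<in> borel_measurable (torus L)" using h by simp
    show "?g \<in> borel_measurable (torus L)" by measurable
  qed (simp add: norm_mult)
  note I = this
  have e: "ek L (- k) x = cis (- (\<xi> \<bullet> x))" for x
    by (simp add: ek_minus \<xi> cis_conv_exp)
  have R: "Re (?g x) = cos (\<xi> \<bullet> x) * h x" "Im (?g x) = - (sin (\<xi> \<bullet> x) * h x)" for x by (simp_all add: e)
  have "Re (integral\<^sup>L (torus L) ?g) = (LINT x|torus L. cos (\<xi> \<bullet> x) * h x)"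
    using integral_Re[OF I] by (simp only: R)
  moreover have "Im (integral\<^sup>L (torus L) ?g) = - (LINT x|torus L. sin (\<xi> \<bullet> x) * h x)"
    using integral_Im[OF I] by (simp only: R integral_minus)
  moreover have r: "Re (complex_of_real c * z) = c * Re z" "Im (complex_of_real c * z) = c * Im z" for c z by simp_all
  have "complex_of_real (L^3) * fc L (\<lambda>x. complex_of_real (h x)) k = integral\<^sup>L (torus L) ?g"
    using L by (simp add: fc_def)
  then have "L^3 * Re (fc L (\<lambda>x. complex_of_real (h x)) k) = Re (integral\<^sup>L (torus L) ?g)"
    "L^3 * Im (fc L (\<lambda>x. complex_of_real (h x)) k) = Im (integral\<^sup>L (torus L) ?g)"
    by (simp_all add: r flip: \<open>complex_of_real (L^3) * fc L (\<lambda>x. complex_of_real (h x)) k = integral\<^sup>L (torus L) ?g\<close> del: of_real_power)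
  ultimately show "L^3 * Re (fc L (\<lambda>x. complex_of_real (h x)) k) = (LINT x|torus L. cos (\<xi> \<bullet> x) * h x)"
    "L^3 * Im (fc L (\<lambda>x. complex_of_real (h x)) k) = - (LINT x|torus L. sin (\<xi> \<bullet> x) * h x)" by simp_all
qed

text \<open>A phase pi/2 turns the cosine into minus the sine, the imaginary part of the conjugate
  character.\<close>

lemma al_fc:
  assumes L: "0 < L" and g: "g \<in> L2_torus L" and \<xi>: "\<xi> = (2 * pi / L) *\<^sub>R freq k"
  shows "al L g \<xi> 0 (axis j 1) = L^3 * Re (fc L (uc g j) k)" "al L g \<xi> (pi / 2) (axis j 1) = L^3 * Im (fc L (uc g j) k)"
proof -
  have i: "integrable (torus L) (\<lambda>x. g x $ j)"
    using integrable_Re[OF L2c_integrable[OF L uc_L2c[OF g, of j]]] by (simp add: uc_def)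
  show "al L g \<xi> 0 (axis j 1) = L^3 * Re (fc L (uc g j) k)"
    using fc_Re_Im(1)[OF L i \<xi>] by (simp add: al_def inner_axis uc_def[abs_def])
  show "al L g \<xi> (pi / 2) (axis j 1) = L^3 * Im (fc L (uc g j) k)"
    using fc_Re_Im(2)[OF L i \<xi>] by (simp add: al_def inner_axis uc_def[abs_def] cos_add)
qed

lemma gm_fc:
  assumes L: "0 < L" and g: "g \<in> L2_torus L" and \<xi>: "\<xi> = (2 * pi / L) *\<^sub>R freq k"
  shows "gm L g \<xi> 0 (axis j 1) = - (\<Sum>i\<in>UNIV. \<xi> $ i * (L^3 * Im (fc L (\<lambda>x. uc g i x * uc g j x) k)))"
    "gm L g \<xi> (pi / 2) (axis j 1) = (\<Sum>i\<in>UNIV. \<xi> $ i * (L^3 * Re (fc L (\<lambda>x. uc g i x * uc g j x) k)))"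
proof -
  have i: "integrable (torus L) (\<lambda>x. g x $ i * g x $ j)" for i
    using integrable_Re[OF L2c_mult_integrable[OF uc_L2c[OF g, of i] uc_L2c[OF g, of j]]] by (simp add: uc_def)
  have u: "(\<lambda>x. uc g i x * uc g j x) = (\<lambda>x. complex_of_real (g x $ i * g x $ j))" for i by (simp add: uc_def)
  have I: "integrable (torus L) (\<lambda>x. \<xi> $ i * (sin (\<xi> \<bullet> x + \<phi>) * (g x $ i * g x $ j)))" for i \<phi>
  proof (rule integrable_mult_right, rule Bochner_Integration.integrable_bound[OF i])
    have [measurable]: "(\<lambda>x. g x $ i * g x $ j) \<in> borel_measurable (torus L)" using i[of i] by simp
    show "(\<lambda>x. sin (\<xi> \<bullet> x + \<phi>) * (g x $ i * g x $ j)) \<in> borel_measurable (torus L)" by measurable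
    show "AE x in torus L. norm (sin (\<xi> \<bullet> x + \<phi>) * (g x $ i * g x $ j)) \<le> norm (g x $ i * g x $ j)"
      by (intro AE_I2) (simp add: abs_mult mult_left_le_one_le)
  qed
  have G: "gm L g \<xi> \<phi> (axis j 1) = (\<Sum>i\<in>UNIV. \<xi> $ i * (LINT x|torus L. sin (\<xi> \<bullet> x + \<phi>) * (g x $ i * g x $ j)))" for \<phi>
  proof -
    have "sin (\<xi> \<bullet> x + \<phi>) * ((\<xi> \<bullet> g x) * (g x \<bullet> axis j 1)) = (\<Sum>i\<in>UNIV. \<xi> $ i * (sin (\<xi> \<bullet> x + \<phi>) * (g x $ i * g x $ j)))" for x
    proof -
      have "\<xi> \<bullet> g x = (\<Sum>i\<in>UNIV. \<xi> $ i * g x $ i)" by (simp add: inner_vec_def)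
      moreover have "g x \<bullet> axis j 1 = g x $ j" by (simp add: inner_axis)
      ultimately show ?thesis by (simp only: sum_distrib_right sum_distrib_left mult_ac)
    qed
    then have "gm L g \<xi> \<phi> (axis j 1) = (LINT x|torus L. (\<Sum>i\<in>UNIV. \<xi> $ i * (sin (\<xi> \<bullet> x + \<phi>) * (g x $ i * g x $ j))))"
      by (simp only: gm_def)
    also have "\<dots> = (\<Sum>i\<in>UNIV. LINT x|torus L. \<xi> $ i * (sin (\<xi> \<bullet> x + \<phi>) * (g x $ i * g x $ j)))"
      by (rule Bochner_Integration.integral_sum) (rule I)
    finally show ?thesis by simp
  qed
  show "gm L g \<xi> 0 (axis j 1) = - (\<Sum>i\<in>UNIV. \<xi> $ i * (L^3 * Im (fc L (\<lambda>x. uc g i x * uc g j x) k)))"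
    unfolding G u fc_Re_Im(2)[OF L i \<xi>] by (simp add: sum_negf)
  show "gm L g \<xi> (pi / 2) (axis j 1) = (\<Sum>i\<in>UNIV. \<xi> $ i * (L^3 * Re (fc L (\<lambda>x. uc g i x * uc g j x) k)))"
    unfolding G u fc_Re_Im(1)[OF L i \<xi>] by (simp add: sin_add)
qed

lemma al_linear:
  assumes L: "0 < L" and g: "g \<in> L2_torus L"
  shows "al L g \<xi> \<phi> (v - c *\<^sub>R w) = al L g \<xi> \<phi> v - c * al L g \<xi> \<phi> w"
    "gm L g \<xi> \<phi> (v - c *\<^sub>R w) = gm L g \<xi> \<phi> v - c * gm L g \<xi> \<phi> w"
    "al L g \<xi> \<phi> v = (\<Sum>j\<in>UNIV. v $ j * al L g \<xi> \<phi> (axis j 1))"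
    "gm L g \<xi> \<phi> v = (\<Sum>j\<in>UNIV. v $ j * gm L g \<xi> \<phi> (axis j 1))"
proof -
  have a: "linear (al L g \<xi> \<phi>)"
    unfolding al_def by (rule linearI) (simp_all add: inner_add_right distrib_left al_integrable[OF L g] mult.left_commute)
  have b: "linear (gm L g \<xi> \<phi>)"
  proof (rule linearI)
    show "gm L g \<xi> \<phi> (x + y) = gm L g \<xi> \<phi> x + gm L g \<xi> \<phi> y" for x y
      unfolding gm_def by (simp add: inner_add_right distrib_left gm_integrable[OF g])
    show "gm L g \<xi> \<phi> (c *\<^sub>R x) = c *\<^sub>R gm L g \<xi> \<phi> x" for c x
      unfolding gm_def by (simp add: mult.left_commute)
  qed
  show "al L g \<xi> \<phi> (v - c *\<^sub>R w) = al L g \<xi> \<phi> v - c * al L g \<xi> \<phi> w"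
    "gm L g \<xi> \<phi> (v - c *\<^sub>R w) = gm L g \<xi> \<phi> v - c * gm L g \<xi> \<phi> w"
    by (simp_all add: linear_diff[OF a] linear_scale[OF a] linear_diff[OF b] linear_scale[OF b])
  have v: "v = (\<Sum>j\<in>UNIV. v $ j *\<^sub>R axis j 1)" using basis_expansion[of v] by (simp add: scalar_mult_eq_scaleR)
  show "al L g \<xi> \<phi> v = (\<Sum>j\<in>UNIV. v $ j * al L g \<xi> \<phi> (axis j 1))"
    by (subst v) (simp add: linear_sum[OF a] linear_scale[OF a])
  show "gm L g \<xi> \<phi> v = (\<Sum>j\<in>UNIV. v $ j * gm L g \<xi> \<phi> (axis j 1))"
    by (subst v) (simp add: linear_sum[OF b] linear_scale[OF b])
qed

text \<open>The norms of weak solutions are integrated over \<open>lebesgue_on\<close>, the tested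
  equations over \<open>lborel\<close>; for Borel functions this makes no difference.\<close>

lemma set_integrable_lebesgue:
  fixes f :: "real \<Rightarrow> real"
  assumes [measurable]: "f \<in> borel_measurable borel"
  shows "set_integrable lborel {a..b} f \<longleftrightarrow> integrable (lebesgue_on {a..b}) f"
    "(LBINT t:{a..b}. f t) = integral\<^sup>L (lebesgue_on {a..b}) f"
proof -
  have m: "(\<lambda>x. indicator {a..b} x * f x) \<in> borel_measurable lborel" by measurable
  show "set_integrable lborel {a..b} f \<longleftrightarrow> integrable (lebesgue_on {a..b}) f"
    unfolding set_integrable_def by (simp add: integrable_restrict_space integrable_completion[OF m])
  show "(LBINT t:{a..b}. f t) = integral\<^sup>L (lebesgue_on {a..b}) f"
    unfolding set_lebesgue_integral_def by (simp add: integral_restrict_space integral_completion[OF m])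
qed

lemma tower_support:
  assumes th: "tower \<theta>" "\<And>t. t \<notin> {a..b} \<Longrightarrow> \<theta> 0 t = 0" and t: "t \<notin> {a..b}"
  shows "\<theta> 1 t = 0"
proof -
  have "((\<lambda>_. 0) has_real_derivative 0) (at t)" by simp
  then have "(\<theta> 0 has_real_derivative 0) (at t)"
    by (rule has_field_derivative_transform_within_open[where S="- {a..b}"]) (use th t in \<open>auto\<close>)
  moreover have "(\<theta> 0 has_real_derivative \<theta> 1 t) (at t)" using tower_deriv[OF th(1), of 0 t] by simp
  ultimately show ?thesis by (rule DERIV_unique[symmetric])
qed

lemma tower_mult_integrable:
  assumes th: "tower \<theta>" "\<And>t. t \<notin> {a..b} \<Longrightarrow> \<theta> n t = 0" and B: "set_integrable lborel {a..b} B"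
  shows "integrable lborel (\<lambda>t. \<theta> n t * B t)"
proof -
  obtain C where C: "\<And>t. t \<in> {a..b} \<Longrightarrow> norm (\<theta> n t) \<le> C"
    using compact_imp_bounded[OF compact_continuous_image[OF tower_continuous[OF th(1)] compact_Icc[of a b]]]
    unfolding bounded_iff by blast
  have [measurable]: "\<theta> n \<in> borel_measurable borel"
    by (rule borel_measurable_continuous_onI) (rule tower_continuous[OF th(1)])
  have eq: "\<theta> n t * B t = \<theta> n t * (indicator {a..b} t *\<^sub>R B t)" for t using th(2)[of t] by (cases "t \<in> {a..b}") auto
  have [measurable]: "(\<lambda>t. indicator {a..b} t *\<^sub>R B t) \<in> borel_measurable borel"
    using B unfolding set_integrable_def by (simp add: borel_measurable_integrable)
  show ?thesis unfolding eq
  proof (rule Bochner_Integration.integrable_bound)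
    show "integrable lborel (\<lambda>t. C * (indicator {a..b} t *\<^sub>R B t))" using B unfolding set_integrable_def by (rule integrable_mult_right)
    show "AE t in lborel. norm (\<theta> n t * (indicator {a..b} t *\<^sub>R B t)) \<le> norm (C * (indicator {a..b} t *\<^sub>R B t))"
      using C by (intro AE_I2) (fastforce simp: indicator_def abs_mult intro!: mult_right_mono split: if_splits)
  qed measurable
qed

context cutoff begin

sublocale bump: time_bump "\<lambda>n s. iter_dderiv (replicate n (axis 1 1)) \<eta> (s *\<^sub>R axis 1 1)"
proof
  show "tower (\<lambda>n s. iter_dderiv (replicate n (axis 1 1)) \<eta> (s *\<^sub>R axis 1 1))" by (rule bump_tower[OF eta_smooth])
  show "0 \<le> iter_dderiv (replicate 0 (axis 1 1)) \<eta> (s *\<^sub>R axis 1 1)" for s using eta_nonneg by simp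
  show "iter_dderiv (replicate 0 (axis 1 1)) \<eta> (s *\<^sub>R axis 1 1) = 1" if "\<bar>s\<bar> \<le> 3/4" for s
    using that by (simp add: eta_one)
  show "iter_dderiv (replicate 0 (axis 1 1)) \<eta> (s *\<^sub>R axis 1 1) = 0" if "1 \<le> \<bar>s\<bar>" for s
    using that by (simp add: eta_zero)
qed

end

lemma set_integrable_sums:
  fixes f :: "'i \<Rightarrow> real \<Rightarrow> real"
  shows "(\<And>i. i \<in> I \<Longrightarrow> set_integrable M A (f i)) \<Longrightarrow> set_integrable M A (\<lambda>t. \<Sum>i\<in>I. f i t)"
  by (simp add: set_integrable_def sum_distrib_left)

section \<open>The modes of a single weak solution\<close>

locale solution = cutoff +
  fixes L \<nu> :: real and f :: "(real \<times> (real^3) \<Rightarrow> real^3) \<Rightarrow> real" and u :: "real \<Rightarrow> real^3 \<Rightarrow> real^3"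
  assumes L: "0 < L" and nu: "0 < \<nu>" and sol: "weak_solution \<eta> L \<nu> f u"
begin

lemma L2: "0 \<le> t \<Longrightarrow> u t \<in> L2_torus L"
  using sol unfolding weak_solution_def by blast

text \<open>The value 0 for t <= 0 makes the modes Borel measurable on the whole line.\<close>

definition mode :: "3 \<Rightarrow> int^3 \<Rightarrow> real \<Rightarrow> complex" where
  "mode i k t = (if 0 < t then fc L (uc (u t) i) k else 0)"
definition quad :: "3 \<Rightarrow> 3 \<Rightarrow> int^3 \<Rightarrow> real \<Rightarrow> complex" where
  "quad i j k t = (if 0 < t then fc L (\<lambda>x. uc (u t) i x * uc (u t) j x) k else 0)"
definition xi :: "int^3 \<Rightarrow> real^3" where "xi k = (2 * pi / L) *\<^sub>R freq k"
definition alt :: "int^3 \<Rightarrow> real \<Rightarrow> real^3 \<Rightarrow> real \<Rightarrow> real" where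
  "alt k \<phi> v t = (if 0 < t then al L (u t) (xi k) \<phi> v else 0)"
definition gmt :: "int^3 \<Rightarrow> real \<Rightarrow> real^3 \<Rightarrow> real \<Rightarrow> real" where
  "gmt k \<phi> v t = (if 0 < t then gm L (u t) (xi k) \<phi> v else 0)"

lemma al_continuous: "continuous_on {0..} (\<lambda>t. al L (u t) (xi k) \<phi> v)"
proof -
  define g where "g x = cos (xi k \<bullet> x + \<phi>) *\<^sub>R v" for x
  have [measurable]: "g \<in> borel_measurable (torus L)" unfolding g_def by measurable
  have "integrable (torus L) (\<lambda>x. (norm (g x))\<^sup>2)"
    by (rule bounded_integrable_torus[OF L, of _ "(norm v)\<^sup>2"])
      (auto simp: g_def power_mult_distrib abs_square_le_1 intro!: mult_left_le_one_le)
  then have "g \<in> L2_torus L" by (simp add: L2_torus_def)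
  then have "continuous_on {0..} (\<lambda>t. LINT x|torus L. u t x \<bullet> g x)" using sol unfolding weak_solution_def by blast
  moreover have "(LINT x|torus L. u t x \<bullet> g x) = al L (u t) (xi k) \<phi> v" for t by (simp add: al_def g_def)
  ultimately show ?thesis by simp
qed

lemma alt_continuous: "continuous_on {0<..} (alt k \<phi> v)"
  by (rule continuous_on_eq[OF continuous_on_subset[OF al_continuous[of k \<phi> v]]]) (auto simp: alt_def)

lemma alt_measurable [measurable]: "alt k \<phi> v \<in> borel_measurable borel"
proof -
  have "(\<lambda>t. indicator {0<..} t *\<^sub>R alt k \<phi> v t) \<in> borel_measurable borel"
    by (rule borel_measurable_continuous_on_indicator[OF _ alt_continuous]) simp
  moreover have "(\<lambda>t. indicator {0<..} t *\<^sub>R alt k \<phi> v t) = alt k \<phi> v" by (auto simp: alt_def fun_eq_iff)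
  ultimately show ?thesis by simp
qed

lemma mode_alt: "complex_of_real (L^3) * mode i k t = Complex (alt k 0 (axis i 1) t) (alt k (pi / 2) (axis i 1) t)"
  using al_fc[OF L L2 xi_def, of t k i] by (simp add: mode_def alt_def complex_eq_iff)

lemma mode_alt': "mode i k t = (complex_of_real (alt k 0 (axis i 1) t) + \<i> * complex_of_real (alt k (pi / 2) (axis i 1) t)) / complex_of_real (L^3)"
  using mode_alt[of i k t] L by (simp add: Complex_eq field_simps)

lemma mode_continuous: "continuous_on {0<..} (mode i k)"
  unfolding mode_alt'[abs_def] using L by (intro continuous_intros alt_continuous) simp

lemma mode_measurable [measurable]: "mode i k \<in> borel_measurable borel"
  unfolding mode_alt'[abs_def] by measurable

text \<open>The distributional divergence condition becomes one at every positive time, because weak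
  continuity makes the pairings continuous in time.\<close>

lemma alt_div: "alt k \<phi> (xi k) t = 0"
proof (cases "0 < t")
  case True
  have dv: "divergence_free L u" using sol unfolding weak_solution_def by blast
  show ?thesis
  proof (rule bump.weak_zero[OF alt_continuous alt_measurable _ True])
    fix \<theta> :: "nat \<Rightarrow> real \<Rightarrow> real" and a b assume th: "tower \<theta>" "0 < a" "\<And>t. t \<notin> {a..b} \<Longrightarrow> \<theta> 0 t = 0"
    have "(LBINT t:{0<..}. \<theta> 0 t * al L (u t) (xi k) \<phi> (xi k)) = 0"
      by (rule divergence_wave[OF L dv th xi_def])
    moreover have "(LBINT t:{0<..}. \<theta> 0 t * al L (u t) (xi k) \<phi> (xi k)) = (LBINT t. \<theta> 0 t * alt k \<phi> (xi k) t)"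
      unfolding set_lebesgue_integral_def by (rule Bochner_Integration.integral_cong) (auto simp: alt_def indicator_def)
    ultimately show "(LBINT t. \<theta> 0 t * alt k \<phi> (xi k) t) = 0" by simp
  qed
qed (simp add: alt_def)

lemma alt_sum: "alt k \<phi> v t = (\<Sum>j\<in>UNIV. v $ j * alt k \<phi> (axis j 1) t)"
  and gmt_sum: "gmt k \<phi> v t = (\<Sum>j\<in>UNIV. v $ j * gmt k \<phi> (axis j 1) t)"
  using al_linear(3,4)[OF L L2, of t "xi k" \<phi> v] by (simp_all add: alt_def gmt_def)

lemma mode_div: "(\<Sum>i\<in>UNIV. fk k i * mode i k t) = 0"
proof -
  have z: "(\<Sum>j\<in>UNIV. freq k $ j * alt k \<phi> (axis j 1) t) = 0" for \<phi>
  proof -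
    have "(2 * pi / L) * (\<Sum>j\<in>UNIV. freq k $ j * alt k \<phi> (axis j 1) t) = 0"
      using alt_div[of k \<phi> t] unfolding alt_sum[of _ _ "xi k"] by (simp add: xi_def sum_distrib_left mult_ac)
    then show ?thesis using L by simp
  qed
  have "(\<Sum>i\<in>UNIV. fk k i * mode i k t) = (complex_of_real (\<Sum>j\<in>UNIV. freq k $ j * alt k 0 (axis j 1) t)
     + \<i> * complex_of_real (\<Sum>j\<in>UNIV. freq k $ j * alt k (pi/2) (axis j 1) t)) / complex_of_real (L^3)"
    unfolding mode_alt' by (simp add: fk_def freq_def sum_distrib_left sum_divide_distrib sum.distrib[symmetric] add_divide_distrib distrib_left mult_ac)
  then show ?thesis unfolding z by simp
qed

lemma mode_mean: "mode i 0 t = 0"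
proof (cases "0 < t")
  case True
  have m: "(LINT x|torus L. u t x) = 0" using sol True unfolding weak_solution_def by simp
  have g: "u t \<in> L2_torus L" using True L2 by simp
  have [measurable]: "u t \<in> borel_measurable (torus L)" using g by (simp add: L2_torus_def)
  have "integrable (torus L) (u t)"
  proof (rule Bochner_Integration.integrable_bound)
    show "integrable (torus L) (\<lambda>x. 1 + (norm (u t x))\<^sup>2)"
      using g bounded_integrable_torus[OF L, of "\<lambda>_. 1::real" 1] by (simp add: L2_torus_def)
    show "AE x in torus L. norm (u t x) \<le> norm (1 + (norm (u t x))\<^sup>2)"
    proof (rule AE_I2)
      fix x
      have "2 * norm (u t x) \<le> 1 + (norm (u t x))\<^sup>2" using sum_squares_bound[of 1 "norm (u t x)"] by simp
      moreover have "0 \<le> norm (u t x)" by simp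
      ultimately show "norm (u t x) \<le> norm (1 + (norm (u t x))\<^sup>2)" unfolding real_norm_def by linarith
    qed
  qed measurable
  then have "(LINT x|torus L. u t x \<bullet> axis i 1) = (LINT x|torus L. u t x) \<bullet> axis i 1"
    by (rule integral_inner_left)
  then have "(LINT x|torus L. u t x $ i) = 0" by (simp add: m inner_axis)
  then have "(LINT x|torus L. complex_of_real (u t x $ i)) = 0" by (simp add: integral_complex_of_real)
  then show ?thesis by (simp add: mode_def fc_def uc_def)
qed (simp add: mode_def)

lemma quad_measurable [measurable]: "quad i j k \<in> borel_measurable borel"
proof -
  define s where "s P t = (\<Sum>n\<in>bl (int P). complex_of_real (low (Suc P) (freq n)) * mode i n t * mode j (k - n) t)" for P t
  show ?thesis
  proof (rule borel_measurable_LIMSEQ_metric)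
    show "s P \<in> borel_measurable borel" for P unfolding s_def by measurable
    fix t
    show "(\<lambda>P. s P t) \<longlonglongrightarrow> quad i j k t"
    proof (cases "0 < t")
      case True
      note g = L2[of t]
      have "(\<lambda>P. fc L (\<lambda>x. tp L (bl (int P)) (lowc L (u t) P i) x * uc (u t) j x) k) \<longlonglongrightarrow> fc L (\<lambda>x. uc (u t) i x * uc (u t) j x) k"
        by (intro fc_mult_limit[OF L] L2c_tp L uc_L2c lowc_limit g) (use True in simp_all)
      then show ?thesis using True by (simp add: quad_def fc_tp_mult[OF L finite_bl uc_L2c[OF g]] s_def mode_def lowc_def)
    qed (simp add: quad_def s_def mode_def)
  qed
qed

text \<open>Poincare's inequality: the mean vanishes and every other frequency has norm at least 1.
  Parseval's identity enters through its defect \<open>e\<close>.\<close>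

lemma component_bound:
  assumes t: "0 < t" and s: "in_Hs \<eta> L 1 (u t)"
  shows "(LINT x|torus L. (cmod (uc (u t) i x))\<^sup>2) \<le> L^3 * (16 / L * (Hs_norm \<eta> L 1 (u t))\<^sup>2)"
proof (rule field_le_epsilon)
  fix e :: real assume e: "0 < e"
  have g: "u t \<in> L2_torus L" using t L2 by simp
  let ?a = "\<lambda>k. (cmod (fc L (uc (u t) i) k))\<^sup>2"
  obtain F where F: "finite F" "\<And>G. finite G \<Longrightarrow> F \<subseteq> G \<Longrightarrow>
     (LINT x|torus L. (cmod (uc (u t) i x))\<^sup>2) - L^3 * (\<Sum>k\<in>G. ?a k) < e"
    by (rule parseval_tail[OF L uc_L2c[OF g] e]) (rule that)
  have "(\<Sum>k\<in>F. ?a k) = (\<Sum>k\<in>F - {0}. ?a k)"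
    using mode_mean[of i t] t by (intro sum.mono_neutral_right F(1)) (auto simp: mode_def)
  also have "\<dots> \<le> (\<Sum>k\<in>F - {0}. (norm (freq k))\<^sup>2 * (\<Sum>i\<in>UNIV. (cmod (fc L (uc (u t) i) k))\<^sup>2))"
  proof (rule sum_mono)
    fix k assume "k \<in> F - {0}"
    then have "1 \<le> (norm (freq k))\<^sup>2" using norm_freq_ge_1[of k] by (simp add: one_le_power)
    moreover have "?a k \<le> (\<Sum>i\<in>UNIV. (cmod (fc L (uc (u t) i) k))\<^sup>2)" by (rule member_le_sum) auto
    ultimately show "?a k \<le> (norm (freq k))\<^sup>2 * (\<Sum>i\<in>UNIV. (cmod (fc L (uc (u t) i) k))\<^sup>2)"
      using mult_mono[of 1 "(norm (freq k))\<^sup>2" "?a k"] by simp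
  qed
  also have "\<dots> \<le> 16 / L * (Hs_norm \<eta> L 1 (u t))\<^sup>2"
    by (rule H1_bound[OF L s]) (use F(1) in auto)
  finally have "L^3 * (\<Sum>k\<in>F. ?a k) \<le> L^3 * (16 / L * (Hs_norm \<eta> L 1 (u t))\<^sup>2)"
    by (rule mult_left_mono) (use L in simp)
  then show "(LINT x|torus L. (cmod (uc (u t) i x))\<^sup>2) \<le> L^3 * (16 / L * (Hs_norm \<eta> L 1 (u t))\<^sup>2) + e"
    using F(2)[OF F(1)] by simp
qed

lemma quad_bound:
  assumes t: "0 < t" and s: "in_Hs \<eta> L 1 (u t)"
  shows "cmod (quad i j k t) \<le> 16 / L * (Hs_norm \<eta> L 1 (u t))\<^sup>2"
proof -
  have g: "u t \<in> L2_torus L" using t L2 by simp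
  let ?K = "16 / L * (Hs_norm \<eta> L 1 (u t))\<^sup>2"
  have "cmod (quad i j k t) \<le> ((LINT x|torus L. (cmod (uc (u t) i x))\<^sup>2) / 1 + 1 * (LINT x|torus L. (cmod (uc (u t) j x))\<^sup>2)) / (2 * L^3)"
    using fc_mult_le[OF L uc_L2c[OF g] uc_L2c[OF g] zero_less_one] t by (simp add: quad_def)
  also have "\<dots> \<le> (L^3 * ?K / 1 + 1 * (L^3 * ?K)) / (2 * L^3)"
    using component_bound[OF assms, of i] component_bound[OF assms, of j] L by (intro divide_right_mono add_mono) auto
  also have "\<dots> = ?K" using L by simp
  finally show ?thesis .
qed

lemma Hs_data:
  assumes "0 < a"
  shows "AE t in lebesgue_on {a..b}. in_Hs \<eta> L 1 (u t)" "integrable (lebesgue_on {a..b}) (\<lambda>t. (Hs_norm \<eta> L 1 (u t))\<^sup>2)"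
  using sol assms unfolding weak_solution_def by blast+

text \<open>\<open>p\<close> will be the real or the imaginary part. Integrability in time comes
  from local square integrability with values in the space of order 1.\<close>

lemma quad_integrable:
  assumes a: "0 < a" and p: "\<And>z. \<bar>p z\<bar> \<le> cmod z" and [measurable]: "p \<in> borel_measurable borel"
  shows "set_integrable lborel {a..b} (\<lambda>t. p (quad i j k t))"
proof -
  have m: "(\<lambda>t. p (quad i j k t)) \<in> borel_measurable borel" by measurable
  have "integrable (lebesgue_on {a..b}) (\<lambda>t. p (quad i j k t))"
  proof (rule Bochner_Integration.integrable_bound)
    show "integrable (lebesgue_on {a..b}) (\<lambda>t. 16 / L * (Hs_norm \<eta> L 1 (u t))\<^sup>2)"
      using Hs_data(2)[OF a] by (rule integrable_mult_right)
    have "(\<lambda>t. p (quad i j k t)) \<in> borel_measurable lebesgue" by (rule measurable_completion) (unfold measurable_lborel2, rule m)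
    from this show "(\<lambda>t. p (quad i j k t)) \<in> borel_measurable (lebesgue_on {a..b})" by (rule measurable_restrict_space1)
    have "AE t in lebesgue_on {a..b}. t \<in> space (lebesgue_on {a..b})" by (rule AE_space)
    then show "AE t in lebesgue_on {a..b}. norm (p (quad i j k t)) \<le> norm (16 / L * (Hs_norm \<eta> L 1 (u t))\<^sup>2)"
      using Hs_data(1)[OF a, of b]
    proof eventually_elim
      case (elim t)
      then have "0 < t" using a by simp
      have "\<bar>p (quad i j k t)\<bar> \<le> cmod (quad i j k t)" by (rule p)
      also have "\<dots> \<le> 16 / L * (Hs_norm \<eta> L 1 (u t))\<^sup>2" by (rule quad_bound) (use elim \<open>0 < t\<close> in auto)
      finally show ?case using L by simp
    qed
  qed
  then show ?thesis by (simp only: set_integrable_lebesgue(1)[OF m])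
qed

lemma gmt_quad:
  "gmt k 0 (axis j 1) t = (\<Sum>i\<in>UNIV. - (xi k $ i * L^3) * Im (quad i j k t))"
  "gmt k (pi / 2) (axis j 1) t = (\<Sum>i\<in>UNIV. (xi k $ i * L^3) * Re (quad i j k t))"
  using gm_fc[OF L L2 xi_def, of t k j] by (simp_all add: gmt_def quad_def sum_negf mult_ac)

lemma gmt_integrable:
  assumes "0 < a" "\<phi> \<in> {0, pi / 2}" shows "set_integrable lborel {a..b} (gmt k \<phi> v)"
proof -
  note I = quad_integrable[OF assms(1), of Im] quad_integrable[OF assms(1), of Re]
  have "set_integrable lborel {a..b} (gmt k \<phi> (axis j 1))" for j
  proof -
    consider "\<phi> = 0" | "\<phi> = pi / 2" using assms(2) by blast
    then show ?thesis
    proof cases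
      case 1
      show ?thesis unfolding 1 gmt_quad(1)[abs_def]
        by (intro set_integrable_sums set_integrable_mult_right I) (auto intro: abs_Im_le_cmod)
    next
      case 2
      show ?thesis unfolding 2 gmt_quad(2)[abs_def]
        by (intro set_integrable_sums set_integrable_mult_right I) (auto intro: abs_Re_le_cmod)
    qed
  qed
  then have "set_integrable lborel {a..b} (\<lambda>t. \<Sum>j\<in>UNIV. v $ j * gmt k \<phi> (axis j 1) t)"
    by (intro set_integrable_sums set_integrable_mult_right)
  moreover have "gmt k \<phi> v = (\<lambda>t. \<Sum>j\<in>UNIV. v $ j * gmt k \<phi> (axis j 1) t)" by (rule ext) (rule gmt_sum)
  ultimately show ?thesis by simp
qed

end

context solution begin

lemma test_eq:
  assumes tha: "tower \<theta>" "0 < a" "\<forall>t. t \<notin> {a..b} \<longrightarrow> \<theta> 0 t = 0" and w: "xi k \<bullet> w = 0" and \<phi>: "\<phi> \<in> {0, pi / 2}"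
  shows "(LBINT t. - (\<theta> 1 t * alt k \<phi> w t) + \<theta> 0 t * (gmt k \<phi> w t + \<nu> * (xi k \<bullet> xi k) * alt k \<phi> w t)) = f (wave \<theta> (xi k) \<phi> w)"
    and "integrable lborel (\<lambda>t. - (\<theta> 1 t * alt k \<phi> w t) + \<theta> 0 t * (gmt k \<phi> w t + \<nu> * (xi k \<bullet> xi k) * alt k \<phi> w t))"
proof -
  have th: "tower \<theta>" "0 < a" "\<And>t. t \<notin> {a..b} \<Longrightarrow> \<theta> 0 t = 0" using tha by auto
  obtain p where p: "distribution L p" "momentum_eq L \<nu> f p u" using sol unfolding weak_solution_def by blast
  have "(LBINT t:{0<..}. - \<theta> 1 t * al L (u t) (xi k) \<phi> w + \<theta> 0 t * (gm L (u t) (xi k) \<phi> w + \<nu> * (xi k \<bullet> xi k) * al L (u t) (xi k) \<phi> w)) = f (wave \<theta> (xi k) \<phi> w)"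
    by (rule momentum_wave[OF L p L2 th xi_def w])
  moreover have "(LBINT t:{0<..}. - \<theta> 1 t * al L (u t) (xi k) \<phi> w + \<theta> 0 t * (gm L (u t) (xi k) \<phi> w + \<nu> * (xi k \<bullet> xi k) * al L (u t) (xi k) \<phi> w))
    = (LBINT t. - (\<theta> 1 t * alt k \<phi> w t) + \<theta> 0 t * (gmt k \<phi> w t + \<nu> * (xi k \<bullet> xi k) * alt k \<phi> w t))"
    unfolding set_lebesgue_integral_def by (rule Bochner_Integration.integral_cong) (auto simp: alt_def gmt_def indicator_def)
  ultimately show "(LBINT t. - (\<theta> 1 t * alt k \<phi> w t) + \<theta> 0 t * (gmt k \<phi> w t + \<nu> * (xi k \<bullet> xi k) * alt k \<phi> w t)) = f (wave \<theta> (xi k) \<phi> w)"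
    by simp
  have c: "set_integrable lborel {a..b} (alt k \<phi> w)"
    unfolding set_integrable_def
    by (rule borel_integrable_compact[OF compact_Icc continuous_on_subset[OF alt_continuous]]) (use th(2) in auto)
  have z: "\<And>t. t \<notin> {a..b} \<Longrightarrow> \<theta> 1 t = 0" by (rule tower_support[OF th(1,3)])
  show "integrable lborel (\<lambda>t. - (\<theta> 1 t * alt k \<phi> w t) + \<theta> 0 t * (gmt k \<phi> w t + \<nu> * (xi k \<bullet> xi k) * alt k \<phi> w t))"
    by (rule Bochner_Integration.integrable_add[OF integrable_minus[OF tower_mult_integrable[OF th(1) z c]]
        tower_mult_integrable[OF th(1,3) set_integral_add(1)[OF gmt_integrable[OF th(2) \<phi>] set_integrable_mult_right[OF c]]]])
qed

lemma alt_integrable: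
  assumes "0 < a" shows "set_integrable lborel {a..b} (alt k \<phi> w)"
  unfolding set_integrable_def
  by (rule borel_integrable_compact[OF compact_Icc continuous_on_subset[OF alt_continuous]]) (use assms in auto)

end

section \<open>The difference of two weak solutions\<close>

locale pair = solution \<eta> L \<nu> f u + V: solution \<eta> L \<nu> f v
  for \<eta> L \<nu> f u v
begin

definition "W i k t = mode i k t - V.mode i k t"
definition "dN i j k t = quad i j k t - V.quad i j k t"
definition "e k t = (\<Sum>l\<in>UNIV. (cmod (W l k t))\<^sup>2)"
definition "be k \<phi> w t = alt k \<phi> w t - V.alt k \<phi> w t"
definition "ga k \<phi> w t = gmt k \<phi> w t - V.gmt k \<phi> w t"
text \<open>The time derivative of \<open>e k\<close>: one factor \<open>kap L\<close> for the
  derivative in the nonlinearity, two for the Laplacian.\<close>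

definition "G k t = 2 * kap L * Im (\<Sum>l\<in>UNIV. \<Sum>i\<in>UNIV. dN i l k t * (fk k i * cnj (W l k t)))
   - 2 * \<nu> * (kap L)\<^sup>2 * (norm (freq k))\<^sup>2 * e k t"

lemma W_continuous: "continuous_on {0<..} (W i k)"
  unfolding W_def[abs_def] by (intro continuous_intros mode_continuous V.mode_continuous)

lemma W_measurable [measurable]: "W i k \<in> borel_measurable borel" unfolding W_def[abs_def] by measurable
lemma dN_measurable [measurable]: "dN i j k \<in> borel_measurable borel" unfolding dN_def[abs_def] by measurable
lemma e_measurable [measurable]: "e k \<in> borel_measurable borel" unfolding e_def[abs_def] by measurable
lemma e_nonneg: "0 \<le> e k t" by (simp add: e_def sum_nonneg)
lemma e_continuous: "continuous_on {0<..} (e k)"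
  unfolding e_def[abs_def] by (intro continuous_intros W_continuous)

lemma G_measurable [measurable]: "G k \<in> borel_measurable borel"
  unfolding G_def[abs_def] by (intro borel_measurable_diff borel_measurable_times borel_measurable_sum borel_measurable_const e_measurable
      measurable_compose[OF _ borel_measurable_Im] cnj_measurable W_measurable dN_measurable)

lemma be_mode: "be k 0 (axis j 1) t = L^3 * Re (W j k t)" "be k (pi / 2) (axis j 1) t = L^3 * Im (W j k t)"
  using arg_cong[OF mode_alt[of j k t], of Re] arg_cong[OF mode_alt[of j k t], of Im]
    arg_cong[OF V.mode_alt[of j k t], of Re] arg_cong[OF V.mode_alt[of j k t], of Im]
  by (simp_all add: be_def W_def right_diff_distrib del: of_real_power)

lemma ga_quad:
  "ga k 0 (axis j 1) t = (\<Sum>i\<in>UNIV. - (xi k $ i * L^3) * Im (dN i j k t))"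
  "ga k (pi / 2) (axis j 1) t = (\<Sum>i\<in>UNIV. (xi k $ i * L^3) * Re (dN i j k t))"
  by (simp_all add: ga_def gmt_quad V.gmt_quad dN_def right_diff_distrib flip: sum_subtractf)

text \<open>For one solution the tested equation contains the distribution \<open>f\<close>, which
  need not be an integrable function of time. Subtraction removes it, and what remains is integrable
  on compact intervals of positive times.\<close>

lemma mode_eq:
  assumes ab: "0 < a" "a \<le> b" and w: "xi k \<bullet> w = 0" and \<phi>: "\<phi> \<in> {0, pi / 2}"
  shows "be k \<phi> w b - be k \<phi> w a = (LBINT t:{a..b}. - (ga k \<phi> w t + \<nu> * (xi k \<bullet> xi k) * be k \<phi> w t))"
    "set_integrable lborel {a..b} (\<lambda>t. - (ga k \<phi> w t + \<nu> * (xi k \<bullet> xi k) * be k \<phi> w t))"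
proof -
  let ?B = "\<lambda>t. - (ga k \<phi> w t + \<nu> * (xi k \<bullet> xi k) * be k \<phi> w t)"
  have B: "set_integrable lborel {a..b} ?B" if "0 < a" for a b
  proof -
    have "set_integrable lborel {a..b} (\<lambda>t. (-1) * (ga k \<phi> w t + \<nu> * (xi k \<bullet> xi k) * be k \<phi> w t))"
      unfolding ga_def be_def
      by (intro set_integrable_mult_right set_integral_add(1) set_integral_diff(1) gmt_integrable V.gmt_integrable alt_integrable V.alt_integrable that \<phi>)
    then show ?thesis by simp
  qed
  show "set_integrable lborel {a..b} ?B" by (rule B[OF ab(1)])
  show "be k \<phi> w b - be k \<phi> w a = (LBINT t:{a..b}. ?B t)"
  proof (rule bump.weak_derivative[OF _ _ B _ ab])
    show "continuous_on {0<..} (be k \<phi> w)" unfolding be_def[abs_def] by (intro continuous_intros alt_continuous V.alt_continuous)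
    show "be k \<phi> w \<in> borel_measurable borel" unfolding be_def[abs_def] by measurable
    fix \<theta> :: "nat \<Rightarrow> real \<Rightarrow> real" and a b assume th: "tower \<theta>" "0 < a" "\<And>t. t \<notin> {a..b} \<Longrightarrow> \<theta> 0 t = 0"
    have th': "\<forall>t. t \<notin> {a..b} \<longrightarrow> \<theta> 0 t = 0" using th(3) by blast
    note I = test_eq[OF th(1,2) th' w \<phi>] V.test_eq[OF th(1,2) th' w \<phi>]
    have "(LBINT t. \<theta> 1 t * be k \<phi> w t + \<theta> 0 t * ?B t) =
      (LBINT t. (- (\<theta> 1 t * V.alt k \<phi> w t) + \<theta> 0 t * (V.gmt k \<phi> w t + \<nu> * (xi k \<bullet> xi k) * V.alt k \<phi> w t))
        - (- (\<theta> 1 t * alt k \<phi> w t) + \<theta> 0 t * (gmt k \<phi> w t + \<nu> * (xi k \<bullet> xi k) * alt k \<phi> w t)))"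
      by (rule Bochner_Integration.integral_cong) (simp_all add: be_def ga_def algebra_simps)
    also have "\<dots> = 0" by (rule trans[OF Bochner_Integration.integral_diff[OF I(4,2)]])
       (rule right_minus_eq[THEN iffD2, OF trans[OF I(3) I(1)[symmetric]]])
    finally show "(LBINT t. \<theta> 1 t * be k \<phi> w t + \<theta> 0 t * ?B t) = 0" .
  qed
qed

text \<open>Both phases and all three coordinates are squared with \<open>square_of_integral\<close>
  and added. The projection onto transversal polarisations leaves no trace in the sum, because the
  difference itself is divergence free.\<close>

lemma e_ode:
  assumes ab: "0 < a" "a \<le> b" and k: "k \<noteq> 0"
  shows "e k b - e k a = (LBINT t:{a..b}. G k t)" "set_integrable lborel {a..b} (G k)"
proof -
  let ?x = "xi k"
  have x: "?x \<bullet> ?x = (kap L)\<^sup>2 * (norm (freq k))\<^sup>2" by (simp add: xi_def kap_def power2_norm_eq_inner) (simp add: power2_eq_square)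
  have xp: "0 < ?x \<bullet> ?x" unfolding x using norm_freq_ge_1[OF k] L by (intro mult_pos_pos) (auto simp: kap_def)
  \<comment> \<open>The projection of a coordinate axis onto the plane orthogonal to the wave
    vector; \<open>mode_eq\<close> admits only such polarisations.\<close>
  define P where "P j = axis j 1 - (?x $ j / (?x \<bullet> ?x)) *\<^sub>R ?x" for j
  have P0: "?x \<bullet> P j = 0" for j using xp by (simp add: P_def inner_diff_right inner_axis)
  have lin: "be k \<phi> (v - c *\<^sub>R w) t = be k \<phi> v t - c * be k \<phi> w t" "ga k \<phi> (v - c *\<^sub>R w) t = ga k \<phi> v t - c * ga k \<phi> w t" for \<phi> v c w t
    using al_linear(1,2)[OF L L2, of t "xi k" \<phi> v c w] al_linear(1,2)[OF L V.L2, of t "xi k" \<phi> v c w]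
    by (simp_all add: be_def ga_def alt_def V.alt_def gmt_def V.gmt_def algebra_simps)
  have b0: "be k \<phi> ?x t = 0" for \<phi> t by (simp add: be_def alt_div V.alt_div)
  have bs: "(\<Sum>j\<in>UNIV. ?x $ j * be k \<phi> (axis j 1) t) = 0" for \<phi> t
    using b0[of \<phi> t] unfolding be_def alt_sum[of k \<phi> ?x] V.alt_sum[of k \<phi> ?x] by (simp add: right_diff_distrib sum_subtractf)
  have bP: "be k \<phi> (P j) t = be k \<phi> (axis j 1) t" for \<phi> j t unfolding P_def lin b0 by simp
  define B where "B \<phi> j t = - (ga k \<phi> (P j) t + \<nu> * (?x \<bullet> ?x) * be k \<phi> (axis j 1) t)" for \<phi> j t
  have sq: "(be k \<phi> (axis j 1) b)\<^sup>2 - (be k \<phi> (axis j 1) a)\<^sup>2 = (LBINT t:{a..b}. 2 * (be k \<phi> (axis j 1) t * B \<phi> j t))"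
    "set_integrable lborel {a..b} (\<lambda>t. be k \<phi> (axis j 1) t * B \<phi> j t)" if "\<phi> \<in> {0, pi / 2}" for \<phi> j
  proof -
    have i: "set_integrable lborel {a..b} (B \<phi> j)" using mode_eq(2)[OF ab P0[of j] that] by (simp add: B_def[abs_def] bP)
    have d: "be k \<phi> (axis j 1) t - be k \<phi> (axis j 1) a = (LBINT s:{a..t}. B \<phi> j s)" if "a \<le> t" "t \<le> b" for t
      using mode_eq(1)[OF ab(1) that(1) P0[of j] \<open>\<phi> \<in> _\<close>] by (simp add: B_def[abs_def] bP)
    show "(be k \<phi> (axis j 1) b)\<^sup>2 - (be k \<phi> (axis j 1) a)\<^sup>2 = (LBINT t:{a..b}. 2 * (be k \<phi> (axis j 1) t * B \<phi> j t))"
      "set_integrable lborel {a..b} (\<lambda>t. be k \<phi> (axis j 1) t * B \<phi> j t)"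
      by (rule square_of_integral[OF ab(2) i d]; assumption)+
  qed
  have sB: "(\<Sum>j\<in>UNIV. be k \<phi> (axis j 1) t * B \<phi> j t) = - (\<Sum>j\<in>UNIV. be k \<phi> (axis j 1) t * ga k \<phi> (axis j 1) t) - \<nu> * (?x \<bullet> ?x) * (\<Sum>j\<in>UNIV. (be k \<phi> (axis j 1) t)\<^sup>2)" for \<phi> t
  proof -
    have "(\<Sum>j\<in>UNIV. be k \<phi> (axis j 1) t * B \<phi> j t) = (\<Sum>j\<in>UNIV. - (be k \<phi> (axis j 1) t * ga k \<phi> (axis j 1) t)
        - \<nu> * (?x \<bullet> ?x) * (be k \<phi> (axis j 1) t)\<^sup>2 + (?x $ j * be k \<phi> (axis j 1) t) * (ga k \<phi> ?x t / (?x \<bullet> ?x)))"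
      by (intro sum.cong refl) (simp add: B_def P_def lin algebra_simps power2_eq_square)
    also have "\<dots> = - (\<Sum>j\<in>UNIV. be k \<phi> (axis j 1) t * ga k \<phi> (axis j 1) t) - \<nu> * (?x \<bullet> ?x) * (\<Sum>j\<in>UNIV. (be k \<phi> (axis j 1) t)\<^sup>2)
        + (\<Sum>j\<in>UNIV. ?x $ j * be k \<phi> (axis j 1) t) * (ga k \<phi> ?x t / (?x \<bullet> ?x))"
      unfolding sum.distrib sum_subtractf sum_negf sum_distrib_left sum_distrib_right ..
    finally show ?thesis unfolding bs by simp
  qed
  have ee: "(\<Sum>j\<in>UNIV. (be k 0 (axis j 1) t)\<^sup>2) + (\<Sum>j\<in>UNIV. (be k (pi / 2) (axis j 1) t)\<^sup>2) = L^6 * e k t" for t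
    unfolding be_mode e_def cmod_power2 by (simp add: power_mult_distrib sum_distrib_left distrib_left flip: sum.distrib power_mult)
  have gg: "(\<Sum>j\<in>UNIV. be k 0 (axis j 1) t * ga k 0 (axis j 1) t) + (\<Sum>j\<in>UNIV. be k (pi / 2) (axis j 1) t * ga k (pi / 2) (axis j 1) t)
     = - (L^6 * (kap L * Im (\<Sum>l\<in>UNIV. \<Sum>i\<in>UNIV. dN i l k t * (fk k i * cnj (W l k t)))))" for t
  proof -
    have L6: "L^6 = L^3 * L^3" by (simp flip: power_add)
    have "Re (fk k i) = freq k $ i" "Im (fk k i) = 0" for i by (simp_all add: fk_def freq_def)
    then show ?thesis
      unfolding be_mode ga_quad sum.distrib[symmetric] L6
      by (simp add: xi_def kap_def sum_distrib_left sum_negf[symmetric] algebra_simps flip: sum.distrib)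
  qed
  have main: "2 * (\<Sum>j\<in>UNIV. be k 0 (axis j 1) t * B 0 j t) + 2 * (\<Sum>j\<in>UNIV. be k (pi/2) (axis j 1) t * B (pi/2) j t) = L^6 * G k t" for t
  proof -
    define p q r s where "p = (\<Sum>j\<in>UNIV. be k 0 (axis j 1) t * ga k 0 (axis j 1) t)" and "q = (\<Sum>j\<in>UNIV. be k (pi / 2) (axis j 1) t * ga k (pi / 2) (axis j 1) t)"
      and "r = (\<Sum>j\<in>UNIV. (be k 0 (axis j 1) t)\<^sup>2)" and "s = (\<Sum>j\<in>UNIV. (be k (pi / 2) (axis j 1) t)\<^sup>2)"
    have "2 * (- p - \<nu> * (?x \<bullet> ?x) * r) + 2 * (- q - \<nu> * (?x \<bullet> ?x) * s) = - 2 * (p + q) - 2 * \<nu> * (?x \<bullet> ?x) * (r + s)" by (simp add: algebra_simps)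
    also have "\<dots> = L^6 * G k t" unfolding p_def q_def r_def s_def gg ee x G_def by (simp add: algebra_simps)
    finally show ?thesis unfolding sB p_def q_def r_def s_def .
  qed
  have I: "set_integrable lborel {a..b} (\<lambda>t. \<Sum>j\<in>UNIV. 2 * (be k \<phi> (axis j 1) t * B \<phi> j t))" if "\<phi> \<in> {0, pi / 2}" for \<phi>
    by (intro set_integrable_sums set_integrable_mult_right sq(2) that)
  have S: "(\<Sum>j\<in>UNIV. (be k \<phi> (axis j 1) b)\<^sup>2) - (\<Sum>j\<in>UNIV. (be k \<phi> (axis j 1) a)\<^sup>2) = (LBINT t:{a..b}. \<Sum>j\<in>UNIV. 2 * (be k \<phi> (axis j 1) t * B \<phi> j t))"
    if "\<phi> \<in> {0, pi / 2}" for \<phi>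
  proof -
    have i: "set_integrable lborel {a..b} (\<lambda>t. 2 * (be k \<phi> (axis j 1) t * B \<phi> j t))" for j
      by (intro set_integrable_mult_right sq(2) that)
    have "(LBINT t:{a..b}. \<Sum>j\<in>UNIV. 2 * (be k \<phi> (axis j 1) t * B \<phi> j t)) = (\<Sum>j\<in>UNIV. LBINT t:{a..b}. 2 * (be k \<phi> (axis j 1) t * B \<phi> j t))"
      unfolding set_lebesgue_integral_def scaleR_sum_right
      by (rule Bochner_Integration.integral_sum) (rule i[unfolded set_integrable_def])
    then show ?thesis by (simp only: sq(1)[OF that] flip: sum_subtractf)
  qed
  have m: "(\<Sum>j\<in>UNIV. 2 * (be k 0 (axis j 1) t * B 0 j t)) + (\<Sum>j\<in>UNIV. 2 * (be k (pi/2) (axis j 1) t * B (pi/2) j t)) = L^6 * G k t" for t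
    using main[of t] by (simp only: sum_distrib_left)
  have "L^6 * e k b - L^6 * e k a = (LBINT t:{a..b}. L^6 * G k t)"
    unfolding ee[symmetric] m[symmetric] using S[of 0] S[of "pi/2"] set_integral_add(2)[OF I[of 0] I[of "pi/2"]] by simp
  then have "L^6 * (e k b - e k a) = L^6 * (LBINT t:{a..b}. G k t)" by (simp add: right_diff_distrib)
  then show "e k b - e k a = (LBINT t:{a..b}. G k t)" using L by simp
  have "set_integrable lborel {a..b} (\<lambda>t. L^6 * G k t)"
    unfolding m[symmetric] by (intro set_integral_add(1) I) auto
  then have "set_integrable lborel {a..b} (\<lambda>t. (1 / L^6) * (L^6 * G k t))" by (rule set_integrable_mult_right)
  then show "set_integrable lborel {a..b} (G k)" using L by simp
qed

end

section \<open>Decay of the energy\<close>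

lemma integral_subinterval_le:
  fixes g :: "real \<Rightarrow> real"
  assumes g: "integrable (lebesgue_on {a..b}) g" "\<And>r. 0 \<le> g r" and st: "a \<le> s" "t \<le> b"
  shows "integrable (lebesgue_on {s..t}) g" "integral\<^sup>L (lebesgue_on {s..t}) g \<le> integral\<^sup>L (lebesgue_on {a..b}) g"
proof -
  have i: "integrable lebesgue (\<lambda>r. indicator {a..b} r *\<^sub>R g r)" using g(1) by (simp add: integrable_restrict_space)
  then have "set_integrable lebesgue {a..b} g" by (simp add: set_integrable_def)
  then have "set_integrable lebesgue {s..t} g" by (rule set_integrable_subset) (use st in auto)
  then have j: "integrable lebesgue (\<lambda>r. indicator {s..t} r *\<^sub>R g r)" by (simp add: set_integrable_def)
  then show "integrable (lebesgue_on {s..t}) g" by (simp add: integrable_restrict_space)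
  have "(LINT r|lebesgue. indicator {s..t} r *\<^sub>R g r) \<le> (LINT r|lebesgue. indicator {a..b} r *\<^sub>R g r)"
    by (rule integral_mono[OF j i]) (use st g(2) in \<open>auto simp: indicator_def\<close>)
  then show "integral\<^sup>L (lebesgue_on {s..t}) g \<le> integral\<^sup>L (lebesgue_on {a..b}) g" by (simp add: integral_restrict_space)
qed

lemma borel_measurable_lebesgue_on:
  fixes g :: "real \<Rightarrow> real"
  assumes "g \<in> borel_measurable borel" shows "g \<in> borel_measurable (lebesgue_on S)"
proof -
  have "g \<in> borel_measurable lebesgue" by (rule measurable_completion) (unfold measurable_lborel2, rule assms)
  then show ?thesis by (rule measurable_restrict_space1)
qed

text \<open>Young's inequality for the mixed term. \<open>M\<close> will be the maximum of the
  truncated energy, which occurs under the root in its own bound.\<close>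

lemma sqrt_absorb:
  fixes M A x :: real assumes "0 \<le> M" "M \<le> A + sqrt M * x" shows "M \<le> 2 * A + x\<^sup>2"
proof -
  have "0 \<le> (sqrt M - x)\<^sup>2" by simp
  also have "\<dots> = M - 2 * (sqrt M * x) + x\<^sup>2" using assms(1) by (simp add: power2_diff)
  finally show ?thesis using assms(2) by simp
qed

section \<open>Truncated energy, dissipation and tails\<close>

context pair begin

definition "FN n = {k::int^3. k \<noteq> 0 \<and> norm (freq k) \<le> real n}"
definition "E n t = (\<Sum>k\<in>FN n. e k t / norm (freq k))"
definition "Dn n t = (\<Sum>k\<in>FN n. norm (freq k) * e k t)"
definition "Rn n t = (\<Sum>k\<in>FN n. (norm (freq k))\<^sup>2 * e k t)"
definition "Rinf t = lim (\<lambda>n. Rn n t)"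
text \<open>The part of the squared norm of order 1 beyond the cutoff. At times that are not
  \<open>good\<close> the limit may be meaningless; the maximum with 0 keeps \<open>tau\<close>
  nonnegative there.\<close>

definition "tau n t = max 0 (Rinf t - Rn n t)"
definition "HH t = (Hs_norm \<eta> L 1 (u t))\<^sup>2 + (Hs_norm \<eta> L 1 (v t))\<^sup>2"
definition "hu t = sqrt (16 / L * (Hs_norm \<eta> L 1 (u t))\<^sup>2)"
definition "good t \<longleftrightarrow> 0 < t \<and> in_Hs \<eta> L 1 (u t) \<and> in_Hs \<eta> L 1 (v t)"

lemma finite_FN [simp]: "finite (FN n)"
  unfolding FN_def by (rule finite_subset[OF _ finite_freq_ball[of "real n"]]) auto

lemma FN_pos: "k \<in> FN n \<Longrightarrow> 1 \<le> norm (freq k)" using norm_freq_ge_1 by (auto simp: FN_def)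

lemma FN_mono: "m \<le> n \<Longrightarrow> FN m \<subseteq> FN n" by (auto simp: FN_def)

lemma FN_exhaust:
  assumes "finite F" obtains n where "m \<le> n" "F - {0} \<subseteq> FN n"
proof -
  obtain n where n: "(\<Sum>k\<in>F. norm (freq k)) \<le> real n" using real_arch_simple by blast
  have "norm (freq k) \<le> real (max m n)" if "k \<in> F" for k
  proof -
    have "norm (freq k) \<le> (\<Sum>k\<in>F. norm (freq k))" using assms that by (intro member_le_sum) auto
    then show ?thesis using n by simp
  qed
  then show thesis by (intro that[of "max m n"]) (auto simp: FN_def)
qed

lemma W_0: "W l 0 t = 0" by (simp add: W_def mode_mean V.mode_mean)
lemma e_0: "e 0 t = 0" by (simp add: e_def W_0)
lemma W_t: "0 < t \<Longrightarrow> W l k t = fc L (uc (u t) l) k - fc L (uc (v t) l) k" by (simp add: W_def mode_def V.mode_def)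

lemma E_nonneg: "0 \<le> E n t" unfolding E_def by (intro sum_nonneg divide_nonneg_nonneg e_nonneg) auto
lemma E_le_Dn: "E n t \<le> Dn n t"
  unfolding E_def Dn_def
proof (rule sum_mono)
  fix k assume "k \<in> FN n"
  note k = FN_pos[OF this]
  have "e k t / norm (freq k) \<le> e k t / 1" using k e_nonneg by (intro divide_left_mono) auto
  also have "\<dots> \<le> norm (freq k) * e k t" using mult_right_mono[OF k e_nonneg[of k t]] by simp
  finally show "e k t / norm (freq k) \<le> norm (freq k) * e k t" .
qed

lemma E_continuous: "continuous_on {0<..} (E n)"
  unfolding E_def[abs_def] by (intro continuous_intros e_continuous) (use FN_pos in fastforce)

lemma tau_measurable: "tau n \<in> borel_measurable borel"
proof -
  have [measurable]: "Rn n \<in> borel_measurable borel" for n unfolding Rn_def[abs_def] by measurable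
  have [measurable]: "Rinf \<in> borel_measurable borel" unfolding Rinf_def[abs_def] by measurable
  show ?thesis unfolding tau_def[abs_def] by measurable
qed

lemma tau_nonneg: "0 \<le> tau n t" by (simp add: tau_def)

lemma sum_bound:
  assumes g: "good t" and F: "finite F" shows "(\<Sum>k\<in>F. (norm (freq k))\<^sup>2 * e k t) \<le> 32 / L * HH t"
proof -
  have t: "0 < t" using g by (simp add: good_def)
  let ?a = "\<lambda>k. \<Sum>i\<in>UNIV. (cmod (fc L (uc (u t) i) k))\<^sup>2" and ?b = "\<lambda>k. \<Sum>i\<in>UNIV. (cmod (fc L (uc (v t) i) k))\<^sup>2"
  have e: "e k t \<le> 2 * ?a k + 2 * ?b k" for k
  proof -
    have "(cmod (x - y))\<^sup>2 \<le> 2 * (cmod x)\<^sup>2 + 2 * (cmod y)\<^sup>2" for x y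
    proof -
      have "(cmod (x - y))\<^sup>2 \<le> (cmod x + cmod y)\<^sup>2" by (intro power_mono norm_triangle_ineq4) auto
      also have "\<dots> \<le> 2 * (cmod x)\<^sup>2 + 2 * (cmod y)\<^sup>2" using sum_squares_bound[of "cmod x" "cmod y"] by (simp add: power2_sum)
      finally show ?thesis .
    qed
    then show ?thesis unfolding e_def W_t[OF t] sum_distrib_left sum.distrib[symmetric] by (intro sum_mono)
  qed
  have "(\<Sum>k\<in>F. (norm (freq k))\<^sup>2 * e k t) = (\<Sum>k\<in>F - {0}. (norm (freq k))\<^sup>2 * e k t)"
    using F by (intro sum.mono_neutral_right) (auto simp: e_0)
  also have "\<dots> \<le> (\<Sum>k\<in>F - {0}. (norm (freq k))\<^sup>2 * (2 * ?a k + 2 * ?b k))"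
    by (intro sum_mono mult_left_mono e) auto
  also have "\<dots> = 2 * (\<Sum>k\<in>F - {0}. (norm (freq k))\<^sup>2 * ?a k) + 2 * (\<Sum>k\<in>F - {0}. (norm (freq k))\<^sup>2 * ?b k)"
    by (simp only: distrib_left sum.distrib sum_distrib_left mult.left_commute)
  also have "\<dots> \<le> 2 * (16 / L * (Hs_norm \<eta> L 1 (u t))\<^sup>2) + 2 * (16 / L * (Hs_norm \<eta> L 1 (v t))\<^sup>2)"
    using g F by (intro add_mono mult_left_mono H1_bound L) (auto simp: good_def)
  also have "\<dots> = 32 / L * HH t" by (simp add: HH_def distrib_left)
  finally show ?thesis .
qed

lemma Rn_limit:
  assumes g: "good t"
  shows "(\<lambda>n. Rn n t) \<longlonglongrightarrow> Rinf t" "Rn n t \<le> Rinf t" "Rinf t \<le> 32 / L * HH t"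
proof -
  have m: "incseq (\<lambda>n. Rn n t)"
    unfolding incseq_def Rn_def using FN_mono by (auto intro!: sum_mono2 mult_nonneg_nonneg e_nonneg)
  have b: "Rn n t \<le> 32 / L * HH t" for n unfolding Rn_def by (rule sum_bound[OF g]) simp
  obtain l where l: "(\<lambda>n. Rn n t) \<longlonglongrightarrow> l" "\<forall>n. Rn n t \<le> l" by (rule incseq_convergent[OF m, of "32 / L * HH t"]) (use b in auto)
  then have "Rinf t = l" unfolding Rinf_def by (simp add: limI)
  with l show "(\<lambda>n. Rn n t) \<longlonglongrightarrow> Rinf t" "Rn n t \<le> Rinf t" by auto
  show "Rinf t \<le> 32 / L * HH t" using l(1) b unfolding \<open>Rinf t = l\<close> by (intro LIMSEQ_le_const2) auto
qed

lemma tau_good: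
  assumes g: "good t"
  shows "tau n t = Rinf t - Rn n t" "tau n t \<le> 32 / L * HH t" "(\<lambda>n. tau n t) \<longlonglongrightarrow> 0"
proof -
  show e: "tau n t = Rinf t - Rn n t" for n using Rn_limit(2)[OF g, of n] by (simp add: tau_def)
  have "0 \<le> Rn n t" unfolding Rn_def by (intro sum_nonneg mult_nonneg_nonneg e_nonneg) auto
  then show "tau n t \<le> 32 / L * HH t" using Rn_limit(3)[OF g] by (simp add: e)
  show "(\<lambda>n. tau n t) \<longlonglongrightarrow> 0" unfolding e using tendsto_diff[OF tendsto_const Rn_limit(1)[OF g], of "Rinf t"] by simp
qed

lemma tail_le:
  assumes g: "good t" and Y: "finite Y" "\<And>m. m \<in> Y \<Longrightarrow> real n < norm (freq m)"
  shows "(\<Sum>m\<in>Y. (norm (freq m))\<^sup>2 * e m t) \<le> tau n t"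
proof -
  obtain N where N: "n \<le> N" "Y - {0} \<subseteq> FN N" by (rule FN_exhaust[OF Y(1)])
  have nz: "0 \<notin> Y" using Y(2)[of 0] by auto
  have "(\<Sum>m\<in>Y. (norm (freq m))\<^sup>2 * e m t) + Rn n t = (\<Sum>m\<in>Y \<union> FN n. (norm (freq m))\<^sup>2 * e m t)"
    unfolding Rn_def using Y by (intro sum.union_disjoint[symmetric]) (auto simp: FN_def, fastforce)
  also have "\<dots> \<le> Rn N t" unfolding Rn_def
    using N nz FN_mono[OF N(1)] by (intro sum_mono2 mult_nonneg_nonneg e_nonneg) auto
  also have "\<dots> \<le> Rinf t" by (rule Rn_limit(2)[OF g])
  finally show ?thesis by (simp add: tau_good(1)[OF g])
qed

text \<open>Beyond the cutoff |k| is at most |k|^2, so the missing dissipation is part of the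
  tail.\<close>

lemma D_le:
  assumes g: "good t" and Y: "finite Y"
  shows "(\<Sum>k\<in>Y. norm (freq k) * e k t) \<le> Dn n t + tau n t"
proof -
  let ?A = "Y \<inter> FN n" and ?B = "{k\<in>Y. real n < norm (freq k)}"
  have "(\<Sum>k\<in>Y. norm (freq k) * e k t) = (\<Sum>k\<in>?A \<union> ?B. norm (freq k) * e k t)"
    using Y by (intro sum.mono_neutral_right) (auto simp: FN_def e_0)
  also have "\<dots> = (\<Sum>k\<in>?A. norm (freq k) * e k t) + (\<Sum>k\<in>?B. norm (freq k) * e k t)"
    using Y by (intro sum.union_disjoint) (auto simp: FN_def)
  also have "\<dots> \<le> Dn n t + (\<Sum>k\<in>?B. (norm (freq k))\<^sup>2 * e k t)"
  proof (rule add_mono)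
    show "(\<Sum>k\<in>?A. norm (freq k) * e k t) \<le> Dn n t"
      unfolding Dn_def by (intro sum_mono2 mult_nonneg_nonneg e_nonneg) auto
    show "(\<Sum>k\<in>?B. norm (freq k) * e k t) \<le> (\<Sum>k\<in>?B. (norm (freq k))\<^sup>2 * e k t)"
    proof (intro sum_mono mult_right_mono e_nonneg)
      fix k assume "k \<in> ?B"
      then have "k \<noteq> 0" by auto
      then show "norm (freq k) \<le> (norm (freq k))\<^sup>2" using norm_freq_ge_1[of k] by (simp add: power2_eq_square)
    qed
  qed
  also have "\<dots> \<le> Dn n t + tau n t" by (rule add_left_mono[OF tail_le[OF g]]) (use Y in auto)
  finally show ?thesis .
qed

lemma E_ode:
  assumes "0 < s" "s \<le> t"
  shows "E n t - E n s = integral\<^sup>L (lebesgue_on {s..t}) (\<lambda>r. \<Sum>k\<in>FN n. G k r / norm (freq k))"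
    "integrable (lebesgue_on {s..t}) (\<lambda>r. \<Sum>k\<in>FN n. G k r / norm (freq k))"
proof -
  have i: "set_integrable lborel {s..t} (\<lambda>r. G k r / norm (freq k))" if "k \<in> FN n" for k
    using e_ode(2)[OF assms, of k] that by (intro set_integrable_divide) (auto simp: FN_def)
  have m: "(\<lambda>r. \<Sum>k\<in>FN n. G k r / norm (freq k)) \<in> borel_measurable borel" by measurable
  have "E n t - E n s = (\<Sum>k\<in>FN n. (e k t - e k s) / norm (freq k))" by (simp add: E_def sum_subtractf diff_divide_distrib)
  also have "\<dots> = (\<Sum>k\<in>FN n. LBINT r:{s..t}. G k r / norm (freq k))"
    using e_ode(1)[OF assms] by (intro sum.cong refl) (auto simp: FN_def)
  also have "\<dots> = (LBINT r:{s..t}. \<Sum>k\<in>FN n. G k r / norm (freq k))"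
    unfolding set_lebesgue_integral_def scaleR_sum_right
    by (rule Bochner_Integration.integral_sum[symmetric]) (use i in \<open>auto simp: set_integrable_def\<close>)
  finally show "E n t - E n s = integral\<^sup>L (lebesgue_on {s..t}) (\<lambda>r. \<Sum>k\<in>FN n. G k r / norm (freq k))"
    unfolding set_integrable_lebesgue(2)[OF m] .
  show "integrable (lebesgue_on {s..t}) (\<lambda>r. \<Sum>k\<in>FN n. G k r / norm (freq k))"
    unfolding set_integrable_lebesgue(1)[OF m, symmetric] by (rule set_integrable_sums) (rule i)
qed

end

locale determined = pair +
  fixes Q :: "real \<Rightarrow> enat"
  assumes wn: "0 < t \<Longrightarrow> lam_ext L (Q t) = max (wavenumber \<eta> L \<nu> 13838 (u t)) (wavenumber \<eta> L \<nu> 13838 (v t))"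
    and low_eq: "0 < t \<Longrightarrow> AE x in torus L. lp_low \<eta> L (u t) (Q t) x = lp_low \<eta> L (v t) (Q t) x"
begin

text \<open>The multiplier \<open>low (Suc q)\<close> of the low part equals 1 for |k| < 2^q, so
  equality of the low parts determines these coefficients.\<close>

lemma W_low:
  assumes t: "0 < t" and q: "Q t = enat q" and k: "norm (freq k) < 2 ^ q" shows "W l k t = 0"
proof -
  let ?a = "\<lambda>g. tp L (bl (int q)) (\<lambda>k. complex_of_real (low (Suc q) (freq k)) * fc L (uc g l) k)"
  have "AE x in torus L. ?a (u t) x = ?a (v t) x"
    using low_eq[OF t] unfolding q by eventually_elim (simp only: lp_low_nth[symmetric])
  then have "fc L (?a (u t)) k = fc L (?a (v t)) k" by (rule fc_cong_AE) measurable
  moreover have b: "(2::real) ^ q \<le> 3/4 * 2 ^ Suc q" "(2::real) ^ q \<le> 2 * 2 ^ q" by simp_all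
  have "low (Suc q) (freq k) = 1" by (rule low_one[OF order_trans[OF less_imp_le[OF k] b(1)]])
  moreover have "k \<in> bl (int q)" unfolding bl_nat mem_Collect_eq by (rule order_trans[OF less_imp_le[OF k] b(2)])
  ultimately show ?thesis by (simp add: fc_tp[OF L] W_t[OF t])
qed

lemma W_infinity:
  assumes t: "0 < t" and q: "Q t = \<infinity>" shows "W l k t = 0"
proof -
  have "AE x in torus L. uc (u t) l x = uc (v t) l x"
    using low_eq[OF t] unfolding q lp_low_def by eventually_elim (simp add: complexify_def vec_eq_iff uc_def)
  then have "fc L (uc (u t) l) k = fc L (uc (v t) l) k"
    by (rule fc_cong_AE) (use L2c_meas[OF uc_L2c] L2 V.L2 t in auto)
  then show ?thesis by (simp add: W_t[OF t])
qed

text \<open>The choice of 13838 cancels the constant of \<open>nonlinear_estimate\<close>. An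
  infinite wavenumber means that the solutions agree at that time, and the left side
  vanishes.\<close>

lemma trilinear_bound:
  assumes g: "good t"
  shows "\<bar>Im (\<Sum>l\<in>UNIV. \<Sum>i\<in>UNIV. \<Sum>k\<in>FN n. dN i l k t * (fk k i * cnj (W l k t) / complex_of_real (norm (freq k))))\<bar>
    \<le> \<nu> / L * (Dn n t + tau n t) + 225 * M * hu t * sqrt (tau n t) * sqrt (E n t)"
proof (cases "Q t")
  case infinity
  have t: "0 < t" using g by (simp add: good_def)
  have "0 \<le> Dn n t" using E_nonneg E_le_Dn by (rule order_trans)
  moreover have "0 \<le> hu t" using L by (simp add: hu_def)
  ultimately show ?thesis using W_infinity[OF t infinity] L nu M(1) E_nonneg[of n t] tau_nonneg[of n t] by simp
next
  case (enat q)
  have t: "0 < t" using g by (simp add: good_def)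
  interpret s: slice \<eta> L \<nu> 13838 "real n" "Dn n t + tau n t" "tau n t" "E n t" "hu t" q "\<lambda>l k. W l k t"
  proof unfold_locales
    show "0 < L" "0 < \<nu>" by (fact L, fact nu)
    show "norm (freq k) < 2 ^ q \<Longrightarrow> W l k t = 0" for l k by (rule W_low[OF t enat])
    show "finite G \<Longrightarrow> (\<Sum>k\<in>G. norm (freq k) * (\<Sum>l\<in>UNIV. (cmod (W l k t))\<^sup>2)) \<le> Dn n t + tau n t" for G
      using D_le[OF g] by (simp only: e_def)
    show "finite G \<Longrightarrow> (\<And>m. m \<in> G \<Longrightarrow> real n < norm (freq m)) \<Longrightarrow>
      (\<Sum>m\<in>G. (norm (freq m))\<^sup>2 * (\<Sum>l\<in>UNIV. (cmod (W l m t))\<^sup>2)) \<le> tau n t" for G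
      using tail_le[OF g, of G n] by (simp only: e_def)
    show "(\<Sum>k | k \<noteq> 0 \<and> norm (freq k) \<le> real n. (\<Sum>l\<in>UNIV. (cmod (W l k t))\<^sup>2) / norm (freq k)) \<le> E n t"
      by (simp add: E_def FN_def e_def)
    show "0 \<le> hu t" using L by (simp add: hu_def)
  qed simp_all
  have F: "s.F = FN n" by (simp add: s.F_def FN_def)
  have w: "wavenumber \<eta> L \<nu> 13838 (u t) \<le> lam_ext L (enat q)" "wavenumber \<eta> L \<nu> 13838 (v t) \<le> lam_ext L (enat q)"
    using wn[OF t] by (simp_all add: enat)
  have "\<bar>Im (\<Sum>l\<in>UNIV. \<Sum>i\<in>UNIV. \<Sum>k\<in>s.F. (fc L (\<lambda>x. uc (u t) i x * uc (u t) l x) k - fc L (\<lambda>x. uc (v t) i x * uc (v t) l x) k) * s.gg i l k)\<bar>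
     \<le> 13838 * (\<nu> / (L * 13838)) * (Dn n t + tau n t) + 225 * M * hu t * sqrt (tau n t) * sqrt (E n t)"
  proof (rule s.nonlinear_estimate[OF _ _ _ w])
    show "u t \<in> L2_torus L" "v t \<in> L2_torus L" using L2 V.L2 t by auto
    show "W i k t = fc L (uc (u t) i) k - fc L (uc (v t) i) k" for i k by (rule W_t[OF t])
    show "(\<Sum>i\<in>UNIV. fk n i * fc L (uc (u t) i) n) = 0" for n using mode_div[of n t] t by (simp add: mode_def)
    show "(\<Sum>i\<in>UNIV. fk n i * fc L (uc (v t) i) n) = 0" for n using V.mode_div[of n t] t by (simp add: V.mode_def)
    show m: "fc L (uc (u t) i) 0 = 0" for i using mode_mean[of i t] t by (simp add: mode_def)
    fix G :: "(int^3) set" assume G: "finite G"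
    have "(\<Sum>n\<in>G. (norm (freq n))\<^sup>2 * (\<Sum>i\<in>UNIV. (cmod (fc L (uc (u t) i) n))\<^sup>2)) =
      (\<Sum>n\<in>G - {0}. (norm (freq n))\<^sup>2 * (\<Sum>i\<in>UNIV. (cmod (fc L (uc (u t) i) n))\<^sup>2))"
      using G by (intro sum.mono_neutral_right) (auto simp: m)
    also have "\<dots> \<le> 16 / L * (Hs_norm \<eta> L 1 (u t))\<^sup>2"
      by (rule H1_bound[OF L]) (use g G in \<open>auto simp: good_def\<close>)
    also have "\<dots> = (hu t)\<^sup>2" unfolding hu_def by (rule real_sqrt_pow2[symmetric]) (use L in simp)
    finally show "(\<Sum>n\<in>G. (norm (freq n))\<^sup>2 * (\<Sum>i\<in>UNIV. (cmod (fc L (uc (u t) i) n))\<^sup>2)) \<le> (hu t)\<^sup>2" .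
  qed
  then show ?thesis using t by (simp add: F s.gg_def dN_def quad_def V.quad_def)
qed

text \<open>The nonlinear term enters with the factor \<open>2 * kap L\<close>. As
  \<open>2 / L\<close> is at most \<open>kap L\<close>, it consumes no more than half of the
  dissipation, up to the tail; the other half dominates the energy because |k| >= 1.\<close>

lemma energy_rate:
  assumes g: "good t"
  shows "(\<Sum>k\<in>FN n. G k t / norm (freq k)) \<le> - (\<nu> * (kap L)\<^sup>2 * E n t) + \<nu> * (kap L)\<^sup>2 * tau n t
     + 450 * kap L * M * (hu t * sqrt (tau n t)) * sqrt (E n t)"
proof -
  let ?T = "\<Sum>l\<in>UNIV. \<Sum>i\<in>UNIV. \<Sum>k\<in>FN n. dN i l k t * (fk k i * cnj (W l k t) / complex_of_real (norm (freq k)))"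
  let ?D = "Dn n t + tau n t" and ?X = "225 * M * hu t * sqrt (tau n t) * sqrt (E n t)"
  have k: "0 < kap L" using L by (simp add: kap_def)
  have T: "?T = (\<Sum>k\<in>FN n. (\<Sum>l\<in>UNIV. \<Sum>i\<in>UNIV. dN i l k t * (fk k i * cnj (W l k t))) / complex_of_real (norm (freq k)))"
    unfolding sum_divide_distrib times_divide_eq_right
    by (subst sum.swap, rule sum.cong[OF refl], subst sum.swap, rule refl)
  have "(\<Sum>k\<in>FN n. G k t / norm (freq k)) = 2 * kap L * Im ?T - 2 * \<nu> * (kap L)\<^sup>2 * Dn n t"
  proof -
    have "G k t / norm (freq k) = 2 * kap L * Im ((\<Sum>l\<in>UNIV. \<Sum>i\<in>UNIV. dN i l k t * (fk k i * cnj (W l k t))) / complex_of_real (norm (freq k)))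
      - 2 * \<nu> * (kap L)\<^sup>2 * (norm (freq k) * e k t)" if "k \<in> FN n" for k
    proof -
      have "(2 * kap L * Im z - 2 * \<nu> * (kap L)\<^sup>2 * r\<^sup>2 * d) / r = 2 * kap L * Im (z / complex_of_real r) - 2 * \<nu> * (kap L)\<^sup>2 * (r * d)"
        if "1 \<le> r" for z r d
        using that unfolding Im_divide_of_real by (simp add: field_simps power2_eq_square)
      then show ?thesis unfolding G_def using FN_pos[OF that] by blast
    qed
    then show ?thesis unfolding T Dn_def by (simp only: sum_subtractf sum_distrib_left[symmetric] Im_sum cong: sum.cong)
  qed
  moreover have "2 * kap L * Im ?T \<le> 2 * kap L * (\<nu> / L * ?D + ?X)"
    using trilinear_bound[OF g, of n] k by (intro mult_left_mono) (simp_all add: abs_le_iff)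
  moreover have "2 * kap L * (\<nu> / L * ?D) \<le> \<nu> * (kap L)\<^sup>2 * ?D"
  proof -
    have D: "0 \<le> ?D" using order_trans[OF E_nonneg E_le_Dn, of n t] tau_nonneg[of n t] by simp
    have "2 / L \<le> kap L" using L pi_ge_two unfolding kap_def by (intro divide_right_mono) auto
    then have "\<nu> * kap L * ?D * (2 / L) \<le> \<nu> * kap L * ?D * kap L" using D k nu by (intro mult_left_mono mult_nonneg_nonneg) auto
    then show ?thesis by (simp add: power2_eq_square mult_ac)
  qed
  moreover have "\<nu> * (kap L)\<^sup>2 * E n t \<le> \<nu> * (kap L)\<^sup>2 * Dn n t" using E_le_Dn nu by (intro mult_left_mono) auto
  moreover have "2 * kap L * (\<nu> / L * ?D + ?X) = 2 * kap L * (\<nu> / L * ?D) + 450 * kap L * M * (hu t * sqrt (tau n t)) * sqrt (E n t)"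
    by (simp add: distrib_left)
  moreover have "\<nu> * (kap L)\<^sup>2 * ?D = \<nu> * (kap L)\<^sup>2 * Dn n t + \<nu> * (kap L)\<^sup>2 * tau n t" by (simp add: distrib_left)
  ultimately show ?thesis by linarith
qed

end

section \<open>Vanishing truncation errors and decay in time\<close>

context determined begin

lemma good_AE: "0 < a \<Longrightarrow> AE t in lebesgue_on {a..b}. good t"
proof -
  assume a: "0 < a"
  have "AE t in lebesgue_on {a..b}. t \<in> space (lebesgue_on {a..b})" by (rule AE_space)
  then show ?thesis using Hs_data(1)[OF a, of b] V.Hs_data(1)[OF a, of b]
    by eventually_elim (use a in \<open>auto simp: good_def\<close>)
qed

text \<open>The majorant is chosen with 48 = 16 + 32, the coefficients in the bounds for the square
  of \<open>hu\<close> and for \<open>tau\<close>; it is integrable because both solutions are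
  locally square integrable with values in the space of order 1.\<close>

lemma dominated_limit:
  assumes a: "0 < a" and m: "\<And>n. g n \<in> borel_measurable (lebesgue_on {a..b})"
    and bound: "\<And>n t. good t \<Longrightarrow> \<bar>g n t\<bar> \<le> 48 / L * HH t" and lim: "\<And>t. good t \<Longrightarrow> (\<lambda>n. g n t) \<longlonglongrightarrow> (0::real)"
  shows "integrable (lebesgue_on {a..b}) (g n)" "(\<lambda>n. integral\<^sup>L (lebesgue_on {a..b}) (g n)) \<longlonglongrightarrow> 0"
proof -
  have H: "integrable (lebesgue_on {a..b}) (\<lambda>t. 48 / L * HH t)"
    unfolding HH_def by (intro integrable_mult_right Bochner_Integration.integrable_add Hs_data(2) V.Hs_data(2) a)
  have b: "AE t in lebesgue_on {a..b}. norm (g n t) \<le> 48 / L * HH t" for n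
    unfolding real_norm_def using good_AE[OF a, of b] by eventually_elim (rule bound)
  have l: "AE t in lebesgue_on {a..b}. (\<lambda>n. g n t) \<longlonglongrightarrow> 0"
    using good_AE[OF a, of b] by eventually_elim (rule lim)
  show "integrable (lebesgue_on {a..b}) (g n)"
  proof (rule Bochner_Integration.integrable_bound[OF H m])
    show "AE t in lebesgue_on {a..b}. norm (g n t) \<le> norm (48 / L * HH t)"
      using b[of n] by eventually_elim (use abs_ge_self order_trans in \<open>fastforce simp only: real_norm_def\<close>)
  qed
  have "(\<lambda>n. integral\<^sup>L (lebesgue_on {a..b}) (g n)) \<longlonglongrightarrow> integral\<^sup>L (lebesgue_on {a..b}) (\<lambda>_. 0)"
    by (rule integral_dominated_convergence[OF _ m H l b]) simp
  then show "(\<lambda>n. integral\<^sup>L (lebesgue_on {a..b}) (g n)) \<longlonglongrightarrow> 0" by simp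
qed

lemma HH_nonneg: "0 \<le> HH t" by (simp add: HH_def)

lemma tau_integral:
  assumes "0 < a"
  shows "integrable (lebesgue_on {a..b}) (tau n)" "(\<lambda>n. integral\<^sup>L (lebesgue_on {a..b}) (tau n)) \<longlonglongrightarrow> 0"
proof -
  have "\<bar>tau n t\<bar> \<le> 48 / L * HH t" if "good t" for n t
  proof -
    have "32 / L * HH t \<le> 48 / L * HH t" using L HH_nonneg by (intro mult_right_mono divide_right_mono) auto
    then show ?thesis using tau_good(2)[OF that, of n] tau_nonneg[of n t] by simp
  qed
  note d = dominated_limit[of a tau, OF assms borel_measurable_lebesgue_on[OF tau_measurable] this tau_good(3)]
  show "integrable (lebesgue_on {a..b}) (tau n)" by (rule d(1)) auto
  show "(\<lambda>n. integral\<^sup>L (lebesgue_on {a..b}) (tau n)) \<longlonglongrightarrow> 0" by (rule d(2)) auto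
qed

definition "hr n t = hu t * sqrt (tau n t)"

lemma hu_nonneg: "0 \<le> hu t" using L by (simp add: hu_def)
lemma hr_nonneg: "0 \<le> hr n t" by (simp add: hr_def hu_nonneg tau_nonneg)

lemma hr_integral:
  assumes "0 < a"
  shows "integrable (lebesgue_on {a..b}) (hr n)" "(\<lambda>n. integral\<^sup>L (lebesgue_on {a..b}) (hr n)) \<longlonglongrightarrow> 0"
proof -
  have b: "\<bar>hr n t\<bar> \<le> 48 / L * HH t" if g: "good t" for n t
  proof -
    have "hu t * sqrt (tau n t) \<le> (hu t)\<^sup>2 + (sqrt (tau n t))\<^sup>2"
      using sum_squares_bound[of "hu t" "sqrt (tau n t)"] mult_nonneg_nonneg[OF hu_nonneg[of t] real_sqrt_ge_zero[OF tau_nonneg[of n t]]] by linarith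
    also have "(hu t)\<^sup>2 = 16 / L * (Hs_norm \<eta> L 1 (u t))\<^sup>2" unfolding hu_def by (rule real_sqrt_pow2) (use L in simp)
    also have "\<dots> \<le> 16 / L * HH t" using L by (intro mult_left_mono) (auto simp: HH_def)
    also have "(sqrt (tau n t))\<^sup>2 = tau n t" by (rule real_sqrt_pow2[OF tau_nonneg])
    also have "16 / L * HH t + tau n t \<le> 16 / L * HH t + 32 / L * HH t" using tau_good(2)[OF g] by (rule add_left_mono)
    also have "\<dots> = 48 / L * HH t" by (simp add: distrib_right[symmetric] add_divide_distrib[symmetric])
    finally show ?thesis using hr_nonneg[of n t] by (simp add: hr_def)
  qed
  have l: "(\<lambda>n. hr n t) \<longlonglongrightarrow> 0" if "good t" for t
    using tendsto_mult_left[OF tendsto_real_sqrt[OF tau_good(3)[OF that]], of "hu t"] by (simp add: hr_def)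
  have m: "hr n \<in> borel_measurable (lebesgue_on {a..b})" for n
  proof -
    have [measurable]: "(\<lambda>t. (Hs_norm \<eta> L 1 (u t))\<^sup>2) \<in> borel_measurable (lebesgue_on {a..b})"
      using Hs_data(2)[OF assms] by (rule borel_measurable_integrable)
    have [measurable]: "tau n \<in> borel_measurable (lebesgue_on {a..b})" by (rule borel_measurable_lebesgue_on[OF tau_measurable])
    show ?thesis unfolding hr_def[abs_def] hu_def by measurable
  qed
  note d = dominated_limit[of a hr, OF assms m b l]
  show "integrable (lebesgue_on {a..b}) (hr n)" by (rule d(1)) auto
  show "(\<lambda>n. integral\<^sup>L (lebesgue_on {a..b}) (hr n)) \<longlonglongrightarrow> 0" by (rule d(2)) auto
qed

lemma E_integrable: "0 < a \<Longrightarrow> integrable (lebesgue_on {a..b}) (E n)"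
proof -
  assume a: "0 < a"
  have m: "E n \<in> borel_measurable borel" unfolding E_def[abs_def] by measurable
  have "set_integrable lborel {a..b} (E n)" unfolding set_integrable_def
    by (rule borel_integrable_compact[OF compact_Icc continuous_on_subset[OF E_continuous]]) (use a in auto)
  then show ?thesis unfolding set_integrable_lebesgue(1)[OF m] .
qed

definition "rate = \<nu> * (kap L)\<^sup>2"
definition "C = 450 * kap L * M"

lemma rate_pos: "0 < rate" using L nu by (simp add: rate_def kap_def)
lemma C_nonneg: "0 \<le> C" using L M(1) by (simp add: C_def kap_def)

text \<open>The bound \<open>S\<close> on the root of the energy is left open: it is first the root
  of the maximum itself and later the bound deduced from it.\<close>

lemma energy_step:
  assumes a: "0 < a" and st: "a \<le> s" "s \<le> t" "t \<le> b" and S: "\<And>r. r \<in> {a..b} \<Longrightarrow> sqrt (E n r) \<le> S" "0 \<le> S"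
  shows "E n t - E n s \<le> - (rate * integral\<^sup>L (lebesgue_on {s..t}) (E n))
    + (rate * integral\<^sup>L (lebesgue_on {a..b}) (tau n) + C * S * integral\<^sup>L (lebesgue_on {a..b}) (hr n))"
proof -
  let ?I = "integral\<^sup>L (lebesgue_on {s..t})"
  note s = less_le_trans[OF a st(1)]
  note sub = integral_subinterval_le[OF tau_integral(1)[OF a] tau_nonneg st(1,3)] integral_subinterval_le[OF hr_integral(1)[OF a] hr_nonneg st(1,3)]
  note iE = E_integrable[OF s]
  have I: "integrable (lebesgue_on {s..t}) (\<lambda>r. - (rate * E n r) + (rate * tau n r + C * S * hr n r))"
    using iE sub(1,3) by simp
  have "E n t - E n s \<le> ?I (\<lambda>r. - (rate * E n r) + (rate * tau n r + C * S * hr n r))"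
    unfolding E_ode(1)[OF s st(2)]
  proof (rule integral_mono_AE[OF E_ode(2)[OF s st(2)] I])
    have "AE r in lebesgue_on {s..t}. r \<in> space (lebesgue_on {s..t})" by (rule AE_space)
    then show "AE r in lebesgue_on {s..t}. (\<Sum>k\<in>FN n. G k r / norm (freq k)) \<le> - (rate * E n r) + (rate * tau n r + C * S * hr n r)"
      using good_AE[OF s, of t]
    proof eventually_elim
      case (elim r)
      then have "sqrt (E n r) \<le> S" using st by (intro S) auto
      then have "C * hr n r * sqrt (E n r) \<le> C * hr n r * S"
        by (intro mult_left_mono mult_nonneg_nonneg C_nonneg hr_nonneg)
      then show ?case using energy_rate[OF elim(2), of n] unfolding rate_def C_def hr_def by (simp add: mult_ac)
    qed
  qed
  also have "\<dots> = - (rate * ?I (E n)) + (rate * ?I (tau n) + C * S * ?I (hr n))"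
    using iE sub(1,3) by simp
  also have "\<dots> \<le> - (rate * ?I (E n)) + (rate * integral\<^sup>L (lebesgue_on {a..b}) (tau n) + C * S * integral\<^sup>L (lebesgue_on {a..b}) (hr n))"
    using sub(2,4) rate_pos C_nonneg S(2) by (intro add_left_mono add_mono mult_left_mono mult_nonneg_nonneg) auto
  finally show ?thesis .
qed

text \<open>Bessel's inequality at a fixed time, hence a bound independent of the
  truncation.\<close>

lemma E_initial: assumes "0 < a" obtains B where "0 \<le> B" "\<And>n. E n a \<le> B"
proof -
  define B where "B = (\<Sum>l\<in>UNIV. (LINT x|torus L. (cmod (uc (u a) l x - uc (v a) l x))\<^sup>2) / L^3)"
  have w: "(\<lambda>x. uc (u a) l x - uc (v a) l x) \<in> L2c L" for l using assms by (intro L2c_diff uc_L2c L2 V.L2) auto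
  have fw: "fc L (\<lambda>x. uc (u a) l x - uc (v a) l x) k = W l k a" for l k
    unfolding W_t[OF assms] using assms by (intro fc_diff L uc_L2c L2 V.L2) auto
  have "E n a \<le> B" for n
  proof -
    have "E n a \<le> (\<Sum>k\<in>FN n. e k a)"
      unfolding E_def
    proof (rule sum_mono)
      fix k assume "k \<in> FN n"
      then have "1 \<le> norm (freq k)" by (rule FN_pos)
      then have "e k a / norm (freq k) \<le> e k a / 1" using e_nonneg by (intro divide_left_mono) auto
      then show "e k a / norm (freq k) \<le> e k a" by simp
    qed
    also have "\<dots> = (\<Sum>l\<in>UNIV. \<Sum>k\<in>FN n. (cmod (W l k a))\<^sup>2)" unfolding e_def by (rule sum.swap)
    also have "\<dots> \<le> B" unfolding B_def
    proof (rule sum_mono)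
      fix l
      show "(\<Sum>k\<in>FN n. (cmod (W l k a))\<^sup>2) \<le> (LINT x|torus L. (cmod (uc (u a) l x - uc (v a) l x))\<^sup>2) / L^3"
        using bessel[OF L w[of l] finite_FN[of n]] L by (simp add: fw pos_le_divide_eq mult.commute)
    qed
    finally show ?thesis .
  qed
  moreover have "0 \<le> B" unfolding B_def using L by (intro sum_nonneg divide_nonneg_nonneg) auto
  ultimately show thesis by (rule that[rotated])
qed

text \<open>Up to an error that vanishes with the truncation, no earlier value of the energy is
  below the final one, so its integral over [1, b] is at least b - 1 times the final value. Together
  with the dissipation this gives decay like 1/b without an exponential estimate. The start at time
  1 stands for any positive time, since the solutions are controlled only on compact intervals of
  positive times.\<close>

lemma energy_decay:
  assumes B: "0 \<le> B" "\<And>n. E n 1 \<le> B" and b: "1 \<le> b" and F: "finite F" "0 \<notin> F"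
  shows "(\<Sum>k\<in>F. e k b / norm (freq k)) \<le> B / (1 + rate * (b - 1))"
proof -
  define P H where "P n = integral\<^sup>L (lebesgue_on {1..b}) (tau n)" and "H n = integral\<^sup>L (lebesgue_on {1..b}) (hr n)" for n
  have P: "P \<longlonglongrightarrow> 0" and H: "H \<longlonglongrightarrow> 0" unfolding P_def H_def by (rule tau_integral hr_integral; simp)+
  define S where "S n = sqrt (2 * (B + rate * P n) + (C * H n)\<^sup>2)" for n
  define \<epsilon> where "\<epsilon> n = rate * P n + C * S n * H n" for n
  have "S \<longlonglongrightarrow> sqrt (2 * (B + rate * 0) + (C * 0)\<^sup>2)" unfolding S_def by (intro tendsto_intros P H)
  then have "\<epsilon> \<longlonglongrightarrow> rate * 0 + C * sqrt (2 * (B + rate * 0) + (C * 0)\<^sup>2) * 0"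
    unfolding \<epsilon>_def by (intro tendsto_intros P H)
  then have eps: "\<epsilon> \<longlonglongrightarrow> 0" by simp
  let ?c = "1 + rate * (b - 1)"
  have c: "0 < ?c" using rate_pos b by (intro add_pos_nonneg) auto
  have decay: "E n b \<le> B / ?c + \<epsilon> n" for n
  proof -
    have "continuous_on {1..b} (E n)" by (rule continuous_on_subset[OF E_continuous]) auto
    then obtain m where m: "m \<in> {1..b}" "\<And>r. r \<in> {1..b} \<Longrightarrow> E n r \<le> E n m"
      using continuous_attains_sup[of "{1..b}" "E n"] b by auto
    have I: "0 \<le> integral\<^sup>L (lebesgue_on {s..t}) (E n)" for s t by (rule integral_nonneg_AE) (simp add: E_nonneg)
    \<comment> \<open>At the maximum the error contains the maximum itself under a root; absorbing
      it yields \<open>S n\<close>, a bound on the whole interval.\<close>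
    have "E n m - E n 1 \<le> - (rate * integral\<^sup>L (lebesgue_on {1..m}) (E n)) + (rate * P n + C * sqrt (E n m) * H n)"
      unfolding P_def H_def by (rule energy_step) (use m E_nonneg in auto)
    moreover have "0 \<le> rate * integral\<^sup>L (lebesgue_on {1..m}) (E n)" using I rate_pos by simp
    ultimately have "E n m \<le> (B + rate * P n) + sqrt (E n m) * (C * H n)" using B(2)[of n] by (simp add: mult_ac)
    then have "E n m \<le> 2 * (B + rate * P n) + (C * H n)\<^sup>2" by (rule sqrt_absorb[OF E_nonneg])
    then have Sm: "sqrt (E n r) \<le> S n" if "r \<in> {1..b}" for r unfolding S_def using m(2)[OF that] by simp
    have S0: "0 \<le> S n" using Sm[OF m(1)] E_nonneg[of n m] order_trans real_sqrt_ge_zero by blast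
    \<comment> \<open>The energy step from \<open>r\<close> to \<open>b\<close>: up to \<epsilon>
      the final value is a lower bound for all earlier ones.\<close>
    have low: "E n b - \<epsilon> n \<le> E n r" if "r \<in> {1..b}" for r
    proof -
      have "E n b - E n r \<le> - (rate * integral\<^sup>L (lebesgue_on {r..b}) (E n)) + \<epsilon> n"
        unfolding \<epsilon>_def P_def H_def by (rule energy_step) (use that Sm S0 in auto)
      moreover have "0 \<le> rate * integral\<^sup>L (lebesgue_on {r..b}) (E n)" using I rate_pos by simp
      ultimately show ?thesis by linarith
    qed
    have "(E n b - \<epsilon> n) * (b - 1) = integral\<^sup>L (lebesgue_on {1..b}) (\<lambda>_. E n b - \<epsilon> n)"
      using b by (simp add: measure_restrict_space)
    also have "\<dots> \<le> integral\<^sup>L (lebesgue_on {1..b}) (E n)"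
    proof (rule integral_mono[OF _ E_integrable])
      have "set_integrable lborel {1..b} (\<lambda>_. E n b - \<epsilon> n)"
        unfolding set_integrable_def by (rule borel_integrable_compact) auto
      then show "integrable (lebesgue_on {1..b}) (\<lambda>_. E n b - \<epsilon> n)" by (subst (asm) set_integrable_lebesgue(1)) auto
    qed (use low in auto)
    finally have "rate * ((E n b - \<epsilon> n) * (b - 1)) \<le> rate * integral\<^sup>L (lebesgue_on {1..b}) (E n)"
      using rate_pos by (intro mult_left_mono) auto
    moreover have "E n b - E n 1 \<le> - (rate * integral\<^sup>L (lebesgue_on {1..b}) (E n)) + \<epsilon> n"
      unfolding \<epsilon>_def P_def H_def by (rule energy_step) (use b Sm S0 in auto)
    ultimately have "E n b - B \<le> - (rate * ((E n b - \<epsilon> n) * (b - 1))) + \<epsilon> n" using B(2)[of n] by linarith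
    then have "(E n b - \<epsilon> n) * ?c \<le> B" by (simp add: algebra_simps)
    then have "E n b - \<epsilon> n \<le> B / ?c" using c by (simp add: pos_le_divide_eq)
    then show ?thesis by simp
  qed
  \<comment> \<open>The finite set lies within the truncation for all large \<open>n\<close>, along
    which the error tends to 0.\<close>
  obtain n0 where n0: "F - {0} \<subseteq> FN n0" by (rule FN_exhaust[OF F(1)])
  have "(\<Sum>k\<in>F. e k b / norm (freq k)) \<le> B / ?c + \<epsilon> n" if "n0 \<le> n" for n
  proof -
    have "F \<subseteq> FN n" using n0 F(2) FN_mono[OF that] by auto
    then have "(\<Sum>k\<in>F. e k b / norm (freq k)) \<le> E n b"
      unfolding E_def by (intro sum_mono2 divide_nonneg_nonneg e_nonneg) auto
    also note decay
    finally show ?thesis .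
  qed
  moreover have "(\<lambda>n. B / ?c + \<epsilon> n) \<longlonglongrightarrow> B / ?c + 0" by (intro tendsto_intros eps)
  ultimately show ?thesis by (intro LIMSEQ_le_const[of _ "B / ?c"]) auto
qed

lemma convergence: "((\<lambda>t. Hs_norm \<eta> L (- 5/4) (\<lambda>x. u t x - v t x)) \<longlongrightarrow> 0) at_top"
proof -
  obtain B where B: "0 \<le> B" "\<And>n. E n 1 \<le> B" by (rule E_initial[OF zero_less_one]) (rule that)
  define K where "K = 24 * M\<^sup>2 * L^3 * L powr (5/2)"
  have K: "(Hs_norm \<eta> L (- 5/4) (\<lambda>x. u t x - v t x))\<^sup>2 \<le> K * (B / (1 + rate * (t - 1)))" if t: "1 \<le> t" for t
  proof -
    have w: "fc L (uc (\<lambda>x. u t x - v t x) l) k = W l k t" for l k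
    proof -
      have "uc (\<lambda>x. u t x - v t x) l = (\<lambda>x. uc (u t) l x - uc (v t) l x)" by (simp add: uc_def fun_eq_iff)
      then show ?thesis using t by (simp add: W_t fc_diff[OF L uc_L2c uc_L2c] L2 V.L2)
    qed
    show ?thesis unfolding K_def
    proof (rule Hs_neg_bound[OF L])
      show "0 \<le> B / (1 + rate * (t - 1))" using B t rate_pos by (intro divide_nonneg_nonneg add_nonneg_nonneg) auto
      show "fc L (uc (\<lambda>x. u t x - v t x) l) 0 = 0" for l by (simp add: w W_0)
      show "finite F \<Longrightarrow> 0 \<notin> F \<Longrightarrow> (\<Sum>k\<in>F. (\<Sum>l\<in>UNIV. (cmod (fc L (uc (\<lambda>x. u t x - v t x) l) k))\<^sup>2) / norm (freq k)) \<le> B / (1 + rate * (t - 1))" for F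
        using energy_decay[OF B t, of F] by (simp add: w e_def)
    qed
  qed
  have "filterlim (\<lambda>t. 1 + rate * (t - 1)) at_top at_top"
    by (intro filterlim_tendsto_add_at_top[OF tendsto_const] filterlim_tendsto_pos_mult_at_top[OF tendsto_const rate_pos])
      (use filterlim_tendsto_add_at_top[OF tendsto_const[of "-1 :: real"] filterlim_ident] in simp)
  then have "((\<lambda>t. B / (1 + rate * (t - 1))) \<longlongrightarrow> 0) at_top" by (rule tendsto_divide_0[OF tendsto_const filterlim_at_top_imp_at_infinity])
  then have "((\<lambda>t. sqrt (K * (B / (1 + rate * (t - 1))))) \<longlongrightarrow> sqrt (K * 0)) at_top" by (intro tendsto_intros)
  then have lim: "((\<lambda>t. sqrt (K * (B / (1 + rate * (t - 1))))) \<longlongrightarrow> 0) at_top" by simp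
  show ?thesis
  proof (rule Lim_null_comparison[OF _ lim])
    show "eventually (\<lambda>t. norm (Hs_norm \<eta> L (- 5/4) (\<lambda>x. u t x - v t x)) \<le> sqrt (K * (B / (1 + rate * (t - 1))))) at_top"
      using eventually_ge_at_top[of 1]
    proof eventually_elim
      case (elim t)
      have "\<bar>Hs_norm \<eta> L (- 5/4) (\<lambda>x. u t x - v t x)\<bar> = sqrt ((Hs_norm \<eta> L (- 5/4) (\<lambda>x. u t x - v t x))\<^sup>2)" by simp
      also have "\<dots> \<le> sqrt (K * (B / (1 + rate * (t - 1))))" using K[OF elim] by (rule real_sqrt_le_mono)
      finally show ?case by simp
    qed
  qed
qed

end

theorem theorem1p2:
  fixes \<eta> :: "real^3 \<Rightarrow> real"
  assumes "lp_cutoff \<eta>"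
  shows "\<exists>c\<^sub>0>0. \<forall>(L::real) (\<nu>::real)
           (f :: (real \<times> (real^3) \<Rightarrow> real^3) \<Rightarrow> real)
           (u :: real \<Rightarrow> real^3 \<Rightarrow> real^3) (v :: real \<Rightarrow> real^3 \<Rightarrow> real^3) (Q :: real \<Rightarrow> enat).
           0 < L \<longrightarrow> 0 < \<nu> \<longrightarrow>
           zero_mean_distribution L f \<longrightarrow>
           weak_solution \<eta> L \<nu> f u \<longrightarrow>
           weak_solution \<eta> L \<nu> f v \<longrightarrow>
           (\<forall>t>0. lam_ext L (Q t) = max (wavenumber \<eta> L \<nu> c\<^sub>0 (u t)) (wavenumber \<eta> L \<nu> c\<^sub>0 (v t))) \<longrightarrow>
           (\<forall>t>0. AE x in torus L. lp_low \<eta> L (u t) (Q t) x = lp_low \<eta> L (v t) (Q t) x) \<longrightarrow>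
           ((\<lambda>t. Hs_norm \<eta> L (- 5/4) (\<lambda>x. u t x - v t x)) \<longlongrightarrow> 0) at_top"
\<comment> \<open>The witness is 6917 + 6921, the constants of transport and stretching.\<close>
proof (intro exI[of _ 13838] conjI allI impI)
  fix L \<nu> :: real and f :: "(real \<times> (real^3) \<Rightarrow> real^3) \<Rightarrow> real" and u v :: "real \<Rightarrow> real^3 \<Rightarrow> real^3" and Q :: "real \<Rightarrow> enat"
  assume H: "0 < L" "0 < \<nu>" "weak_solution \<eta> L \<nu> f u" "weak_solution \<eta> L \<nu> f v"
    "\<forall>t>0. lam_ext L (Q t) = max (wavenumber \<eta> L \<nu> 13838 (u t)) (wavenumber \<eta> L \<nu> 13838 (v t))"
    "\<forall>t>0. AE x in torus L. lp_low \<eta> L (u t) (Q t) x = lp_low \<eta> L (v t) (Q t) x"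
  have "determined \<eta> L \<nu> f u v Q"
  proof unfold_locales
    show "lp_cutoff \<eta>" by (rule assms)
  qed (use H in auto)
  then show "((\<lambda>t. Hs_norm \<eta> L (- 5/4) (\<lambda>x. u t x - v t x)) \<longlongrightarrow> 0) at_top"
    by (rule determined.convergence)
qed simp

end
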